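(* The homomorphism $\vartheta:\ddot Y'_h(\mathfrak{gl}_1)\to U(\bar{\mathfrak D}_h)$ determined by $$e_j\mapsto x^j\partial,\quad f_j\mapsto-\partial^{-1}x^j,\quad\psi_j\mapsto(x-h)^j-x^j-(-h)^jc_{\mathfrak D}\qquad(j\ge0),$$ whose image lies in $U(\bar{\mathfrak D}^0_h)$, provides an isomorphism $\vartheta:\ddot Y'_h(\mathfrak{gl}_1)\to U(\bar{\mathfrak D}^0_h)$.
   Context: $h$ is a formal variable; $\mathbb Z_+=\{0,1,2,\dots\}$. $\ddot Y'_h(\mathfrak{gl}_1)$ (the quotient by $(h_3)$ of the formal affine Yangian $\ddot Y'_{-h-h_3,h,h_3}(\mathfrak{gl}_1)$) is the unital associative $\mathbb C[[h]]$-algebra topologically generated by $e_j,f_j,\psi_j$ ($j\in\mathbb Z_+$) subject to the relations ($i,j,i_1,i_2,i_3\in\mathbb Z_+$; $\mathrm{Sym}_{\mathfrak S_3}$ is the sum over permutations of $i_1,i_2,i_3$): - $[\psi_i,\psi_j]=0$, $[e_i,f_j]=\psi_{i+j}$; - $[e_{i+3},e_j]-3[e_{i+2},e_{j+1}]+3[e_{i+1},e_{j+2}]-[e_i,e_{j+3}]-h^2([e_{i+1},e_j]-[e_i,e_{j+1}])=0$; - $[f_{i+3},f_j]-3[f_{i+2},f_{j+1}]+3[f_{i+1},f_{j+2}]-[f_i,f_{j+3}]-h^2([f_{i+1},f_j]-[f_i,f_{j+1}])=0$; - $[\psi_{i+3},e_j]-3[\psi_{i+2},e_{j+1}]+3[\psi_{i+1},e_{j+2}]-[\psi_i,e_{j+3}]-h^2([\psi_{i+1},e_j]-[\psi_i,e_{j+1}])=0$;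 - $[\psi_{i+3},f_j]-3[\psi_{i+2},f_{j+1}]+3[\psi_{i+1},f_{j+2}]-[\psi_i,f_{j+3}]-h^2([\psi_{i+1},f_j]-[\psi_i,f_{j+1}])=0$; - $[\psi_0,e_j]=[\psi_1,e_j]=0$, $[\psi_2,e_j]=2h^2e_j$; $[\psi_0,f_j]=[\psi_1,f_j]=0$, $[\psi_2,f_j]=-2h^2f_j$; - $\mathrm{Sym}_{\mathfrak S_3}[e_{i_1},[e_{i_2},e_{i_3+1}]]=0$, $\mathrm{Sym}_{\mathfrak S_3}[f_{i_1},[f_{i_2},f_{i_3+1}]]=0$. $\mathfrak D_h$ is the unital associative $\mathbb C[[h]]$-algebra topologically generated by $x,\partial^{\pm1}$ with $\partial\partial^{-1}=\partial^{-1}\partial=1$, $\partial x=(x+h)\partial$, viewed as a Lie algebra with the commutator bracket; $\bar{\mathfrak D}_h=\mathfrak D_h\oplus\mathbb C[[h]]c_{\mathfrak D}$ is its central extension by the 2-cocycle $$\phi_{\mathfrak D}(f(x)\partial^r,g(x)\partial^{-s})=\begin{cases}\sum_{l=-r}^{-1}f(lh)g((l+r)h)&r=s>0\\-\sum_{l=r}^{-1}g(lh)f((l-r)h)&r=s<0\\0&\text{otherwise.}\end{cases}$$ $\bar{\mathfrak D}^0_h\subset\bar{\mathfrak D}_h$ is the Lie subalgebra which is the free $\mathbb C[[h]]$-submodule spanned by $\{c_{\mathfrak D},hx^i\partial^0,h^{j-1}x^i\partial^{\pm j}\mid i\in\mathbb Z_+,j\in\mathbb N\}$. $U(\cdot)$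 denotes the universal enveloping algebra. *)

theory Defs
  imports
    "HOL-Computational_Algebra.Polynomial"
    "HOL-Computational_Algebra.Formal_Power_Series"
    "HOL-Algebra.QuotRing"
    "HOL-Algebra.Module"
begin

type_synonym scal = "complex fps"

abbreviation hh :: scal where "hh \<equiv> fps_X"


section \<open>Topological algebras over the formal power series in h\<close>

text \<open>An algebra is a record of type \<open>(scal, 'a) module\<close>: its ring structure together with the
  scalar action. All algebras carry the h-adic topology.\<close>

definition alg_hom :: "(scal, 'a) module \<Rightarrow> (scal, 'b) module \<Rightarrow> ('a \<Rightarrow> 'b) set" where
  "alg_hom A B = {\<theta> \<in> ring_hom A B. \<forall>c. \<forall>a \<in> carrier A. \<theta> (c \<odot>\<^bsub>A\<^esub> a) = c \<odot>\<^bsub>B\<^esub> \<theta> a}"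

definition alg_iso :: "(scal, 'a) module \<Rightarrow> (scal, 'b) module \<Rightarrow> ('a \<Rightarrow> 'b) set" where
  "alg_iso A B = {\<theta> \<in> alg_hom A B. bij_betw \<theta> (carrier A) (carrier B)}"

text \<open>The h-adic completion of the free unital associative algebra on \<open>G\<close>. An element is its family
  of coefficients, indexed by words in \<open>G\<close> and tending to 0 h-adically.\<close>

definition cfree :: "'g set \<Rightarrow> (scal, 'g list \<Rightarrow> scal) module" where
  "cfree G = \<lparr>
     carrier = {a. (\<forall>w. w \<notin> lists G \<longrightarrow> a w = 0) \<and> (\<forall>n. finite {w. \<not> hh ^ n dvd a w})},
     mult = (\<lambda>a b w. \<Sum>k\<le>length w. a (take k w) * b (drop k w)),
     one = (\<lambda>w. if w = [] then 1 else 0),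
     zero = (\<lambda>w. 0),
     add = (\<lambda>a b w. a w + b w),
     smult = (\<lambda>c a w. c * a w)\<rparr>"

definition gen :: "'g \<Rightarrow> 'g list \<Rightarrow> scal" where
  "gen g = (\<lambda>w. if w = [g] then 1 else 0)"

definition hadic_closed :: "(scal, 'a) module \<Rightarrow> 'a set \<Rightarrow> bool" where
  "hadic_closed A I \<longleftrightarrow>
     (\<forall>a \<in> carrier A. (\<forall>n. \<exists>b \<in> I. \<exists>d \<in> carrier A. a = b \<oplus>\<^bsub>A\<^esub> ((hh ^ n) \<odot>\<^bsub>A\<^esub> d)) \<longrightarrow> a \<in> I)"

definition closed_ideal :: "(scal, 'a) module \<Rightarrow> 'a set \<Rightarrow> 'a set" where
  "closed_ideal A S = \<Inter> {I. ideal I A \<and> hadic_closed A I \<and> S \<subseteq> I}"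

definition quot_alg :: "(scal, 'a) module \<Rightarrow> 'a set \<Rightarrow> (scal, 'a set) module" where
  "quot_alg A I = \<lparr>
     carrier = carrier (A Quot I),
     mult = mult (A Quot I),
     one = one (A Quot I),
     zero = zero (A Quot I),
     add = add (A Quot I),
     smult = (\<lambda>c C. \<Union>a \<in> C. I +>\<^bsub>A\<^esub> (c \<odot>\<^bsub>A\<^esub> a))\<rparr>"

text \<open>The algebra topologically generated by \<open>G\<close> subject to the relations \<open>r = 0\<close>, \<open>r \<in> S\<close>.
  The quotient is by a closed ideal, hence again h-adically complete and separated.\<close>

definition pres_alg :: "'g set \<Rightarrow> ('g list \<Rightarrow> scal) set \<Rightarrow> (scal, ('g list \<Rightarrow> scal) set) module" where
  "pres_alg G S = quot_alg (cfree G) (closed_ideal (cfree G) S)"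

definition pres_class ::
    "'g set \<Rightarrow> ('g list \<Rightarrow> scal) set \<Rightarrow> ('g list \<Rightarrow> scal) \<Rightarrow> ('g list \<Rightarrow> scal) set" where
  "pres_class G S a = closed_ideal (cfree G) S +>\<^bsub>cfree G\<^esub> a"

definition comm :: "(scal, 'a) module \<Rightarrow> 'a \<Rightarrow> 'a \<Rightarrow> 'a" where
  "comm A a b = (a \<otimes>\<^bsub>A\<^esub> b) \<ominus>\<^bsub>A\<^esub> (b \<otimes>\<^bsub>A\<^esub> a)"


section \<open>The algebra Y\<close>

datatype ygen = E nat | F nat | Psi nat

definition cubic :: "(scal, 'a) module \<Rightarrow> (nat \<Rightarrow> 'a) \<Rightarrow> (nat \<Rightarrow> 'a) \<Rightarrow> nat \<Rightarrow> nat \<Rightarrow> 'a" where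
  "cubic A a b i j =
     comm A (a (i + 3)) (b j)
     \<ominus>\<^bsub>A\<^esub> (3 \<odot>\<^bsub>A\<^esub> comm A (a (i + 2)) (b (j + 1)))
     \<oplus>\<^bsub>A\<^esub> (3 \<odot>\<^bsub>A\<^esub> comm A (a (i + 1)) (b (j + 2)))
     \<ominus>\<^bsub>A\<^esub> comm A (a i) (b (j + 3))
     \<ominus>\<^bsub>A\<^esub> ((hh ^ 2) \<odot>\<^bsub>A\<^esub> (comm A (a (i + 1)) (b j) \<ominus>\<^bsub>A\<^esub> comm A (a i) (b (j + 1))))"

definition serre :: "(scal, 'a) module \<Rightarrow> (nat \<Rightarrow> 'a) \<Rightarrow> nat \<Rightarrow> nat \<Rightarrow> nat \<Rightarrow> 'a" where
  "serre A a i1 i2 i3 =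
     (let t = (\<lambda>p q r. comm A (a p) (comm A (a q) (a (r + 1)))) in
      t i1 i2 i3 \<oplus>\<^bsub>A\<^esub> t i1 i3 i2 \<oplus>\<^bsub>A\<^esub> t i2 i1 i3 \<oplus>\<^bsub>A\<^esub> t i2 i3 i1 \<oplus>\<^bsub>A\<^esub> t i3 i1 i2 \<oplus>\<^bsub>A\<^esub> t i3 i2 i1)"

definition Y_rels :: "(ygen list \<Rightarrow> scal) set" where
  "Y_rels =
     (let A = cfree (UNIV :: ygen set);
          e = (\<lambda>i. gen (E i)); f = (\<lambda>i. gen (F i)); p = (\<lambda>i. gen (Psi i)) in
      {comm A (p i) (p j) | i j. True}
      \<union> {comm A (e i) (f j) \<ominus>\<^bsub>A\<^esub> p (i + j) | i j. True}
      \<union> {cubic A e e i j | i j. True}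
      \<union> {cubic A f f i j | i j. True}
      \<union> {cubic A p e i j | i j. True}
      \<union> {cubic A p f i j | i j. True}
      \<union> {comm A (p 0) (e j) | j. True}
      \<union> {comm A (p 1) (e j) | j. True}
      \<union> {comm A (p 2) (e j) \<ominus>\<^bsub>A\<^esub> ((2 * hh ^ 2) \<odot>\<^bsub>A\<^esub> e j) | j. True}
      \<union> {comm A (p 0) (f j) | j. True}
      \<union> {comm A (p 1) (f j) | j. True}
      \<union> {comm A (p 2) (f j) \<ominus>\<^bsub>A\<^esub> ((- 2 * hh ^ 2) \<odot>\<^bsub>A\<^esub> f j) | j. True}
      \<union> {serre A e i1 i2 i3 | i1 i2 i3. True}
      \<union> {serre A f i1 i2 i3 | i1 i2 i3. True})"

definition Y_alg :: "(scal, (ygen list \<Rightarrow> scal) set) module" where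
  "Y_alg = pres_alg UNIV Y_rels"

definition Y_gen :: "ygen \<Rightarrow> (ygen list \<Rightarrow> scal) set" where
  "Y_gen g = pres_class UNIV Y_rels (gen g)"


section \<open>The algebra of difference operators and its cocycle\<close>

datatype dgen = DX | DP | DM  \<comment> \<open>\<open>x\<close>, \<open>\<partial>\<close>, \<open>\<partial>\<^sup>-\<^sup>1\<close>\<close>

type_synonym dop = "(dgen list \<Rightarrow> scal) set"

definition D_rels :: "(dgen list \<Rightarrow> scal) set" where
  "D_rels =
     (let A = cfree (UNIV :: dgen set); x = gen DX; d = gen DP; d' = gen DM in
      {(d \<otimes>\<^bsub>A\<^esub> d') \<ominus>\<^bsub>A\<^esub> \<one>\<^bsub>A\<^esub>,
       (d' \<otimes>\<^bsub>A\<^esub> d) \<ominus>\<^bsub>A\<^esub> \<one>\<^bsub>A\<^esub>,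
       (d \<otimes>\<^bsub>A\<^esub> x) \<ominus>\<^bsub>A\<^esub> ((x \<oplus>\<^bsub>A\<^esub> (hh \<odot>\<^bsub>A\<^esub> \<one>\<^bsub>A\<^esub>)) \<otimes>\<^bsub>A\<^esub> d)})"

definition D_alg :: "(scal, dop) module" where
  "D_alg = pres_alg UNIV D_rels"

definition D_x :: dop where
  "D_x = pres_class UNIV D_rels (gen DX)"

definition D_d :: "int \<Rightarrow> dop" where
  "D_d r = (if 0 \<le> r then pres_class UNIV D_rels (gen DP) [^]\<^bsub>D_alg\<^esub> nat r
            else pres_class UNIV D_rels (gen DM) [^]\<^bsub>D_alg\<^esub> nat (- r))"

text \<open>\<open>f(x) \<partial>\<^sup>r\<close> for a polynomial \<open>f\<close>.\<close>

definition D_op :: "scal poly \<Rightarrow> int \<Rightarrow> dop" where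
  "D_op f r =
     (\<Oplus>\<^bsub>D_alg\<^esub>i \<in> {..degree f}. coeff f i \<odot>\<^bsub>D_alg\<^esub> (D_x [^]\<^bsub>D_alg\<^esub> i)) \<otimes>\<^bsub>D_alg\<^esub> D_d r"

text \<open>\<open>phi_val f r g s\<close> is the prescribed value on the pair \<open>f(x) \<partial>\<^sup>r\<close>, \<open>g(x) \<partial>\<^sup>-\<^sup>s\<close>.\<close>

definition phi_val :: "scal poly \<Rightarrow> int \<Rightarrow> scal poly \<Rightarrow> int \<Rightarrow> scal" where
  "phi_val f r g s =
     (if r = s \<and> s > 0 then
        (\<Sum>l \<in> {- r .. - 1}. poly f (of_int l * hh) * poly g (of_int (l + r) * hh))
      else if r = s \<and> s < 0 then
        - (\<Sum>l \<in> {r .. - 1}. poly g (of_int l * hh) * poly f (of_int (l - r) * hh))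
      else 0)"

definition bilinear_form :: "(scal, 'a) module \<Rightarrow> ('a \<Rightarrow> 'a \<Rightarrow> scal) \<Rightarrow> bool" where
  "bilinear_form A \<phi> \<longleftrightarrow>
     (\<forall>a \<in> carrier A. \<forall>b \<in> carrier A. \<forall>c \<in> carrier A.
        \<phi> (a \<oplus>\<^bsub>A\<^esub> b) c = \<phi> a c + \<phi> b c \<and> \<phi> a (b \<oplus>\<^bsub>A\<^esub> c) = \<phi> a b + \<phi> a c) \<and>
     (\<forall>k. \<forall>a \<in> carrier A. \<forall>b \<in> carrier A.
        \<phi> (k \<odot>\<^bsub>A\<^esub> a) b = k * \<phi> a b \<and> \<phi> a (k \<odot>\<^bsub>A\<^esub> b) = k * \<phi> a b)"

text \<open>The bilinear extension of the prescribed values. It exists because the \<open>x\<^sup>i \<partial>\<^sup>r\<close> form a topological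
  basis of \<open>D_alg\<close> and \<open>phi_val\<close> is bilinear in \<open>f\<close>, \<open>g\<close>. Its values on \<open>carrier D_alg\<close> are unique:
  bilinear forms are automatically h-adically continuous, and the \<open>f(x) \<partial>\<^sup>r\<close> span a dense submodule.\<close>

definition phi_D :: "dop \<Rightarrow> dop \<Rightarrow> scal" where
  "phi_D = (SOME \<phi>. bilinear_form D_alg \<phi> \<and>
     (\<forall>f r g s. \<phi> (D_op f r) (D_op g (- s)) = phi_val f r g s))"


section \<open>Lie algebras and completed enveloping algebras\<close>

record 'a lie_alg = "'a partial_object" +
  lzero :: 'a
  ladd :: "'a \<Rightarrow> 'a \<Rightarrow> 'a"
  lsmult :: "scal \<Rightarrow> 'a \<Rightarrow> 'a"
  lbracket :: "'a \<Rightarrow> 'a \<Rightarrow> 'a"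

inductive_set lspan :: "'a lie_alg \<Rightarrow> 'a set \<Rightarrow> 'a set" for L S where
  zero: "lzero L \<in> lspan L S"
| base: "a \<in> S \<Longrightarrow> a \<in> lspan L S"
| add: "a \<in> lspan L S \<Longrightarrow> b \<in> lspan L S \<Longrightarrow> ladd L a b \<in> lspan L S"
| smult: "a \<in> lspan L S \<Longrightarrow> lsmult L c a \<in> lspan L S"

text \<open>The algebra topologically generated by the elements of \<open>L\<close>, subject to linearity of
  \<open>L \<rightarrow> U(L)\<close> and to \<open>ab - ba = [a, b]\<close>; this is the h-adic completion of the quotient of the
  tensor algebra that defines the universal enveloping algebra.\<close>

definition env_rels :: "'a lie_alg \<Rightarrow> ('a list \<Rightarrow> scal) set" where
  "env_rels L =
     (let A = cfree (carrier L) in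
      {gen (ladd L a b) \<ominus>\<^bsub>A\<^esub> (gen a \<oplus>\<^bsub>A\<^esub> gen b) | a b. a \<in> carrier L \<and> b \<in> carrier L}
      \<union> {gen (lsmult L c a) \<ominus>\<^bsub>A\<^esub> (c \<odot>\<^bsub>A\<^esub> gen a) | c a. a \<in> carrier L}
      \<union> {comm A (gen a) (gen b) \<ominus>\<^bsub>A\<^esub> gen (lbracket L a b) | a b. a \<in> carrier L \<and> b \<in> carrier L})"

definition env :: "'a lie_alg \<Rightarrow> (scal, ('a list \<Rightarrow> scal) set) module" where
  "env L = pres_alg (carrier L) (env_rels L)"

definition env_in :: "'a lie_alg \<Rightarrow> 'a \<Rightarrow> ('a list \<Rightarrow> scal) set" where
  "env_in L a = pres_class (carrier L) (env_rels L) (gen a)"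

text \<open>The canonical map \<open>U(L') \<rightarrow> U(L)\<close> for a Lie subalgebra \<open>L'\<close> of \<open>L\<close>. Here
  \<open>cfree (carrier L')\<close> is literally a subset of \<open>cfree (carrier L)\<close>, and a coset of the smaller
  ideal is sent to the coset of the larger ideal containing it. So the map depends on \<open>L\<close> only.\<close>

definition env_incl :: "'a lie_alg \<Rightarrow> ('a list \<Rightarrow> scal) set \<Rightarrow> ('a list \<Rightarrow> scal) set" where
  "env_incl L C = (\<Union>a \<in> C. pres_class (carrier L) (env_rels L) a)"


section \<open>The central extension and its Lie subalgebra\<close>

definition Dbar :: "(dop \<times> scal) lie_alg" where
  "Dbar = \<lparr>
     carrier = carrier D_alg \<times> UNIV,
     lzero = (\<zero>\<^bsub>D_alg\<^esub>, 0),
     ladd = (\<lambda>(a, s) (b, t). (a \<oplus>\<^bsub>D_alg\<^esub> b, s + t)),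
     lsmult = (\<lambda>k (a, s). (k \<odot>\<^bsub>D_alg\<^esub> a, k * s)),
     lbracket = (\<lambda>(a, s) (b, t). (comm D_alg a b, phi_D a b))\<rparr>"

definition c_D :: "dop \<times> scal" where
  "c_D = (\<zero>\<^bsub>D_alg\<^esub>, 1)"

definition D_in :: "dop \<Rightarrow> dop \<times> scal" where
  "D_in a = (a, 0)"

definition D_mon :: "nat \<Rightarrow> int \<Rightarrow> dop" where
  "D_mon i r = (D_x [^]\<^bsub>D_alg\<^esub> i) \<otimes>\<^bsub>D_alg\<^esub> D_d r"

definition Dbar0 :: "(dop \<times> scal) lie_alg" where
  "Dbar0 = Dbar\<lparr>carrier := lspan Dbar
     ({c_D}
      \<union> {lsmult Dbar hh (D_in (D_mon i 0)) | i. True}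
      \<union> {lsmult Dbar (hh ^ (j - 1)) (D_in (D_mon i (int j))) | i j. j \<ge> 1}
      \<union> {lsmult Dbar (hh ^ (j - 1)) (D_in (D_mon i (- int j))) | i j. j \<ge> 1})\<rparr>"


section \<open>The homomorphism\<close>

definition img_e :: "nat \<Rightarrow> dop \<times> scal" where
  "img_e j = D_in (D_mon j 1)"

definition img_f :: "nat \<Rightarrow> dop \<times> scal" where
  "img_f j = D_in (\<ominus>\<^bsub>D_alg\<^esub> (D_d (- 1) \<otimes>\<^bsub>D_alg\<^esub> (D_x [^]\<^bsub>D_alg\<^esub> j)))"

definition img_psi :: "nat \<Rightarrow> dop \<times> scal" where
  "img_psi j =
     ladd Dbar
       (D_in (((D_x \<ominus>\<^bsub>D_alg\<^esub> (hh \<odot>\<^bsub>D_alg\<^esub> \<one>\<^bsub>D_alg\<^esub>)) [^]\<^bsub>D_alg\<^esub> j)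
              \<ominus>\<^bsub>D_alg\<^esub> (D_x [^]\<^bsub>D_alg\<^esub> j)))
       (lsmult Dbar (- ((- hh) ^ j)) c_D)"

definition theta_on_gens ::
    "((ygen list \<Rightarrow> scal) set \<Rightarrow> ((dop \<times> scal) list \<Rightarrow> scal) set) \<Rightarrow> bool" where
  "theta_on_gens \<theta> \<longleftrightarrow>
     (\<forall>j. \<theta> (Y_gen (E j)) = env_in Dbar (img_e j) \<and>
          \<theta> (Y_gen (F j)) = env_in Dbar (img_f j) \<and>
          \<theta> (Y_gen (Psi j)) = env_in Dbar (img_psi j))"

end

theory Submission
  imports Defs "HOL-Library.Option_ord" "HOL-Library.Product_Lexorder"
begin

text \<open>The homomorphism exists because every defining relation of the affine Yangian \<open>Y\<close>, evaluated on the
images of the generators in the Lie algebra \<open>Dbar0\<close>, is an identity between polynomials in \<open>x\<close> and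
\<open>h\<close> (\<open>theta_free_rels\<close>). That it is bijective is seen by comparing \<open>Y\<close> modulo \<open>h\<close>, where an upper
bound for its size is available, with \<open>U(Dbar)\<close>, where the Poincare-Birkhoff-Witt theorem gives a
lower bound.

Upper bound. Modulo \<open>h\<close> the \<open>\<psi>\<^sub>j\<close> become central and the cubic relations lose their lower order terms.
Together with the Serre relations they force the Lie algebra generated by the \<open>e\<^sub>j\<close> to be spanned by one vector
\<open>W j i\<close> for every degree \<open>j \<ge> 1\<close> and every \<open>i \<ge> 0\<close>, with bracket
\<open>[W j i, W m k] = (jk - im) W (j + m) (i + k - 1)\<close> (\<open>W_bracket\<close>); the same holds for the \<open>f\<^sub>j\<close>, and
\<open>[e\<^sub>i, f\<^sub>j] = \<psi>\<^sub>i\<^sub>+\<^sub>j\<close> is the only nonzero bracket between the two halves. So there are vectors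
\<open>cur_basis b\<close> of \<open>Y/hY\<close>, indexed like the basis of \<open>Dbar0\<close>, whose ordered products span \<open>Y/hY\<close>
(\<open>cur_word_sorted_span\<close>). Each \<open>cur_basis b\<close> has a lift to \<open>Y\<close> that is mapped exactly to the basis
element \<open>basis_elt b\<close>, which is \<open>h\<^sup>k x\<^sup>i \<partial>\<^sup>r\<close> or the central element (\<open>lifts_cur_basis\<close>): the commutator with
\<open>\<partial>\<^sup>\<plusminus>\<^sup>1\<close> is a finite difference in \<open>x\<close>, and its term of lowest order in \<open>h\<close> can be solved for.

Lower bound. Sorting a word in the basis \<open>c, x\<^sup>i \<partial>\<^sup>r\<close> of \<open>Dbar\<close> by means of the commutation relations
gives a result that does not depend on the chosen sequence of swaps, by the Jacobi identity
(\<open>normal_order_swap\<close>). The coefficients of the result are linear functionals on \<open>U(Dbar)\<close>. Their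
pullbacks to \<open>Y\<close>, the functionals \<open>pbw_coord s\<close> for sorted \<open>s\<close>, take the value \<open>h\<^sup>n\<^sup>(\<^sup>s\<^sup>)\<close> on the ordered
product of lifts belonging to \<open>s\<close> and vanish on those belonging to other sorted words; here \<open>n(s)\<close> adds
up the powers of \<open>h\<close> in the basis elements.

Injectivity. Write \<open>a \<in> Y\<close> as a combination of ordered products with complex coefficients \<open>c\<^sub>s\<close>, plus \<open>h d\<close>.
Repeating this for \<open>d\<close> shows that \<open>pbw_coord s\<close> is always divisible by \<open>h\<^sup>n\<^sup>(\<^sup>s\<^sup>)\<close>, so that
\<open>pbw_coord s a = h\<^sup>n\<^sup>(\<^sup>s\<^sup>) (c\<^sub>s + h \<dots>)\<close>. If all coordinates of \<open>a\<close> vanish, then all \<open>c\<^sub>s\<close> vanish, \<open>a = h d\<close>, and the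
coordinates of \<open>d\<close> vanish again. Hence \<open>a\<close> is divisible by all powers of \<open>h\<close> and is zero
(\<open>pbw_coord_zero_imp_Iz\<close>). This proves that even the composite \<open>Y \<rightarrow> U(Dbar0) \<rightarrow> U(Dbar)\<close> is injective.

Surjectivity. The basis elements of \<open>Dbar0\<close>, hence all words in \<open>Dbar0\<close>, are in the image of
\<open>Y \<rightarrow> U(Dbar0)\<close>, and every element of \<open>U(Dbar0)\<close> is a combination of words up to a multiple of \<open>h\<close>;
successive approximation gives the rest (\<open>theta_free_surj\<close>). Together with the injectivity of the composite this
also makes \<open>U(Dbar0) \<rightarrow> U(Dbar)\<close> injective.

Elements of presented algebras are handled through representatives: formal series in words with
coefficients tending to zero, modulo the closed ideal of relations.\<close>

section \<open>Convergent sums of power series\<close>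

lemma hh_power_dvd_iff: "hh ^ n dvd c \<longleftrightarrow> (\<forall>k<n. fps_nth c k = 0)"
proof
  assume "hh ^ n dvd c"
  then obtain d where "c = hh ^ n * d" by (auto simp: dvd_def)
  then show "\<forall>k<n. fps_nth c k = 0" by (simp add: fps_X_power_mult_nth)
next
  assume a: "\<forall>k<n. fps_nth c k = 0"
  have "c = hh ^ n * fps_shift n c"
    by (rule fps_ext) (use a in \<open>auto simp: fps_X_power_mult_nth\<close>)
  then show "hh ^ n dvd c" by (metis dvd_triv_left)
qed

lemma hh_power_dvd_all_imp_zero: "(\<And>n. hh ^ n dvd c) \<Longrightarrow> c = 0"
  by (rule fps_ext) (auto simp: hh_power_dvd_iff)

text \<open>Convergence of the family to zero in the \<open>h\<close>-adic topology; \<open>null_iff\<close> gives the usual form. This one is suited to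
  sums that are computed coefficient by coefficient.\<close>

definition null :: "('b \<Rightarrow> scal) \<Rightarrow> bool" where
  "null f \<longleftrightarrow> (\<forall>n. finite {b. fps_nth (f b) n \<noteq> 0})"

text \<open>The \<open>h\<close>-adic sum of a family that tends to zero. Only finitely many members contribute to a given
  coefficient, so all sums are finite and no topology on \<open>scal\<close> is involved.\<close>

definition hsum :: "('b \<Rightarrow> scal) \<Rightarrow> scal" where
  "hsum f = Abs_fps (\<lambda>n. \<Sum>b | fps_nth (f b) n \<noteq> 0. fps_nth (f b) n)"

lemma null_iff: "null f \<longleftrightarrow> (\<forall>n. finite {b. \<not> hh ^ n dvd f b})"
proof
  assume a: "null f"
  show "\<forall>n. finite {b. \<not> hh ^ n dvd f b}"
  proof
    fix n
    have "{b. \<not> hh ^ n dvd f b} \<subseteq> (\<Union>k<n. {b. fps_nth (f b) k \<noteq> 0})"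
      by (auto simp: hh_power_dvd_iff)
    then show "finite {b. \<not> hh ^ n dvd f b}"
      by (rule finite_subset) (use a in \<open>auto simp: null_def\<close>)
  qed
next
  assume a: "\<forall>n. finite {b. \<not> hh ^ n dvd f b}"
  show "null f" unfolding null_def
  proof
    fix n
    have "{b. fps_nth (f b) n \<noteq> 0} \<subseteq> {b. \<not> hh ^ Suc n dvd f b}"
      unfolding hh_power_dvd_iff by blast
    then show "finite {b. fps_nth (f b) n \<noteq> 0}"
      using a finite_subset by blast
  qed
qed

lemma null_lower: "null f \<Longrightarrow> finite {b. \<exists>k\<le>n. fps_nth (f b) k \<noteq> 0}"
proof -
  assume a: "null f"
  have "{b. \<exists>k\<le>n. fps_nth (f b) k \<noteq> 0} = (\<Union>k\<le>n. {b. fps_nth (f b) k \<noteq> 0})" by auto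
  then show ?thesis using a by (auto simp: null_def)
qed

lemma nth_hsum:
  assumes "finite Fs" "\<And>b. b \<notin> Fs \<Longrightarrow> fps_nth (f b) n = 0"
  shows "fps_nth (hsum f) n = (\<Sum>b\<in>Fs. fps_nth (f b) n)"
proof -
  have "(\<Sum>b | fps_nth (f b) n \<noteq> 0. fps_nth (f b) n) = (\<Sum>b\<in>Fs. fps_nth (f b) n)"
    by (rule sum.mono_neutral_left) (use assms in auto)
  then show ?thesis by (simp add: hsum_def)
qed

lemma null_finite: "finite {b. f b \<noteq> 0} \<Longrightarrow> null f"
  unfolding null_def by (auto elim!: rev_finite_subset)

lemma null_finite': "finite Fs \<Longrightarrow> (\<And>b. b \<notin> Fs \<Longrightarrow> f b = 0) \<Longrightarrow> null f"
  by (rule null_finite, rule finite_subset[of _ Fs]) auto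

lemma null_zero [simp]: "null (\<lambda>b. 0)" by (simp add: null_def)

lemma null_add: "null f \<Longrightarrow> null g \<Longrightarrow> null (\<lambda>b. f b + g b)"
  unfolding null_def
proof
  fix n assume a: "\<forall>n. finite {b. fps_nth (f b) n \<noteq> 0}" "\<forall>n. finite {b. fps_nth (g b) n \<noteq> 0}"
  have "{b. fps_nth (f b + g b) n \<noteq> 0} \<subseteq> {b. fps_nth (f b) n \<noteq> 0} \<union> {b. fps_nth (g b) n \<noteq> 0}" by auto
  then show "finite {b. fps_nth (f b + g b) n \<noteq> 0}" using a finite_subset by blast
qed

lemma null_uminus: "null f \<Longrightarrow> null (\<lambda>b. - f b)"
  by (simp add: null_def)

lemma null_diff: "null f \<Longrightarrow> null g \<Longrightarrow> null (\<lambda>b. f b - g b)"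
  using null_add[of f "\<lambda>b. - g b"] null_uminus[of g] by simp

lemma null_mult_gen:
  assumes "null f" shows "null (\<lambda>b. f b * g b)"
  unfolding null_iff
proof
  fix n
  have "{b. \<not> hh ^ n dvd f b * g b} \<subseteq> {b. \<not> hh ^ n dvd f b}" by auto
  then show "finite {b. \<not> hh ^ n dvd f b * g b}"
    using assms finite_subset unfolding null_iff by blast
qed

lemma null_mult_gen': "null f \<Longrightarrow> null (\<lambda>b. g b * f b)"
  using null_mult_gen[of f g] by (simp add: mult.commute)

lemma null_subset: "null f \<Longrightarrow> (\<And>b. g b = 0 \<or> g b = f b) \<Longrightarrow> null g"
proof -
  assume a: "null f" "\<And>b. g b = 0 \<or> g b = f b"
  have "\<And>n. {b. fps_nth (g b) n \<noteq> 0} \<subseteq> {b. fps_nth (f b) n \<noteq> 0}" 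
    using a(2) by (metis (mono_tags, lifting) Collect_mono fps_zero_nth)
  then show ?thesis using a(1) finite_subset unfolding null_def by blast
qed

lemma null_prod:
  assumes "null f" "null g" shows "null (\<lambda>(p,q). f p * g q * k p q)"
  unfolding null_iff
proof
  fix n
  have "{z. \<not> hh ^ n dvd (case z of (p,q) \<Rightarrow> f p * g q * k p q)} \<subseteq> {b. \<not> hh ^ n dvd f b} \<times> {b. \<not> hh ^ n dvd g b}" by auto
  then show "finite {z. \<not> hh ^ n dvd (case z of (p,q) \<Rightarrow> f p * g q * k p q)}"
    by (rule finite_subset) (use assms in \<open>auto simp: null_iff\<close>)
qed

lemma hsum_zero [simp]: "hsum (\<lambda>b. 0) = 0"
  by (simp add: hsum_def fps_eq_iff)

lemma hsum_add:
  assumes "null f" "null g" shows "hsum (\<lambda>b. f b + g b) = hsum f + hsum g"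
proof (rule fps_ext)
  fix n
  let ?Fs = "{b. fps_nth (f b) n \<noteq> 0} \<union> {b. fps_nth (g b) n \<noteq> 0}"
  have fin: "finite ?Fs" using assms by (auto simp: null_def)
  show "fps_nth (hsum (\<lambda>b. f b + g b)) n = fps_nth (hsum f + hsum g) n"
    using nth_hsum[OF fin, of "\<lambda>b. f b + g b" n] nth_hsum[OF fin, of f n] nth_hsum[OF fin, of g n]
    by (simp add: sum.distrib)
qed

lemma hsum_cmult:
  assumes "null f" shows "hsum (\<lambda>b. c * f b) = c * hsum f"
proof (rule fps_ext)
  fix n
  let ?Fs = "{b. \<exists>k\<le>n. fps_nth (f b) k \<noteq> 0}"
  have fin: "finite ?Fs" using null_lower[OF assms] .
  have "fps_nth (hsum (\<lambda>b. c * f b)) n = (\<Sum>b\<in>?Fs. fps_nth (c * f b) n)"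
    by (rule nth_hsum[OF fin]) (auto simp: fps_mult_nth)
  also have "\<dots> = (\<Sum>i=0..n. \<Sum>b\<in>?Fs. fps_nth c i * fps_nth (f b) (n-i))"
    unfolding fps_mult_nth by (rule sum.swap)
  also have "\<dots> = (\<Sum>i=0..n. fps_nth c i * fps_nth (hsum f) (n-i))"
  proof (rule sum.cong[OF refl])
    fix i assume "i \<in> {0..n}"
    have "fps_nth (hsum f) (n-i) = (\<Sum>b\<in>?Fs. fps_nth (f b) (n-i))"
      by (rule nth_hsum[OF fin]) auto
    then show "(\<Sum>b\<in>?Fs. fps_nth c i * fps_nth (f b) (n-i)) = fps_nth c i * fps_nth (hsum f) (n-i)"
      by (simp add: sum_distrib_left)
  qed
  finally show "fps_nth (hsum (\<lambda>b. c * f b)) n = fps_nth (c * hsum f) n" by (simp add: fps_mult_nth)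
qed

lemma hsum_multc: "null f \<Longrightarrow> hsum (\<lambda>b. f b * c) = hsum f * c"
  using hsum_cmult[of f c] by (simp add: mult.commute)

lemma hsum_uminus: "null f \<Longrightarrow> hsum (\<lambda>b. - f b) = - hsum f"
  using hsum_cmult[of f "-1"] by simp

lemma hsum_diff: "null f \<Longrightarrow> null g \<Longrightarrow> hsum (\<lambda>b. f b - g b) = hsum f - hsum g"
  using hsum_add[of f "\<lambda>b. - g b"] null_uminus[of g] hsum_uminus[of g] by simp

lemma hsum_finite:
  assumes "finite Fs" "\<And>b. b \<notin> Fs \<Longrightarrow> f b = 0" shows "hsum f = sum f Fs"
proof (rule fps_ext)
  fix n
  have "fps_nth (hsum f) n = (\<Sum>b\<in>Fs. fps_nth (f b) n)"
    by (rule nth_hsum) (use assms in auto)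
  then show "fps_nth (hsum f) n = fps_nth (sum f Fs) n" by (simp add: fps_sum_nth)
qed

lemma hsum_single: "hsum (\<lambda>b. if b = c then f b else 0) = f c"
  using hsum_finite[of "{c}" "\<lambda>b. if b = c then f b else 0"] by simp

lemma hsum_dvd: "(\<And>b. hh ^ n dvd f b) \<Longrightarrow> hh ^ n dvd hsum f"
  unfolding hh_power_dvd_iff by (simp add: hsum_def)

lemma null_swap: 
  assumes "null (\<lambda>(p,q). Fs p q)" shows "null (\<lambda>(q,p). Fs p q)"
proof -
  have "{z. fps_nth (case z of (q,p) \<Rightarrow> Fs p q) n \<noteq> 0} = prod.swap ` {z. fps_nth (case z of (p,q) \<Rightarrow> Fs p q) n \<noteq> 0}" for n
    by (auto simp: image_iff)
  then show ?thesis using assms unfolding null_def by auto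
qed

lemma null_hsum:
  assumes "null (\<lambda>(p,q). Fs p q)" shows "null (\<lambda>p. hsum (\<lambda>q. Fs p q))"
proof -
  have "finite {p. fps_nth (hsum (Fs p)) n \<noteq> 0}" for n
  proof -
    have "{p. fps_nth (hsum (Fs p)) n \<noteq> 0} \<subseteq> fst ` {z. fps_nth (case z of (p,q) \<Rightarrow> Fs p q) n \<noteq> 0}"
    proof
      fix p assume "p \<in> {p. fps_nth (hsum (Fs p)) n \<noteq> 0}"
      then obtain q where "fps_nth (Fs p q) n \<noteq> 0"
        unfolding hsum_def by (auto elim: sum.not_neutral_contains_not_neutral)
      then show "p \<in> fst ` {z. fps_nth (case z of (p,q) \<Rightarrow> Fs p q) n \<noteq> 0}"
        by (auto simp: image_iff intro!: bexI[of _ "(p, q)"])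
    qed
    then show ?thesis using assms finite_subset unfolding null_def by blast
  qed
  then show ?thesis by (simp add: null_def)
qed

lemma hsum_hsum_pair:
  assumes "null (\<lambda>(p,q). Fs p q)"
  shows "hsum (\<lambda>p. hsum (\<lambda>q. Fs p q)) = hsum (\<lambda>(p,q). Fs p q)"
proof (rule fps_ext)
  fix n
  let ?S = "{z. fps_nth (case z of (p,q) \<Rightarrow> Fs p q) n \<noteq> 0}"
  have fin: "finite ?S" using assms unfolding null_def by blast
  let ?P = "fst ` ?S" and ?Q = "snd ` ?S"
  have o: "p \<in> ?P \<and> q \<in> ?Q" if "fps_nth (Fs p q) n \<noteq> 0" for p q
    using that by (auto simp: image_iff intro!: bexI[of _ "(p, q)"])
  have 1: "fps_nth (hsum (Fs p)) n = (\<Sum>q\<in>?Q. fps_nth (Fs p q) n)" for p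
    by (rule nth_hsum) (use fin o in auto)
  have "fps_nth (hsum (\<lambda>p. hsum (Fs p))) n = (\<Sum>p\<in>?P. \<Sum>q\<in>?Q. fps_nth (Fs p q) n)"
    unfolding 1[symmetric]
  proof (rule nth_hsum)
    fix p assume "p \<notin> ?P"
    then have "\<And>q. fps_nth (Fs p q) n = 0" using o by blast
    then show "fps_nth (hsum (Fs p)) n = 0" unfolding 1 by simp
  qed (use fin in auto)
  also have "\<dots> = (\<Sum>z\<in>?P\<times>?Q. fps_nth (case z of (p,q) \<Rightarrow> Fs p q) n)"
    unfolding sum.cartesian_product by (rule sum.cong) auto
  also have "\<dots> = fps_nth (hsum (\<lambda>(p,q). Fs p q)) n"
  proof (rule nth_hsum[symmetric])
    fix z assume "z \<notin> ?P \<times> ?Q"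
    then show "fps_nth (case z of (p,q) \<Rightarrow> Fs p q) n = 0" using o[of "fst z" "snd z"]
      by (cases z) auto
  qed (use fin in auto)
  finally show "fps_nth (hsum (\<lambda>p. hsum (Fs p))) n = fps_nth (hsum (\<lambda>(p,q). Fs p q)) n" .
qed

lemma hsum_reindex:
  assumes "bij_betw \<pi> {b. f b \<noteq> 0} {c. g c \<noteq> 0}" "\<And>b. f b \<noteq> 0 \<Longrightarrow> g (\<pi> b) = f b"
  shows "hsum f = hsum g"
proof (rule fps_ext)
  fix n
  have sf: "{b. fps_nth (f b) n \<noteq> 0} \<subseteq> {b. f b \<noteq> 0}" by auto
  have "bij_betw \<pi> {b. fps_nth (f b) n \<noteq> 0} {c. fps_nth (g c) n \<noteq> 0}"
  proof (rule bij_betw_subset[OF assms(1) sf, of "{c. fps_nth (g c) n \<noteq> 0}"])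
    show "\<pi> ` {b. fps_nth (f b) n \<noteq> 0} = {c. fps_nth (g c) n \<noteq> 0}"
    proof (intro equalityI subsetI)
      fix c assume "c \<in> {c. fps_nth (g c) n \<noteq> 0}"
      then have c: "fps_nth (g c) n \<noteq> 0" by simp
      then have "g c \<noteq> 0" by auto
      then obtain b where "f b \<noteq> 0" "c = \<pi> b" using assms(1) by (auto simp: bij_betw_def)
      then show "c \<in> \<pi> ` {b. fps_nth (f b) n \<noteq> 0}" using c assms(2) by auto
    next
      fix c assume "c \<in> \<pi> ` {b. fps_nth (f b) n \<noteq> 0}"
      then obtain b where b: "fps_nth (f b) n \<noteq> 0" "c = \<pi> b" by auto
      then have "f b \<noteq> 0" by auto
      then show "c \<in> {c. fps_nth (g c) n \<noteq> 0}" using b assms(2) by auto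
    qed
  qed
  then have "(\<Sum>b | fps_nth (f b) n \<noteq> 0. fps_nth (g (\<pi> b)) n) = (\<Sum>c | fps_nth (g c) n \<noteq> 0. fps_nth (g c) n)"
    by (rule sum.reindex_bij_betw)
  moreover have "(\<Sum>b | fps_nth (f b) n \<noteq> 0. fps_nth (g (\<pi> b)) n) = (\<Sum>b | fps_nth (f b) n \<noteq> 0. fps_nth (f b) n)"
    by (rule sum.cong) (use assms(2) sf in auto)
  ultimately show "fps_nth (hsum f) n = fps_nth (hsum g) n" by (simp add: hsum_def)
qed

text \<open>Fubini for families that tend to zero jointly. Rearrangements of multiple sums below, in particular
  associativity of the free algebra, all go through this lemma.\<close>

lemma hsum_swap:
  assumes "null (\<lambda>(p,q). Fs p q)"
  shows "hsum (\<lambda>p. hsum (\<lambda>q. Fs p q)) = hsum (\<lambda>q. hsum (\<lambda>p. Fs p q))"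
proof -
  have "hsum (\<lambda>(p,q). Fs p q) = hsum (\<lambda>(q,p). Fs p q)"
    by (rule hsum_reindex[where \<pi>=prod.swap]) (auto simp: bij_betw_def inj_on_def image_iff)
  then show ?thesis using hsum_hsum_pair[OF assms] hsum_hsum_pair[OF null_swap[OF assms]] by simp
qed

lemma hsum_sum:
  assumes "finite T" "\<And>t. t \<in> T \<Longrightarrow> null (f t)"
  shows "hsum (\<lambda>b. \<Sum>t\<in>T. f t b) = (\<Sum>t\<in>T. hsum (f t))"
    and "null (\<lambda>b. \<Sum>t\<in>T. f t b)"
proof -
  have "null (\<lambda>b. \<Sum>t\<in>T. f t b) \<and> hsum (\<lambda>b. \<Sum>t\<in>T. f t b) = (\<Sum>t\<in>T. hsum (f t))"
    using assms
  proof (induction T rule: finite_induct)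
    case (insert x Fs)
    then have "null (\<lambda>b. \<Sum>t\<in>Fs. f t b)" "null (f x)" by auto
    then show ?case using insert by (simp add: hsum_add null_add)
  qed simp
  then show "hsum (\<lambda>b. \<Sum>t\<in>T. f t b) = (\<Sum>t\<in>T. hsum (f t))"
    and "null (\<lambda>b. \<Sum>t\<in>T. f t b)" by auto
qed

section \<open>Linear functionals on completed free algebras\<close>

text \<open>The value at \<open>a\<close> of the continuous linear functional that takes the word \<open>w\<close> to \<open>V w\<close>. As \<open>a\<close>
  tends to zero in all applications, \<open>V\<close> can be arbitrary.\<close>

definition lin :: "('g list \<Rightarrow> scal) \<Rightarrow> ('g list \<Rightarrow> scal) \<Rightarrow> scal" where
  "lin V a = hsum (\<lambda>w. a w * V w)"

definition word :: "'g list \<Rightarrow> 'g list \<Rightarrow> scal" where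
  "word w = (\<lambda>v. if v = w then 1 else 0)"

lemma gen_eq_word: "gen g = word [g]" by (simp add: gen_def word_def)

definition cmul :: "('g list \<Rightarrow> scal) \<Rightarrow> ('g list \<Rightarrow> scal) \<Rightarrow> ('g list \<Rightarrow> scal)" where
  "cmul a b = (\<lambda>w. \<Sum>k\<le>length w. a (take k w) * b (drop k w))"

lemma cfree_simps:
  "mult (cfree G) = cmul" "one (cfree G) = word []" "zero (cfree G) = (\<lambda>w. 0)"
  "add (cfree G) = (\<lambda>a b w. a w + b w)" "smult (cfree G) = (\<lambda>c a w. c * a w)"
  by (simp_all add: cfree_def cmul_def word_def fun_eq_iff)

lemma carrier_cfree: "a \<in> carrier (cfree G) \<longleftrightarrow> (\<forall>w. w \<notin> lists G \<longrightarrow> a w = 0) \<and> null a"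
  by (simp add: cfree_def null_iff)

lemma null_word: "null (word w)"
  by (rule null_finite'[of "{w}"]) (auto simp: word_def)

lemma lin_word [simp]: "lin V (word w) = V w"
proof -
  have "(\<lambda>v. word w v * V v) = (\<lambda>v. if v = w then V v else 0)" by (auto simp: word_def)
  then show ?thesis by (simp add: lin_def hsum_single)
qed

lemma lin_add: "null a \<Longrightarrow> null b \<Longrightarrow> lin V (\<lambda>w. a w + b w) = lin V a + lin V b"
  by (simp add: lin_def distrib_right hsum_add null_mult_gen)

lemma lin_diff: "null a \<Longrightarrow> null b \<Longrightarrow> lin V (\<lambda>w. a w - b w) = lin V a - lin V b"
  by (simp add: lin_def left_diff_distrib hsum_diff null_mult_gen)

lemma lin_smult: "null a \<Longrightarrow> lin V (\<lambda>w. c * a w) = c * lin V a"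
  by (simp add: lin_def mult.assoc hsum_cmult null_mult_gen)

lemma lin_zero [simp]: "lin V (\<lambda>w. 0) = 0" by (simp add: lin_def)

lemma lin_delta: "lin (\<lambda>v. if v = w then 1 else 0) a = a w"
proof -
  have "(\<lambda>v. a v * (if v = w then 1 else 0)) = (\<lambda>v. if v = w then a v else 0)" by auto
  then show ?thesis by (simp add: lin_def hsum_single)
qed

lemma null_append:
  assumes "null a" "null b"
  shows "null (\<lambda>w. \<Sum>k\<le>length w. a (take k w) * b (drop k w))"
  unfolding null_iff
proof
  fix n
  have "{w. \<not> hh ^ n dvd (\<Sum>k\<le>length w. a (take k w) * b (drop k w))} \<subseteq>
     (\<lambda>(u,v). u @ v) ` ({b. \<not> hh ^ n dvd a b} \<times> {c. \<not> hh ^ n dvd b c})"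
  proof
    fix w assume "w \<in> {w. \<not> hh ^ n dvd (\<Sum>k\<le>length w. a (take k w) * b (drop k w))}"
    then obtain k where "\<not> hh ^ n dvd a (take k w) * b (drop k w)"
      using dvd_sum[of "{..length w}" "hh^n" "\<lambda>k. a (take k w) * b (drop k w)"] by auto
    then have "\<not> hh ^ n dvd a (take k w)" "\<not> hh ^ n dvd b (drop k w)" by auto
    then show "w \<in> (\<lambda>(u,v). u @ v) ` ({b. \<not> hh ^ n dvd a b} \<times> {c. \<not> hh ^ n dvd b c})"
      by (intro image_eqI[of _ _ "(take k w, drop k w)"]) auto
  qed
  then show "finite {w. \<not> hh ^ n dvd (\<Sum>k\<le>length w. a (take k w) * b (drop k w))}"
    by (rule finite_subset) (use assms in \<open>auto simp: null_iff\<close>)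
qed

lemma null_cmul: "null a \<Longrightarrow> null b \<Longrightarrow> null (cmul a b)"
  unfolding cmul_def by (rule null_append)

text \<open>Sum over the pairs of factors instead of over their products: each word \<open>w\<close> has one splitting
  \<open>w = u @ v\<close> for every position.\<close>

lemma lin_cmul:
  assumes "null a" "null b"
  shows "lin V (cmul a b) = hsum (\<lambda>u. a u * lin (\<lambda>v. V (u @ v)) b)"
proof -
  let ?Fs = "\<lambda>w (u,v). if w = u @ v then a u * b v * V (u @ v) else 0"
  have nF: "null (\<lambda>(w,z). ?Fs w z)"
    unfolding null_iff
  proof
    fix n
    have "{x. \<not> hh ^ n dvd (case x of (w,z) \<Rightarrow> ?Fs w z)} \<subseteq>
       (\<lambda>(u,v). (u @ v,(u,v))) ` ({b. \<not> hh ^ n dvd a b} \<times> {c. \<not> hh ^ n dvd b c})"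
      by (auto simp: image_iff split: if_splits)
    then show "finite {x. \<not> hh ^ n dvd (case x of (w,z) \<Rightarrow> ?Fs w z)}"
      by (rule finite_subset) (use assms in \<open>auto simp: null_iff\<close>)
  qed
  have inner: "hsum (?Fs w) = cmul a b w * V w" for w
  proof -
    let ?T = "(\<lambda>k. (take k w, drop k w)) ` {..length w}"
    have inj: "inj_on (\<lambda>k. (take k w, drop k w)) {..length w}"
      by (rule inj_onI) (metis Pair_inject atMost_iff length_take min.absorb2)
    have "hsum (?Fs w) = sum (?Fs w) ?T"
    proof (rule hsum_finite)
      fix z :: "'a list \<times> 'a list" assume z: "z \<notin> ?T"
      obtain u v where [simp]: "z = (u,v)" by (cases z)
      have "w \<noteq> u @ v" using z by (auto simp: image_iff dest!: bspec[of _ _ "length u"])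
      then show "?Fs w z = 0" by simp
    qed simp
    also have "\<dots> = (\<Sum>k\<le>length w. a (take k w) * b (drop k w) * V w)"
      by (subst sum.reindex[OF inj]) (auto intro!: sum.cong)
    finally show ?thesis by (simp add: cmul_def sum_distrib_right)
  qed
  have "lin V (cmul a b) = hsum (\<lambda>w. hsum (?Fs w))" by (simp add: lin_def inner)
  also have "\<dots> = hsum (\<lambda>z. hsum (\<lambda>w. ?Fs w z))" by (rule hsum_swap[OF nF])
  also have "\<dots> = hsum (\<lambda>(u,v). a u * b v * V (u @ v))"
  proof (rule arg_cong[where f=hsum], rule ext)
    fix z :: "'a list \<times> 'a list"
    obtain u v where [simp]: "z = (u,v)" by (cases z)
    show "hsum (\<lambda>w. ?Fs w z) = (case z of (u,v) \<Rightarrow> a u * b v * V (u @ v))"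
      using hsum_single[of "u @ v" "\<lambda>w. a u * b v * V (u @ v)"] by simp
  qed
  also have "\<dots> = hsum (\<lambda>u. hsum (\<lambda>v. a u * b v * V (u @ v)))"
    by (rule hsum_hsum_pair[symmetric]) (rule null_prod[OF assms])
  also have "\<dots> = hsum (\<lambda>u. a u * lin (\<lambda>v. V (u @ v)) b)"
    by (simp add: lin_def mult.assoc hsum_cmult null_mult_gen assms)
  finally show ?thesis .
qed

lemma lin_cmul': "null a \<Longrightarrow> null b \<Longrightarrow> lin V (cmul a b) = lin (\<lambda>u. lin (\<lambda>v. V (u @ v)) b) a"
  by (subst lin_cmul) (auto simp: lin_def)

text \<open>Both sides have the same value under every functional, because iterating \<open>lin_cmul'\<close> turns either of
  them into a triple sum over concatenations; evaluating at the words recovers the coefficients.\<close>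

lemma cmul_assoc:
  fixes a b c :: "'g list \<Rightarrow> scal"
  assumes "null a" "null b" "null c"
  shows "cmul (cmul a b) c = cmul a (cmul b c)"
proof
  fix w
  let ?\<delta> = "\<lambda>v::'g list. if v = w then 1 else (0::scal)"
  have "cmul (cmul a b) c w = lin ?\<delta> (cmul (cmul a b) c)" by (simp add: lin_delta)
  also have "\<dots> = lin ?\<delta> (cmul a (cmul b c))"
    by (simp add: lin_cmul' null_cmul assms)
  finally show "cmul (cmul a b) c w = cmul a (cmul b c) w" by (simp add: lin_delta)
qed

lemma cmul_one_left: "cmul (word []) a = a"
proof
  fix w
  have "(\<Sum>k\<le>length w. word [] (take k w) * a (drop k w)) = (\<Sum>k\<in>{0}. word [] (take k w) * a (drop k w))"
    by (rule sum.mono_neutral_right) (auto simp: word_def)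
  then show "cmul (word []) a w = a w" by (simp add: cmul_def word_def)
qed

lemma cmul_one_right: "cmul a (word []) = a"
proof
  fix w
  have "(\<Sum>k\<le>length w. a (take k w) * word [] (drop k w)) = (\<Sum>k\<in>{length w}. a (take k w) * word [] (drop k w))"
    by (rule sum.mono_neutral_right) (auto simp: word_def)
  then show "cmul a (word []) w = a w" by (simp add: cmul_def word_def)
qed

lemma cmul_add_left: "cmul (\<lambda>w. a w + b w) c = (\<lambda>w. cmul a c w + cmul b c w)"
  by (simp add: cmul_def distrib_right sum.distrib fun_eq_iff)

lemma cmul_add_right: "cmul c (\<lambda>w. a w + b w) = (\<lambda>w. cmul c a w + cmul c b w)"
  by (simp add: cmul_def distrib_left sum.distrib fun_eq_iff)

lemma cmul_smult_left: "cmul (\<lambda>w. k * a w) c = (\<lambda>w. k * cmul a c w)"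
  by (simp add: cmul_def sum_distrib_left mult.assoc fun_eq_iff)

lemma cmul_smult_right: "cmul c (\<lambda>w. k * a w) = (\<lambda>w. k * cmul c a w)"
  by (simp add: cmul_def sum_distrib_left mult.left_commute fun_eq_iff)

lemma cmul_diff_left: "cmul (\<lambda>w. a w - b w) c = (\<lambda>w. cmul a c w - cmul b c w)"
  by (simp add: cmul_def left_diff_distrib sum_subtractf fun_eq_iff)

lemma cmul_diff_right: "cmul c (\<lambda>w. a w - b w) = (\<lambda>w. cmul c a w - cmul c b w)"
  by (simp add: cmul_def right_diff_distrib sum_subtractf fun_eq_iff)

lemma cmul_word:
  fixes u v :: "'g list"
  shows "cmul (word u) (word v) = word (u @ v)"
proof
  fix w
  let ?\<delta> = "\<lambda>v::'g list. if v = w then 1 else (0::scal)"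
  have "cmul (word u) (word v) w = lin ?\<delta> (cmul (word u) (word v))" by (simp add: lin_delta)
  also have "\<dots> = ?\<delta> (u @ v)" by (simp add: lin_cmul' null_word)
  finally show "cmul (word u) (word v) w = word (u @ v) w" by (auto simp: word_def)
qed

section \<open>Algebras over the power series and their presentations\<close>

locale scal_alg = ring A for A :: "(scal, 'a) module" (structure) +
  assumes smult_closed [simp, intro]: "x \<in> carrier A \<Longrightarrow> c \<odot> x \<in> carrier A"
    and smult_add: "x \<in> carrier A \<Longrightarrow> y \<in> carrier A \<Longrightarrow> c \<odot> (x \<oplus> y) = c \<odot> x \<oplus> c \<odot> y"
    and add_smult: "x \<in> carrier A \<Longrightarrow> (c + d) \<odot> x = c \<odot> x \<oplus> d \<odot> x"
    and smult_smult: "x \<in> carrier A \<Longrightarrow> c \<odot> (d \<odot> x) = (c * d) \<odot> x"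
    and smult_one [simp]: "x \<in> carrier A \<Longrightarrow> 1 \<odot> x = x"
    and smult_mult_left: "x \<in> carrier A \<Longrightarrow> y \<in> carrier A \<Longrightarrow> (c \<odot> x) \<otimes> y = c \<odot> (x \<otimes> y)"
    and smult_mult_right: "x \<in> carrier A \<Longrightarrow> y \<in> carrier A \<Longrightarrow> x \<otimes> (c \<odot> y) = c \<odot> (x \<otimes> y)"
begin

lemma smult_zero [simp]: "c \<odot> \<zero> = \<zero>"
proof -
  have "c \<odot> \<zero> = c \<odot> \<zero> \<oplus> c \<odot> \<zero>" using smult_add[of \<zero> \<zero> c] by simp
  then show ?thesis by (metis add.l_cancel_one smult_closed zero_closed)
qed

lemma zero_smult [simp]: assumes "x \<in> carrier A" shows "0 \<odot> x = \<zero>"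
proof -
  have "0 \<odot> x = 0 \<odot> x \<oplus> 0 \<odot> x" using add_smult[of x 0 0] assms by simp
  then show ?thesis by (metis add.l_cancel_one assms smult_closed zero_closed)
qed

lemma uminus_smult: assumes "x \<in> carrier A" shows "(- c) \<odot> x = \<ominus> (c \<odot> x)"
proof -
  have "(- c) \<odot> x \<oplus> c \<odot> x = \<zero>" using add_smult[of x "- c" c] assms by simp
  then show ?thesis using assms by (metis minus_equality smult_closed)
qed

lemma smult_a_inv: assumes "x \<in> carrier A" shows "c \<odot> (\<ominus> x) = \<ominus> (c \<odot> x)"
proof -
  have "c \<odot> (\<ominus> x) \<oplus> c \<odot> x = \<zero>" using smult_add[of "\<ominus> x" x c] assms by (simp add: l_neg)
  then show ?thesis using assms by (metis minus_equality smult_closed a_inv_closed)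
qed

lemma a_inv_smult: "x \<in> carrier A \<Longrightarrow> \<ominus> x = (- 1) \<odot> x"
  using uminus_smult[of x 1] by simp

lemma smult_minus: "x \<in> carrier A \<Longrightarrow> y \<in> carrier A \<Longrightarrow> c \<odot> (x \<ominus> y) = c \<odot> x \<ominus> c \<odot> y"
  by (simp add: a_minus_def smult_add smult_a_inv)

lemma add_minus_add:
  assumes "u \<in> carrier A" "v \<in> carrier A" "w \<in> carrier A"
  shows "(u \<oplus> v) \<ominus> (u \<oplus> w) = v \<ominus> w"
proof -
  have "(u \<oplus> v) \<ominus> (u \<oplus> w) = (v \<oplus> u) \<oplus> (\<ominus> u \<oplus> \<ominus> w)"
    using assms by (simp add: a_minus_def minus_add a_comm)
  also have "\<dots> = v \<oplus> ((u \<oplus> \<ominus> u) \<oplus> \<ominus> w)" using assms by (simp add: a_assoc del: r_neg)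
  finally show ?thesis using assms by (simp add: r_neg a_minus_def)
qed

lemma minus_eq_zeroD:
  assumes "x \<in> carrier A" "y \<in> carrier A" "x \<ominus> y = \<zero>" shows "x = y"
  using assms by (metis a_minus_def add.inv_closed minus_equality r_neg minus_minus)

lemma comm_closed [simp, intro]: "x \<in> carrier A \<Longrightarrow> y \<in> carrier A \<Longrightarrow> comm A x y \<in> carrier A"
  by (simp add: comm_def)

end

locale sep_alg = scal_alg +
  assumes separated: "x \<in> carrier A \<Longrightarrow> (\<And>n. \<exists>d\<in>carrier A. x = (hh ^ n) \<odot> d) \<Longrightarrow> x = \<zero>"

lemma cfree_ring: "ring (cfree G)"
proof (rule ringI)
  show "abelian_group (cfree G)"
  proof (rule abelian_groupI)
    fix x assume x: "x \<in> carrier (cfree G)"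
    show "\<exists>y\<in>carrier (cfree G). y \<oplus>\<^bsub>cfree G\<^esub> x = \<zero>\<^bsub>cfree G\<^esub>"
      using x by (intro bexI[of _ "\<lambda>w. - x w"]) (auto simp: carrier_cfree cfree_simps null_uminus)
  qed (auto simp: carrier_cfree cfree_simps null_add add_ac)
  have cm: "cmul x y \<in> carrier (cfree G)" if "x \<in> carrier (cfree G)" "y \<in> carrier (cfree G)" for x y
  proof -
    have "cmul x y w = 0" if w: "w \<notin> lists G" for w
    proof -
      have "x (take k w) * y (drop k w) = 0" for k
      proof -
        have "take k w \<notin> lists G \<or> drop k w \<notin> lists G"
          using w by (metis append_in_lists_conv append_take_drop_id)
        then show ?thesis using \<open>x \<in> _\<close> \<open>y \<in> _\<close> by (auto simp: carrier_cfree)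
      qed
      then show ?thesis unfolding cmul_def by (intro sum.neutral) blast
    qed
    then show ?thesis using that by (auto simp: carrier_cfree null_cmul)
  qed
  have one: "word [] \<in> carrier (cfree G)"
    by (auto simp: carrier_cfree null_word) (auto simp: word_def split: if_splits)
  have nl: "null x" if "x \<in> carrier (cfree G)" for x using that by (simp add: carrier_cfree)
  show "Group.monoid (cfree G)"
    by (rule monoidI) (simp_all add: cfree_simps cm one nl cmul_one_left cmul_one_right cmul_assoc)
qed (auto simp: carrier_cfree cfree_simps cmul_add_left cmul_add_right)

lemma cfree_scal_alg: "scal_alg (cfree G)"
  by (intro scal_alg.intro cfree_ring scal_alg_axioms.intro)
    (auto simp: carrier_cfree cfree_simps null_mult_gen' cmul_smult_left cmul_smult_right algebra_simps)

lemma carrier_cfreeD: "a \<in> carrier (cfree G) \<Longrightarrow> null a"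
  by (simp add: carrier_cfree)

lemma cfree_closed:
  "a \<in> carrier (cfree G) \<Longrightarrow> b \<in> carrier (cfree G) \<Longrightarrow> (\<lambda>w. a w + b w) \<in> carrier (cfree G)"
  "a \<in> carrier (cfree G) \<Longrightarrow> b \<in> carrier (cfree G) \<Longrightarrow> (\<lambda>w. a w - b w) \<in> carrier (cfree G)"
  "a \<in> carrier (cfree G) \<Longrightarrow> (\<lambda>w. c * a w) \<in> carrier (cfree G)"
  "a \<in> carrier (cfree G) \<Longrightarrow> (\<lambda>w. - a w) \<in> carrier (cfree G)"
  "(\<lambda>w. 0) \<in> carrier (cfree G)"
  by (auto simp: carrier_cfree null_add null_diff null_mult_gen' null_uminus)

lemma cmul_closed: "a \<in> carrier (cfree G) \<Longrightarrow> b \<in> carrier (cfree G) \<Longrightarrow> cmul a b \<in> carrier (cfree G)"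
  using ring.ring_simprules(5)[OF cfree_ring[of G], of a b] by (simp add: cfree_simps)

lemma word_closed: "w \<in> lists G \<Longrightarrow> word w \<in> carrier (cfree G)"
  by (auto simp: carrier_cfree null_word) (auto simp: word_def split: if_splits)

lemma cfree_a_inv: "a \<in> carrier (cfree G) \<Longrightarrow> \<ominus>\<^bsub>cfree G\<^esub> a = (\<lambda>w. - a w)"
  using scal_alg.a_inv_smult[OF cfree_scal_alg, of a G] by (simp add: cfree_simps)

lemma cfree_minus:
  "b \<in> carrier (cfree G) \<Longrightarrow> a \<ominus>\<^bsub>cfree G\<^esub> b = (\<lambda>w. a w - b w)"
  by (simp add: a_minus_def cfree_a_inv) (simp add: cfree_simps)

lemma cfree_comm:
  "a \<in> carrier (cfree G) \<Longrightarrow> b \<in> carrier (cfree G) \<Longrightarrow> comm (cfree G) a b = (\<lambda>w. cmul a b w - cmul b a w)"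
  by (simp add: comm_def cfree_minus cmul_closed cfree_simps)

text \<open>A property that holds on words, respects linear combinations and passes to \<open>h\<close>-adic limits holds
  everywhere: modulo \<open>h\<^sup>n\<close> an element is a finite combination of words. The set \<open>X\<close> bounds the support.\<close>

lemma cfree_dense_induct:
  assumes a: "a \<in> carrier (cfree G)" and X: "X \<subseteq> lists G" "\<And>w. a w \<noteq> 0 \<Longrightarrow> w \<in> X"
    and zero: "P (\<lambda>w. 0)" and word: "\<And>w. w \<in> X \<Longrightarrow> P (word w)"
    and add: "\<And>a b. a \<in> carrier (cfree G) \<Longrightarrow> b \<in> carrier (cfree G) \<Longrightarrow> P a \<Longrightarrow> P b \<Longrightarrow> P (\<lambda>w. a w + b w)"
    and smult: "\<And>a c. a \<in> carrier (cfree G) \<Longrightarrow> P a \<Longrightarrow> P (\<lambda>w. c * a w)"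
    and lim: "\<And>a. a \<in> carrier (cfree G) \<Longrightarrow>
       (\<And>n. \<exists>b d. b \<in> carrier (cfree G) \<and> d \<in> carrier (cfree G) \<and> P b \<and> a = (\<lambda>w. b w + hh ^ n * d w)) \<Longrightarrow> P a"
  shows "P a"
proof (rule lim[OF a])
  fix n
  let ?W = "{w. \<not> hh ^ n dvd a w}"
  have na: "null a" using a by (simp add: carrier_cfree)
  have fin: "finite ?W" using na by (simp add: null_iff)
  have WX: "?W \<subseteq> X" using X(2) by force
  have *: "(\<lambda>w. if w \<in> H then a w else 0) \<in> carrier (cfree G) \<and> P (\<lambda>w. if w \<in> H then a w else 0)"
    if "finite H" "H \<subseteq> X" for H
    using that
  proof (induction H rule: finite_induct)
    case (insert w H)
    have e: "(\<lambda>v. if v \<in> insert w H then a v else 0) = (\<lambda>v. (if v \<in> H then a v else 0) + a w * word w v)"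
      using insert(2) by (auto simp: word_def fun_eq_iff)
    have c: "word w \<in> carrier (cfree G)" using insert X by (intro word_closed) auto
    show ?case unfolding e
      using insert by (intro conjI cfree_closed add smult c word) auto
  qed (simp add: zero cfree_closed)
  let ?d = "\<lambda>w. if w \<in> ?W then 0 else fps_shift n (a w)"
  have d: "?d \<in> carrier (cfree G)"
    unfolding carrier_cfree null_def
  proof (intro conjI allI impI)
    fix w assume "w \<notin> lists G" then show "?d w = 0" using X by force
  next
    fix k
    have "{w. fps_nth (?d w) k \<noteq> 0} \<subseteq> {w. fps_nth (a w) (k + n) \<noteq> 0}" by auto
    then show "finite {w. fps_nth (?d w) k \<noteq> 0}" using na finite_subset unfolding null_def by blast
  qed
  have e: "a = (\<lambda>w. (if w \<in> ?W then a w else 0) + hh ^ n * ?d w)"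
    by (rule ext, rule fps_ext) (auto simp: fps_X_power_mult_nth hh_power_dvd_iff)
  show "\<exists>b d. b \<in> carrier (cfree G) \<and> d \<in> carrier (cfree G) \<and> P b \<and> a = (\<lambda>w. b w + hh ^ n * d w)"
    using *[OF fin WX] d e by blast
qed

context scal_alg begin

lemma ideal_smult:
  assumes I: "ideal I A" and x: "x \<in> I" shows "c \<odot> x \<in> I"
proof -
  interpret ideal I A by fact
  have "x \<in> carrier A" using x a_subset by blast
  then have "c \<odot> x = (c \<odot> \<one>) \<otimes> x" by (simp add: smult_mult_left)
  then show ?thesis using I_l_closed[OF x, of "c \<odot> \<one>"] by simp
qed

lemma closed_ideal_props:
  assumes S: "S \<subseteq> carrier A"
  shows "ideal (closed_ideal A S) A" "hadic_closed A (closed_ideal A S)" "S \<subseteq> closed_ideal A S"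
proof -
  let ?M = "{I. ideal I A \<and> hadic_closed A I \<and> S \<subseteq> I}"
  have "carrier A \<in> ?M" using S oneideal by (simp add: hadic_closed_def)
  then have ne: "?M \<noteq> {}" by blast
  show "ideal (closed_ideal A S) A"
    unfolding closed_ideal_def by (rule i_Intersect) (use ne in auto)
  show "hadic_closed A (closed_ideal A S)"
    unfolding hadic_closed_def
  proof (intro ballI impI)
    fix a assume a: "a \<in> carrier A"
      and l: "\<forall>n. \<exists>b\<in>closed_ideal A S. \<exists>d\<in>carrier A. a = b \<oplus> (hh ^ n) \<odot> d"
    have "a \<in> I" if I: "I \<in> ?M" for I
    proof -
      have "\<forall>n. \<exists>b\<in>I. \<exists>d\<in>carrier A. a = b \<oplus> (hh ^ n) \<odot> d"
        using l I unfolding closed_ideal_def by blast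
      then show ?thesis using I a unfolding hadic_closed_def by blast
    qed
    then show "a \<in> closed_ideal A S" unfolding closed_ideal_def by blast
  qed
  show "S \<subseteq> closed_ideal A S" unfolding closed_ideal_def by blast
qed

lemma quot_alg_ring: assumes "ideal I A" shows "ring (quot_alg A I)"
proof -
  interpret R: ring "A Quot I" using assms by (rule ideal.quotient_is_ring)
  have sel: "carrier (quot_alg A I) = carrier (A Quot I)" "mult (quot_alg A I) = mult (A Quot I)"
    "one (quot_alg A I) = one (A Quot I)" "zero (quot_alg A I) = zero (A Quot I)"
    "add (quot_alg A I) = add (A Quot I)"
    by (simp_all add: quot_alg_def)
  show ?thesis
  proof (rule ringI)
    show "abelian_group (quot_alg A I)"
    proof (rule abelian_groupI)
      fix x assume "x \<in> carrier (quot_alg A I)"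
      then show "\<exists>y\<in>carrier (quot_alg A I). y \<oplus>\<^bsub>quot_alg A I\<^esub> x = \<zero>\<^bsub>quot_alg A I\<^esub>"
        unfolding sel by (intro bexI[of _ "\<ominus>\<^bsub>A Quot I\<^esub> x"]) (simp_all add: R.l_neg)
    qed (unfold sel, simp_all add: R.a_ac)
    show "Group.monoid (quot_alg A I)"
      by (rule monoidI; unfold sel) (simp_all add: R.m_assoc)
  qed (unfold sel, simp_all add: R.l_distr R.r_distr)
qed

end

lemma closed_ideal_least: "ideal I A \<Longrightarrow> hadic_closed A I \<Longrightarrow> S \<subseteq> I \<Longrightarrow> closed_ideal A S \<subseteq> I"
  unfolding closed_ideal_def by blast

text \<open>Statements about the quotient are reduced to membership in the closed ideal \<open>Iz\<close> by means of
  the class map \<open>cl\<close>, so that cosets do not have to be handled later.\<close>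

locale presentation =
  fixes G :: "'g set" and S :: "('g list \<Rightarrow> scal) set"
  assumes S: "S \<subseteq> carrier (cfree G)"
begin

abbreviation "Fr \<equiv> cfree G"
abbreviation "Iz \<equiv> closed_ideal (cfree G) S"
abbreviation "Q \<equiv> pres_alg G S"
abbreviation "cl \<equiv> pres_class G S"

sublocale Fr: scal_alg "cfree G" by (rule cfree_scal_alg)

lemma Iz_ideal: "ideal Iz Fr" using Fr.closed_ideal_props[OF S] by blast

lemma Iz_closed: "hadic_closed Fr Iz" using Fr.closed_ideal_props[OF S] by blast

lemma S_Iz: "S \<subseteq> Iz" using Fr.closed_ideal_props[OF S] by blast

lemma Iz_carrier: "a \<in> Iz \<Longrightarrow> a \<in> carrier Fr"
  using additive_subgroup.a_subset[OF ideal.axioms(1)[OF Iz_ideal]] by blast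

lemma Iz_ops:
  "(\<lambda>w. 0) \<in> Iz"
  "a \<in> Iz \<Longrightarrow> b \<in> Iz \<Longrightarrow> (\<lambda>w. a w + b w) \<in> Iz"
  "a \<in> Iz \<Longrightarrow> b \<in> Iz \<Longrightarrow> (\<lambda>w. a w - b w) \<in> Iz"
  "a \<in> Iz \<Longrightarrow> (\<lambda>w. c * a w) \<in> Iz"
  "a \<in> Iz \<Longrightarrow> b \<in> carrier Fr \<Longrightarrow> cmul a b \<in> Iz"
  "a \<in> Iz \<Longrightarrow> b \<in> carrier Fr \<Longrightarrow> cmul b a \<in> Iz"
proof -
  interpret Iz: ideal Iz "cfree G" by (rule Iz_ideal)
  show z: "(\<lambda>w. 0) \<in> Iz" using Iz.zero_closed by (simp add: cfree_simps)
  show ad: "a \<in> Iz \<Longrightarrow> b \<in> Iz \<Longrightarrow> (\<lambda>w. a w + b w) \<in> Iz" for a b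
    using Iz.a_closed[of a b] by (simp add: cfree_simps)
  show sm: "a \<in> Iz \<Longrightarrow> (\<lambda>w. c * a w) \<in> Iz" for a c
    using Fr.ideal_smult[OF Iz_ideal, of a c] by (simp add: cfree_simps)
  show "a \<in> Iz \<Longrightarrow> b \<in> Iz \<Longrightarrow> (\<lambda>w. a w - b w) \<in> Iz"
    using ad[OF _ sm[of b "-1"], of a] by simp
  show "a \<in> Iz \<Longrightarrow> b \<in> carrier Fr \<Longrightarrow> cmul a b \<in> Iz"
    using Iz.I_r_closed[of a b] by (simp add: cfree_simps)
  show "a \<in> Iz \<Longrightarrow> b \<in> carrier Fr \<Longrightarrow> cmul b a \<in> Iz"
    using Iz.I_l_closed[of a b] by (simp add: cfree_simps)
qed

lemma Iz_lim:
  assumes "a \<in> carrier Fr" "\<And>n. \<exists>b\<in>Iz. \<exists>d\<in>carrier Fr. a = (\<lambda>w. b w + hh ^ n * d w)"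
  shows "a \<in> Iz"
  using Iz_closed assms unfolding hadic_closed_def by (simp add: cfree_simps)

lemma Q_def': "Q = quot_alg Fr Iz" by (simp add: pres_alg_def)

lemma carrier_Q: "carrier Q = cl ` carrier Fr"
  by (auto simp: Q_def' quot_alg_def FactRing_def A_RCOSETS_def' pres_class_def)

lemma cl_closed [simp, intro]: "a \<in> carrier Fr \<Longrightarrow> cl a \<in> carrier Q"
  by (auto simp: carrier_Q)

lemma cl_mem: "a \<in> carrier Fr \<Longrightarrow> a \<in> cl a"
proof -
  interpret Iz: ideal Iz "cfree G" by (rule Iz_ideal)
  show "a \<in> carrier Fr \<Longrightarrow> a \<in> cl a" unfolding pres_class_def by (rule Iz.a_rcos_self)
qed

lemma cl_mem_iff: "a \<in> carrier Fr \<Longrightarrow> b \<in> cl a \<longleftrightarrow> b \<in> carrier Fr \<and> (\<lambda>w. b w - a w) \<in> Iz"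
proof -
  assume a: "a \<in> carrier Fr"
  have "b \<in> cl a \<longleftrightarrow> (\<exists>i\<in>Iz. b = (\<lambda>w. i w + a w))"
    by (auto simp: pres_class_def a_r_coset_def' cfree_simps)
  also have "\<dots> \<longleftrightarrow> b \<in> carrier Fr \<and> (\<lambda>w. b w - a w) \<in> Iz"
  proof safe
    fix i assume "i \<in> Iz"
    then show "(\<lambda>w. i w + a w) \<in> carrier (cfree G)" "(\<lambda>w. i w + a w - a w) \<in> Iz"
      using a Iz_carrier[of i] by (simp_all add: cfree_closed)
  next
    assume "(\<lambda>w. b w - a w) \<in> Iz"
    then show "\<exists>i\<in>Iz. b = (\<lambda>w. i w + a w)" by (intro bexI) auto
  qed
  finally show ?thesis .
qed

lemma cl_eq_iff:
  assumes "a \<in> carrier Fr" "b \<in> carrier Fr"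
  shows "cl a = cl b \<longleftrightarrow> (\<lambda>w. a w - b w) \<in> Iz"
proof
  assume "cl a = cl b"
  then have "a \<in> cl b" using cl_mem[OF assms(1)] by simp
  then show "(\<lambda>w. a w - b w) \<in> Iz" by (simp add: cl_mem_iff assms)
next
  assume ab: "(\<lambda>w. a w - b w) \<in> Iz"
  show "cl a = cl b"
  proof (rule Set.set_eqI)
    fix x
    have "(\<lambda>w. x w - a w) \<in> Iz \<longleftrightarrow> (\<lambda>w. x w - b w) \<in> Iz"
      using Iz_ops(2)[OF _ ab, of "\<lambda>w. x w - a w"] Iz_ops(3)[OF _ ab, of "\<lambda>w. x w - b w"] by simp blast
    then show "x \<in> cl a \<longleftrightarrow> x \<in> cl b" by (simp add: cl_mem_iff assms)
  qed
qed

lemma cl_ops: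
  assumes "a \<in> carrier Fr" "b \<in> carrier Fr"
  shows "cl a \<oplus>\<^bsub>Q\<^esub> cl b = cl (\<lambda>w. a w + b w)"
    "cl a \<otimes>\<^bsub>Q\<^esub> cl b = cl (cmul a b)"
    "c \<odot>\<^bsub>Q\<^esub> cl a = cl (\<lambda>w. c * a w)"
    "\<one>\<^bsub>Q\<^esub> = cl (word [])"
    "\<zero>\<^bsub>Q\<^esub> = cl (\<lambda>w. 0)"
proof -
  interpret h: ring_hom_ring Fr "Fr Quot Iz" "(+>\<^bsub>Fr\<^esub>) Iz"
    by (rule ideal.rcos_ring_hom_ring[OF Iz_ideal])
  show "cl a \<oplus>\<^bsub>Q\<^esub> cl b = cl (\<lambda>w. a w + b w)" "cl a \<otimes>\<^bsub>Q\<^esub> cl b = cl (cmul a b)"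
    using h.hom_add[OF assms] h.hom_mult[OF assms]
    by (simp_all add: Q_def' quot_alg_def pres_class_def cfree_simps)
  show "\<one>\<^bsub>Q\<^esub> = cl (word [])" "\<zero>\<^bsub>Q\<^esub> = cl (\<lambda>w. 0)"
    using h.hom_one h.hom_zero
    by (simp_all add: Q_def' quot_alg_def pres_class_def cfree_simps)
  have "c \<odot>\<^bsub>Q\<^esub> cl a = (\<Union>x\<in>cl a. cl (\<lambda>w. c * x w))"
    by (simp add: Q_def' quot_alg_def pres_class_def cfree_simps)
  also have "\<dots> = cl (\<lambda>w. c * a w)"
  proof -
    have "cl (\<lambda>w. c * x w) = cl (\<lambda>w. c * a w)" if "x \<in> cl a" for x
    proof -
      have x: "x \<in> carrier Fr" "(\<lambda>w. x w - a w) \<in> Iz" using that by (auto simp: cl_mem_iff assms)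
      show ?thesis using Iz_ops(4)[OF x(2), of c]
        by (subst cl_eq_iff) (auto simp: cfree_closed x assms right_diff_distrib)
    qed
    then show ?thesis using cl_mem[OF assms(1)] by blast
  qed
  finally show "c \<odot>\<^bsub>Q\<^esub> cl a = cl (\<lambda>w. c * a w)" .
qed

lemma Q_ring: "ring Q" unfolding Q_def' by (rule Fr.quot_alg_ring[OF Iz_ideal])

lemma Q_sep_alg: "sep_alg Q"
proof (intro sep_alg.intro scal_alg.intro Q_ring scal_alg_axioms.intro sep_alg_axioms.intro)
  fix x assume x: "x \<in> carrier Q" and lim: "\<And>n. \<exists>d\<in>carrier Q. x = hh ^ n \<odot>\<^bsub>Q\<^esub> d"
  obtain a where a: "a \<in> carrier Fr" "x = cl a" using x by (auto simp: carrier_Q)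
  have "a \<in> Iz"
  proof (rule Iz_lim[OF a(1)])
    fix n
    obtain d where d: "d \<in> carrier Fr" "cl a = hh ^ n \<odot>\<^bsub>Q\<^esub> cl d" using lim[of n] a(2) by (auto simp: carrier_Q)
    then have "(\<lambda>w. a w - hh ^ n * d w) \<in> Iz"
      by (simp add: cl_ops cl_eq_iff a cfree_closed)
    then show "\<exists>b\<in>Iz. \<exists>d\<in>carrier Fr. a = (\<lambda>w. b w + hh ^ n * d w)"
      using d by (intro bexI[of _ "\<lambda>w. a w - hh ^ n * d w"] bexI[of _ d]) auto
  qed
  then show "x = \<zero>\<^bsub>Q\<^esub>" using a by (simp add: cl_ops(5)[OF a(1) a(1)] cl_eq_iff cfree_closed)
qed (auto simp: carrier_Q cl_ops cfree_closed cmul_closed cmul_smult_left cmul_smult_right algebra_simps)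

sublocale Q: sep_alg Q by (rule Q_sep_alg)

lemma cl_alg_hom: "cl \<in> alg_hom Fr Q"
  unfolding alg_hom_def
  by (auto intro!: ring_hom_memI simp: cl_ops[symmetric] cfree_simps cl_ops(4)[OF cfree_closed(5) cfree_closed(5)])

end

lemma alg_hom_closed: "\<theta> \<in> alg_hom A B \<Longrightarrow> x \<in> carrier A \<Longrightarrow> \<theta> x \<in> carrier B"
  by (auto simp: alg_hom_def ring_hom_closed)

lemma alg_hom_add: "\<theta> \<in> alg_hom A B \<Longrightarrow> x \<in> carrier A \<Longrightarrow> y \<in> carrier A \<Longrightarrow> \<theta> (x \<oplus>\<^bsub>A\<^esub> y) = \<theta> x \<oplus>\<^bsub>B\<^esub> \<theta> y"
  by (auto simp: alg_hom_def ring_hom_add)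

lemma alg_hom_mult: "\<theta> \<in> alg_hom A B \<Longrightarrow> x \<in> carrier A \<Longrightarrow> y \<in> carrier A \<Longrightarrow> \<theta> (x \<otimes>\<^bsub>A\<^esub> y) = \<theta> x \<otimes>\<^bsub>B\<^esub> \<theta> y"
  by (auto simp: alg_hom_def ring_hom_mult)

lemma alg_hom_smult: "\<theta> \<in> alg_hom A B \<Longrightarrow> x \<in> carrier A \<Longrightarrow> \<theta> (c \<odot>\<^bsub>A\<^esub> x) = c \<odot>\<^bsub>B\<^esub> \<theta> x"
  by (auto simp: alg_hom_def)

lemma alg_hom_one: "\<theta> \<in> alg_hom A B \<Longrightarrow> \<theta> \<one>\<^bsub>A\<^esub> = \<one>\<^bsub>B\<^esub>"
  by (auto simp: alg_hom_def ring_hom_one)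

lemma alg_hom_minus:
  assumes "\<theta> \<in> alg_hom A B" "scal_alg A" "scal_alg B" "x \<in> carrier A" "y \<in> carrier A"
  shows "\<theta> (x \<ominus>\<^bsub>A\<^esub> y) = \<theta> x \<ominus>\<^bsub>B\<^esub> \<theta> y"
proof -
  interpret A: scal_alg A by fact
  interpret B: scal_alg B by fact
  show ?thesis using assms
    by (simp add: a_minus_def A.a_inv_smult B.a_inv_smult alg_hom_add alg_hom_smult alg_hom_closed)
qed

lemma alg_hom_comm:
  assumes "\<theta> \<in> alg_hom A B" "scal_alg A" "scal_alg B" "x \<in> carrier A" "y \<in> carrier A"
  shows "\<theta> (comm A x y) = comm B (\<theta> x) (\<theta> y)"
proof -
  interpret A: scal_alg A by fact
  interpret B: scal_alg B by fact
  show ?thesis using assms by (simp add: comm_def alg_hom_minus alg_hom_mult)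
qed

lemma alg_hom_comp: "\<theta> \<in> alg_hom A B \<Longrightarrow> \<eta> \<in> alg_hom B C \<Longrightarrow> (\<lambda>x. \<eta> (\<theta> x)) \<in> alg_hom A C"
  by (auto simp: alg_hom_def ring_hom_def Pi_def)

context presentation begin

text \<open>The kernel of a homomorphism to a separated algebra is \<open>h\<close>-adically closed, so it contains the
  closed ideal as soon as it contains the relations.\<close>

lemma kernel_kills:
  assumes B: "sep_alg B" and \<theta>: "\<theta> \<in> alg_hom Fr B" and rel: "\<And>r. r \<in> S \<Longrightarrow> \<theta> r = \<zero>\<^bsub>B\<^esub>"
    and a: "a \<in> Iz"
  shows "\<theta> a = \<zero>\<^bsub>B\<^esub>"
proof -
  interpret B: sep_alg B by fact
  have hom: "ring_hom_ring Fr B \<theta>"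
    using \<theta> by (intro ring_hom_ringI2 Fr.ring_axioms B.ring_axioms) (simp add: alg_hom_def)
  interpret h: ring_hom_ring Fr B \<theta> by (rule hom)
  let ?K = "a_kernel Fr B \<theta>"
  have K: "x \<in> ?K \<longleftrightarrow> x \<in> carrier Fr \<and> \<theta> x = \<zero>\<^bsub>B\<^esub>" for x
    unfolding a_kernel_def' by (rule mem_Collect_eq)
  have "hadic_closed Fr ?K"
    unfolding hadic_closed_def
  proof (intro ballI impI)
    fix x assume x: "x \<in> carrier Fr"
      and l: "\<forall>n. \<exists>b\<in>?K. \<exists>d\<in>carrier Fr. x = b \<oplus>\<^bsub>Fr\<^esub> (hh ^ n) \<odot>\<^bsub>Fr\<^esub> d"
    have "\<theta> x = \<zero>\<^bsub>B\<^esub>"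
    proof (rule B.separated)
      show "\<theta> x \<in> carrier B" using x \<theta> by (rule alg_hom_closed[rotated])
      fix n
      obtain b d where b: "b \<in> ?K" "d \<in> carrier Fr" "x = b \<oplus>\<^bsub>Fr\<^esub> (hh ^ n) \<odot>\<^bsub>Fr\<^esub> d" using l by blast
      then have "\<theta> x = (hh ^ n) \<odot>\<^bsub>B\<^esub> \<theta> d"
        using \<theta> by (simp add: K alg_hom_add alg_hom_smult alg_hom_closed del: h.hom_add)
      then show "\<exists>d\<in>carrier B. \<theta> x = (hh ^ n) \<odot>\<^bsub>B\<^esub> d" using b \<theta> by (auto intro: alg_hom_closed)
    qed
    then show "x \<in> ?K" using x K by blast
  qed
  then have "Iz \<subseteq> ?K"
    using h.kernel_is_ideal S rel by (intro closed_ideal_least) (auto simp: K)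
  then show ?thesis using a K by blast
qed

lemma lift_hom:
  assumes B: "sep_alg B" and \<theta>: "\<theta> \<in> alg_hom Fr B" and rel: "\<And>r. r \<in> S \<Longrightarrow> \<theta> r = \<zero>\<^bsub>B\<^esub>"
  shows "\<exists>\<eta>\<in>alg_hom Q B. \<forall>a\<in>carrier Fr. \<eta> (cl a) = \<theta> a"
proof -
  interpret B: sep_alg B by fact
  have eq: "\<theta> a = \<theta> b" if "a \<in> carrier Fr" "b \<in> carrier Fr" "cl a = cl b" for a b
  proof -
    have "(\<lambda>w. a w - b w) \<in> Iz" using that by (simp add: cl_eq_iff)
    then have "\<theta> (a \<ominus>\<^bsub>Fr\<^esub> b) = \<zero>\<^bsub>B\<^esub>" using kernel_kills[OF assms] that by (simp add: cfree_minus)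
    then have "\<theta> a \<ominus>\<^bsub>B\<^esub> \<theta> b = \<zero>\<^bsub>B\<^esub>"
      using alg_hom_minus[OF \<theta> Fr.scal_alg_axioms B.scal_alg_axioms] that by simp
    then show ?thesis
      using B.minus_eq_zeroD[OF alg_hom_closed[OF \<theta> that(1)] alg_hom_closed[OF \<theta> that(2)]] by blast
  qed
  define \<eta> where "\<eta> = (\<lambda>C. \<theta> (SOME a. a \<in> carrier Fr \<and> cl a = C))"
  have \<eta>: "\<eta> (cl a) = \<theta> a" if "a \<in> carrier Fr" for a
  proof -
    have "(SOME b. b \<in> carrier Fr \<and> cl b = cl a) \<in> carrier Fr \<and> cl (SOME b. b \<in> carrier Fr \<and> cl b = cl a) = cl a"
      by (rule someI[of _ a]) (use that in auto)
    then show ?thesis unfolding \<eta>_def by (intro eq) (use that in auto)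
  qed
  have "\<eta> \<in> alg_hom Q B"
    unfolding alg_hom_def
  proof (intro CollectI conjI ring_hom_memI ballI allI)
    show "\<eta> \<one>\<^bsub>Q\<^esub> = \<one>\<^bsub>B\<^esub>"
      using alg_hom_one[OF \<theta>] by (simp add: cl_ops(4)[OF cfree_closed(5) cfree_closed(5)] \<eta> word_closed cfree_simps)
  next
    fix x assume "x \<in> carrier Q"
    then obtain a where a: "a \<in> carrier Fr" "x = cl a" by (auto simp: carrier_Q)
    show "\<eta> x \<in> carrier B" using alg_hom_closed[OF \<theta> a(1)] a by (simp add: \<eta>)
    show "\<eta> (c \<odot>\<^bsub>Q\<^esub> x) = c \<odot>\<^bsub>B\<^esub> \<eta> x" for c
      using alg_hom_smult[OF \<theta> a(1), of c] a by (simp add: cl_ops \<eta> cfree_closed cfree_simps)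
    fix y assume "y \<in> carrier Q"
    then obtain b where b: "b \<in> carrier Fr" "y = cl b" by (auto simp: carrier_Q)
    show "\<eta> (x \<otimes>\<^bsub>Q\<^esub> y) = \<eta> x \<otimes>\<^bsub>B\<^esub> \<eta> y"
      using alg_hom_mult[OF \<theta> a(1) b(1)] a b by (simp add: cl_ops \<eta> cmul_closed cfree_simps)
    show "\<eta> (x \<oplus>\<^bsub>Q\<^esub> y) = \<eta> x \<oplus>\<^bsub>B\<^esub> \<eta> y"
      using alg_hom_add[OF \<theta> a(1) b(1)] a b by (simp add: cl_ops \<eta> cfree_closed cfree_simps)
  qed
  then show ?thesis using \<eta> by blast
qed

text \<open>The induction principle of the completed free algebra, transported to the quotient.\<close>

lemma Q_dense_induct:
  assumes x: "x \<in> carrier Q"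
    and word: "\<And>w. w \<in> lists G \<Longrightarrow> P (cl (word w))"
    and add: "\<And>a b. a \<in> carrier Q \<Longrightarrow> b \<in> carrier Q \<Longrightarrow> P a \<Longrightarrow> P b \<Longrightarrow> P (a \<oplus>\<^bsub>Q\<^esub> b)"
    and smult: "\<And>a c. a \<in> carrier Q \<Longrightarrow> P a \<Longrightarrow> P (c \<odot>\<^bsub>Q\<^esub> a)"
    and lim: "\<And>a. a \<in> carrier Q \<Longrightarrow>
       (\<And>n. \<exists>b d. b \<in> carrier Q \<and> d \<in> carrier Q \<and> P b \<and> a = b \<oplus>\<^bsub>Q\<^esub> (hh ^ n) \<odot>\<^bsub>Q\<^esub> d) \<Longrightarrow> P a"
  shows "P x"
proof -
  obtain a where a: "a \<in> carrier Fr" "x = cl a" using x by (auto simp: carrier_Q)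
  have "P (cl a)"
    using a(1)
  proof (rule cfree_dense_induct[where X="lists G" and P="\<lambda>a. P (cl a)"])
    show "\<And>w. a w \<noteq> 0 \<Longrightarrow> w \<in> lists G" using a(1) by (auto simp: carrier_cfree)
    show "P (cl (\<lambda>w. 0))" using smult[OF _ word[of "[]"], of 0] cl_ops(5)[OF cfree_closed(5) cfree_closed(5)] by (simp add: word_closed)
    show "P (cl (word w))" if "w \<in> lists G" for w using word that .
    show "P (cl (\<lambda>w. a w + b w))" if "a \<in> carrier Fr" "b \<in> carrier Fr" "P (cl a)" "P (cl b)" for a b
      using add[of "cl a" "cl b"] that by (simp add: cl_ops)
    show "P (cl (\<lambda>w. c * a w))" if "a \<in> carrier Fr" "P (cl a)" for a c
      using smult[of "cl a" c] that by (simp add: cl_ops)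
    show "P (cl a)" if a: "a \<in> carrier Fr" and l: "\<And>n. \<exists>b d. b \<in> carrier Fr \<and> d \<in> carrier Fr \<and> P (cl b) \<and> a = (\<lambda>w. b w + hh ^ n * d w)" for a
    proof (rule lim)
      show "cl a \<in> carrier Q" using a by simp
      fix n
      obtain b d where "b \<in> carrier Fr" "d \<in> carrier Fr" "P (cl b)" "a = (\<lambda>w. b w + hh ^ n * d w)" using l by blast
      then show "\<exists>b d. b \<in> carrier Q \<and> d \<in> carrier Q \<and> P b \<and> cl a = b \<oplus>\<^bsub>Q\<^esub> (hh ^ n) \<odot>\<^bsub>Q\<^esub> d"
        by (intro exI[of _ "cl b"] exI[of _ "cl d"]) (simp add: cl_ops cfree_closed)
    qed
  qed simp
  then show ?thesis using a by simp
qed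

lemma hom_unique:
  assumes B: "sep_alg B" and \<theta>: "\<theta> \<in> alg_hom Q B" and \<eta>: "\<eta> \<in> alg_hom Q B"
    and gens: "\<And>g. g \<in> G \<Longrightarrow> \<theta> (cl (gen g)) = \<eta> (cl (gen g))" and x: "x \<in> carrier Q"
  shows "\<theta> x = \<eta> x"
  using x
proof (rule Q_dense_induct)
  interpret B: sep_alg B by fact
  show "\<theta> (cl (word w)) = \<eta> (cl (word w))" if "w \<in> lists G" for w
    using that
  proof (induction w)
    case Nil
    show ?case using alg_hom_one[OF \<theta>] alg_hom_one[OF \<eta>]
      by (simp add: cl_ops(4)[OF cfree_closed(5) cfree_closed(5)])
  next
    case (Cons g w)
    have "cl (word (g # w)) = cl (gen g) \<otimes>\<^bsub>Q\<^esub> cl (word w)"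
      using Cons by (simp add: cl_ops gen_eq_word word_closed cmul_word)
    then show ?case
      using Cons gens by (simp add: alg_hom_mult[OF \<theta>] alg_hom_mult[OF \<eta>] gen_eq_word word_closed)
  qed
  fix a assume a: "a \<in> carrier Q"
    and l: "\<And>n. \<exists>b d. b \<in> carrier Q \<and> d \<in> carrier Q \<and> \<theta> b = \<eta> b \<and> a = b \<oplus>\<^bsub>Q\<^esub> (hh ^ n) \<odot>\<^bsub>Q\<^esub> d"
  have "\<theta> a \<ominus>\<^bsub>B\<^esub> \<eta> a = \<zero>\<^bsub>B\<^esub>"
  proof (rule B.separated)
    show "\<theta> a \<ominus>\<^bsub>B\<^esub> \<eta> a \<in> carrier B"
      using alg_hom_closed[OF \<theta> a] alg_hom_closed[OF \<eta> a] by simp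
    fix n
    obtain b d where b: "b \<in> carrier Q" "d \<in> carrier Q" "\<theta> b = \<eta> b" "a = b \<oplus>\<^bsub>Q\<^esub> (hh ^ n) \<odot>\<^bsub>Q\<^esub> d"
      using l by blast
    have c: "\<eta> b \<in> carrier B" "\<eta> d \<in> carrier B" "\<theta> d \<in> carrier B" using b \<theta> \<eta> by (auto simp: alg_hom_closed)
    have "\<theta> a \<ominus>\<^bsub>B\<^esub> \<eta> a = (\<eta> b \<oplus>\<^bsub>B\<^esub> (hh ^ n) \<odot>\<^bsub>B\<^esub> \<theta> d) \<ominus>\<^bsub>B\<^esub> (\<eta> b \<oplus>\<^bsub>B\<^esub> (hh ^ n) \<odot>\<^bsub>B\<^esub> \<eta> d)"
      using b by (simp add: alg_hom_add[OF \<theta>] alg_hom_add[OF \<eta>] alg_hom_smult[OF \<theta>] alg_hom_smult[OF \<eta>])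
    also have "\<dots> = (hh ^ n) \<odot>\<^bsub>B\<^esub> \<theta> d \<ominus>\<^bsub>B\<^esub> (hh ^ n) \<odot>\<^bsub>B\<^esub> \<eta> d"
    proof -
      have "(u \<oplus>\<^bsub>B\<^esub> v) \<ominus>\<^bsub>B\<^esub> (u \<oplus>\<^bsub>B\<^esub> w) = v \<ominus>\<^bsub>B\<^esub> w" if "u \<in> carrier B" "v \<in> carrier B" "w \<in> carrier B" for u v w
        using that by (rule B.add_minus_add)
      then show ?thesis using c by simp
    qed
    also have "\<dots> = (hh ^ n) \<odot>\<^bsub>B\<^esub> (\<theta> d \<ominus>\<^bsub>B\<^esub> \<eta> d)" using c by (simp add: B.smult_minus)
    finally show "\<exists>d\<in>carrier B. \<theta> a \<ominus>\<^bsub>B\<^esub> \<eta> a = (hh ^ n) \<odot>\<^bsub>B\<^esub> d" using c by blast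
  qed
  then show "\<theta> a = \<eta> a"
    using B.minus_eq_zeroD[OF alg_hom_closed[OF \<theta> a] alg_hom_closed[OF \<eta> a]] by blast
qed (simp_all add: alg_hom_add[OF \<theta>] alg_hom_add[OF \<eta>] alg_hom_smult[OF \<theta>] alg_hom_smult[OF \<eta>])

text \<open>A functional need not be multiplicative, so its kernel need not be an ideal. The elements that it kills after
  multiplication by arbitrary words on both sides do form a closed ideal.\<close>

lemma functional_kills:
  assumes rel: "\<And>r p q. r \<in> S \<Longrightarrow> p \<in> lists G \<Longrightarrow> q \<in> lists G \<Longrightarrow> lin (\<lambda>v. V (p @ v @ q)) r = 0"
    and a: "a \<in> Iz"
  shows "lin V a = 0"
proof -
  define K where "K = {a \<in> carrier Fr. \<forall>p\<in>lists G. \<forall>q\<in>lists G. lin (\<lambda>v. V (p @ v @ q)) a = 0}"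
  have KI: "a \<in> K" if "a \<in> carrier Fr" "\<And>p q. p \<in> lists G \<Longrightarrow> q \<in> lists G \<Longrightarrow> lin (\<lambda>v. V (p @ v @ q)) a = 0" for a
    unfolding K_def using that by blast
  have KD: "a \<in> carrier Fr" "null a" "p \<in> lists G \<Longrightarrow> q \<in> lists G \<Longrightarrow> lin (\<lambda>v. V (p @ v @ q)) a = 0"
    if "a \<in> K" for a p q
    using that carrier_cfreeD unfolding K_def by blast+
  have lin_ext: "lin f x = 0" if "\<And>u. u \<in> lists G \<Longrightarrow> f u = 0" "x \<in> carrier Fr" for f x
  proof -
    have "(\<lambda>w. x w * f w) = (\<lambda>w. 0)"
    proof
      fix w show "x w * f w = 0"
        using that by (cases "w \<in> lists G") (auto simp: carrier_cfree)
    qed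
    then show ?thesis by (simp add: lin_def)
  qed
  have "ideal K Fr"
  proof (rule idealI)
    show "subgroup K (add_monoid Fr)"
    proof
      fix x assume x: "x \<in> K"
      have "inv\<^bsub>add_monoid Fr\<^esub> x = (\<lambda>w. (-1) * x w)" 
        using KD(1)[OF x] cfree_a_inv[of x G] by (simp add: a_inv_def)
      moreover have "lin (\<lambda>v. V (p @ v @ q)) (\<lambda>w. (-1) * x w) = 0"
        if "p \<in> lists G" "q \<in> lists G" for p q
        using KD[OF x] that by (subst lin_smult) simp_all
      ultimately show "inv\<^bsub>add_monoid Fr\<^esub> x \<in> K"
        using cfree_closed(3)[OF KD(1)[OF x], of "-1"] by (simp add: KI)
    next
      show "K \<subseteq> carrier (add_monoid Fr)" using KD(1) by auto
      show "\<one>\<^bsub>add_monoid Fr\<^esub> \<in> K" by (rule KI) (simp_all add: cfree_simps cfree_closed)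
    next
      fix x y assume xy: "x \<in> K" "y \<in> K"
      show "x \<otimes>\<^bsub>add_monoid Fr\<^esub> y \<in> K"
        by (rule KI) (use KD[OF xy(1)] KD[OF xy(2)] in \<open>simp_all add: cfree_simps cfree_closed lin_add\<close>)
    qed
    fix x y assume x: "x \<in> K" and y: "y \<in> carrier Fr"
    have n: "null x" "null y" using KD(2)[OF x] y by (auto simp: carrier_cfreeD)
    show "y \<otimes>\<^bsub>Fr\<^esub> x \<in> K"
    proof (rule KI)
      fix p q assume pq: "p \<in> lists G" "q \<in> lists G"
      have *: "lin (\<lambda>v. V (p @ (u @ v) @ q)) x = 0" if "u \<in> lists G" for u
      proof -
        have "p @ u \<in> lists G" using pq that by simp
        then show ?thesis using KD(3)[OF x, of "p @ u" q] pq by simp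
      qed
      then show "lin (\<lambda>v. V (p @ v @ q)) (y \<otimes>\<^bsub>Fr\<^esub> x) = 0"
        using lin_ext[OF * y] by (simp add: cfree_simps lin_cmul' n)
    qed (use KD(1)[OF x] y in \<open>simp add: cfree_simps cmul_closed\<close>)
    show "x \<otimes>\<^bsub>Fr\<^esub> y \<in> K"
    proof (rule KI)
      fix p q assume pq: "p \<in> lists G" "q \<in> lists G"
      have nn: "null (\<lambda>(u,v). x u * y v * V (p @ (u @ v) @ q))" by (rule null_prod[OF n])
      have "lin (\<lambda>v. V (p @ v @ q)) (cmul x y) = hsum (\<lambda>u. hsum (\<lambda>v. x u * y v * V (p @ (u @ v) @ q)))"
        unfolding lin_cmul[OF n] by (simp add: lin_def mult.assoc hsum_cmult null_mult_gen n)
      also have "\<dots> = hsum (\<lambda>v. hsum (\<lambda>u. x u * y v * V (p @ (u @ v) @ q)))"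
        by (rule hsum_swap[OF nn])
      also have "\<dots> = hsum (\<lambda>v. y v * lin (\<lambda>u. V (p @ u @ (v @ q))) x)"
      proof (rule arg_cong[where f=hsum], rule ext)
        fix v
        have "hsum (\<lambda>u. x u * y v * V (p @ (u @ v) @ q)) = hsum (\<lambda>u. y v * (x u * V (p @ u @ v @ q)))"
          by (simp add: mult_ac)
        then show "hsum (\<lambda>u. x u * y v * V (p @ (u @ v) @ q)) = y v * lin (\<lambda>u. V (p @ u @ (v @ q))) x"
          by (simp add: lin_def hsum_cmult null_mult_gen n)
      qed
      also have "\<dots> = hsum (\<lambda>v::'g list. 0)"
      proof (rule arg_cong[where f=hsum], rule ext)
        fix v
        show "y v * lin (\<lambda>u. V (p @ u @ (v @ q))) x = 0"
        proof (cases "v \<in> lists G")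
          case True
          then show ?thesis using KD(3)[OF x, of p "v @ q"] pq by simp
        qed (use y in \<open>auto simp: carrier_cfree\<close>)
      qed
      finally show "lin (\<lambda>v. V (p @ v @ q)) (x \<otimes>\<^bsub>Fr\<^esub> y) = 0" by (simp add: cfree_simps)
    qed (use KD(1)[OF x] y in \<open>simp add: cfree_simps cmul_closed\<close>)
  qed (rule Fr.ring_axioms)
  moreover have "hadic_closed Fr K"
    unfolding hadic_closed_def
  proof (intro ballI impI)
    fix x assume x: "x \<in> carrier Fr"
      and l: "\<forall>n. \<exists>b\<in>K. \<exists>d\<in>carrier Fr. x = b \<oplus>\<^bsub>Fr\<^esub> (hh ^ n) \<odot>\<^bsub>Fr\<^esub> d"
    show "x \<in> K"
    proof (rule KI[OF x], rule hh_power_dvd_all_imp_zero)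
      fix p q assume pq: "p \<in> lists G" "q \<in> lists G"
      fix n
      obtain b d where b: "b \<in> K" "d \<in> carrier Fr" "x = (\<lambda>w. b w + hh ^ n * d w)"
        using l[rule_format, of n] by (auto simp: cfree_simps)
      then have "lin (\<lambda>v. V (p @ v @ q)) x = hh ^ n * lin (\<lambda>v. V (p @ v @ q)) d"
        using pq KD[OF b(1)] by (simp add: lin_add lin_smult carrier_cfreeD null_mult_gen')
      then show "hh ^ n dvd lin (\<lambda>v. V (p @ v @ q)) x" by simp
    qed
  qed
  ultimately have "Iz \<subseteq> K"
    using S rel by (intro closed_ideal_least subsetI KI) blast+
  then show ?thesis using KD(3)[of a "[]" "[]"] a by auto
qed

end

section \<open>Normal ordering in enveloping algebras\<close>

fun desc :: "'b::linorder list \<Rightarrow> ('b list \<times> 'b \<times> 'b \<times> 'b list) option" where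
  "desc (a # b # v) = (if b < a then Some ([], a, b, v)
     else map_option (\<lambda>(u, x, y, w). (a # u, x, y, w)) (desc (b # v)))"
| "desc _ = None"

fun inversions :: "'b::linorder list \<Rightarrow> nat" where
  "inversions [] = 0"
| "inversions (x # xs) = length (filter (\<lambda>y. y < x) xs) + inversions xs"

lemma desc_SomeD:
  "desc w = Some (u, a, b, v) \<Longrightarrow> w = u @ a # b # v \<and> b < a \<and> sorted (u @ [a])"
proof (induction w arbitrary: u rule: desc.induct)
  case (1 x y w)
  show ?case
  proof (cases "y < x")
    case False
    then obtain u' where u': "desc (y # w) = Some (u', a, b, v)" "u = x # u'" using 1(2) by auto
    have "y # w = u' @ a # b # v" "b < a" "sorted (u' @ [a])" using 1(1)[OF False u'(1)] by auto
    moreover have "x \<le> hd (u' @ [a])" using False calculation(1) by (cases u') auto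
    ultimately show ?thesis using u' by (cases u') auto
  qed (use 1(2) in auto)
qed auto

lemma desc_NoneD: "desc w = None \<Longrightarrow> sorted w"
  by (induction w rule: desc.induct) (auto split: if_splits)

lemma sorted_desc: "sorted w \<Longrightarrow> desc w = None"
proof (rule ccontr)
  assume w: "sorted w" "desc w \<noteq> None"
  then obtain u a b v where d: "desc w = Some (u, a, b, v)" by auto
  from desc_SomeD[OF d] w(1) show False by (auto simp: sorted_append)
qed

lemma inversions_swap: "b < a \<Longrightarrow> inversions (u @ b # a # v) < inversions (u @ a # b # v)"
proof (induction u)
  case (Cons x u)
  have "length (filter (\<lambda>y. y < x) (u @ b # a # v)) = length (filter (\<lambda>y. y < x) (u @ a # b # v))"
    by simp
  then show ?case using Cons by simp
qed auto

text \<open>If \<open>br\<close> is a Lie bracket, the value at \<open>w\<close> of the functional that agrees with \<open>f\<close> on sorted words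
  and respects the commutation relations: the leftmost descent \<open>ab\<close> of \<open>w\<close> is replaced by \<open>ba + [a, b]\<close>. The first
  term has fewer inversions, the second is shorter. That swaps at other places give the same value
  is the content of \<open>normal_order_swap\<close>.\<close>

function normal_order :: "('b::linorder \<Rightarrow> 'b \<Rightarrow> 'b \<Rightarrow> scal) \<Rightarrow> ('b list \<Rightarrow> scal) \<Rightarrow> 'b list \<Rightarrow> scal" where
  "normal_order br f w = (case desc w of None \<Rightarrow> f w
     | Some (u, a, b, v) \<Rightarrow> normal_order br f (u @ b # a # v) + hsum (\<lambda>d. br a b d * normal_order br f (u @ d # v)))"
  by auto
termination
  by (relation "measures [\<lambda>(br, f, w). length w, \<lambda>(br, f, w). inversions w]")
    (auto dest!: desc_SomeD intro: inversions_swap)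

declare normal_order.simps [simp del]

text \<open>The bookkeeping for a word \<open>xyz\<close> with \<open>x > y > z\<close>. The two ways to sort it pass through
  \<open>yxz, yzx, zyx\<close> and through \<open>xzy, zxy, zyx\<close>; the correction terms \<open>P, Q, R\<close> belong to the brackets of
  \<open>x, y\<close>, of \<open>x, z\<close> and of \<open>y, z\<close>. Their differences are double brackets, which cancel by the
  Jacobi identity.\<close>

lemma overlap_cancel:
  fixes N :: "'a::ab_group_add"
  assumes "N = yxz + P1" "yxz = yzx + Q1" "yzx = zyx + R1" "xzy = zxy + Q2" "zxy = zyx + P2"
    and J: "P1 - P2 = J1" "R1 - R2 = J2" "Q2 - Q1 = - J3" "J1 + J2 + J3 = 0"
  shows "N = xzy + R2"
proof -
  have "J3 = Q1 - Q2" using J(3) by (metis minus_diff_eq minus_minus)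
  then have "(P1 - P2) + (R1 - R2) + (Q1 - Q2) = 0" using J by simp
  moreover have "N - (xzy + R2) = (P1 - P2) + (R1 - R2) + (Q1 - Q2)"
    by (simp add: assms(1-5) algebra_simps)
  ultimately show ?thesis by simp
qed

locale lie_structure =
  fixes br :: "'b::linorder \<Rightarrow> 'b \<Rightarrow> 'b \<Rightarrow> scal"
  assumes fin: "finite {d. br x y d \<noteq> 0}"
    and antisym: "br y x d = - br x y d"
    and jacobi: "hsum (\<lambda>d. br x y d * br d z e) + hsum (\<lambda>d. br y z d * br d x e)
      + hsum (\<lambda>d. br z x d * br d y e) = 0"
begin

lemma null_br: "null (br x y)" using fin by (rule null_finite)

definition bs :: "'b \<Rightarrow> 'b \<Rightarrow> ('b \<Rightarrow> scal) \<Rightarrow> scal" where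
  "bs x y g = hsum (\<lambda>d. br x y d * g d)"

lemma bs_add: "bs x y (\<lambda>d. g d + k d) = bs x y g + bs x y k"
  by (simp add: bs_def distrib_left hsum_add null_mult_gen null_br)

lemma bs_diff: "bs x y (\<lambda>d. g d - k d) = bs x y g - bs x y k"
  by (simp add: bs_def right_diff_distrib hsum_diff null_mult_gen null_br)

lemma bs_antisym: "bs y x g = - bs x y g"
  by (simp add: bs_def antisym[of x y] hsum_uminus null_mult_gen null_br)

lemma bs_refl: "bs x x g = 0"
proof -
  have "br x x d = 0" for d using antisym[of x x d] by (simp add: fps_eq_iff) 
  then show ?thesis by (simp add: bs_def)
qed

lemma bs_swap: "bs x y (\<lambda>d. bs z w (\<lambda>e. g d e)) = bs z w (\<lambda>e. bs x y (\<lambda>d. g d e))"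
proof -
  have n: "null (\<lambda>(d,e). br x y d * br z w e * g d e)" by (rule null_prod) (rule null_br)+
  have "bs x y (\<lambda>d. bs z w (\<lambda>e. g d e)) = hsum (\<lambda>d. hsum (\<lambda>e. br x y d * br z w e * g d e))"
    by (simp add: bs_def mult.assoc hsum_cmult null_mult_gen null_br)
  also have "\<dots> = hsum (\<lambda>e. hsum (\<lambda>d. br x y d * br z w e * g d e))" by (rule hsum_swap[OF n])
  also have "\<dots> = hsum (\<lambda>e. hsum (\<lambda>d. br z w e * (br x y d * g d e)))" by (simp add: mult_ac)
  also have "\<dots> = bs z w (\<lambda>e. bs x y (\<lambda>d. g d e))"
    by (simp add: bs_def hsum_cmult null_mult_gen null_br)
  finally show ?thesis .
qed

lemma bs_nested: "bs x y (\<lambda>d. bs d z g) = hsum (\<lambda>e. hsum (\<lambda>d. br x y d * br d z e) * g e)"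
  and null_nested: "null (\<lambda>e. hsum (\<lambda>d. br x y d * br d z e))"
proof -
  have n: "null (\<lambda>(d,e). br x y d * br d z e * k e)" for k
  proof (rule null_finite'[of "Sigma {d. br x y d \<noteq> 0} (\<lambda>d. {e. br d z e \<noteq> 0})"])
    show "finite (Sigma {d. br x y d \<noteq> 0} (\<lambda>d. {e. br d z e \<noteq> 0}))" using fin by auto
  qed auto
  have "bs x y (\<lambda>d. bs d z g) = hsum (\<lambda>d. hsum (\<lambda>e. br x y d * br d z e * g e))"
    by (simp add: bs_def mult.assoc hsum_cmult null_mult_gen null_br)
  also have "\<dots> = hsum (\<lambda>e. hsum (\<lambda>d. br x y d * br d z e * g e))" by (rule hsum_swap[OF n])
  also have "\<dots> = hsum (\<lambda>e. hsum (\<lambda>d. br x y d * br d z e) * g e)"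
    by (simp add: hsum_multc null_mult_gen null_br)
  finally show "bs x y (\<lambda>d. bs d z g) = hsum (\<lambda>e. hsum (\<lambda>d. br x y d * br d z e) * g e)" .
  have "null (\<lambda>(e,d). br x y d * br d z e)" using null_swap[OF n[of "\<lambda>_. 1"]] by simp
  then show "null (\<lambda>e. hsum (\<lambda>d. br x y d * br d z e))" by (rule null_hsum)
qed

lemma bs_jacobi: "bs x y (\<lambda>d. bs d z g) + bs y z (\<lambda>d. bs d x g) + bs z x (\<lambda>d. bs d y g) = 0"
proof -
  have n: "null (\<lambda>e. hsum (\<lambda>d. br x y d * br d z e) * g e)" for x y z
    by (rule null_mult_gen[OF null_nested])
  have "bs x y (\<lambda>d. bs d z g) + bs y z (\<lambda>d. bs d x g) + bs z x (\<lambda>d. bs d y g) =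
    hsum (\<lambda>e. (hsum (\<lambda>d. br x y d * br d z e) + hsum (\<lambda>d. br y z d * br d x e)
      + hsum (\<lambda>d. br z x d * br d y e)) * g e)"
    by (simp add: bs_nested distrib_right hsum_add null_add n)
  then show ?thesis by (simp add: jacobi)
qed

lemma normal_order_sorted: "sorted w \<Longrightarrow> normal_order br f w = f w"
  by (subst normal_order.simps) (simp add: sorted_desc)

text \<open>The diamond argument. By definition the equation holds for the leftmost descent. A second descent
  either is disjoint from it, and then the two swaps commute, or overlaps with it, and then the
  Jacobi identity reconciles them. Both cases only compare words that are shorter or have fewer inversions.\<close>

lemma normal_order_descent:
  "b < a \<Longrightarrow> normal_order br f (u @ a # b # v) =
     normal_order br f (u @ b # a # v) + bs a b (\<lambda>d. normal_order br f (u @ d # v))"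
proof (induction "u @ a # b # v" arbitrary: u a b v rule: wf_induct_rule[OF wf_measures[of "[length, inversions]"]])
  case (1 u a b v)
  let ?N = "normal_order br f"
  have IH: "?N (u' @ a' # b' # v') = ?N (u' @ b' # a' # v') + bs a' b' (\<lambda>d. ?N (u' @ d # v'))"
    if "b' < a'" "length (u' @ a' # b' # v') < length (u @ a # b # v) \<or>
       (length (u' @ a' # b' # v') = length (u @ a # b # v) \<and>
        inversions (u' @ a' # b' # v') < inversions (u @ a # b # v))" for u' a' b' v'
    by (rule 1(1)) (use that in auto)
  have R: "?N (u' @ a' # b' # v') = ?N (u' @ b' # a' # v') + bs a' b' (\<lambda>d. ?N (u' @ d # v'))"
    if "length (u' @ v') < length (u @ v)" for u' a' b' v'
  proof (cases a' b' rule: linorder_cases)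
    case less
    then show ?thesis using IH[of a' b' u' v'] bs_antisym[of a' b'] that by simp
  next
    case equal then show ?thesis by (simp add: bs_refl)
  next
    case greater then show ?thesis using IH[of b' a' u' v'] that by simp
  qed
  have "\<not> sorted (u @ a # b # v)" using \<open>b < a\<close> by (auto simp: sorted_append)
  then obtain u' a' b' v' where d: "desc (u @ a # b # v) = Some (u', a', b', v')"
    using desc_NoneD by (cases "desc (u @ a # b # v)") auto
  have w: "u @ a # b # v = u' @ a' # b' # v'" and ba': "b' < a'" and so: "sorted (u' @ [a'])"
    using desc_SomeD[OF d] by auto
  have N: "?N (u @ a # b # v) = ?N (u' @ b' # a' # v') + bs a' b' (\<lambda>d. ?N (u' @ d # v'))"
    by (subst normal_order.simps) (simp add: d bs_def)
  have "\<exists>t. u = u' @ t \<and> a' # b' # v' = t @ a # b # v"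
  proof -
    have "\<exists>t. (u = u' @ t \<and> t @ a # b # v = a' # b' # v') \<or> (u @ t = u' \<and> a # b # v = t @ a' # b' # v')"
      using w by (simp add: append_eq_append_conv2)
    then obtain t where t: "(u = u' @ t \<and> t @ a # b # v = a' # b' # v') \<or> (u @ t = u' \<and> a # b # v = t @ a' # b' # v')" ..
    show ?thesis
    proof (cases "u = u' @ t \<and> t @ a # b # v = a' # b' # v'")
      case False
      then have t2: "u' = u @ t" "a # b # v = t @ a' # b' # v'" using t by auto
      show ?thesis
      proof (cases t)
        case (Cons p t')
        show ?thesis
        proof (cases t')
          case Nil
          then show ?thesis using Cons t2 so \<open>b < a\<close> by (auto simp: sorted_append)
        next
          case (Cons q t'')
          then show ?thesis using \<open>t = p # t'\<close> t2 so \<open>b < a\<close> by (auto simp: sorted_append)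
        qed
      qed (use t2 in auto)
    qed auto
  qed
  then obtain t where t: "u = u' @ t" "a' # b' # v' = t @ a # b # v" by blast
  consider "t = []" | "t = [a']" "b' = a" "v' = b # v" | m where "t = a' # b' # m" "v' = m @ a # b # v"
    using t(2) by (cases t; cases "tl t") auto
  then show ?case
  proof cases
    case 1
    then show ?thesis using N t by simp
  next
    case 2
    \<comment> \<open>The two descents overlap in a word \<open>xyz\<close> with \<open>x > y > z\<close>.\<close>
    let ?x = a' and ?y = a and ?z = b
    have u: "u = u' @ [?x]" using t 2 by simp
    have xy: "?y < ?x" and yz: "?z < ?y" using ba' 2 \<open>b < a\<close> by auto
    have i1: "inversions (u' @ ?y # ?x # ?z # v) < inversions (u' @ ?x # ?y # ?z # v)"
      by (rule inversions_swap[OF xy])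
    have i2: "inversions (u' @ ?y # ?z # ?x # v) < inversions (u' @ ?y # ?x # ?z # v)"
      using inversions_swap[of ?z ?x "u' @ [?y]" v] xy yz by simp
    have i3: "inversions (u' @ ?x # ?z # ?y # v) < inversions (u' @ ?x # ?y # ?z # v)"
      using inversions_swap[of ?z ?y "u' @ [?x]" v] yz by simp
    have i4: "inversions (u' @ ?z # ?x # ?y # v) < inversions (u' @ ?x # ?z # ?y # v)"
      using inversions_swap[of ?z ?x u' "?y # v"] xy yz by simp
    have e1: "?N (u' @ ?y # ?x # ?z # v) = ?N (u' @ ?y # ?z # ?x # v) + bs ?x ?z (\<lambda>d. ?N (u' @ ?y # d # v))"
      using IH[of ?z ?x "u' @ [?y]" v] xy yz i1 by (simp add: u)
    have e2: "?N (u' @ ?y # ?z # ?x # v) = ?N (u' @ ?z # ?y # ?x # v) + bs ?y ?z (\<lambda>d. ?N (u' @ d # ?x # v))"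
      using IH[of ?z ?y u' "?x # v"] yz i1 i2 by (simp add: u)
    have e3: "?N (u' @ ?x # ?z # ?y # v) = ?N (u' @ ?z # ?x # ?y # v) + bs ?x ?z (\<lambda>d. ?N (u' @ d # ?y # v))"
      using IH[of ?z ?x u' "?y # v"] xy yz i3 by (simp add: u)
    have e4: "?N (u' @ ?z # ?x # ?y # v) = ?N (u' @ ?z # ?y # ?x # v) + bs ?x ?y (\<lambda>d. ?N (u' @ ?z # d # v))"
      using IH[of ?y ?x "u' @ [?z]" v] xy i3 i4 by (simp add: u)
    let ?g = "\<lambda>e. ?N (u' @ e # v)"
    have r: "?N (u' @ d # c # v) - ?N (u' @ c # d # v) = bs d c ?g" for c d
      using R[of u' v d c] by (simp add: u)
    have "bs ?x ?y (\<lambda>d. ?N (u' @ d # ?z # v)) - bs ?x ?y (\<lambda>d. ?N (u' @ ?z # d # v)) = bs ?x ?y (\<lambda>d. bs d ?z ?g)"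
      by (simp add: bs_diff[symmetric] r)
    moreover have "bs ?y ?z (\<lambda>d. ?N (u' @ d # ?x # v)) - bs ?y ?z (\<lambda>d. ?N (u' @ ?x # d # v)) = bs ?y ?z (\<lambda>d. bs d ?x ?g)"
      by (simp add: bs_diff[symmetric] r)
    moreover have "bs ?x ?z (\<lambda>d. ?N (u' @ d # ?y # v)) - bs ?x ?z (\<lambda>d. ?N (u' @ ?y # d # v)) = - bs ?z ?x (\<lambda>d. bs d ?y ?g)"
      by (simp add: bs_diff[symmetric] r bs_antisym[of ?z ?x])
    moreover note bs_jacobi[of ?x ?y ?z ?g]
    moreover have "?N (u @ a # b # v) = ?N (u' @ ?y # ?x # ?z # v) + bs ?x ?y (\<lambda>d. ?N (u' @ d # ?z # v))"
      using N 2 by simp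
    ultimately have "?N (u @ a # b # v) = ?N (u' @ ?x # ?z # ?y # v) + bs ?y ?z (\<lambda>d. ?N (u' @ ?x # d # v))"
      using overlap_cancel[OF _ e1 e2 e3 e4] by blast
    then show ?thesis by (simp add: u)
  next
    case (3 m)
    have u: "u = u' @ a' # b' # m" using t 3 by simp
    have i1: "inversions (u' @ b' # a' # m @ a # b # v) < inversions (u @ a # b # v)"
      using inversions_swap[OF ba', of u' "m @ a # b # v"] by (simp add: u)
    have i2: "inversions (u' @ a' # b' # m @ b # a # v) < inversions (u @ a # b # v)"
      using inversions_swap[OF \<open>b < a\<close>, of u v] by (simp add: u)
    have e1: "?N (u' @ b' # a' # m @ a # b # v) = ?N (u' @ b' # a' # m @ b # a # v) + bs a b (\<lambda>e. ?N (u' @ b' # a' # m @ e # v))"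
      using IH[of b a "u' @ b' # a' # m" v] \<open>b < a\<close> i1 by (simp add: u)
    have e2: "?N (u' @ a' # b' # m @ b # a # v) = ?N (u' @ b' # a' # m @ b # a # v) + bs a' b' (\<lambda>d. ?N (u' @ d # m @ b # a # v))"
      using IH[of b' a' u' "m @ b # a # v"] ba' i2 by (simp add: u)
    have e3: "?N (u' @ d # m @ a # b # v) = ?N (u' @ d # m @ b # a # v) + bs a b (\<lambda>e. ?N (u' @ d # m @ e # v))" for d
      using R[of "u' @ d # m" v a b] by (simp add: u)
    have e4: "?N (u' @ a' # b' # m @ e # v) = ?N (u' @ b' # a' # m @ e # v) + bs a' b' (\<lambda>d. ?N (u' @ d # m @ e # v))" for e
      using R[of u' "m @ e # v" a' b'] by (simp add: u)
    have "?N (u @ a # b # v) = ?N (u' @ b' # a' # m @ a # b # v) + bs a' b' (\<lambda>d. ?N (u' @ d # m @ a # b # v))"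
      using N 3 by simp
    also have "\<dots> = ?N (u' @ a' # b' # m @ b # a # v) + bs a b (\<lambda>e. ?N (u' @ a' # b' # m @ e # v))"
      by (simp add: e1 e2 e3 e4 bs_add bs_swap[of a' b' a b])
    finally show ?thesis by (simp add: u)
  qed
qed

text \<open>The consistency statement behind the Poincare-Birkhoff-Witt theorem: normal ordering is compatible with
  the defining relations of the enveloping algebra at every position of a word.\<close>

theorem normal_order_swap:
  "normal_order br f (u @ a # b # v) - normal_order br f (u @ b # a # v) =
     hsum (\<lambda>d. br a b d * normal_order br f (u @ d # v))"
proof (cases a b rule: linorder_cases)
  case less
  then show ?thesis using normal_order_descent[of a b f u v] bs_antisym[of a b] by (simp add: bs_def)
next
  case equal then show ?thesis using bs_refl[of a] by (simp add: bs_def)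
next
  case greater then show ?thesis using normal_order_descent[of b a f u v] by (simp add: bs_def)
qed

end

section \<open>Functionals on presented algebras\<close>

context presentation begin

text \<open>The functional on the quotient induced by one that vanishes on the ideal of relations.\<close>

definition fnl :: "('g list \<Rightarrow> scal) \<Rightarrow> ('g list \<Rightarrow> scal) set \<Rightarrow> scal" where
  "fnl V C = lin V (SOME a. a \<in> carrier Fr \<and> cl a = C)"

lemma fnl_cl:
  assumes kills: "\<And>a. a \<in> Iz \<Longrightarrow> lin V a = 0" and a: "a \<in> carrier Fr"
  shows "fnl V (cl a) = lin V a"
proof -
  define b where "b = (SOME b. b \<in> carrier Fr \<and> cl b = cl a)"
  have "b \<in> carrier Fr \<and> cl b = cl a" unfolding b_def by (rule someI[of _ a]) (use a in auto)
  then have b: "b \<in> carrier Fr" "cl b = cl a" by auto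
  then have "(\<lambda>w. b w - a w) \<in> Iz" using a cl_eq_iff by blast
  then have "lin V b - lin V a = 0"
    using kills lin_diff[OF carrier_cfreeD[OF b(1)] carrier_cfreeD[OF a], of V] by simp
  then show ?thesis by (simp add: fnl_def b_def)
qed

lemma fnl_linear:
  assumes kills: "\<And>a. a \<in> Iz \<Longrightarrow> lin V a = 0" and x: "x \<in> carrier Q"
  shows "y \<in> carrier Q \<Longrightarrow> fnl V (x \<oplus>\<^bsub>Q\<^esub> y) = fnl V x + fnl V y"
    and "fnl V (c \<odot>\<^bsub>Q\<^esub> x) = c * fnl V x"
proof -
  obtain a where a: "a \<in> carrier Fr" "x = cl a" using x by (auto simp: carrier_Q)
  show "fnl V (c \<odot>\<^bsub>Q\<^esub> x) = c * fnl V x"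
    using a by (simp add: cl_ops fnl_cl[OF kills] cfree_closed lin_smult carrier_cfreeD)
  assume "y \<in> carrier Q"
  then obtain b where b: "b \<in> carrier Fr" "y = cl b" by (auto simp: carrier_Q)
  show "fnl V (x \<oplus>\<^bsub>Q\<^esub> y) = fnl V x + fnl V y"
    using a b by (simp add: cl_ops fnl_cl[OF kills] cfree_closed lin_add carrier_cfreeD)
qed

end

section \<open>Normal forms of difference operators\<close>

definition sh :: "int \<Rightarrow> scal poly \<Rightarrow> scal poly" where
  "sh r f = pcompose f [:of_int r * hh, 1:]"

lemma sh_ops:
  "sh r (f + g) = sh r f + sh r g" "sh r (f - g) = sh r f - sh r g" "sh r (f * g) = sh r f * sh r g"
  "sh r (Polynomial.smult c f) = Polynomial.smult c (sh r f)" "sh r 1 = 1" "sh r 0 = 0" "sh r (- f) = - sh r f"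
  by (simp_all add: sh_def pcompose_add pcompose_diff pcompose_mult pcompose_smult pcompose_1 pcompose_uminus)

lemma sh_sh: "sh r (sh s f) = sh (r + s) f"
proof -
  have "sh r (sh s f) = pcompose f (pcompose [:of_int s * hh, 1:] [:of_int r * hh, 1:])"
    by (simp add: sh_def pcompose_assoc)
  also have "pcompose [:of_int s * hh, 1:] [:of_int r * hh, 1:] = [:of_int (r + s) * hh, 1 :: scal:]"
    by (simp add: pcompose_pCons algebra_simps)
  finally show ?thesis by (simp add: sh_def)
qed

lemma sh_0 [simp]: "sh 0 f = f"
  by (simp add: sh_def pcompose_idR)

lemma sh_pCons_0: "sh r (pCons 0 p) = pCons 0 (sh r p) + Polynomial.smult (of_int r * hh) (sh r p)"
  by (simp add: sh_def pcompose_pCons)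

lemma poly_sh: "poly (sh r f) x = poly f (x + of_int r * hh)"
  by (simp add: sh_def poly_pcompose add.commute)

lemma sh_sum: "sh r (sum f T) = (\<Sum>i\<in>T. sh r (f i))"
  by (simp add: sh_def pcompose_sum)

fun word_deg :: "dgen list \<Rightarrow> int" where
  "word_deg [] = 0"
| "word_deg (DX # w) = word_deg w"
| "word_deg (DP # w) = word_deg w + 1"
| "word_deg (DM # w) = word_deg w - 1"

text \<open>Moving all powers of \<open>\<partial>\<close> to the right turns a word into \<open>f(x) \<partial>\<^sup>r\<close>; here \<open>r\<close> is \<open>word_deg\<close> and \<open>f\<close> is
  \<open>word_poly\<close>. Each \<open>\<partial>\<^sup>\<plusminus>\<^sup>1\<close> that is moved past \<open>f(x)\<close> shifts it to \<open>f(x \<plusminus> h)\<close>.\<close>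

fun word_poly :: "dgen list \<Rightarrow> scal poly" where
  "word_poly [] = 1"
| "word_poly (DX # w) = [:0, 1:] * word_poly w"
| "word_poly (DP # w) = sh 1 (word_poly w)"
| "word_poly (DM # w) = sh (-1) (word_poly w)"

lemma word_deg_append: "word_deg (u @ v) = word_deg u + word_deg v"
  by (induction u rule: word_deg.induct) auto

lemma word_poly_append: "word_poly (u @ v) = word_poly u * sh (word_deg u) (word_poly v)"
proof (induction u rule: word_poly.induct)
  case (2 w) then show ?case by (simp only: append_Cons word_poly.simps word_deg.simps mult.assoc)
next
  case (3 w) then show ?case by (simp add: sh_ops sh_sh add.commute)
next
  case (4 w) then show ?case by (simp add: sh_ops sh_sh)
qed simp

definition dpow :: "int \<Rightarrow> dgen list" where
  "dpow r = (if 0 \<le> r then replicate (nat r) DP else replicate (nat (- r)) DM)"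

text \<open>The word \<open>x\<^sup>i \<partial>\<^sup>r\<close>, for a pair \<open>(r, i)\<close>.\<close>

definition mon_word :: "int \<times> nat \<Rightarrow> dgen list" where
  "mon_word d = replicate (snd d) DX @ dpow (fst d)"

lemma nf_dpow: "word_deg (dpow r) = r" "word_poly (dpow r) = 1"
proof -
  have "word_deg (replicate n DP) = int n" "word_deg (replicate n DM) = - int n" "word_poly (replicate n DP) = 1" "word_poly (replicate n DM) = 1" for n
    by (induction n) (auto simp: sh_ops)
  then show "word_deg (dpow r) = r" "word_poly (dpow r) = 1" by (auto simp: dpow_def)
qed

lemma nf_mon_word: "word_deg (mon_word (r, i)) = r" "word_poly (mon_word (r, i)) = monom 1 i"
proof -
  have "word_deg (replicate i DX) = 0" "word_poly (replicate i DX) = monom 1 i"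
    by (induction i) (simp_all add: monom_Suc)
  then show "word_deg (mon_word (r, i)) = r" "word_poly (mon_word (r, i)) = monom 1 i"
    by (simp_all add: mon_word_def word_deg_append word_poly_append nf_dpow sh_ops)
qed

lemma inj_mon_word: "inj mon_word"
proof (rule injI)
  fix d e assume a: "mon_word d = mon_word e"
  obtain r i s j where de: "d = (r, i)" "e = (s, j)" by (cases d, cases e)
  have "r = s" using a nf_mon_word(1)[of r i] nf_mon_word(1)[of s j] de by simp
  moreover have "monom (1::scal) i = monom 1 j" using a nf_mon_word(2)[of r i] nf_mon_word(2)[of s j] de by simp
  then have "i = j" by (metis degree_monom_eq one_neq_zero)
  ultimately show "d = e" using de by simp
qed

definition mon_coeff :: "int \<times> nat \<Rightarrow> dgen list \<Rightarrow> scal" where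
  "mon_coeff d w = (if word_deg w = fst d then coeff (word_poly w) (snd d) else 0)"

lemma mon_coeff_mon_word: "mon_coeff d (mon_word e) = (if d = e then 1 else 0)"
  by (cases d; cases e) (auto simp: mon_coeff_def nf_mon_word)

lemma D_rels_eq: "D_rels = {\<lambda>w. word [DP, DM] w - word [] w, \<lambda>w. word [DM, DP] w - word [] w,
   \<lambda>w. word [DP, DX] w - (word [DX, DP] w + hh * word [DP] w)}"
proof -
  have c: "word w \<in> carrier (cfree (UNIV :: dgen set))" for w by (rule word_closed) simp
  have c2: "(\<lambda>w. word [DX, DP] w + hh * word [DP] w) \<in> carrier (cfree (UNIV :: dgen set))"
    by (intro cfree_closed c)
  show ?thesis
    unfolding D_rels_def Let_def gen_eq_word cfree_simps
    by (simp add: cmul_word cmul_add_left cmul_smult_left cmul_one_left cfree_minus[OF c] cfree_minus[OF c2])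
qed

lemma word_closed_UNIV: "word w \<in> carrier (cfree UNIV)"
  by (rule word_closed) simp

interpretation D: presentation "UNIV :: dgen set" D_rels
  rewrites "pres_alg UNIV D_rels = D_alg"
proof -
  show "presentation (UNIV :: dgen set) D_rels"
    unfolding presentation_def D_rels_eq by (auto intro!: cfree_closed word_closed)
qed (simp add: D_alg_def)

text \<open>Both sides of each relation have the same normal form \<open>f(x) \<partial>\<^sup>r\<close>, so its coefficients are
  well defined on the algebra of difference operators. This is what makes the monomials \<open>x\<^sup>i \<partial>\<^sup>r\<close> independent.\<close>

lemma mon_coeff_kills: "a \<in> D.Iz \<Longrightarrow> lin (mon_coeff d) a = 0"
proof (rule D.functional_kills)
  fix r :: "dgen list \<Rightarrow> scal" and p q assume r: "r \<in> D_rels"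
  let ?V = "\<lambda>v. mon_coeff d (p @ v @ q)"
  have e: "?V [DP, DM] = ?V []" "?V [DM, DP] = ?V []"
    by (simp_all add: mon_coeff_def word_deg_append word_poly_append sh_sh sh_ops)
  have "word_poly (DP # DX # q) = word_poly (DX # DP # q) + Polynomial.smult hh (word_poly (DP # q))"
    by (simp add: sh_pCons_0)
  then have e3: "?V [DP, DX] = ?V [DX, DP] + hh * ?V [DP]"
    by (simp add: mon_coeff_def word_deg_append word_poly_append sh_ops distrib_left del: word_poly.simps)
  show "lin ?V r = 0"
    using r e e3 by (auto simp: D_rels_eq lin_diff lin_add lin_smult null_word null_add null_mult_gen')
qed

text \<open>The same element, rewritten as a convergent combination of the words \<open>x\<^sup>i \<partial>\<^sup>r\<close>.\<close>

definition normal_form :: "(dgen list \<Rightarrow> scal) \<Rightarrow> (dgen list \<Rightarrow> scal)" where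
  "normal_form a = (\<lambda>w. if w \<in> range mon_word then lin (mon_coeff (inv_into UNIV mon_word w)) a else 0)"

lemma normal_form_mon_word: "normal_form a (mon_word d) = lin (mon_coeff d) a"
  by (simp add: normal_form_def inv_f_f[OF inj_mon_word])

lemma null_coords: assumes a: "null a" shows "null (\<lambda>d. lin (mon_coeff d) a)"
proof -
  have "null (\<lambda>(d,u). a u * mon_coeff d u)"
    unfolding null_iff
  proof
    fix n
    have f: "finite {d. mon_coeff d u \<noteq> 0}" for u
    proof (rule finite_subset)
      show "{d. mon_coeff d u \<noteq> 0} \<subseteq> {word_deg u} \<times> {..degree (word_poly u)}"
        by (auto simp: mon_coeff_def le_degree split: if_splits)
    qed simp
    have "{z. \<not> hh ^ n dvd (case z of (d,u) \<Rightarrow> a u * mon_coeff d u)} \<subseteq> prod.swap ` Sigma {u. \<not> hh ^ n dvd a u} (\<lambda>u. {d. mon_coeff d u \<noteq> 0})"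
      by (auto simp: image_iff)
    then show "finite {z. \<not> hh ^ n dvd (case z of (d,u) \<Rightarrow> a u * mon_coeff d u)}"
      by (rule finite_subset) (use a f in \<open>auto simp: null_iff\<close>)
  qed
  then show ?thesis unfolding lin_def by (rule null_hsum)
qed

lemma normal_form_closed: assumes "a \<in> carrier (cfree UNIV)" shows "normal_form a \<in> carrier (cfree UNIV)"
proof -
  have "null (normal_form a)" unfolding null_def
  proof
    fix n
    have "{w. fps_nth (normal_form a w) n \<noteq> 0} \<subseteq> mon_word ` {d. fps_nth (lin (mon_coeff d) a) n \<noteq> 0}"
      by (auto simp: normal_form_def inv_f_f[OF inj_mon_word] split: if_splits)
    then show "finite {w. fps_nth (normal_form a w) n \<noteq> 0}"
      by (rule finite_subset) (use null_coords[OF carrier_cfreeD[OF assms]] in \<open>auto simp: null_def\<close>)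
  qed
  then show ?thesis by (simp add: carrier_cfree)
qed

lemma normal_form_linear:
  assumes "a \<in> carrier (cfree UNIV)" "b \<in> carrier (cfree UNIV)"
  shows "normal_form (\<lambda>w. a w + b w) = (\<lambda>w. normal_form a w + normal_form b w)" "normal_form (\<lambda>w. c * a w) = (\<lambda>w. c * normal_form a w)"
  using assms by (auto simp: normal_form_def fun_eq_iff lin_add lin_smult carrier_cfreeD)

lemma normal_form_Iz: "a \<in> D.Iz \<Longrightarrow> normal_form a = (\<lambda>w. 0)"
  by (auto simp: normal_form_def mon_coeff_kills)

text \<open>That \<open>a\<close> and its normal form agree in the algebra of difference operators. This holds for all \<open>a\<close>,
  which means that the monomials \<open>x\<^sup>i \<partial>\<^sup>r\<close> span topologically.\<close>

definition normalizes :: "(dgen list \<Rightarrow> scal) \<Rightarrow> bool" where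
  "normalizes a \<longleftrightarrow> (\<lambda>w. a w - normal_form a w) \<in> D.Iz"

lemma normalizes_add:
  assumes "a \<in> carrier (cfree UNIV)" "b \<in> carrier (cfree UNIV)" "normalizes a" "normalizes b"
  shows "normalizes (\<lambda>w. a w + b w)"
  using D.Iz_ops(2)[of "\<lambda>w. a w - normal_form a w" "\<lambda>w. b w - normal_form b w"] assms
  by (simp add: normalizes_def normal_form_linear algebra_simps)

lemma normalizes_smult:
  assumes "a \<in> carrier (cfree UNIV)" "normalizes a" shows "normalizes (\<lambda>w. c * a w)"
  using D.Iz_ops(4)[of "\<lambda>w. a w - normal_form a w" c] assms by (simp add: normalizes_def normal_form_linear algebra_simps)

lemma normalizes_lim:
  assumes a: "a \<in> carrier (cfree UNIV)"
    and l: "\<And>n. \<exists>b d. b \<in> carrier (cfree UNIV) \<and> d \<in> carrier (cfree UNIV) \<and> normalizes b \<and> a = (\<lambda>w. b w + hh ^ n * d w)"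
  shows "normalizes a"
  unfolding normalizes_def
proof (rule D.Iz_lim)
  show "(\<lambda>w. a w - normal_form a w) \<in> carrier (cfree UNIV)" by (intro cfree_closed normal_form_closed a)
  fix n
  obtain b d where b: "b \<in> carrier (cfree UNIV)" "d \<in> carrier (cfree UNIV)" "normalizes b" "a = (\<lambda>w. b w + hh ^ n * d w)"
    using l by blast
  have "(\<lambda>w. a w - normal_form a w) = (\<lambda>w. (b w - normal_form b w) + hh ^ n * (d w - normal_form d w))"
  proof -
    have "normal_form a = (\<lambda>w. normal_form b w + hh ^ n * normal_form d w)" using b by (simp add: normal_form_linear cfree_closed)
    then show ?thesis using b(4) by (simp add: algebra_simps)
  qed
  then show "\<exists>b\<in>D.Iz. \<exists>d\<in>carrier (cfree UNIV). (\<lambda>w. a w - normal_form a w) = (\<lambda>w. b w + hh ^ n * d w)"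
    using b by (intro bexI[of _ "\<lambda>w. b w - normal_form b w"] bexI[of _ "\<lambda>w. d w - normal_form d w"])
      (auto simp: normalizes_def intro!: cfree_closed normal_form_closed)
qed

lemma normalizes_Iz: "a \<in> D.Iz \<Longrightarrow> normalizes a"
  by (simp add: normalizes_def normal_form_Iz)

lemma normalizes_cong:
  assumes ab: "(\<lambda>w. a w - b w) \<in> D.Iz" and b: "b \<in> carrier (cfree UNIV)" "normalizes b" shows "normalizes a"
proof -
  have "a = (\<lambda>w. (a w - b w) + b w)" by simp
  then show ?thesis using normalizes_add[OF D.Iz_carrier[OF ab] b(1) normalizes_Iz[OF ab] b(2)] by simp
qed

lemma normalizes_mon_word: "normalizes (word (mon_word d))"
proof -
  have "normal_form (word (mon_word d)) = word (mon_word d)"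
  proof
    fix w
    show "normal_form (word (mon_word d)) w = word (mon_word d) w"
    proof (cases "w \<in> range mon_word")
      case True
      then obtain e where w: "w = mon_word e" by auto
      have "normal_form (word (mon_word d)) w = (if e = d then 1 else 0)" unfolding w normal_form_mon_word lin_word mon_coeff_mon_word ..
      then show ?thesis unfolding w by (simp add: word_def inj_eq[OF inj_mon_word])
    next
      case False
      then show ?thesis by (auto simp: normal_form_def word_def)
    qed
  qed
  then show ?thesis by (simp add: normalizes_def D.Iz_ops)
qed

lemma normalizes_left_mult:
  assumes g: "\<And>d. normalizes (word (g # mon_word d))" and a: "a \<in> carrier (cfree UNIV)" "normalizes a"
  shows "normalizes (cmul (word [g]) a)"
proof -
  have c: "word [g] \<in> carrier (cfree UNIV)" by (rule word_closed_UNIV)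
  have "normalizes (cmul (word [g]) (normal_form a))"
    using normal_form_closed[OF a(1)]
  proof (rule cfree_dense_induct[where X="range mon_word" and P="\<lambda>b. normalizes (cmul (word [g]) b)"])
    show "w \<in> range mon_word" if "normal_form a w \<noteq> 0" for w using that by (auto simp: normal_form_def split: if_splits)
    show "normalizes (cmul (word [g]) (\<lambda>w. 0))" by (simp add: cmul_def normalizes_Iz D.Iz_ops)
    show "normalizes (cmul (word [g]) (word w))" if "w \<in> range mon_word" for w using that g by (auto simp: cmul_word)
    show "normalizes (cmul (word [g]) (\<lambda>w. a w + b w))"
      if "a \<in> carrier (cfree UNIV)" "b \<in> carrier (cfree UNIV)" "normalizes (cmul (word [g]) a)" "normalizes (cmul (word [g]) b)" for a b
      using that c by (simp add: cmul_add_right normalizes_add cmul_closed)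
    show "normalizes (cmul (word [g]) (\<lambda>w. k * a w))" if "a \<in> carrier (cfree UNIV)" "normalizes (cmul (word [g]) a)" for a k
      using that c by (simp add: cmul_smult_right normalizes_smult cmul_closed)
    show "normalizes (cmul (word [g]) a)" if a: "a \<in> carrier (cfree UNIV)"
      and l: "\<And>n. \<exists>b d. b \<in> carrier (cfree UNIV) \<and> d \<in> carrier (cfree UNIV) \<and> normalizes (cmul (word [g]) b) \<and> a = (\<lambda>w. b w + hh ^ n * d w)" for a
    proof (rule normalizes_lim)
      show "cmul (word [g]) a \<in> carrier (cfree UNIV)" using a c by (rule cmul_closed[rotated])
      fix n
      obtain b d where b: "b \<in> carrier (cfree UNIV)" "d \<in> carrier (cfree UNIV)" "normalizes (cmul (word [g]) b)" "a = (\<lambda>w. b w + hh ^ n * d w)"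
        using l by blast
      then show "\<exists>b d. b \<in> carrier (cfree UNIV) \<and> d \<in> carrier (cfree UNIV) \<and> normalizes b \<and> cmul (word [g]) a = (\<lambda>w. b w + hh ^ n * d w)"
        using c by (intro exI[of _ "cmul (word [g]) b"] exI[of _ "cmul (word [g]) d"])
          (simp add: cmul_closed cmul_add_right cmul_smult_right)
    qed
  qed simp
  moreover have "(\<lambda>w. cmul (word [g]) a w - cmul (word [g]) (normal_form a) w) \<in> D.Iz"
    using D.Iz_ops(6)[OF a(2)[unfolded normalizes_def] c] by (simp add: cmul_diff_right)
  ultimately show ?thesis using normalizes_cong cmul_closed[OF c normal_form_closed[OF a(1)]] by blast
qed

lemma D_rel_right:
  "(\<lambda>w. word (DP # DM # v) w - word v w) \<in> D.Iz"
  "(\<lambda>w. word (DM # DP # v) w - word v w) \<in> D.Iz"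
  "(\<lambda>w. word (DP # DX # v) w - (word (DX # DP # v) w + hh * word (DP # v) w)) \<in> D.Iz"
  "(\<lambda>w. word (DM # DX # v) w - (word (DX # DM # v) w - hh * word (DM # v) w)) \<in> D.Iz"
proof -
  have r: "r \<in> D_rels \<Longrightarrow> cmul r (word v) \<in> D.Iz" for r v
    using D.S_Iz by (intro D.Iz_ops word_closed_UNIV) auto
  show 1: "(\<lambda>w. word (DP # DM # v) w - word v w) \<in> D.Iz" for v
    using r[of "\<lambda>w. word [DP, DM] w - word [] w" v] by (simp add: D_rels_eq cmul_diff_left cmul_word)
  show 2: "(\<lambda>w. word (DM # DP # v) w - word v w) \<in> D.Iz" for v
    using r[of "\<lambda>w. word [DM, DP] w - word [] w" v] by (simp add: D_rels_eq cmul_diff_left cmul_word)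
  show 3: "(\<lambda>w. word (DP # DX # v) w - (word (DX # DP # v) w + hh * word (DP # v) w)) \<in> D.Iz" for v
    using r[of "\<lambda>w. word [DP, DX] w - (word [DX, DP] w + hh * word [DP] w)" v]
    by (simp add: D_rels_eq cmul_diff_left cmul_add_left cmul_smult_left cmul_word)
  have l: "cmul (word u) a \<in> D.Iz" if "a \<in> D.Iz" for u a
    using that by (intro D.Iz_ops word_closed_UNIV)
  \<comment> \<open>conjugate the relation \<open>\<partial>x = (x + h)\<partial>\<close> by \<open>\<partial>\<^sup>-\<^sup>1\<close>\<close>
  have a: "(\<lambda>w. word (DM # DP # DX # DM # v) w - (word (DM # DX # DP # DM # v) w + hh * word (DM # DP # DM # v) w)) \<in> D.Iz"
    using l[OF 3[of "DM # v"], of "[DM]"] by (simp add: cmul_diff_right cmul_add_right cmul_smult_right cmul_word)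
  have b: "(\<lambda>w. word (DM # DX # DP # DM # v) w - word (DM # DX # v) w) \<in> D.Iz"
    using l[OF 1[of v], of "[DM, DX]"] by (simp add: cmul_diff_right cmul_word)
  have "(\<lambda>w. (word (DM # DP # DX # DM # v) w - word (DX # DM # v) w)
      - (word (DM # DP # DX # DM # v) w - (word (DM # DX # DP # DM # v) w + hh * word (DM # DP # DM # v) w))
      - (word (DM # DX # DP # DM # v) w - word (DM # DX # v) w)
      - hh * (word (DM # DP # DM # v) w - word (DM # v) w)) \<in> D.Iz"
    by (intro D.Iz_ops(3) 2 a b D.Iz_ops(4))
  then show "(\<lambda>w. word (DM # DX # v) w - (word (DX # DM # v) w - hh * word (DM # v) w)) \<in> D.Iz"
    by (simp add: algebra_simps)
qed

lemma normalizes_DX: "normalizes (word (DX # mon_word d))"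
  using normalizes_mon_word[of "(fst d, Suc (snd d))"] by (simp add: mon_word_def)

lemma normalizes_DP: "normalizes (word (DP # mon_word (r, i)))"
proof (induction i)
  case 0
  show ?case
  proof (cases "0 \<le> r")
    case True
    then have "DP # mon_word (r, 0) = mon_word (r + 1, 0)" by (simp add: mon_word_def dpow_def nat_add_distrib)
    then show ?thesis by (simp add: normalizes_mon_word)
  next
    case False
    then have "nat (- r) = Suc (nat (- (r + 1)))" by simp
    moreover have "dpow (r + 1) = replicate (nat (- (r + 1))) DM"
      using False by (cases "r = -1") (auto simp: dpow_def)
    ultimately have "DP # mon_word (r, 0) = DP # DM # mon_word (r + 1, 0)"
      using False by (simp add: mon_word_def) (simp add: dpow_def)
    then show ?thesis using normalizes_cong[OF D_rel_right(1)[of "mon_word (r + 1, 0)"] word_closed_UNIV normalizes_mon_word] by simp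
  qed
next
  case (Suc i)
  have e: "mon_word (r, Suc i) = DX # mon_word (r, i)" by (simp add: mon_word_def)
  have "normalizes (word (DX # DP # mon_word (r, i)))"
    using normalizes_left_mult[OF normalizes_DX word_closed_UNIV Suc.IH] by (simp add: cmul_word)
  then have "normalizes (\<lambda>w. word (DX # DP # mon_word (r, i)) w + hh * word (DP # mon_word (r, i)) w)"
    by (intro normalizes_add normalizes_smult Suc.IH cfree_closed word_closed_UNIV)
  then show ?case unfolding e
    by (rule normalizes_cong[OF D_rel_right(3), rotated]) (intro cfree_closed word_closed_UNIV)
qed

lemma normalizes_DM: "normalizes (word (DM # mon_word (r, i)))"
proof (induction i)
  case 0
  show ?case
  proof (cases "0 < r")
    case False
    then have "nat (- (r - 1)) = Suc (nat (- r))" by simp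
    then have "DM # mon_word (r, 0) = mon_word (r - 1, 0)" using False by (auto simp: mon_word_def dpow_def)
    then show ?thesis by (simp add: normalizes_mon_word)
  next
    case True
    then have "nat r = Suc (nat (r - 1))" by simp
    then have "DM # mon_word (r, 0) = DM # DP # mon_word (r - 1, 0)" using True by (auto simp: mon_word_def dpow_def)
    then show ?thesis using normalizes_cong[OF D_rel_right(2)[of "mon_word (r - 1, 0)"] word_closed_UNIV normalizes_mon_word] by simp
  qed
next
  case (Suc i)
  have e: "mon_word (r, Suc i) = DX # mon_word (r, i)" by (simp add: mon_word_def)
  have "normalizes (word (DX # DM # mon_word (r, i)))"
    using normalizes_left_mult[OF normalizes_DX word_closed_UNIV Suc.IH] by (simp add: cmul_word)
  then have "normalizes (\<lambda>w. word (DX # DM # mon_word (r, i)) w + (- hh) * word (DM # mon_word (r, i)) w)"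
    by (intro normalizes_add normalizes_smult Suc.IH cfree_closed word_closed_UNIV)
  then have "normalizes (\<lambda>w. word (DX # DM # mon_word (r, i)) w - hh * word (DM # mon_word (r, i)) w)" by simp
  then show ?case unfolding e
    by (rule normalizes_cong[OF D_rel_right(4), rotated]) (intro cfree_closed word_closed_UNIV)
qed

lemma normalizes_word: "normalizes (word w)"
proof (induction w)
  case Nil
  show ?case using normalizes_mon_word[of "(0, 0)"] by (simp add: mon_word_def dpow_def)
next
  case (Cons g w)
  have "normalizes (word (g # mon_word d))" for d
    using normalizes_DX normalizes_DP[of "fst d" "snd d"] normalizes_DM[of "fst d" "snd d"] by (cases g) auto
  then show ?case using normalizes_left_mult[OF _ word_closed_UNIV Cons.IH, of g] by (simp add: cmul_word)
qed

lemma normalizes_all: assumes "a \<in> carrier (cfree UNIV)" shows "normalizes a"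
  using assms
proof (rule cfree_dense_induct[where X=UNIV])
  show "normalizes (\<lambda>w. 0)" by (rule normalizes_Iz[OF D.Iz_ops(1)])
qed (auto intro: normalizes_word normalizes_add normalizes_smult normalizes_lim)

definition D_coord :: "int \<times> nat \<Rightarrow> dop \<Rightarrow> scal" where
  "D_coord d = D.fnl (mon_coeff d)"

lemma D_coord_cl: "a \<in> carrier (cfree UNIV) \<Longrightarrow> D_coord d (D.cl a) = lin (mon_coeff d) a"
  unfolding D_coord_def by (rule D.fnl_cl[OF mon_coeff_kills])

lemma D_coord_add: "x \<in> carrier D_alg \<Longrightarrow> y \<in> carrier D_alg \<Longrightarrow> D_coord d (x \<oplus>\<^bsub>D_alg\<^esub> y) = D_coord d x + D_coord d y"
  and D_coord_smult: "x \<in> carrier D_alg \<Longrightarrow> D_coord d (c \<odot>\<^bsub>D_alg\<^esub> x) = c * D_coord d x"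
  unfolding D_coord_def by (rule D.fnl_linear[OF mon_coeff_kills]; assumption)+

lemma D_coord_minus: "x \<in> carrier D_alg \<Longrightarrow> y \<in> carrier D_alg \<Longrightarrow> D_coord d (x \<ominus>\<^bsub>D_alg\<^esub> y) = D_coord d x - D_coord d y"
  by (simp add: a_minus_def D_coord_add D.Q.a_inv_smult D_coord_smult)

lemma D_coord_zero: "D_coord d \<zero>\<^bsub>D_alg\<^esub> = 0"
  using D_coord_smult[of "\<zero>\<^bsub>D_alg\<^esub>" d 0] by simp

lemma null_D_coord: "x \<in> carrier D_alg \<Longrightarrow> null (\<lambda>d. D_coord d x)"
  by (auto simp: D.carrier_Q D_coord_cl null_coords carrier_cfreeD)

text \<open>The monomials \<open>x\<^sup>i \<partial>\<^sup>r\<close> are a topological basis. From here on, equations between difference operators are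
  checked on coordinates.\<close>

lemma D_coord_eqI:
  assumes "x \<in> carrier D_alg" "y \<in> carrier D_alg" "\<And>d. D_coord d x = D_coord d y" shows "x = y"
proof -
  obtain a b where a: "a \<in> carrier (cfree UNIV)" "x = D.cl a" and b: "b \<in> carrier (cfree UNIV)" "y = D.cl b"
    using assms by (auto simp: D.carrier_Q)
  have "normal_form a = normal_form b" using assms(3) by (auto simp: normal_form_def a b D_coord_cl fun_eq_iff)
  have "(\<lambda>w. (a w - normal_form a w) - (b w - normal_form b w)) \<in> D.Iz"
    by (rule D.Iz_ops(3)[OF normalizes_all[OF a(1), unfolded normalizes_def] normalizes_all[OF b(1), unfolded normalizes_def]])
  then have "(\<lambda>w. a w - b w) \<in> D.Iz" by (simp add: \<open>normal_form a = normal_form b\<close>)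
  then show ?thesis using D.cl_eq_iff a b by simp
qed

section \<open>Operators with polynomial coefficients\<close>

text \<open>A representative of \<open>f(x) \<partial>\<^sup>r\<close> in the free algebra.\<close>

definition opf :: "scal poly \<Rightarrow> int \<Rightarrow> dgen list \<Rightarrow> scal" where
  "opf f r = (\<lambda>w. \<Sum>i\<le>degree f. coeff f i * word (mon_word (r, i)) w)"

lemma cfree_sum_closed: "finite T \<Longrightarrow> (\<And>i. i \<in> T \<Longrightarrow> a i \<in> carrier (cfree G)) \<Longrightarrow> (\<lambda>w. \<Sum>i\<in>T. a i w) \<in> carrier (cfree G)"
  by (induction T rule: finite_induct) (auto simp: cfree_closed)

lemma opf_closed: "opf f r \<in> carrier (cfree UNIV)"
  unfolding opf_def by (intro cfree_sum_closed cfree_closed word_closed_UNIV) auto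

lemma lin_opf: "lin V (opf f r) = (\<Sum>i\<le>degree f. coeff f i * V (mon_word (r, i)))"
  unfolding lin_def opf_def sum_distrib_right
  by (subst hsum_sum(1)) (auto simp: null_mult_gen null_mult_gen' null_word mult.assoc hsum_cmult lin_word[unfolded lin_def])

lemma D_x_pow: "D_x [^]\<^bsub>D_alg\<^esub> (n::nat) = D.cl (word (replicate n DX))"
proof (induction n)
  case 0
  show ?case using D.cl_ops(4)[OF cfree_closed(5) cfree_closed(5)] by simp
next
  case (Suc n)
  then show ?case
    by (simp add: D_x_def gen_eq_word D.cl_ops word_closed_UNIV cmul_word replicate_append_same)
qed

lemma D_pow_gen: "D.cl (gen g) [^]\<^bsub>D_alg\<^esub> (n::nat) = D.cl (word (replicate n g))"
proof (induction n)
  case 0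
  show ?case using D.cl_ops(4)[OF cfree_closed(5) cfree_closed(5)] by simp
next
  case (Suc n)
  then show ?case
    by (simp add: gen_eq_word D.cl_ops word_closed_UNIV cmul_word replicate_append_same)
qed

lemma D_d_eq: "D_d r = D.cl (word (dpow r))"
  by (simp add: D_d_def D_pow_gen dpow_def)

lemma D_mon_eq: "D_mon i r = D.cl (word (mon_word (r, i)))"
  by (simp add: D_mon_def D_x_pow D_d_eq D.cl_ops word_closed_UNIV cmul_word mon_word_def)

lemma D_op_eq: "D_op f r = D.cl (opf f r)"
proof -
  have "(\<Oplus>\<^bsub>D_alg\<^esub>i \<in> T. coeff f i \<odot>\<^bsub>D_alg\<^esub> (D_x [^]\<^bsub>D_alg\<^esub> i)) = D.cl (\<lambda>w. \<Sum>i\<in>T. coeff f i * word (replicate i DX) w)"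
    if "finite T" for T :: "nat set"
    using that
  proof (induction T rule: finite_induct)
    case empty
    then show ?case using D.cl_ops(5)[OF cfree_closed(5) cfree_closed(5)] by simp
  next
    case (insert x T)
    have c: "(\<lambda>i. coeff f i \<odot>\<^bsub>D_alg\<^esub> (D_x [^]\<^bsub>D_alg\<^esub> i)) \<in> UNIV \<rightarrow> carrier D_alg"
      by (auto simp: D_x_pow word_closed_UNIV)
    have s: "(\<lambda>w. \<Sum>i\<in>T. coeff f i * word (replicate i DX) w) \<in> carrier (cfree UNIV)"
      by (intro cfree_sum_closed cfree_closed word_closed_UNIV insert)
    show ?case using insert c s
      by (subst D.Q.finsum_insert) (auto simp: D_x_pow D.cl_ops word_closed_UNIV cfree_closed)
  qed
  from this[of "{..degree f}"] have "D_op f r = D.cl (\<lambda>w. \<Sum>i\<le>degree f. coeff f i * word (replicate i DX) w) \<otimes>\<^bsub>D_alg\<^esub> D.cl (word (dpow r))"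
    by (simp add: D_op_def D_d_eq)
  also have "\<dots> = D.cl (cmul (\<lambda>w. \<Sum>i\<le>degree f. coeff f i * word (replicate i DX) w) (word (dpow r)))"
    by (intro D.cl_ops cfree_sum_closed cfree_closed word_closed_UNIV) auto
  also have "cmul (\<lambda>w. \<Sum>i\<in>T. coeff f i * word (replicate i DX) w) (word (dpow r)) = (\<lambda>w. \<Sum>i\<in>T. coeff f i * word (mon_word (r, i)) w)"
    if "finite T" for T
    using that
  proof (induction T rule: finite_induct)
    case empty then show ?case by (simp add: cmul_def)
  next
    case (insert x T)
    then show ?case by (simp add: cmul_add_left cmul_smult_left cmul_word mon_word_def)
  qed
  finally show ?thesis by (simp add: opf_def)
qed

lemma D_op_closed [simp, intro]: "D_op f r \<in> carrier D_alg"
  by (simp add: D_op_eq opf_closed)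

lemma D_coord_D_op: "D_coord d (D_op f r) = (if fst d = r then coeff f (snd d) else 0)"
proof -
  have "D_coord d (D_op f r) = (\<Sum>i\<le>degree f. coeff f i * (if d = (r, i) then 1 else 0))"
    by (simp add: D_op_eq D_coord_cl opf_closed lin_opf mon_coeff_mon_word)
  also have "\<dots> = (if fst d = r then coeff f (snd d) else 0)"
  proof (cases "fst d = r")
    case True
    then have "(d = (r, i)) = (i = snd d)" for i by (cases d) auto
    then show ?thesis using True
      by (auto simp: if_distrib[where f="\<lambda>x. _ * x"] sum.delta coeff_eq_0 not_le cong: if_cong)
  qed (auto intro!: sum.neutral)
  finally show ?thesis .
qed

lemma D_coord_D_op_mult_general:
  "D_coord d (D_op f r \<otimes>\<^bsub>D_alg\<^esub> D_op g s) = (if fst d = r + s then coeff (f * sh r g) (snd d) else 0)"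
proof -
  have "D_coord d (D_op f r \<otimes>\<^bsub>D_alg\<^esub> D_op g s) =
     (\<Sum>i\<le>degree f. coeff f i * (\<Sum>j\<le>degree g. coeff g j * mon_coeff d (mon_word (r, i) @ mon_word (s, j))))"
    by (simp add: D_op_eq D.cl_ops opf_closed D_coord_cl cmul_closed lin_cmul' carrier_cfreeD[OF opf_closed] lin_opf)
  also have "\<dots> = (if fst d = r + s then coeff (\<Sum>i\<le>degree f. \<Sum>j\<le>degree g. monom (coeff f i) i * sh r (monom (coeff g j) j)) (snd d) else 0)"
  proof (cases "fst d = r + s")
    case True
    have "coeff f i * (coeff g j * mon_coeff d (mon_word (r, i) @ mon_word (s, j))) = coeff (monom (coeff f i) i * sh r (monom (coeff g j) j)) (snd d)" for i j
    proof -
      have "monom (coeff f i) i = Polynomial.smult (coeff f i) (monom 1 i)" "monom (coeff g j) j = Polynomial.smult (coeff g j) (monom 1 j)"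
        by (simp_all add: smult_monom)
      then have "coeff (monom (coeff f i) i * sh r (monom (coeff g j) j)) (snd d) = coeff f i * (coeff g j * coeff (monom 1 i * sh r (monom 1 j)) (snd d))"
        by (simp only: sh_ops mult_smult_left mult_smult_right coeff_smult mult.left_commute)
      then show ?thesis using True by (simp add: mon_coeff_def word_deg_append word_poly_append nf_mon_word)
    qed
    then show ?thesis using True by (simp add: coeff_sum sum_distrib_left)
  next
    case False
    then show ?thesis by (simp add: mon_coeff_def word_deg_append nf_mon_word)
  qed
  also have "(\<Sum>i\<le>degree f. \<Sum>j\<le>degree g. monom (coeff f i) i * sh r (monom (coeff g j) j)) = f * sh r g"
    by (simp only: sum_product[symmetric] sh_sum[symmetric] poly_as_sum_of_monoms)
  finally show ?thesis .
qed

lemma D_op_mult: "D_op f r \<otimes>\<^bsub>D_alg\<^esub> D_op g s = D_op (f * sh r g) (r + s)"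
  by (rule D_coord_eqI) (auto simp: D_coord_D_op_mult_general D_coord_D_op)

lemma D_op_add: "D_op f r \<oplus>\<^bsub>D_alg\<^esub> D_op g r = D_op (f + g) r"
  by (rule D_coord_eqI) (auto simp: D_coord_D_op D_coord_add)

lemma D_op_smult: "c \<odot>\<^bsub>D_alg\<^esub> D_op f r = D_op (Polynomial.smult c f) r"
  by (rule D_coord_eqI) (auto simp: D_coord_D_op D_coord_smult)

lemma D_op_minus: "D_op f r \<ominus>\<^bsub>D_alg\<^esub> D_op g r = D_op (f - g) r"
  by (rule D_coord_eqI) (auto simp: D_coord_D_op D_coord_minus)

lemma D_op_zero: "D_op 0 r = \<zero>\<^bsub>D_alg\<^esub>"
  by (rule D_coord_eqI) (auto simp: D_coord_D_op D_coord_zero)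

lemma D_op_comm: "comm D_alg (D_op f r) (D_op g s) = D_op (f * sh r g - g * sh s f) (r + s)"
  by (simp add: comm_def D_op_mult D_op_minus add.commute[of s r])

lemma D_mon_op: "D_mon i r = D_op (monom 1 i) r"
proof (rule D_coord_eqI)
  show "D_mon i r \<in> carrier D_alg" by (simp add: D_mon_eq word_closed_UNIV)
  show "D_coord d (D_mon i r) = D_coord d (D_op (monom 1 i) r)" for d
    by (cases d) (auto simp: D_mon_eq D_coord_cl word_closed_UNIV mon_coeff_mon_word D_coord_D_op)
qed simp

section \<open>The cocycle\<close>

definition neg :: "int \<Rightarrow> scal" where "neg l = (if l < 0 then 1 else 0)"

text \<open>The cocycle in the uniform shape \<open>tr([P, a] b)\<close> familiar from the central extension of
  infinite matrices: \<open>f(x) \<partial>\<^sup>r\<close> acts on functions on \<open>h\<int>\<close>, and \<open>P\<close> is the projection to the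
  negative half line, with diagonal entries \<open>neg\<close>.
  Differences of \<open>neg\<close> have finite support, so the sum over all integers is finite, and it can be
  shifted freely. That replaces the case distinction in \<open>phi_val\<close>.\<close>

definition phi_poly :: "scal poly \<Rightarrow> int \<Rightarrow> scal poly \<Rightarrow> int \<Rightarrow> scal" where
  "phi_poly f r g t = (if r + t = 0 then
     hsum (\<lambda>l. (neg l - neg (l + r)) * (poly f (of_int l * hh) * poly g (of_int (l + r) * hh))) else 0)"

lemma null_neg: "null (\<lambda>l. (neg l - neg (l + r)) * c l)"
  by (rule null_finite'[of "{- \<bar>r\<bar>..\<bar>r\<bar>}"]) (auto simp: neg_def)

lemma hsum_shift: "hsum (\<lambda>l::int. f (l + r)) = hsum f"
  by (rule hsum_reindex[where \<pi>="\<lambda>l. l + r"])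
    (auto simp: bij_betw_def inj_on_def image_iff intro!: exI[of _ "_ - r"])

lemma phi_val_eq: "phi_val f r g s = phi_poly f r g (- s)"
proof (cases "r = s")
  case True
  consider "s > 0" | "s < 0" | "s = 0" by linarith
  then show ?thesis
  proof cases
    case 1
    have "phi_poly f r g (- s) = (\<Sum>l\<in>{- s..- 1}. (neg l - neg (l + s)) * (poly f (of_int l * hh) * poly g (of_int (l + s) * hh)))"
      unfolding phi_poly_def using True 1 by (simp, intro hsum_finite) (auto simp: neg_def)
    also have "\<dots> = (\<Sum>l\<in>{- s..- 1}. poly f (of_int l * hh) * poly g (of_int (l + s) * hh))"
      by (rule sum.cong) (auto simp: neg_def)
    finally show ?thesis using True 1 by (simp add: phi_val_def)
  next
    case 2
    have "phi_poly f r g (- s) = (\<Sum>l\<in>{0..- s - 1}. (neg l - neg (l + s)) * (poly f (of_int l * hh) * poly g (of_int (l + s) * hh)))"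
      unfolding phi_poly_def using True 2 by (simp, intro hsum_finite) (auto simp: neg_def)
    also have "\<dots> = (\<Sum>l\<in>{0..- s - 1}. - (poly f (of_int l * hh) * poly g (of_int (l + s) * hh)))"
      by (rule sum.cong) (auto simp: neg_def)
    also have "\<dots> = (\<Sum>l\<in>{s..- 1}. - (poly g (of_int l * hh) * poly f (of_int (l - s) * hh)))"
      by (rule sum.reindex_bij_witness[where i="\<lambda>l. l - s" and j="\<lambda>l. l + s"]) (auto simp: mult.commute)
    finally show ?thesis using True 2 by (simp add: phi_val_def sum_negf)
  next
    case 3
    then show ?thesis using True by (simp add: phi_val_def phi_poly_def)
  qed
qed (auto simp: phi_val_def phi_poly_def)

lemma phi_poly_linear:
  "phi_poly (f + f') r g t = phi_poly f r g t + phi_poly f' r g t" "phi_poly (Polynomial.smult c f) r g t = c * phi_poly f r g t"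
  "phi_poly f r (g + g') t = phi_poly f r g t + phi_poly f r g' t" "phi_poly f r (Polynomial.smult c g) t = c * phi_poly f r g t"
  by (simp_all add: phi_poly_def distrib_left distrib_right hsum_add null_neg mult.left_commute[of _ c] hsum_cmult mult.assoc)

lemma phi_poly_diff: "phi_poly (f - f') r g t = phi_poly f r g t - phi_poly f' r g t"
  using phi_poly_linear(1)[of f "Polynomial.smult (-1) f'"] phi_poly_linear(2)[of "-1" f'] by simp

lemma phi_poly_antisym: "phi_poly g t f r = - phi_poly f r g t"
proof (cases "r + t = 0")
  case True
  then have t: "t = - r" by simp
  have "phi_poly g t f r = hsum (\<lambda>l. (neg l - neg (l + t)) * (poly g (of_int l * hh) * poly f (of_int (l + t) * hh)))"
    using True by (simp add: phi_poly_def add.commute)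
  also have "\<dots> = hsum (\<lambda>l. (neg (l + r) - neg (l + r + t)) * (poly g (of_int (l + r) * hh) * poly f (of_int (l + r + t) * hh)))"
    by (rule hsum_shift[symmetric])
  also have "\<dots> = hsum (\<lambda>l. - ((neg l - neg (l + r)) * (poly f (of_int l * hh) * poly g (of_int (l + r) * hh))))"
    by (simp add: t algebra_simps)
  also have "\<dots> = - phi_poly f r g t" using True by (simp add: phi_poly_def hsum_uminus null_neg)
  finally show ?thesis .
qed (simp add: phi_poly_def add.commute)

text \<open>After shifting the summation variable, all three terms become sums of the same product
  \<open>f(lh) g((l + r)h) k((l + r + s)h)\<close>, with weights that are differences of \<open>neg\<close> and cancel cyclically.\<close>

lemma phi_poly_cocycle:
  "phi_poly (f * sh r g) (r + s) k t + phi_poly (g * sh s k) (s + t) f r + phi_poly (k * sh t f) (t + r) g s = 0"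
proof (cases "r + s + t = 0")
  case True
  then have t: "t = - r - s" by simp
  define X where "X l = poly f (of_int l * hh) * (poly g (of_int (l + r) * hh) * poly k (of_int (l + r + s) * hh))" for l
  have 1: "phi_poly (f * sh r g) (r + s) k t = hsum (\<lambda>l. (neg l - neg (l + (r + s))) * X l)"
    using True by (simp add: phi_poly_def poly_sh X_def algebra_simps)
  have "phi_poly (g * sh s k) (s + t) f r = hsum (\<lambda>l. (neg l - neg (l + (s + t))) * (poly (g * sh s k) (of_int l * hh) * poly f (of_int (l + (s + t)) * hh)))"
    using True by (simp add: phi_poly_def add.commute add.left_commute)
  also have "\<dots> = hsum (\<lambda>l. (neg (l + r) - neg (l + r + (s + t))) * (poly (g * sh s k) (of_int (l + r) * hh) * poly f (of_int (l + r + (s + t)) * hh)))"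
    by (rule hsum_shift[symmetric])
  also have "\<dots> = hsum (\<lambda>l. (neg (l + r) - neg l) * X l)"
    by (simp add: poly_sh X_def t algebra_simps)
  finally have 2: "phi_poly (g * sh s k) (s + t) f r = hsum (\<lambda>l. (neg (l + r) - neg l) * X l)" .
  have "phi_poly (k * sh t f) (t + r) g s = hsum (\<lambda>l. (neg l - neg (l + (t + r))) * (poly (k * sh t f) (of_int l * hh) * poly g (of_int (l + (t + r)) * hh)))"
    using True by (simp add: phi_poly_def add.commute add.left_commute)
  also have "\<dots> = hsum (\<lambda>l. (neg (l + (r + s)) - neg (l + (r + s) + (t + r))) * (poly (k * sh t f) (of_int (l + (r + s)) * hh) * poly g (of_int (l + (r + s) + (t + r)) * hh)))"
    by (rule hsum_shift[symmetric])
  also have "\<dots> = hsum (\<lambda>l. (neg (l + (r + s)) - neg (l + r)) * X l)"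
    by (simp add: poly_sh X_def t algebra_simps)
  finally have 3: "phi_poly (k * sh t f) (t + r) g s = hsum (\<lambda>l. (neg (l + (r + s)) - neg (l + r)) * X l)" .
  have n: "null (\<lambda>l. (neg (l + a) - neg (l + b)) * X l)" for a b
  proof (rule null_finite'[of "{- \<bar>a\<bar> - \<bar>b\<bar>..\<bar>a\<bar> + \<bar>b\<bar>}"])
  qed (auto simp: neg_def)
  have n1: "null (\<lambda>l. (neg l - neg (l + (r + s))) * X l)" and n2: "null (\<lambda>l. (neg (l + r) - neg l) * X l)"
    using n[of 0 "r + s"] n[of r 0] by simp_all
  have "phi_poly (f * sh r g) (r + s) k t + phi_poly (g * sh s k) (s + t) f r + phi_poly (k * sh t f) (t + r) g s
     = hsum (\<lambda>l. (neg l - neg (l + (r + s))) * X l + (neg (l + r) - neg l) * X l + (neg (l + (r + s)) - neg (l + r)) * X l)"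
    unfolding 1 2 3 by (simp only: hsum_add null_add n n1 n2)
  also have "\<dots> = 0" by (simp add: algebra_simps)
  finally show ?thesis .
next
  case False
  then show ?thesis by (simp add: phi_poly_def algebra_simps)
qed

section \<open>Structure constants of the central extension\<close>

type_synonym bas = "(int \<times> nat) option"

text \<open>The coefficient of \<open>\<partial>\<^sup>r\<^sup>+\<^sup>s\<close> in the commutator of \<open>f(x) \<partial>\<^sup>r\<close> and \<open>g(x) \<partial>\<^sup>s\<close>.\<close>

definition pb :: "scal poly \<Rightarrow> int \<Rightarrow> scal poly \<Rightarrow> int \<Rightarrow> scal poly" where
  "pb f r g s = f * sh r g - g * sh s f"

text \<open>The coordinates of \<open>f(x) \<partial>\<^sup>r\<close> plus \<open>c\<close> times the central element, which has index \<open>None\<close>.\<close>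

definition hc :: "scal poly \<Rightarrow> int \<Rightarrow> scal \<Rightarrow> bas \<Rightarrow> scal" where
  "hc f r c d = (case d of None \<Rightarrow> c | Some (t, k) \<Rightarrow> if t = r then coeff f k else 0)"

text \<open>The structure constants of the central extension in the basis \<open>x\<^sup>i \<partial>\<^sup>r\<close>, with index \<open>Some (r, i)\<close>,
  together with the central element.\<close>

definition br :: "bas \<Rightarrow> bas \<Rightarrow> bas \<Rightarrow> scal" where
  "br x y = (case (x, y) of (Some (r, i), Some (s, j)) \<Rightarrow>
     hc (pb (monom 1 i) r (monom 1 j) s) (r + s) (phi_poly (monom 1 i) r (monom 1 j) s) | _ \<Rightarrow> (\<lambda>d. 0))"

lemma pb_linear:
  "pb (f + f') r g s = pb f r g s + pb f' r g s" "pb (Polynomial.smult c f) r g s = Polynomial.smult c (pb f r g s)"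
  "pb f r (g + g') s = pb f r g s + pb f r g' s" "pb f r (Polynomial.smult c g) s = Polynomial.smult c (pb f r g s)"
  by (simp_all add: pb_def sh_ops algebra_simps smult_diff_right)

lemma pb_jacobi: "pb (pb f r g s) (r + s) k t + pb (pb g s k t) (s + t) f r + pb (pb k t f r) (t + r) g s = 0"
  by (simp add: pb_def sh_ops sh_sh algebra_simps)

lemma hc_linear:
  "hc (f + g) r (a + b) d = hc f r a d + hc g r b d" "hc (Polynomial.smult k f) r (k * a) d = k * hc f r a d"
  by (auto simp: hc_def split: option.splits)

lemma coeff_eq_0_beyond: "\<forall>k\<in>{..degree f}. n \<noteq> k \<Longrightarrow> coeff f n = 0"
  by (rule ccontr) (auto dest: le_degree)

lemma hc_finite: "finite {d. hc f r c d \<noteq> 0}"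
proof (rule finite_subset)
  show "{d. hc f r c d \<noteq> 0} \<subseteq> insert None ((\<lambda>k. Some (r, k)) ` {..degree f})"
  proof
    fix d assume "d \<in> {d. hc f r c d \<noteq> 0}"
    then show "d \<in> insert None ((\<lambda>k. Some (r, k)) ` {..degree f})"
      by (cases d) (auto simp: hc_def le_degree split: if_splits)
  qed
qed simp

lemma hsum_hc: "hsum (\<lambda>d. hc f r c d * G d) = c * G None + (\<Sum>k\<le>degree f. coeff f k * G (Some (r, k)))"
proof -
  have "hsum (\<lambda>d. hc f r c d * G d) = (\<Sum>d\<in>insert None ((\<lambda>k. Some (r, k)) ` {..degree f}). hc f r c d * G d)"
    by (rule hsum_finite) (auto simp: hc_def image_iff intro: coeff_eq_0_beyond split: option.splits)
  also have "\<dots> = c * G None + (\<Sum>d\<in>(\<lambda>k. Some (r, k)) ` {..degree f}. hc f r c d * G d)"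
    by (subst sum.insert) (auto simp: hc_def)
  also have "(\<Sum>d\<in>(\<lambda>k. Some (r, k)) ` {..degree f}. hc f r c d * G d) = (\<Sum>k\<le>degree f. coeff f k * G (Some (r, k)))"
    by (subst sum.reindex) (auto simp: inj_on_def hc_def)
  finally show ?thesis .
qed

text \<open>Linear maps are determined by the powers of \<open>x\<close>. This passes from the structure constants, which only see
  monomials, to brackets of arbitrary polynomial operators.\<close>

lemma linear_on_monoms:
  fixes L :: "scal poly \<Rightarrow> scal"
  assumes add: "\<And>f g. L (f + g) = L f + L g" and sm: "\<And>c f. L (Polynomial.smult c f) = c * L f"
  shows "(\<Sum>k\<le>degree f. coeff f k * L (monom 1 k)) = L f"
proof -
  have z: "L 0 = 0" using sm[of 0 0] by simp
  have "L (\<Sum>k\<in>T. monom (coeff f k) k) = (\<Sum>k\<in>T. coeff f k * L (monom 1 k))" if "finite T" for T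
    using that
  proof (induction T rule: finite_induct)
    case (insert x T)
    have "monom (coeff f x) x = Polynomial.smult (coeff f x) (monom 1 x)" by (simp add: smult_monom)
    then show ?case using insert by (simp add: add sm)
  qed (simp add: z)
  from this[of "{..degree f}"] show ?thesis by (simp add: poly_as_sum_of_monoms)
qed

lemma hsum_hc_br:
  "hsum (\<lambda>d. hc f r c d * br d (Some (s, j)) e) = hc (pb f r (monom 1 j) s) (r + s) (phi_poly f r (monom 1 j) s) e"
proof -
  have "(\<Sum>k\<le>degree f. coeff f k * br (Some (r, k)) (Some (s, j)) e) =
    (\<Sum>k\<le>degree f. coeff f k * hc (pb (monom 1 k) r (monom 1 j) s) (r + s) (phi_poly (monom 1 k) r (monom 1 j) s) e)"
    by (simp add: br_def)
  also have "\<dots> = hc (pb f r (monom 1 j) s) (r + s) (phi_poly f r (monom 1 j) s) e"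
    by (rule linear_on_monoms[where L="\<lambda>f. hc (pb f r (monom 1 j) s) (r + s) (phi_poly f r (monom 1 j) s) e"])
      (simp_all add: pb_linear phi_poly_linear hc_linear)
  finally show ?thesis by (simp add: hsum_hc br_def)
qed

lemma phi_poly_jacobi: "phi_poly (pb f r g s) (r + s) k t + phi_poly (pb g s k t) (s + t) f r + phi_poly (pb k t f r) (t + r) g s = 0"
proof -
  have "phi_poly (pb f r g s) (r + s) k t + phi_poly (pb g s k t) (s + t) f r + phi_poly (pb k t f r) (t + r) g s =
    (phi_poly (f * sh r g) (r + s) k t + phi_poly (g * sh s k) (s + t) f r + phi_poly (k * sh t f) (t + r) g s)
    - (phi_poly (g * sh s f) (s + r) k t + phi_poly (f * sh r k) (r + t) g s + phi_poly (k * sh t g) (t + s) f r)"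
    by (simp add: pb_def phi_poly_diff algebra_simps)
  then show ?thesis unfolding phi_poly_cocycle by simp
qed

interpretation B: lie_structure br
proof
  fix x y z e :: bas and d :: bas
  show "finite {d. br x y d \<noteq> 0}"
    by (auto simp: br_def hc_finite split: option.splits)
  show "br y x d = - br x y d"
  proof (cases "x = None \<or> y = None")
    case False
    then obtain r i s j where e: "x = Some (r, i)" "y = Some (s, j)" by auto
    have "phi_poly (monom 1 j) s (monom 1 i) r = - phi_poly (monom 1 i) r (monom 1 j) s" by (rule phi_poly_antisym)
    then show ?thesis by (simp add: e br_def hc_def pb_def add.commute[of s r] split: option.splits)
  qed (auto simp: br_def split: option.splits)
  show "hsum (\<lambda>d. br x y d * br d z e) + hsum (\<lambda>d. br y z d * br d x e) + hsum (\<lambda>d. br z x d * br d y e) = 0"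
  proof (cases "x = None \<or> y = None \<or> z = None")
    case True
    have [simp]: "br None w = (\<lambda>d. 0)" "br w None = (\<lambda>d. 0)" for w
      by (auto simp: br_def split: option.splits)
    show ?thesis using True by auto
  next
    case False
    then obtain r i s j t k where e: "x = Some (r, i)" "y = Some (s, j)" "z = Some (t, k)" by auto
    have b: "br (Some (r, i)) (Some (s, j)) = hc (pb (monom 1 i) r (monom 1 j) s) (r + s) (phi_poly (monom 1 i) r (monom 1 j) s)" for r i s j
      by (simp add: br_def)
    have t1: "t + (r + s) = r + s + t" "s + t + r = r + s + t" "t + r + s = r + s + t" by simp_all
    show ?thesis
      unfolding e b hsum_hc_br t1 hc_linear(1)[symmetric] pb_jacobi phi_poly_jacobi
      by (simp add: hc_def split: option.splits)
  qed
qed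

section \<open>Coordinates of the central extension\<close>

text \<open>Linear functionals over \<open>scal\<close> are automatically \<open>h\<close>-adically continuous, since they take multiples of
  \<open>h\<^sup>n\<close> to multiples of \<open>h\<^sup>n\<close>; so they are determined by their values on the operators \<open>f(x) \<partial>\<^sup>r\<close>.\<close>

lemma D_functional_eq:
  assumes "\<And>x y. x \<in> carrier D_alg \<Longrightarrow> y \<in> carrier D_alg \<Longrightarrow> p (x \<oplus>\<^bsub>D_alg\<^esub> y) = p x + p y"
    "\<And>x y. x \<in> carrier D_alg \<Longrightarrow> y \<in> carrier D_alg \<Longrightarrow> q (x \<oplus>\<^bsub>D_alg\<^esub> y) = q x + q y"
    "\<And>c x. x \<in> carrier D_alg \<Longrightarrow> p (c \<odot>\<^bsub>D_alg\<^esub> x) = c * p x"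
    "\<And>c x. x \<in> carrier D_alg \<Longrightarrow> q (c \<odot>\<^bsub>D_alg\<^esub> x) = c * (q x :: scal)"
    "\<And>f r. p (D_op f r) = q (D_op f r)"
    and x: "x \<in> carrier D_alg"
  shows "p x = q x"
  using x
proof (rule D.Q_dense_induct)
  fix w :: "dgen list"
  have "D.cl (word w) = D_op (word_poly w) (word_deg w)"
    by (rule D_coord_eqI) (auto simp: word_closed_UNIV D_coord_cl D_coord_D_op mon_coeff_def)
  then show "p (D.cl (word w)) = q (D.cl (word w))" using assms(5) by simp
next
  fix a assume a: "a \<in> carrier D_alg"
    and l: "\<And>n. \<exists>b d. b \<in> carrier D_alg \<and> d \<in> carrier D_alg \<and> p b = q b \<and> a = b \<oplus>\<^bsub>D_alg\<^esub> hh ^ n \<odot>\<^bsub>D_alg\<^esub> d"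
  have "p a - q a = 0"
  proof (rule hh_power_dvd_all_imp_zero)
    fix n
    obtain b d where "b \<in> carrier D_alg" "d \<in> carrier D_alg" "p b = q b" "a = b \<oplus>\<^bsub>D_alg\<^esub> hh ^ n \<odot>\<^bsub>D_alg\<^esub> d"
      using l by blast
    then have "p a - q a = hh ^ n * (p d - q d)" by (simp add: assms algebra_simps)
    then show "hh ^ n dvd p a - q a" by simp
  qed
  then show "p a = q a" by simp
qed (simp_all add: assms)

text \<open>The continuous bilinear form with given values on pairs of monomials.\<close>

definition bil :: "(int \<times> nat \<Rightarrow> int \<times> nat \<Rightarrow> scal) \<Rightarrow> dop \<Rightarrow> dop \<Rightarrow> scal" where
  "bil \<beta> a b = hsum (\<lambda>p. hsum (\<lambda>q. D_coord p a * D_coord q b * \<beta> p q))"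

lemma bil_inner: "b \<in> carrier D_alg \<Longrightarrow> hsum (\<lambda>q. D_coord p a * D_coord q b * \<beta> p q) = D_coord p a * hsum (\<lambda>q. D_coord q b * \<beta> p q)"
  by (simp add: mult.assoc hsum_cmult null_mult_gen null_D_coord)

lemma bil_eq: "b \<in> carrier D_alg \<Longrightarrow> bil \<beta> a b = hsum (\<lambda>p. D_coord p a * hsum (\<lambda>q. D_coord q b * \<beta> p q))"
  by (simp add: bil_def bil_inner)

lemma bil_linear:
  assumes "a \<in> carrier D_alg" "b \<in> carrier D_alg" "c \<in> carrier D_alg"
  shows "bil \<beta> (a \<oplus>\<^bsub>D_alg\<^esub> b) c = bil \<beta> a c + bil \<beta> b c"
    "bil \<beta> c (a \<oplus>\<^bsub>D_alg\<^esub> b) = bil \<beta> c a + bil \<beta> c b"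
    "bil \<beta> (k \<odot>\<^bsub>D_alg\<^esub> a) c = k * bil \<beta> a c"
    "bil \<beta> c (k \<odot>\<^bsub>D_alg\<^esub> a) = k * bil \<beta> c a"
  using assms
  by (simp_all add: bil_eq D_coord_add D_coord_smult distrib_right distrib_left hsum_add hsum_cmult
      null_mult_gen null_D_coord mult.assoc mult.left_commute[of _ k])

lemma hsum_D_coord_D_op: "hsum (\<lambda>q. D_coord q (D_op f r) * G q) = (\<Sum>i\<le>degree f. coeff f i * G (r, i))"
proof -
  have "hsum (\<lambda>q. D_coord q (D_op f r) * G q) = (\<Sum>q\<in>(\<lambda>i. (r, i)) ` {..degree f}. D_coord q (D_op f r) * G q)"
    by (rule hsum_finite) (auto simp: D_coord_D_op image_iff intro: coeff_eq_0_beyond)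
  also have "\<dots> = (\<Sum>i\<le>degree f. coeff f i * G (r, i))"
    by (subst sum.reindex) (auto simp: inj_on_def D_coord_D_op)
  finally show ?thesis .
qed

lemma bil_D_op: "bil \<beta> (D_op f r) (D_op g s) = (\<Sum>i\<le>degree f. coeff f i * (\<Sum>j\<le>degree g. coeff g j * \<beta> (r, i) (s, j)))"
  by (simp add: bil_eq hsum_D_coord_D_op)

lemma bil_D_op_linear:
  assumes "\<And>f f' g. L (f + f') g = L f g + L f' g" "\<And>c f g. L (Polynomial.smult c f) g = c * L f g"
    "\<And>f g g'. L f (g + g') = L f g + L f g'" "\<And>c f g. L f (Polynomial.smult c g) = c * L f g"
    and "\<And>i j. \<beta> (r, i) (s, j) = L (monom 1 i) (monom 1 j)"
  shows "bil \<beta> (D_op f r) (D_op g s) = L f g"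
proof -
  have "(\<Sum>j\<le>degree g. coeff g j * L f' (monom 1 j)) = L f' g" for f'
    by (rule linear_on_monoms) (simp_all add: assms)
  moreover have "(\<Sum>i\<le>degree f. coeff f i * L (monom 1 i) g) = L f g"
    by (rule linear_on_monoms[where L="\<lambda>f. L f g"]) (simp_all add: assms)
  ultimately show ?thesis by (simp add: bil_D_op assms(5))
qed

definition phb :: "int \<times> nat \<Rightarrow> int \<times> nat \<Rightarrow> scal" where
  "phb p q = phi_poly (monom 1 (snd p)) (fst p) (monom 1 (snd q)) (fst q)"

text \<open>The choice in the definition of \<open>phi_D\<close> is not vacuous: \<open>bil\<close> extends the prescribed values.\<close>

lemma phi_D_spec: "bilinear_form D_alg phi_D \<and> (\<forall>f r g s. phi_D (D_op f r) (D_op g (- s)) = phi_val f r g s)"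
  unfolding phi_D_def
proof (rule someI[of _ "bil phb"], intro conjI allI)
  show "bilinear_form D_alg (bil phb)" by (simp add: bilinear_form_def bil_linear)
  show "bil phb (D_op f r) (D_op g (- s)) = phi_val f r g s" for f r g s
    unfolding phi_val_eq
    by (rule bil_D_op_linear[where L="\<lambda>f g. phi_poly f r g (- s)"]) (simp_all add: phi_poly_linear phb_def)
qed

lemma phi_D_D_op: "phi_D (D_op f r) (D_op g s) = phi_poly f r g s"
  using phi_D_spec phi_val_eq[of f r g "- s"] by (metis minus_minus)

lemma phi_D_linear:
  assumes "a \<in> carrier D_alg" "b \<in> carrier D_alg" "c \<in> carrier D_alg"
  shows "phi_D (a \<oplus>\<^bsub>D_alg\<^esub> b) c = phi_D a c + phi_D b c"
    "phi_D c (a \<oplus>\<^bsub>D_alg\<^esub> b) = phi_D c a + phi_D c b"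
    "phi_D (k \<odot>\<^bsub>D_alg\<^esub> a) c = k * phi_D a c"
    "phi_D c (k \<odot>\<^bsub>D_alg\<^esub> a) = k * phi_D c a"
  using phi_D_spec assms unfolding bilinear_form_def by blast+

lemma D_bilinear_eq:
  assumes "\<And>a b c k. a \<in> carrier D_alg \<Longrightarrow> b \<in> carrier D_alg \<Longrightarrow> c \<in> carrier D_alg \<Longrightarrow>
      p (a \<oplus>\<^bsub>D_alg\<^esub> b) c = p a c + p b c \<and> p c (a \<oplus>\<^bsub>D_alg\<^esub> b) = p c a + p c b \<and>
      p (k \<odot>\<^bsub>D_alg\<^esub> a) c = k * p a c \<and> p c (k \<odot>\<^bsub>D_alg\<^esub> a) = k * p c a"
    "\<And>a b c k. a \<in> carrier D_alg \<Longrightarrow> b \<in> carrier D_alg \<Longrightarrow> c \<in> carrier D_alg \<Longrightarrow>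
      q (a \<oplus>\<^bsub>D_alg\<^esub> b) c = q a c + q b c \<and> q c (a \<oplus>\<^bsub>D_alg\<^esub> b) = q c a + q c b \<and>
      q (k \<odot>\<^bsub>D_alg\<^esub> a) c = k * q a c \<and> q c (k \<odot>\<^bsub>D_alg\<^esub> a) = k * (q c a :: scal)"
    and D: "\<And>f r g s. p (D_op f r) (D_op g s) = q (D_op f r) (D_op g s)"
    and x: "x \<in> carrier D_alg" and y: "y \<in> carrier D_alg"
  shows "p x y = q x y"
proof (rule D_functional_eq[where p="\<lambda>x. p x y" and q="\<lambda>x. q x y", OF _ _ _ _ _ x])
  show "p (D_op f r) y = q (D_op f r) y" for f r
    by (rule D_functional_eq[OF _ _ _ _ _ y]) (use assms(1,2) D in auto)
qed (use assms(1,2) y in auto)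

definition Dbar_coord :: "dop \<times> scal \<Rightarrow> bas \<Rightarrow> scal" where
  "Dbar_coord u d = (case d of None \<Rightarrow> snd u | Some p \<Rightarrow> D_coord p (fst u))"

lemma null_option: assumes "null (\<lambda>p. f (Some p))" shows "null f"
proof -
  have "finite {d. fps_nth (f d) n \<noteq> 0}" for n
  proof (rule finite_subset)
    show "{d. fps_nth (f d) n \<noteq> 0} \<subseteq> insert None (Some ` {p. fps_nth (f (Some p)) n \<noteq> 0})"
      by (auto simp: image_iff) (metis option.exhaust)
  qed (use assms in \<open>auto simp: null_def\<close>)
  then show ?thesis by (simp add: null_def)
qed

lemma hsum_option: assumes "f None = 0" shows "hsum f = hsum (\<lambda>p. f (Some p))"
proof (rule hsum_reindex[symmetric, where \<pi>=Some])
  have "d \<in> Some ` {b. f (Some b) \<noteq> 0}" if "f d \<noteq> 0" for d using that assms by (cases d) auto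
  then show "bij_betw Some {b. f (Some b) \<noteq> 0} {c. f c \<noteq> 0}" by (auto simp: bij_betw_def)
qed simp

lemma null_Dbar_coord: "u \<in> carrier Dbar \<Longrightarrow> null (Dbar_coord u)"
  by (rule null_option) (auto simp: Dbar_coord_def Dbar_def intro: null_D_coord)

lemma Dbar_coord_linear:
  "u \<in> carrier Dbar \<Longrightarrow> v \<in> carrier Dbar \<Longrightarrow> Dbar_coord (ladd Dbar u v) d = Dbar_coord u d + Dbar_coord v d"
  "u \<in> carrier Dbar \<Longrightarrow> Dbar_coord (lsmult Dbar c u) d = c * Dbar_coord u d"
  by (auto simp: Dbar_coord_def Dbar_def D_coord_add D_coord_smult split: option.splits)

lemma Dbar_coord_D_op: "Dbar_coord (D_op f r, c) = hc f r c"
  by (auto simp: Dbar_coord_def hc_def D_coord_D_op fun_eq_iff split: option.splits)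

text \<open>Both sides are bilinear in the difference operators, so it suffices to compare them on \<open>f(x) \<partial>\<^sup>r\<close> and
  \<open>g(x) \<partial>\<^sup>s\<close>.\<close>

lemma Dbar_coord_bracket:
  assumes u: "u \<in> carrier Dbar" and v: "v \<in> carrier Dbar"
  shows "Dbar_coord (lbracket Dbar u v) e = hsum (\<lambda>p. hsum (\<lambda>q. Dbar_coord u p * Dbar_coord v q * br p q e))"
proof -
  obtain a s b t where uv: "u = (a, s)" "v = (b, t)" "a \<in> carrier D_alg" "b \<in> carrier D_alg"
    using u v by (auto simp: Dbar_def)
  have br0: "br None w d = 0" "br w None d = 0" for w d by (auto simp: br_def split: option.splits)
  have "hsum (\<lambda>p. hsum (\<lambda>q. Dbar_coord u p * Dbar_coord v q * br p q e)) = bil (\<lambda>p q. br (Some p) (Some q) e) a b"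
    by (simp add: hsum_option br0 bil_def) (simp add: Dbar_coord_def uv)
  also have "\<dots> = Dbar_coord (lbracket Dbar (a, s) (b, t)) e"
  proof (rule D_bilinear_eq[OF _ _ _ uv(3,4), symmetric])
    let ?p = "\<lambda>a b. Dbar_coord (lbracket Dbar (a, s) (b, t)) e"
    fix a b c k assume "a \<in> carrier D_alg" "b \<in> carrier D_alg" "c \<in> carrier D_alg"
    then show "?p (a \<oplus>\<^bsub>D_alg\<^esub> b) c = ?p a c + ?p b c \<and> ?p c (a \<oplus>\<^bsub>D_alg\<^esub> b) = ?p c a + ?p c b \<and>
      ?p (k \<odot>\<^bsub>D_alg\<^esub> a) c = k * ?p a c \<and> ?p c (k \<odot>\<^bsub>D_alg\<^esub> a) = k * ?p c a"
      by (auto simp: Dbar_def Dbar_coord_def comm_def phi_D_linear D_coord_minus D_coord_add D_coord_smult D.Q.l_distr D.Q.r_distr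
          D.Q.smult_mult_left D.Q.smult_mult_right right_diff_distrib split: option.splits)
  next
    fix f r g s'
    have "bil (\<lambda>p q. br (Some p) (Some q) e) (D_op f r) (D_op g s') = hc (pb f r g s') (r + s') (phi_poly f r g s') e"
      by (rule bil_D_op_linear[where L="\<lambda>f g. hc (pb f r g s') (r + s') (phi_poly f r g s') e"])
        (simp_all add: pb_linear phi_poly_linear hc_linear br_def)
    then show "Dbar_coord (lbracket Dbar (D_op f r, s) (D_op g s', t)) e = bil (\<lambda>p q. br (Some p) (Some q) e) (D_op f r) (D_op g s')"
      by (simp add: Dbar_def D_op_comm phi_D_D_op Dbar_coord_D_op pb_def)
  qed (simp add: bil_linear)
  finally show ?thesis using uv by simp
qed

section \<open>Multilinear extension of functionals on words\<close>

text \<open>A functional on words in the basis extends multilinearly to words in arbitrary elements of \<open>Dbar\<close>, which are the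
  generators in the presentation of the enveloping algebra.\<close>

fun multi_ext :: "(bas list \<Rightarrow> scal) \<Rightarrow> (dop \<times> scal) list \<Rightarrow> scal" where
  "multi_ext g [] = g []"
| "multi_ext g (a # v) = hsum (\<lambda>b. Dbar_coord a b * multi_ext (\<lambda>w. g (b # w)) v)"

lemma null_Dbar_coord_mult: "a \<in> carrier Dbar \<Longrightarrow> null (\<lambda>b. Dbar_coord a b * c b)"
  by (rule null_mult_gen[OF null_Dbar_coord])

lemma multi_ext_hsum:
  assumes "set v \<subseteq> carrier Dbar" "null c"
  shows "multi_ext (\<lambda>w. hsum (\<lambda>d. c d * g d w)) v = hsum (\<lambda>d. c d * multi_ext (g d) v)"
  using assms(1)
proof (induction v arbitrary: g)
  case (Cons a v)
  have n: "null (\<lambda>(b,d). Dbar_coord a b * c d * k b d)" for k using Cons by (intro null_prod null_Dbar_coord assms) auto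
  have "multi_ext (\<lambda>w. hsum (\<lambda>d. c d * g d w)) (a # v) = hsum (\<lambda>b. Dbar_coord a b * hsum (\<lambda>d. c d * multi_ext (\<lambda>w. g d (b # w)) v))"
    using Cons by simp
  also have "\<dots> = hsum (\<lambda>b. hsum (\<lambda>d. Dbar_coord a b * c d * multi_ext (\<lambda>w. g d (b # w)) v))"
    by (simp add: mult.assoc hsum_cmult null_mult_gen assms)
  also have "\<dots> = hsum (\<lambda>d. hsum (\<lambda>b. Dbar_coord a b * c d * multi_ext (\<lambda>w. g d (b # w)) v))"
    by (rule hsum_swap[OF n])
  also have "\<dots> = hsum (\<lambda>d. hsum (\<lambda>b. c d * (Dbar_coord a b * multi_ext (\<lambda>w. g d (b # w)) v)))"
    by (simp add: mult_ac)
  also have "\<dots> = hsum (\<lambda>d. c d * multi_ext (g d) (a # v))"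
    using Cons by (simp add: hsum_cmult null_Dbar_coord_mult)
  finally show ?case .
qed simp

lemma multi_ext_diff: "set v \<subseteq> carrier Dbar \<Longrightarrow> multi_ext (\<lambda>w. g w - k w) v = multi_ext g v - multi_ext k v"
proof (induction v arbitrary: g k)
  case (Cons a v)
  then show ?case by (simp add: right_diff_distrib hsum_diff null_Dbar_coord_mult)
qed simp

lemma multi_ext_linear:
  assumes "set u \<subseteq> carrier Dbar" "set v \<subseteq> carrier Dbar" "a \<in> carrier Dbar" "b \<in> carrier Dbar"
  shows "multi_ext g (u @ ladd Dbar a b # v) = multi_ext g (u @ a # v) + multi_ext g (u @ b # v)"
    "multi_ext g (u @ lsmult Dbar c a # v) = c * multi_ext g (u @ a # v)"
  using assms
proof (induction u arbitrary: g)
  case Nil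
  case 1 then show ?case by (simp add: Dbar_coord_linear distrib_right hsum_add null_Dbar_coord_mult)
next
  case Nil
  case 2 then show ?case by (simp add: Dbar_coord_linear mult.assoc hsum_cmult null_Dbar_coord_mult)
next
  case (Cons x u)
  case 1 then show ?case using Cons by (simp add: distrib_left hsum_add null_Dbar_coord_mult)
next
  case (Cons x u)
  case 2 then show ?case using Cons by (simp add: mult.left_commute[of _ c] hsum_cmult null_Dbar_coord_mult)
qed

text \<open>By multilinearity the relation \<open>xy - yx = [x, y]\<close> has to be tested on basis elements only.\<close>

lemma multi_ext_bracket:
  assumes "set u \<subseteq> carrier Dbar" "set v \<subseteq> carrier Dbar" "x \<in> carrier Dbar" "y \<in> carrier Dbar"
    and rel: "\<And>u a b v. g (u @ a # b # v) - g (u @ b # a # v) = hsum (\<lambda>d. br a b d * g (u @ d # v))"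
  shows "multi_ext g (u @ x # y # v) - multi_ext g (u @ y # x # v) = multi_ext g (u @ lbracket Dbar x y # v)"
  using assms(1) rel
proof (induction u arbitrary: g)
  case Nil
  define M where "M p q = multi_ext (\<lambda>w. g (p # q # w)) v" for p q
  define m where "m d = multi_ext (\<lambda>w. g (d # w)) v" for d
  have in1: "hsum (\<lambda>q. Dbar_coord x p * Dbar_coord y q * k q) = Dbar_coord x p * hsum (\<lambda>q. Dbar_coord y q * k q)" for p k
    using assms by (simp add: mult.assoc hsum_cmult null_Dbar_coord_mult)
  have n: "null (\<lambda>(p,q). Dbar_coord x p * Dbar_coord y q * k p q)" for k using assms by (intro null_prod null_Dbar_coord)
  have n1: "null (\<lambda>q. Dbar_coord x p * Dbar_coord y q * k q)" for p k
    by (intro null_mult_gen null_mult_gen' null_Dbar_coord assms)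
  have 1: "multi_ext g (x # y # v) = hsum (\<lambda>p. hsum (\<lambda>q. Dbar_coord x p * Dbar_coord y q * M p q))"
    by (simp add: in1 M_def)
  have "multi_ext g (y # x # v) = hsum (\<lambda>q. hsum (\<lambda>p. Dbar_coord x p * Dbar_coord y q * M q p))"
    using assms by (simp add: M_def mult.left_commute[of "Dbar_coord x _"] mult.assoc hsum_cmult null_Dbar_coord_mult)
  also have "\<dots> = hsum (\<lambda>p. hsum (\<lambda>q. Dbar_coord x p * Dbar_coord y q * M q p))"
    by (rule hsum_swap[OF n, symmetric])
  finally have 2: "multi_ext g (y # x # v) = hsum (\<lambda>p. hsum (\<lambda>q. Dbar_coord x p * Dbar_coord y q * M q p))" .
  have M: "M p q - M q p = hsum (\<lambda>d. br p q d * m d)" for p q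
  proof -
    have "M p q - M q p = multi_ext (\<lambda>w. g (p # q # w) - g (q # p # w)) v"
      using assms by (simp add: M_def multi_ext_diff)
    also have "\<dots> = multi_ext (\<lambda>w. hsum (\<lambda>d. br p q d * g (d # w))) v"
      using Nil(2)[of "[]"] by simp
    finally show ?thesis using assms by (simp add: multi_ext_hsum B.null_br m_def)
  qed
  have n3: "null (\<lambda>(d,z). case z of (p,q) \<Rightarrow> Dbar_coord x p * Dbar_coord y q * (br p q d * m d))"
    unfolding null_iff
  proof
    fix n
    let ?S = "Sigma ({p. \<not> hh ^ n dvd Dbar_coord x p} \<times> {q. \<not> hh ^ n dvd Dbar_coord y q}) (\<lambda>(p,q). {d. br p q d \<noteq> 0})"
    have "{w. \<not> hh ^ n dvd (case w of (d,z) \<Rightarrow> case z of (p,q) \<Rightarrow> Dbar_coord x p * Dbar_coord y q * (br p q d * m d))} \<subseteq> prod.swap ` ?S"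
      by (auto simp: image_iff)
    moreover have "finite ?S"
      using null_Dbar_coord[OF assms(3)] null_Dbar_coord[OF assms(4)] B.fin by (intro finite_SigmaI finite_cartesian_product) (auto simp: null_iff)
    ultimately show "finite {w. \<not> hh ^ n dvd (case w of (d,z) \<Rightarrow> case z of (p,q) \<Rightarrow> Dbar_coord x p * Dbar_coord y q * (br p q d * m d))}"
      using finite_subset by blast
  qed
  have "multi_ext g (x # y # v) - multi_ext g (y # x # v) = hsum (\<lambda>p. hsum (\<lambda>q. Dbar_coord x p * Dbar_coord y q * (M p q - M q p)))"
    unfolding 1 2 right_diff_distrib by (simp add: hsum_diff null_hsum[OF n] n1)
  also have "\<dots> = hsum (\<lambda>(p,q). Dbar_coord x p * Dbar_coord y q * (M p q - M q p))" by (rule hsum_hsum_pair[OF n])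
  also have "\<dots> = hsum (\<lambda>z. hsum (\<lambda>d. case z of (p,q) \<Rightarrow> Dbar_coord x p * Dbar_coord y q * (br p q d * m d)))"
    by (rule arg_cong[where f=hsum]) (auto simp: fun_eq_iff M hsum_cmult null_mult_gen B.null_br)
  also have "\<dots> = hsum (\<lambda>d. hsum (\<lambda>z. case z of (p,q) \<Rightarrow> Dbar_coord x p * Dbar_coord y q * (br p q d * m d)))"
    by (rule hsum_swap[OF n3, symmetric])
  also have "\<dots> = hsum (\<lambda>d. hsum (\<lambda>p. hsum (\<lambda>q. Dbar_coord x p * Dbar_coord y q * (br p q d * m d))))"
    by (rule arg_cong[where f=hsum]) (auto simp: fun_eq_iff hsum_hsum_pair[OF n])
  also have "\<dots> = hsum (\<lambda>d. Dbar_coord (lbracket Dbar x y) d * m d)"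
  proof (rule arg_cong[where f=hsum], rule HOL.ext)
    fix d
    have "hsum (\<lambda>p. hsum (\<lambda>q. Dbar_coord x p * Dbar_coord y q * (br p q d * m d))) = hsum (\<lambda>p. hsum (\<lambda>q. Dbar_coord x p * Dbar_coord y q * br p q d)) * m d"
      using null_hsum[OF n, of "\<lambda>p q. br p q d"]
      by (simp add: mult.assoc[symmetric] hsum_multc n1)
    then show "hsum (\<lambda>p. hsum (\<lambda>q. Dbar_coord x p * Dbar_coord y q * (br p q d * m d))) = Dbar_coord (lbracket Dbar x y) d * m d"
      by (simp add: Dbar_coord_bracket assms)
  qed
  finally show ?case by (simp add: m_def)
next
  case (Cons z u)
  have IH: "multi_ext (\<lambda>w. g (b # w)) (u @ x # y # v) - multi_ext (\<lambda>w. g (b # w)) (u @ y # x # v) = multi_ext (\<lambda>w. g (b # w)) (u @ lbracket Dbar x y # v)" for b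
  proof (rule Cons.IH)
    show "set u \<subseteq> carrier Dbar" using Cons.prems by simp
    show "g (b # u @ a # c # v) - g (b # u @ c # a # v) = hsum (\<lambda>d. br a c d * g (b # u @ d # v))" for u a c v
      using Cons.prems(2)[of "b # u"] by simp
  qed
  show ?case using Cons.prems(1) by (simp add: IH[symmetric] right_diff_distrib hsum_diff null_Dbar_coord_mult)
qed

section \<open>Completed enveloping algebras\<close>

text \<open>Closure under the operations is what makes the defining relations of the enveloping algebra lie in the
  free algebra on the carrier. It applies to \<open>Dbar\<close> and \<open>Dbar0\<close> alike.\<close>

locale lie_closed =
  fixes L :: "'a lie_alg"
  assumes ladd_closed [simp, intro]: "x \<in> carrier L \<Longrightarrow> y \<in> carrier L \<Longrightarrow> ladd L x y \<in> carrier L"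
    and lsmult_closed [simp, intro]: "x \<in> carrier L \<Longrightarrow> lsmult L c x \<in> carrier L"
    and lbracket_closed [simp, intro]: "x \<in> carrier L \<Longrightarrow> y \<in> carrier L \<Longrightarrow> lbracket L x y \<in> carrier L"
begin

lemma gen_closed: "x \<in> carrier L \<Longrightarrow> gen x \<in> carrier (cfree (carrier L))"
  by (simp add: gen_eq_word word_closed)

lemma env_rels_eq:
  "env_rels L = {\<lambda>w. gen (ladd L a b) w - (gen a w + gen b w) | a b. a \<in> carrier L \<and> b \<in> carrier L}
    \<union> {\<lambda>w. gen (lsmult L c a) w - c * gen a w | c a. a \<in> carrier L}
    \<union> {\<lambda>w. (cmul (gen a) (gen b) w - cmul (gen b) (gen a) w) - gen (lbracket L a b) w | a b. a \<in> carrier L \<and> b \<in> carrier L}"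
proof -
  have 1: "gen (ladd L a b) \<ominus>\<^bsub>cfree (carrier L)\<^esub> (gen a \<oplus>\<^bsub>cfree (carrier L)\<^esub> gen b) = (\<lambda>w. gen (ladd L a b) w - (gen a w + gen b w))"
    if "a \<in> carrier L" "b \<in> carrier L" for a b
    using that by (simp add: cfree_simps cfree_minus gen_closed cfree_closed)
  have 2: "gen (lsmult L c a) \<ominus>\<^bsub>cfree (carrier L)\<^esub> (c \<odot>\<^bsub>cfree (carrier L)\<^esub> gen a) = (\<lambda>w. gen (lsmult L c a) w - c * gen a w)"
    if "a \<in> carrier L" for c a
    using that by (simp add: cfree_simps cfree_minus gen_closed cfree_closed)
  have 3: "comm (cfree (carrier L)) (gen a) (gen b) \<ominus>\<^bsub>cfree (carrier L)\<^esub> gen (lbracket L a b) = (\<lambda>w. (cmul (gen a) (gen b) w - cmul (gen b) (gen a) w) - gen (lbracket L a b) w)"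
    if "a \<in> carrier L" "b \<in> carrier L" for a b
    using that by (simp add: cfree_comm cfree_minus gen_closed)
  show ?thesis
    unfolding env_rels_def Let_def
    by (intro arg_cong2[where f="(\<union>)"] Collect_cong ex_cong1 rev_conj_cong refl) (simp_all only: 1 2 3)
qed

sublocale presentation "carrier L" "env_rels L"
  rewrites "pres_alg (carrier L) (env_rels L) = env L"
proof -
  show "presentation (carrier L) (env_rels L)"
    unfolding presentation_def env_rels_eq
    by (auto intro!: cfree_closed cmul_closed gen_closed)
qed (simp add: env_def)

abbreviation "io \<equiv> env_in L"

lemma io_eq: "io x = cl (gen x)" by (simp add: env_in_def)

lemma io_closed [simp, intro]: "x \<in> carrier L \<Longrightarrow> io x \<in> carrier (env L)"
  by (simp add: io_eq gen_closed)

lemma io_add: assumes "x \<in> carrier L" "y \<in> carrier L" shows "io x \<oplus>\<^bsub>env L\<^esub> io y = io (ladd L x y)"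
proof -
  have "(\<lambda>w. gen (ladd L x y) w - (gen x w + gen y w)) \<in> Iz"
    by (rule subsetD[OF S_Iz], unfold env_rels_eq, rule UnI1, rule UnI1) (use assms in blast)
  then have "cl (gen (ladd L x y)) = cl (\<lambda>w. gen x w + gen y w)"
    using assms by (simp add: cl_eq_iff gen_closed cfree_closed)
  then show ?thesis using assms by (simp add: io_eq cl_ops gen_closed)
qed

lemma io_smult: assumes "x \<in> carrier L" shows "c \<odot>\<^bsub>env L\<^esub> io x = io (lsmult L c x)"
proof -
  have "(\<lambda>w. gen (lsmult L c x) w - c * gen x w) \<in> Iz"
    by (rule subsetD[OF S_Iz], unfold env_rels_eq, rule UnI1, rule UnI2) (use assms in blast)
  then have "cl (gen (lsmult L c x)) = cl (\<lambda>w. c * gen x w)"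
    using assms by (simp add: cl_eq_iff gen_closed cfree_closed)
  then show ?thesis using cl_ops(3)[OF gen_closed[OF assms] gen_closed[OF assms]] by (simp add: io_eq)
qed

lemma cl_minus: "a \<in> carrier Fr \<Longrightarrow> b \<in> carrier Fr \<Longrightarrow> cl a \<ominus>\<^bsub>env L\<^esub> cl b = cl (\<lambda>w. a w - b w)"
  using cl_ops(1)[of a "\<lambda>w. - 1 * b w"]
  by (simp add: a_minus_def Q.a_inv_smult cl_ops(3)[of b b] cfree_closed)

lemma io_comm: assumes "x \<in> carrier L" "y \<in> carrier L" shows "comm (env L) (io x) (io y) = io (lbracket L x y)"
proof -
  have "(\<lambda>w. (cmul (gen x) (gen y) w - cmul (gen y) (gen x) w) - gen (lbracket L x y) w) \<in> Iz"
    by (rule subsetD[OF S_Iz], unfold env_rels_eq, rule UnI2) (use assms in blast)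
  then have "cl (\<lambda>w. cmul (gen x) (gen y) w - cmul (gen y) (gen x) w) = cl (gen (lbracket L x y))"
    using assms by (simp add: cl_eq_iff gen_closed cfree_closed cmul_closed)
  then show ?thesis using assms by (simp add: comm_def io_eq cl_ops gen_closed cl_minus cmul_closed)
qed

lemma io_minus: assumes "x \<in> carrier L" "y \<in> carrier L"
  shows "io x \<ominus>\<^bsub>env L\<^esub> io y = io (ladd L x (lsmult L (- 1) y))"
  using assms by (simp add: a_minus_def Q.a_inv_smult io_smult io_add)

end

lemma Dbar_simps:
  "ladd Dbar (a, s) (b, t) = (a \<oplus>\<^bsub>D_alg\<^esub> b, s + t)" "lsmult Dbar k (a, s) = (k \<odot>\<^bsub>D_alg\<^esub> a, k * s)"
  "lbracket Dbar (a, s) (b, t) = (comm D_alg a b, phi_D a b)" "lzero Dbar = (\<zero>\<^bsub>D_alg\<^esub>, 0)"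
  "(a, s) \<in> carrier Dbar \<longleftrightarrow> a \<in> carrier D_alg"
  by (simp_all add: Dbar_def)

interpretation U: lie_closed Dbar
  by standard (auto simp: Dbar_def)

subsection \<open>Functionals on the enveloping algebra of the central extension\<close>

text \<open>A functional on basis words that respects the commutation relations defines a functional on \<open>U(Dbar)\<close>.\<close>

lemma multi_ext_kills:
  assumes rel: "\<And>u a b v. \<nu> (u @ a # b # v) - \<nu> (u @ b # a # v) = hsum (\<lambda>d. br a b d * \<nu> (u @ d # v))"
    and a: "a \<in> U.Iz"
  shows "lin (multi_ext \<nu>) a = 0"
proof (rule U.functional_kills[OF _ a])
  fix r p q assume r: "r \<in> env_rels Dbar" and "p \<in> lists (carrier Dbar)" "q \<in> lists (carrier Dbar)"
  then have pq: "set p \<subseteq> carrier Dbar" "set q \<subseteq> carrier Dbar" by auto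
  let ?l = "lin (\<lambda>v. multi_ext \<nu> (p @ v @ q))"
  from r consider (add) a b where "a \<in> carrier Dbar" "b \<in> carrier Dbar" "r = (\<lambda>w. word [ladd Dbar a b] w - (word [a] w + word [b] w))"
    | (smult) c a where "a \<in> carrier Dbar" "r = (\<lambda>w. word [lsmult Dbar c a] w - c * word [a] w)"
    | (bracket) a b where "a \<in> carrier Dbar" "b \<in> carrier Dbar" "r = (\<lambda>w. (word [a, b] w - word [b, a] w) - word [lbracket Dbar a b] w)"
    unfolding U.env_rels_eq gen_eq_word cmul_word by auto
  then show "?l r = 0"
  proof cases
    case add
    have "?l r = multi_ext \<nu> (p @ ladd Dbar a b # q) - (multi_ext \<nu> (p @ a # q) + multi_ext \<nu> (p @ b # q))"
      unfolding add(3) by (simp add: lin_diff lin_add null_word null_add)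
    then show ?thesis using multi_ext_linear(1)[OF pq add(1,2)] by simp
  next
    case smult
    have "?l r = multi_ext \<nu> (p @ lsmult Dbar c a # q) - c * multi_ext \<nu> (p @ a # q)"
      unfolding smult(2) by (simp add: lin_diff lin_smult null_word null_mult_gen')
    then show ?thesis using multi_ext_linear(2)[OF pq smult(1) smult(1)] by simp
  next
    case bracket
    have "?l r = (multi_ext \<nu> (p @ a # b # q) - multi_ext \<nu> (p @ b # a # q)) - multi_ext \<nu> (p @ lbracket Dbar a b # q)"
      unfolding bracket(3) by (simp add: lin_diff null_word null_diff)
    then show ?thesis using multi_ext_bracket[of p q a b \<nu>, OF pq bracket(1,2) rel] by simp
  qed
qed

section \<open>The Lie subalgebra\<close>

text \<open>\<open>f(x) \<partial>\<^sup>r\<close> plus \<open>c\<close> times the central element.\<close>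

definition DE :: "scal poly \<Rightarrow> int \<Rightarrow> scal \<Rightarrow> dop \<times> scal" where
  "DE f r c = (D_op f r, c)"

lemma DE_closed [simp, intro]: "DE f r c \<in> carrier Dbar"
  by (simp add: DE_def Dbar_simps)

lemma DE_ops:
  "ladd Dbar (DE f r c) (DE g r d) = DE (f + g) r (c + d)"
  "lsmult Dbar k (DE f r c) = DE (Polynomial.smult k f) r (k * c)"
  "lbracket Dbar (DE f r c) (DE g s d) = DE (pb f r g s) (r + s) (phi_poly f r g s)"
  by (simp_all add: DE_def Dbar_simps D_op_add D_op_smult D_op_comm phi_D_D_op pb_def)

lemma DE_zero: "DE 0 r 0 = lzero Dbar"
  by (simp add: DE_def Dbar_simps D_op_zero)

lemma Dbar_coord_DE: "Dbar_coord (DE f r c) = hc f r c"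
  by (simp add: DE_def Dbar_coord_D_op)

text \<open>The power of \<open>h\<close> that multiplies \<open>x\<^sup>i \<partial>\<^sup>r\<close> in the basis of \<open>Dbar0\<close>.\<close>

definition h_exp :: "int \<Rightarrow> nat" where
  "h_exp r = (if r = 0 then 1 else nat \<bar>r\<bar> - 1)"

definition basis_elt :: "bas \<Rightarrow> dop \<times> scal" where
  "basis_elt b = (case b of None \<Rightarrow> DE 0 0 1 | Some (r, i) \<Rightarrow> DE (monom (hh ^ h_exp r) i) r 0)"

lemma basis_elt_simps: "basis_elt None = DE 0 0 1" "basis_elt (Some (r, i)) = DE (monom (hh ^ h_exp r) i) r 0"
  by (simp_all add: basis_elt_def)

lemma lsmult_D_mon: "lsmult Dbar k (D_in (D_mon i r)) = DE (monom k i) r 0"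
  by (simp add: D_in_def D_mon_op Dbar_simps D_op_smult DE_def smult_monom)

lemma Dbar0_basis:
  "{c_D} \<union> {lsmult Dbar hh (D_in (D_mon i 0)) | i. True}
   \<union> {lsmult Dbar (hh ^ (j - 1)) (D_in (D_mon i (int j))) | i j. j \<ge> 1}
   \<union> {lsmult Dbar (hh ^ (j - 1)) (D_in (D_mon i (- int j))) | i j. j \<ge> 1} = range basis_elt"
  (is "?A = _")
proof
  show "?A \<subseteq> range basis_elt"
  proof
    fix x assume "x \<in> ?A"
    then consider "x = c_D" | i where "x = DE (monom hh i) 0 0"
      | i j where "x = DE (monom (hh ^ (j - 1)) i) (int j) 0" "j \<ge> (1::nat)"
      | i j where "x = DE (monom (hh ^ (j - 1)) i) (- int j) 0" "j \<ge> (1::nat)"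
      unfolding lsmult_D_mon by auto
    then show "x \<in> range basis_elt"
    proof cases
      case 1
      then have "x = basis_elt None" by (simp add: basis_elt_simps DE_def c_D_def D_op_zero)
      then show ?thesis by blast
    next
      case (2 i)
      then have "x = basis_elt (Some (0, i))" by (simp add: basis_elt_simps h_exp_def)
      then show ?thesis by blast
    next
      case (3 i j)
      then have "x = basis_elt (Some (int j, i))" by (simp add: basis_elt_simps h_exp_def)
      then show ?thesis by blast
    next
      case (4 i j)
      then have "x = basis_elt (Some (- int j, i))" by (simp add: basis_elt_simps h_exp_def)
      then show ?thesis by blast
    qed
  qed
  show "range basis_elt \<subseteq> ?A"
  proof
    fix x assume "x \<in> range basis_elt"
    then obtain b where x: "x = basis_elt b" by blast
    show "x \<in> ?A"
    proof (cases b)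
      case None
      then have "x = c_D" using x by (simp add: basis_elt_simps DE_def c_D_def D_op_zero)
      then show ?thesis by blast
    next
      case (Some p)
      then obtain r i where b: "b = Some (r, i)" by (cases p) auto
      consider "r = 0" | "r > 0" | "r < 0" by linarith
      then show ?thesis
      proof cases
        case 1
        then have "x = lsmult Dbar hh (D_in (D_mon i 0))" using x b by (simp add: basis_elt_simps h_exp_def lsmult_D_mon)
        then show ?thesis by blast
      next
        case 2
        then have "x = lsmult Dbar (hh ^ (nat r - 1)) (D_in (D_mon i (int (nat r))))" "nat r \<ge> 1"
          using x b by (simp_all add: basis_elt_simps h_exp_def lsmult_D_mon)
        then show ?thesis by blast
      next
        case 3
        then have "x = lsmult Dbar (hh ^ (nat (- r) - 1)) (D_in (D_mon i (- int (nat (- r)))))" "nat (- r) \<ge> 1"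
          using x b by (simp_all add: basis_elt_simps h_exp_def lsmult_D_mon)
        then show ?thesis by blast
      qed
    qed
  qed
qed

lemma Dbar0_eq: "Dbar0 = Dbar\<lparr>carrier := lspan Dbar (range basis_elt)\<rparr>"
  unfolding Dbar0_def Dbar0_basis ..

lemma carrier_Dbar0: "carrier Dbar0 = lspan Dbar (range basis_elt)"
  by (simp add: Dbar0_eq)

lemma Dbar0_simps [simp]:
  "ladd Dbar0 = ladd Dbar" "lsmult Dbar0 = lsmult Dbar"
  "lbracket Dbar0 = lbracket Dbar" "lzero Dbar0 = lzero Dbar"
  by (simp_all add: Dbar0_eq)

lemma basis_elt_Dbar: "basis_elt b \<in> carrier Dbar"
  by (auto simp: basis_elt_def split: option.splits)

lemma Dbar0_subset: "x \<in> lspan Dbar (range basis_elt) \<Longrightarrow> x \<in> carrier Dbar"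
proof (induction rule: lspan.induct)
  case zero
  show ?case by (simp add: Dbar_def)
qed (auto simp: basis_elt_Dbar)

text \<open>The condition on \<open>f\<close> for \<open>f(x) \<partial>\<^sup>r\<close> to belong to \<open>Dbar0\<close>.\<close>

definition adm :: "int \<Rightarrow> scal poly \<Rightarrow> bool" where
  "adm r f \<longleftrightarrow> (\<exists>g. f = Polynomial.smult (hh ^ h_exp r) g)"

lemma adm_ops: "adm r 0" "adm r f \<Longrightarrow> adm r g \<Longrightarrow> adm r (f + g)" "adm r f \<Longrightarrow> adm r (Polynomial.smult c f)"
proof -
  show "adm r 0" by (auto simp: adm_def intro: exI[of _ 0])
  show "adm r f \<Longrightarrow> adm r g \<Longrightarrow> adm r (f + g)"
    unfolding adm_def by (metis smult_add_right)
  show "adm r f \<Longrightarrow> adm r (Polynomial.smult c f)"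
    unfolding adm_def by (metis smult_smult mult.commute)
qed

lemma DE_Dbar0: assumes "adm r f" shows "DE f r c \<in> carrier Dbar0"
proof -
  obtain g where f: "f = Polynomial.smult (hh ^ h_exp r) g" using assms by (auto simp: adm_def)
  have c: "DE 0 r c \<in> lspan Dbar (range basis_elt)"
  proof -
    have "DE 0 r c = lsmult Dbar c (basis_elt None)" by (simp add: basis_elt_simps DE_ops) (simp add: DE_def D_op_zero)
    then show ?thesis by (simp add: lspan.base lspan.smult)
  qed
  have "DE (Polynomial.smult (hh ^ h_exp r) (\<Sum>i\<in>T. monom (coeff g i) i)) r c \<in> lspan Dbar (range basis_elt)" if "finite T" for T
    using that
  proof (induction T rule: finite_induct)
    case empty
    then show ?case using c by simp
  next
    case (insert x T)
    have e: "DE (Polynomial.smult (hh ^ h_exp r) (\<Sum>i\<in>insert x T. monom (coeff g i) i)) r c =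
      ladd Dbar (lsmult Dbar (coeff g x) (basis_elt (Some (r, x)))) (DE (Polynomial.smult (hh ^ h_exp r) (\<Sum>i\<in>T. monom (coeff g i) i)) r c)"
      using insert by (simp add: basis_elt_simps DE_ops smult_monom smult_add_right mult.commute)
    have "lsmult Dbar (coeff g x) (basis_elt (Some (r, x))) \<in> lspan Dbar (range basis_elt)"
      by (intro lspan.smult lspan.base) blast
    then show ?case unfolding e using insert.IH by (rule lspan.add)
  qed
  from this[of "{..degree g}"] show ?thesis by (simp add: f poly_as_sum_of_monoms carrier_Dbar0)
qed

lemma sh_mod: "\<exists>g. sh r f = f + Polynomial.smult hh g"
proof (induction f)
  case 0
  show ?case by (rule exI[of _ 0]) (simp add: sh_ops)
next
  case (pCons a p)
  then obtain g where g: "sh r p = p + Polynomial.smult hh g" by blast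
  have "sh r (pCons a p) = [:a:] + pCons 0 (sh r p) + Polynomial.smult (of_int r * hh) (sh r p)"
    by (simp add: sh_def pcompose_pCons)
  also have "\<dots> = pCons a p + Polynomial.smult hh (pCons 0 g + Polynomial.smult (of_int r) (sh r p))"
    by (simp add: g smult_add_right mult.commute)
  finally show ?case by blast
qed

text \<open>Since \<open>f(x + sh)\<close> and \<open>f(x)\<close> agree modulo \<open>h\<close>, a commutator always gains one factor \<open>h\<close>. With
  it, the exponents for \<open>r\<close> and \<open>s\<close> add up to at least the exponent required for \<open>r + s\<close>.\<close>

lemma adm_pb: assumes "adm r f" "adm s g" shows "adm (r + s) (pb f r g s)"
proof -
  obtain f1 g1 where fg: "f = Polynomial.smult (hh ^ h_exp r) f1" "g = Polynomial.smult (hh ^ h_exp s) g1"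
    using assms by (auto simp: adm_def)
  obtain f2 g2 where sh: "sh s f1 = f1 + Polynomial.smult hh f2" "sh r g1 = g1 + Polynomial.smult hh g2"
    using sh_mod by meson
  have "pb f1 r g1 s = Polynomial.smult hh (f1 * g2 - g1 * f2)"
    by (simp add: pb_def sh algebra_simps smult_diff_right)
  then have e: "pb f r g s = Polynomial.smult (hh ^ (h_exp r + h_exp s + 1)) (f1 * g2 - g1 * f2)"
    by (simp add: fg pb_linear power_add mult_ac)
  have "h_exp (r + s) \<le> h_exp r + h_exp s + 1" by (auto simp: h_exp_def)
  then obtain n where "h_exp r + h_exp s + 1 = h_exp (r + s) + n" using le_Suc_ex by blast
  then have "hh ^ (h_exp r + h_exp s + 1) = hh ^ h_exp (r + s) * hh ^ n" by (metis power_add)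
  then have "pb f r g s = Polynomial.smult (hh ^ h_exp (r + s)) (Polynomial.smult (hh ^ n) (f1 * g2 - g1 * f2))"
    using e by simp
  then show ?thesis unfolding adm_def by blast
qed

lemma adm_basis_elt: "adm r (monom (hh ^ h_exp r) i)"
  unfolding adm_def by (rule exI[of _ "monom 1 i"]) (simp add: smult_monom)

lemma bracket_basis_elt: "lbracket Dbar (basis_elt a) (basis_elt b) \<in> lspan Dbar (range basis_elt)"
proof -
  have y: "\<exists>f r c. basis_elt a = DE f r c \<and> adm r f" for a
    by (cases a) (force simp: basis_elt_simps adm_ops adm_basis_elt split: prod.splits)+
  obtain f r c where a: "basis_elt a = DE f r c" "adm r f" using y by blast
  obtain g s d where b: "basis_elt b = DE g s d" "adm s g" using y by blast
  show ?thesis using DE_Dbar0[OF adm_pb[OF a(2) b(2)]] by (simp add: a b DE_ops carrier_Dbar0)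
qed

lemma lbracket_linear:
  assumes "x \<in> carrier Dbar" "y \<in> carrier Dbar" "z \<in> carrier Dbar"
  shows "lbracket Dbar (ladd Dbar x y) z = ladd Dbar (lbracket Dbar x z) (lbracket Dbar y z)"
    "lbracket Dbar z (ladd Dbar x y) = ladd Dbar (lbracket Dbar z x) (lbracket Dbar z y)"
    "lbracket Dbar (lsmult Dbar k x) z = lsmult Dbar k (lbracket Dbar x z)"
    "lbracket Dbar z (lsmult Dbar k x) = lsmult Dbar k (lbracket Dbar z x)"
proof -
  obtain a s b t c u where e: "x = (a, s)" "y = (b, t)" "z = (c, u)" "a \<in> carrier D_alg" "b \<in> carrier D_alg" "c \<in> carrier D_alg"
    using assms by (cases x; cases y; cases z) (auto simp: Dbar_simps)
  have 1: "comm D_alg (a \<oplus>\<^bsub>D_alg\<^esub> b) c = comm D_alg a c \<oplus>\<^bsub>D_alg\<^esub> comm D_alg b c"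
    and 2: "comm D_alg c (a \<oplus>\<^bsub>D_alg\<^esub> b) = comm D_alg c a \<oplus>\<^bsub>D_alg\<^esub> comm D_alg c b"
    by (rule D_coord_eqI; use e in \<open>simp add: comm_def D_coord_add D_coord_minus D.Q.l_distr D.Q.r_distr\<close>)+
  have 3: "comm D_alg (k \<odot>\<^bsub>D_alg\<^esub> a) c = k \<odot>\<^bsub>D_alg\<^esub> comm D_alg a c"
    and 4: "comm D_alg c (k \<odot>\<^bsub>D_alg\<^esub> a) = k \<odot>\<^bsub>D_alg\<^esub> comm D_alg c a"
    using e by (simp_all add: comm_def D.Q.smult_mult_left D.Q.smult_mult_right D.Q.smult_minus)
  show "lbracket Dbar (ladd Dbar x y) z = ladd Dbar (lbracket Dbar x z) (lbracket Dbar y z)"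
    "lbracket Dbar z (ladd Dbar x y) = ladd Dbar (lbracket Dbar z x) (lbracket Dbar z y)"
    "lbracket Dbar (lsmult Dbar k x) z = lsmult Dbar k (lbracket Dbar x z)"
    "lbracket Dbar z (lsmult Dbar k x) = lsmult Dbar k (lbracket Dbar z x)"
    using e by (simp_all add: Dbar_simps 1 2 3 4 phi_D_linear)
qed

lemma lzero_Dbar: "lzero Dbar = lsmult Dbar 0 (basis_elt None)"
  by (simp add: basis_elt_simps DE_ops DE_zero)

lemma lspan_bracket:
  assumes x: "x \<in> lspan Dbar (range basis_elt)" and y: "y \<in> lspan Dbar (range basis_elt)"
  shows "lbracket Dbar x y \<in> lspan Dbar (range basis_elt)"
  using x
proof (induction rule: lspan.induct)
  case zero
  have "lbracket Dbar (lzero Dbar) y = lsmult Dbar 0 (lbracket Dbar (basis_elt None) y)"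
    unfolding lzero_Dbar by (rule lbracket_linear(3)[OF basis_elt_Dbar basis_elt_Dbar Dbar0_subset[OF y]])
  moreover have "\<dots> = lsmult Dbar 0 (basis_elt None)"
    using U.lbracket_closed[OF basis_elt_Dbar[of None] Dbar0_subset[OF y]] basis_elt_Dbar[of None]
    by (cases "lbracket Dbar (basis_elt None) y"; cases "basis_elt None") (simp add: Dbar_simps)
  ultimately show ?case by (auto intro: lspan.intros)
next
  case (base x)
  then obtain a where x: "x = basis_elt a" by blast
  show ?case
    using y
  proof (induction rule: lspan.induct)
    case zero
    have "lbracket Dbar x (lzero Dbar) = lsmult Dbar 0 (lbracket Dbar x (basis_elt None))"
      unfolding lzero_Dbar x by (rule lbracket_linear(4)[OF basis_elt_Dbar basis_elt_Dbar basis_elt_Dbar])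
    then show ?case using bracket_basis_elt by (auto simp: x intro: lspan.smult)
  next
    case (base y) then show ?case using bracket_basis_elt x by auto
  next
    case (add b c)
    then show ?case using lbracket_linear(2)[of b c x] basis_elt_Dbar x by (auto intro: lspan.add simp: Dbar0_subset)
  next
    case (smult b c)
    then show ?case using lbracket_linear(4)[of b b x c] basis_elt_Dbar x by (auto intro: lspan.smult simp: Dbar0_subset)
  qed
next
  case (add b c)
  then show ?case using lbracket_linear(1)[of b c y] y by (auto intro: lspan.add simp: Dbar0_subset)
next
  case (smult b c)
  then show ?case using lbracket_linear(3)[of b b y c] y by (auto intro: lspan.smult simp: Dbar0_subset)
qed

interpretation U0: lie_closed Dbar0
  by standard (auto simp: carrier_Dbar0 intro: lspan.intros lspan_bracket)

lemma basis_elt_Dbar0: "basis_elt b \<in> carrier Dbar0" by (simp add: carrier_Dbar0 lspan.base)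

section \<open>The inclusion of enveloping algebras\<close>

lemma cfree_mono: "G \<subseteq> H \<Longrightarrow> a \<in> carrier (cfree G) \<Longrightarrow> a \<in> carrier (cfree H)"
  by (auto simp: carrier_cfree dest: lists_mono[THEN subsetD])

lemma Dbar0_Fr: "a \<in> carrier (cfree (carrier Dbar0)) \<Longrightarrow> a \<in> carrier (cfree (carrier Dbar))"
  by (rule cfree_mono[rotated]) (auto simp: carrier_Dbar0 Dbar0_subset)

lemma env_rels_Dbar0: "env_rels Dbar0 \<subseteq> env_rels Dbar"
proof
  fix r assume r: "r \<in> env_rels Dbar0"
  have *: "a \<in> lspan Dbar (range basis_elt) \<Longrightarrow> a \<in> carrier Dbar" for a by (rule Dbar0_subset)
  show "r \<in> env_rels Dbar"
    using r unfolding U.env_rels_eq U0.env_rels_eq Dbar0_simps carrier_Dbar0 by (blast intro: *)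
qed

lemma alg_hom_res_cl: "U.cl \<in> alg_hom (cfree (carrier Dbar0)) (env Dbar)"
proof -
  have "a \<in> carrier (cfree (carrier Dbar0)) \<Longrightarrow> a \<in> carrier (cfree (carrier Dbar))" for a by (rule Dbar0_Fr)
  then show ?thesis
    using U.cl_alg_hom unfolding alg_hom_def ring_hom_def by (auto simp: cfree_simps)
qed

text \<open>The relations of \<open>U(Dbar0)\<close> are among those of \<open>U(Dbar)\<close>, so the smaller closed ideal is contained
  in the larger one, although the ambient free algebras differ.\<close>

lemma U0_Iz_sub: "a \<in> U0.Iz \<Longrightarrow> a \<in> U.Iz"
proof -
  assume a: "a \<in> U0.Iz"
  have ac: "a \<in> carrier (cfree (carrier Dbar))" by (rule Dbar0_Fr[OF U0.Iz_carrier[OF a]])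
  have "U.cl a = \<zero>\<^bsub>env Dbar\<^esub>"
  proof (rule U0.kernel_kills[OF U.Q_sep_alg alg_hom_res_cl _ a])
    fix r assume r: "r \<in> env_rels Dbar0"
    then have "r \<in> U.Iz" using env_rels_Dbar0 U.S_Iz by blast
    then show "U.cl r = \<zero>\<^bsub>env Dbar\<^esub>"
      using U.Iz_carrier[of r] U.cl_ops(5)[OF cfree_closed(5) cfree_closed(5)] by (simp add: U.cl_eq_iff cfree_closed)
  qed
  then show ?thesis using ac U.cl_ops(5)[OF cfree_closed(5) cfree_closed(5)] by (simp add: U.cl_eq_iff cfree_closed)
qed

lemma env_incl_cl:
  assumes a: "a \<in> carrier (cfree (carrier Dbar0))" shows "env_incl Dbar (U0.cl a) = U.cl a"
proof -
  have "U.cl b = U.cl a" if b: "b \<in> U0.cl a" for b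
  proof -
    have "b \<in> carrier (cfree (carrier Dbar0))" "(\<lambda>w. b w - a w) \<in> U0.Iz"
      using b by (auto simp: U0.cl_mem_iff[OF a])
    then show ?thesis using a by (simp add: U.cl_eq_iff Dbar0_Fr U0_Iz_sub)
  qed
  then show ?thesis using U0.cl_mem[OF a] unfolding env_incl_def by blast
qed

lemma env_incl_hom: "env_incl Dbar \<in> alg_hom (env Dbar0) (env Dbar)"
  unfolding alg_hom_def
proof (intro CollectI conjI ring_hom_memI ballI allI)
  show "env_incl Dbar \<one>\<^bsub>env Dbar0\<^esub> = \<one>\<^bsub>env Dbar\<^esub>"
    using U0.cl_ops(4)[OF cfree_closed(5) cfree_closed(5)] U.cl_ops(4)[OF cfree_closed(5) cfree_closed(5)]
    by (simp add: env_incl_cl word_closed)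
next
  fix x assume "x \<in> carrier (env Dbar0)"
  then obtain a where a: "a \<in> carrier (cfree (carrier Dbar0))" "x = U0.cl a" by (auto simp: U0.carrier_Q)
  show "env_incl Dbar x \<in> carrier (env Dbar)" using a by (simp add: env_incl_cl Dbar0_Fr)
  show "env_incl Dbar (c \<odot>\<^bsub>env Dbar0\<^esub> x) = c \<odot>\<^bsub>env Dbar\<^esub> env_incl Dbar x" for c
    using a by (simp add: env_incl_cl U0.cl_ops(3)[OF a(1) a(1)] U.cl_ops(3)[OF Dbar0_Fr[OF a(1)] Dbar0_Fr[OF a(1)]] cfree_closed del: Dbar0_simps)
  fix y assume "y \<in> carrier (env Dbar0)"
  then obtain b where b: "b \<in> carrier (cfree (carrier Dbar0))" "y = U0.cl b" by (auto simp: U0.carrier_Q)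
  show "env_incl Dbar (x \<otimes>\<^bsub>env Dbar0\<^esub> y) = env_incl Dbar x \<otimes>\<^bsub>env Dbar\<^esub> env_incl Dbar y"
    "env_incl Dbar (x \<oplus>\<^bsub>env Dbar0\<^esub> y) = env_incl Dbar x \<oplus>\<^bsub>env Dbar\<^esub> env_incl Dbar y"
    using a b by (simp_all add: env_incl_cl U0.cl_ops U.cl_ops Dbar0_Fr cfree_closed cmul_closed del: Dbar0_simps)
qed

section \<open>Images of the generators\<close>

lemma D_x_op: "D_x = D_op [:0, 1:] 0"
proof -
  have "D_x = D_mon 1 0" using D_x_pow[of 1] by (simp add: D_mon_eq mon_word_def dpow_def D_x_def gen_eq_word)
  then show ?thesis by (simp add: D_mon_op monom_Suc one_pCons)
qed

lemma D_one_op: "\<one>\<^bsub>D_alg\<^esub> = D_op 1 0"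
proof -
  have "D_mon 0 0 = D_op (monom 1 0) 0" by (rule D_mon_op)
  then show ?thesis using D.cl_ops(4)[OF cfree_closed(5) cfree_closed(5)]
    by (simp add: D_mon_eq mon_word_def dpow_def monom_0 one_pCons)
qed

lemma D_op_pow: "D_op f 0 [^]\<^bsub>D_alg\<^esub> (n::nat) = D_op (f ^ n) 0"
  by (induction n) (simp_all add: D_one_op D_op_mult mult.commute)

lemma D_d_op: "D_d r = D_op 1 r"
proof -
  have "D_mon 0 r = D_op (monom 1 0) r" by (rule D_mon_op)
  then show ?thesis by (simp add: D_mon_eq mon_word_def D_d_eq monom_0 one_pCons)
qed

text \<open>The variable \<open>x\<close> and the constant \<open>h\<close> as polynomials. With both of them in the same commutative ring,
  the relations become identities that ring normalization can check.\<close>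

definition xx :: "scal poly" where "xx = [:0, 1:]"

definition cc :: "scal poly" where "cc = [:hh:]"

lemma sh_xx: "sh r xx = xx + of_int r * cc"
  by (simp add: sh_def xx_def cc_def of_int_poly pcompose_pCons)

lemma sh_power: "sh r (f ^ n) = sh r f ^ n"
  by (induction n) (simp_all add: sh_ops)

lemma monom_xx: "monom 1 n = xx ^ n"
  by (simp add: xx_def monom_altdef)

lemma smult_cc: "Polynomial.smult (hh ^ n) f = cc ^ n * f"
  by (simp add: cc_def) (metis mult_smult_left mult_1 pCons_one smult_monom monom_0 mult.right_neutral poly_const_pow)

lemma img_e_DE: "img_e j = DE (xx ^ j) 1 0"
  by (simp add: img_e_def D_in_def D_mon_op DE_def monom_xx)

lemma img_f_DE: "img_f j = DE (- ((xx - cc) ^ j)) (- 1) 0"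
proof -
  have "D_d (- 1) \<otimes>\<^bsub>D_alg\<^esub> (D_x [^]\<^bsub>D_alg\<^esub> j) = D_op ((xx - cc) ^ j) (- 1)"
    by (simp add: D_d_op D_x_op D_op_pow D_op_mult sh_power sh_xx[of "-1", unfolded xx_def] xx_def)
  then show ?thesis
    by (simp add: img_f_def D_in_def DE_def D.Q.a_inv_smult D_op_smult)
qed

lemma img_psi_DE: "img_psi j = DE ((xx - cc) ^ j - xx ^ j) 0 (- ((- hh) ^ j))"
proof -
  have "D_x \<ominus>\<^bsub>D_alg\<^esub> (hh \<odot>\<^bsub>D_alg\<^esub> \<one>\<^bsub>D_alg\<^esub>) = D_op (xx - cc) 0"
    by (simp add: D_x_op D_one_op D_op_smult D_op_minus xx_def cc_def one_pCons)
  then show ?thesis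
    by (simp add: img_psi_def D_in_def DE_def D_op_pow D_x_op D_op_minus Dbar_simps c_D_def xx_def)
qed

section \<open>Pushing forward along a map of letters\<close>

text \<open>The continuous homomorphism of free algebras induced by a map of the generators.\<close>

definition push :: "('g \<Rightarrow> 'k) \<Rightarrow> ('g list \<Rightarrow> scal) \<Rightarrow> ('k list \<Rightarrow> scal)" where
  "push u a = (\<lambda>w. lin (\<lambda>v. if map u v = w then 1 else 0) a)"

lemma push_dvd:
  assumes "\<not> hh ^ n dvd push u a w" shows "\<exists>v. map u v = w \<and> \<not> hh ^ n dvd a v"
proof (rule ccontr)
  assume n: "\<not> ?thesis"
  have "hh ^ n dvd push u a w"
    unfolding push_def lin_def by (rule hsum_dvd) (use n in auto)
  then show False using assms by simp
qed

lemma null_push: assumes "null a" shows "null (push u a)"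
  unfolding null_iff
proof
  fix n
  have "{w. \<not> hh ^ n dvd push u a w} \<subseteq> map u ` {v. \<not> hh ^ n dvd a v}"
    using push_dvd by fast
  then show "finite {w. \<not> hh ^ n dvd push u a w}"
    using assms finite_subset unfolding null_iff by blast
qed

lemma push_word: "push u (word v) = word (map u v)"
  by (auto simp: push_def word_def[of "map u v"] fun_eq_iff)

text \<open>A functional on the target pulls back to the functional with coefficients \<open>V (map u v)\<close>; this is the exchange of
  the sum over words with the sum over the fibres of \<open>map u\<close>.\<close>

lemma lin_push: assumes "null a" shows "lin V (push u a) = lin (\<lambda>v. V (map u v)) a"
proof -
  let ?F = "\<lambda>w v. a v * (if map u v = w then V w else 0)"
  have n: "null (\<lambda>(w,v). ?F w v)"
    unfolding null_iff
  proof
    fix n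
    have "{z. \<not> hh ^ n dvd (case z of (w,v) \<Rightarrow> ?F w v)} \<subseteq> (\<lambda>v. (map u v, v)) ` {v. \<not> hh ^ n dvd a v}"
      by (auto simp: image_iff split: if_splits)
    then show "finite {z. \<not> hh ^ n dvd (case z of (w,v) \<Rightarrow> ?F w v)}"
      by (rule finite_subset) (use assms in \<open>auto simp: null_iff\<close>)
  qed
  have "push u a w * V w = hsum (?F w)" for w
  proof -
    have "push u a w * V w = hsum (\<lambda>v. a v * (if map u v = w then 1 else 0) * V w)"
      unfolding push_def lin_def by (rule hsum_multc[symmetric]) (rule null_mult_gen[OF assms])
    also have "\<dots> = hsum (?F w)" by (rule arg_cong[where f=hsum]) auto
    finally show ?thesis .
  qed
  then have "lin V (push u a) = hsum (\<lambda>w. hsum (?F w))" by (simp add: lin_def)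
  also have "\<dots> = hsum (\<lambda>v. hsum (\<lambda>w. ?F w v))" by (rule hsum_swap[OF n])
  also have "\<dots> = hsum (\<lambda>v. a v * V (map u v))"
  proof (rule arg_cong[where f=hsum], rule HOL.ext)
    fix v
    have "(\<lambda>w. ?F w v) = (\<lambda>w. if w = map u v then a v * V w else 0)" by auto
    then show "hsum (\<lambda>w. ?F w v) = a v * V (map u v)" by (simp add: hsum_single)
  qed
  finally show ?thesis by (simp add: lin_def)
qed

lemma push_alg_hom:
  fixes u :: "'g \<Rightarrow> 'k"
  assumes u: "u ` G \<subseteq> H" shows "push u \<in> alg_hom (cfree G) (cfree H)"
  unfolding alg_hom_def
proof (intro CollectI conjI ring_hom_memI ballI allI)
  show "push u \<one>\<^bsub>cfree G\<^esub> = \<one>\<^bsub>cfree H\<^esub>" by (simp add: cfree_simps push_word)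
next
  fix a assume a: "a \<in> carrier (cfree G)"
  have na: "null a" using a by (rule carrier_cfreeD)
  show "push u a \<in> carrier (cfree H)"
    unfolding carrier_cfree
  proof (intro conjI allI impI null_push na)
    fix w assume w: "w \<notin> lists H"
    show "push u a w = 0"
    proof (rule hh_power_dvd_all_imp_zero, rule ccontr)
      fix n assume "\<not> hh ^ n dvd push u a w"
      then obtain v where v: "map u v = w" "\<not> hh ^ n dvd a v" using push_dvd by blast
      then have "a v \<noteq> 0" by auto
      then have "v \<in> lists G" using a by (auto simp: carrier_cfree)
      then have "w \<in> lists H" using v u by (auto simp: image_subset_iff)
      then show False using w by simp
    qed
  qed
  show "push u (c \<odot>\<^bsub>cfree G\<^esub> a) = c \<odot>\<^bsub>cfree H\<^esub> push u a" for c
    by (simp add: cfree_simps push_def lin_smult na)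
  fix b assume b: "b \<in> carrier (cfree G)"
  have nb: "null b" using b by (rule carrier_cfreeD)
  show "push u (a \<oplus>\<^bsub>cfree G\<^esub> b) = push u a \<oplus>\<^bsub>cfree H\<^esub> push u b"
    by (simp add: cfree_simps push_def lin_add na nb)
  show "push u (a \<otimes>\<^bsub>cfree G\<^esub> b) = push u a \<otimes>\<^bsub>cfree H\<^esub> push u b"
  proof
    fix w
    let ?d = "\<lambda>v :: 'k list. if v = w then 1 else (0::scal)"
    have "cmul (push u a) (push u b) w = lin ?d (cmul (push u a) (push u b))" by (simp add: lin_delta)
    also have "\<dots> = lin (\<lambda>u1. lin (\<lambda>v1. ?d (u1 @ v1)) (push u b)) (push u a)"
      by (rule lin_cmul'[OF null_push[OF na] null_push[OF nb]])
    also have "\<dots> = lin (\<lambda>u1. lin (\<lambda>v1. ?d (map u u1 @ map u v1)) b) a"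
      by (simp add: lin_push na nb)
    also have "\<dots> = push u (cmul a b) w"
      by (simp add: push_def lin_cmul' na nb)
    finally show "push u (a \<otimes>\<^bsub>cfree G\<^esub> b) w = (push u a \<otimes>\<^bsub>cfree H\<^esub> push u b) w"
      by (simp add: cfree_simps)
  qed
qed

section \<open>The relations hold in the enveloping algebra\<close>

lemma alg_hom_cubic:
  assumes "\<theta> \<in> alg_hom A B" "scal_alg A" "scal_alg B" "\<And>i. a i \<in> carrier A" "\<And>i. b i \<in> carrier A"
  shows "\<theta> (cubic A a b i j) = cubic B (\<lambda>i. \<theta> (a i)) (\<lambda>i. \<theta> (b i)) i j"
proof -
  interpret A: scal_alg A by fact
  interpret B: scal_alg B by fact
  note h = alg_hom_minus[OF assms(1-3)] alg_hom_add[OF assms(1)] alg_hom_smult[OF assms(1)] alg_hom_comm[OF assms(1-3)]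
  show ?thesis by (simp add: cubic_def h assms(4,5))
qed

lemma alg_hom_serre:
  assumes "\<theta> \<in> alg_hom A B" "scal_alg A" "scal_alg B" "\<And>i. a i \<in> carrier A"
  shows "\<theta> (serre A a i j k) = serre B (\<lambda>i. \<theta> (a i)) i j k"
proof -
  interpret A: scal_alg A by fact
  interpret B: scal_alg B by fact
  note h = alg_hom_add[OF assms(1)] alg_hom_comm[OF assms(1-3)]
  show ?thesis by (simp add: serre_def Let_def h assms(4))
qed

lemma pb_neg: "pb (- f) r g s = - pb f r g s" "pb f r (- g) s = - pb f r g s"
  by (simp_all add: pb_def sh_ops)

lemma smult_poly:
  "Polynomial.smult 3 f = 3 * f" "Polynomial.smult (- 1) f = - (f :: scal poly)"
  "Polynomial.smult (hh ^ 2) f = cc ^ 2 * f" "Polynomial.smult (2 * hh ^ 2) f = 2 * cc ^ 2 * f"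
  "Polynomial.smult (- 2 * hh ^ 2) f = - 2 * cc ^ 2 * f"
proof -
  show "Polynomial.smult 3 f = 3 * f" by (simp add: numeral_poly)
  show "Polynomial.smult (- 1) f = - f" by simp
  show h: "Polynomial.smult (hh ^ 2) f = cc ^ 2 * f" by (rule smult_cc)
  show h2: "Polynomial.smult (2 * hh ^ 2) f = 2 * cc ^ 2 * f"
  proof -
    have "Polynomial.smult (2 * hh ^ 2) f = Polynomial.smult 2 (Polynomial.smult (hh ^ 2) f)"
      by (rule poly_eqI) (simp only: coeff_smult mult.assoc)
    also have "\<dots> = 2 * Polynomial.smult (hh ^ 2) f" by (simp add: numeral_poly mult.commute)
    finally have "Polynomial.smult (2 * hh ^ 2) f = 2 * Polynomial.smult (hh ^ 2) f" .
    then show ?thesis by (simp add: h mult.assoc)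
  qed
  show "Polynomial.smult (- 2 * hh ^ 2) f = - 2 * cc ^ 2 * f"
  proof -
    have "Polynomial.smult (- 2 * hh ^ 2) f = - Polynomial.smult (2 * hh ^ 2) f" by (rule poly_eqI) simp
    then show ?thesis by (simp add: h2)
  qed
qed

text \<open>The value of the cubic relation on a product \<open>z\<^sup>i w\<^sup>j\<close> of commuting variables: it equals
  \<open>z\<^sup>i w\<^sup>j ((z - w)\<^sup>3 - c\<^sup>2 (z - w))\<close>.\<close>

definition cube_expr :: "'a::comm_ring_1 \<Rightarrow> 'a \<Rightarrow> 'a \<Rightarrow> nat \<Rightarrow> nat \<Rightarrow> 'a" where
  "cube_expr c z w i j = z ^ (i + 3) * w ^ j - 3 * (z ^ (i + 2) * w ^ (j + 1)) + 3 * (z ^ (i + 1) * w ^ (j + 2))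
     - z ^ i * w ^ (j + 3) - c ^ 2 * (z ^ (i + 1) * w ^ j - z ^ i * w ^ (j + 1))"

lemma cube_expr_zero:
  assumes "z - w = d" "d ^ 3 = c ^ 2 * d" shows "cube_expr c z w i j = 0"
proof -
  have "cube_expr c z w i j = z ^ i * w ^ j * ((z - w) ^ 3 - c ^ 2 * (z - w))"
    by (simp add: cube_expr_def power_add power2_eq_square power3_eq_cube algebra_simps)
  then show ?thesis using assms by simp
qed

text \<open>In the images of the cubic relations, \<open>z\<close> and \<open>w\<close> are shifts of \<open>x\<close> by multiples of \<open>c = h\<close> whose difference is
  \<open>0\<close>, \<open>c\<close> or \<open>- c\<close>. These are the roots of \<open>d\<^sup>3 = c\<^sup>2 d\<close>, which explains the coefficients of the relation.\<close>

lemma cube_steps: "(0::'a::comm_ring_1) ^ 3 = c ^ 2 * 0" "c ^ 3 = c ^ 2 * c" "(- c) ^ 3 = c ^ 2 * (- c)"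
  by (simp_all add: power2_eq_square power3_eq_cube)

text \<open>With \<open>x, y, z\<close> in arithmetic progression, as the shifts \<open>x, x + h, x + 2h\<close> are, the symmetrized triple
  bracket has the factor \<open>x + z - 2y = 0\<close>.\<close>

lemma serre_id:
  fixes x y z :: "'a::comm_ring_1"
  assumes "x + z = 2 * y"
  defines "t \<equiv> \<lambda>p q r. x ^ p * (y ^ q * z ^ (r + 1) - y ^ (r + 1) * z ^ q) - (x ^ q * y ^ (r + 1) - x ^ (r + 1) * y ^ q) * z ^ p"
  shows "t i j k + t i k j + t j i k + t j k i + t k i j + t k j i = 0"
proof -
  define M where "M = x ^ i * y ^ j * z ^ k + x ^ i * y ^ k * z ^ j + x ^ j * y ^ i * z ^ k + x ^ j * y ^ k * z ^ i + x ^ k * y ^ i * z ^ j + x ^ k * y ^ j * z ^ i"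
  have "t i j k + t i k j + t j i k + t j k i + t k i j + t k j i = (x + z - 2 * y) * M"
    by (simp add: t_def M_def algebra_simps)
  then show ?thesis using assms(1) by simp
qed

lemma sh_numeral: "sh r (numeral n) = numeral n"
  by (simp add: sh_def numeral_poly)

lemma phi_poly_degree: "r + t \<noteq> 0 \<Longrightarrow> phi_poly f r g t = 0"
  by (simp add: phi_poly_def)

lemma phi_poly_zero_zero: "phi_poly f 0 g 0 = 0"
  by (simp add: phi_poly_def)

text \<open>The only nonzero value of the cocycle that enters the relations; it produces the central part of \<open>\<psi>\<^sub>i\<^sub>+\<^sub>j\<close>. The
  sum consists of the term \<open>l = - 1\<close>.\<close>

lemma phi_poly_ef: "phi_poly (xx ^ i) 1 (- ((xx - cc) ^ j)) (- 1) = - ((- hh) ^ (i + j))"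
proof -
  have *: "(\<lambda>l. (neg l - neg (l + 1)) * (poly (xx ^ i) (of_int l * hh) * poly (- ((xx - cc) ^ j)) (of_int (l + 1) * hh)))
     = (\<lambda>l. if l = - 1 then - ((- hh) ^ (i + j)) else 0)"
    by (auto simp: neg_def fun_eq_iff xx_def cc_def power_add)
  show ?thesis by (simp only: phi_poly_def * hsum_single add.right_inverse) simp
qed

lemma sh_xx_cc: "sh r (xx - cc) = xx - cc + of_int r * cc" "sh r cc = cc"
proof -
  show "sh r cc = cc" by (simp add: sh_def cc_def)
  then show "sh r (xx - cc) = xx - cc + of_int r * cc" by (simp add: sh_ops sh_xx)
qed

definition img :: "ygen \<Rightarrow> dop \<times> scal" where
  "img g = (case g of E i \<Rightarrow> img_e i | F i \<Rightarrow> img_f i | Psi i \<Rightarrow> img_psi i)"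

lemma img_simps:
  "img (E i) = DE (xx ^ i) 1 0" "img (F i) = DE (- ((xx - cc) ^ i)) (- 1) 0"
  "img (Psi i) = DE ((xx - cc) ^ i - xx ^ i) 0 (- ((- hh) ^ i))"
  by (simp_all add: img_def img_e_DE img_f_DE img_psi_DE)

lemma img_Dbar0: "img g \<in> carrier Dbar0"
proof (cases g)
  case (E i)
  have "adm 1 (xx ^ i)" by (auto simp: adm_def h_exp_def)
  then show ?thesis by (simp add: E img_simps DE_Dbar0)
next
  case (F i)
  have "adm (- 1) (- ((xx - cc) ^ i))" by (auto simp: adm_def h_exp_def)
  then show ?thesis by (simp add: F img_simps DE_Dbar0)
next
  case (Psi i)
  obtain g where "sh (- 1) (xx ^ i) = xx ^ i + Polynomial.smult hh g" using sh_mod by blast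
  then have "(xx - cc) ^ i - xx ^ i = Polynomial.smult hh g" by (simp add: sh_power sh_xx)
  then have "adm 0 ((xx - cc) ^ i - xx ^ i)" by (auto simp: adm_def h_exp_def)
  then show ?thesis by (simp add: Psi img_simps DE_Dbar0)
qed

abbreviation (input) "UA \<equiv> env Dbar0"
abbreviation "AY \<equiv> cfree (UNIV :: ygen set)"

text \<open>The homomorphism of the theorem before passing to the quotient on the side of the Yangian.\<close>

definition theta_free :: "(ygen list \<Rightarrow> scal) \<Rightarrow> ((dop \<times> scal) list \<Rightarrow> scal) set" where
  "theta_free a = U0.cl (push img a)"

lemma theta_free_hom: "theta_free \<in> alg_hom AY UA"
  unfolding theta_free_def
  by (rule alg_hom_comp[OF push_alg_hom U0.cl_alg_hom]) (use img_Dbar0 in auto)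

lemma theta_free_gen: "theta_free (gen g) = U0.io (img g)"
  by (simp add: theta_free_def gen_eq_word push_word U0.io_eq)

definition lsub :: "dop \<times> scal \<Rightarrow> dop \<times> scal \<Rightarrow> dop \<times> scal" where
  "lsub x y = ladd Dbar x (lsmult Dbar (- 1) y)"

text \<open>The cubic and Serre expressions inside the Lie algebra \<open>Dbar0\<close>. The relations are checked there, where only
  polynomials have to be compared, and then carried to the enveloping algebra.\<close>

definition lcubic :: "(nat \<Rightarrow> dop \<times> scal) \<Rightarrow> (nat \<Rightarrow> dop \<times> scal) \<Rightarrow> nat \<Rightarrow> nat \<Rightarrow> dop \<times> scal" where
  "lcubic a b i j = (let B = lbracket Dbar in
     lsub (lsub (ladd Dbar (lsub (B (a (i + 3)) (b j)) (lsmult Dbar 3 (B (a (i + 2)) (b (j + 1)))))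
       (lsmult Dbar 3 (B (a (i + 1)) (b (j + 2))))) (B (a i) (b (j + 3))))
       (lsmult Dbar (hh ^ 2) (lsub (B (a (i + 1)) (b j)) (B (a i) (b (j + 1))))))"

definition lserre :: "(nat \<Rightarrow> dop \<times> scal) \<Rightarrow> nat \<Rightarrow> nat \<Rightarrow> nat \<Rightarrow> dop \<times> scal" where
  "lserre a i1 i2 i3 = (let t = (\<lambda>p q r. lbracket Dbar (a p) (lbracket Dbar (a q) (a (r + 1)))); A = ladd Dbar in
     A (A (A (A (A (t i1 i2 i3) (t i1 i3 i2)) (t i2 i1 i3)) (t i2 i3 i1)) (t i3 i1 i2)) (t i3 i2 i1))"

lemma U0_closed:
  "x \<in> carrier Dbar0 \<Longrightarrow> y \<in> carrier Dbar0 \<Longrightarrow> ladd Dbar x y \<in> carrier Dbar0"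
  "x \<in> carrier Dbar0 \<Longrightarrow> lsmult Dbar c x \<in> carrier Dbar0"
  "x \<in> carrier Dbar0 \<Longrightarrow> y \<in> carrier Dbar0 \<Longrightarrow> lbracket Dbar x y \<in> carrier Dbar0"
  using U0.ladd_closed U0.lsmult_closed U0.lbracket_closed by auto

lemma lsub_closed: "x \<in> carrier Dbar0 \<Longrightarrow> y \<in> carrier Dbar0 \<Longrightarrow> lsub x y \<in> carrier Dbar0"
  by (simp add: lsub_def U0_closed)

lemma io_ops:
  assumes "x \<in> carrier Dbar0" "y \<in> carrier Dbar0"
  shows "U0.io x \<oplus>\<^bsub>UA\<^esub> U0.io y = U0.io (ladd Dbar x y)"
    "c \<odot>\<^bsub>UA\<^esub> U0.io x = U0.io (lsmult Dbar c x)"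
    "comm UA (U0.io x) (U0.io y) = U0.io (lbracket Dbar x y)"
    "U0.io x \<ominus>\<^bsub>UA\<^esub> U0.io y = U0.io (lsub x y)"
  using U0.io_add[OF assms] U0.io_smult[OF assms(1)] U0.io_comm[OF assms] U0.io_minus[OF assms]
  by (simp_all add: lsub_def)

lemma io_cubic:
  assumes "\<And>i. a i \<in> carrier Dbar0" "\<And>i. b i \<in> carrier Dbar0"
  shows "cubic UA (\<lambda>i. U0.io (a i)) (\<lambda>i. U0.io (b i)) i j = U0.io (lcubic a b i j)"
  by (simp add: cubic_def lcubic_def Let_def io_ops(1,3,4) io_ops(2)[OF _ assms(1)] U0_closed lsub_closed assms)

lemma io_serre:
  assumes "\<And>i. a i \<in> carrier Dbar0"
  shows "serre UA (\<lambda>i. U0.io (a i)) i j k = U0.io (lserre a i j k)"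
  by (simp add: serre_def lserre_def Let_def io_ops(1,3) U0_closed assms)

lemma io_zero: "U0.io (DE 0 r 0) = \<zero>\<^bsub>UA\<^esub>"
proof -
  have "DE 0 r 0 = lsmult Dbar 0 (DE 0 r 0)" by (simp add: DE_ops)
  moreover have "DE 0 r 0 \<in> carrier Dbar0" by (rule DE_Dbar0[OF adm_ops(1)])
  ultimately show ?thesis using io_ops(2)[of "DE 0 r 0" "DE 0 r 0" 0] by simp
qed

lemma lsub_DE: "lsub (DE f r c) (DE g r d) = DE (f - g) r (c - d)"
  by (simp add: lsub_def DE_ops)

lemma lcubic_DE:
  assumes "\<And>i. a i = DE (f i) r (c i)" "\<And>i. b i = DE (g i) s (d i)" "r + s \<noteq> 0"
  shows "lcubic a b i j = DE (pb (f (i + 3)) r (g j) s - 3 * pb (f (i + 2)) r (g (j + 1)) s + 3 * pb (f (i + 1)) r (g (j + 2)) s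
    - pb (f i) r (g (j + 3)) s - cc ^ 2 * (pb (f (i + 1)) r (g j) s - pb (f i) r (g (j + 1)) s)) (r + s) 0"
  unfolding lcubic_def Let_def assms(1,2) DE_ops(3) phi_poly_degree[OF assms(3)]
  by (simp only: DE_ops lsub_DE smult_poly) simp

text \<open>The bracket of the images is a combination of products of two shifts of \<open>x\<close>, and the cubic expression
  is applied to each product separately.\<close>

lemma lcubic_zero:
  "lcubic (\<lambda>i. img (E i)) (\<lambda>i. img (E i)) i j = DE 0 2 0"
  "lcubic (\<lambda>i. img (F i)) (\<lambda>i. img (F i)) i j = DE 0 (- 2) 0"
  "lcubic (\<lambda>i. img (Psi i)) (\<lambda>i. img (E i)) i j = DE 0 1 0"
  "lcubic (\<lambda>i. img (Psi i)) (\<lambda>i. img (F i)) i j = DE 0 (- 1) 0"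
proof -
  let ?x = "xx" and ?y = "xx + cc" and ?u = "xx - cc" and ?v = "xx - cc - cc"
  have pbee: "pb (?x ^ i) 1 (?x ^ j) 1 = ?x ^ i * ?y ^ j - ?y ^ i * ?x ^ j" for i j
    by (simp add: pb_def sh_power sh_xx mult.commute)
  have pbff: "pb (- (?u ^ i)) (- 1) (- (?u ^ j)) (- 1) = ?u ^ i * ?v ^ j - ?v ^ i * ?u ^ j" for i j
    by (simp add: pb_def sh_ops(7) sh_power sh_xx_cc mult.commute)
  have pbpe: "pb (?u ^ i - ?x ^ i) 0 (?x ^ j) 1 = ?u ^ i * ?x ^ j - 2 * (?x ^ i * ?x ^ j) + ?y ^ i * ?x ^ j" for i j
    by (simp add: pb_def sh_ops(2) sh_power sh_xx_cc sh_xx algebra_simps)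
  have pbpf: "pb (?u ^ i - ?x ^ i) 0 (- (?u ^ j)) (- 1) = ?x ^ i * ?u ^ j - 2 * (?u ^ i * ?u ^ j) + ?v ^ i * ?u ^ j" for i j
    by (simp add: pb_def sh_ops(2,7) sh_power sh_xx_cc sh_xx algebra_simps)
  have z: "cube_expr cc ?x ?y i j = 0" "cube_expr cc ?y ?x i j = 0" "cube_expr cc ?u ?v i j = 0" "cube_expr cc ?v ?u i j = 0"
    "cube_expr cc ?u ?x i j = 0" "cube_expr cc ?x ?x i j = 0" "cube_expr cc ?x ?u i j = 0" "cube_expr cc ?u ?u i j = 0"
    by (rule cube_expr_zero[OF _ cube_steps(3)] cube_expr_zero[OF _ cube_steps(2)] cube_expr_zero[OF _ cube_steps(1)]; simp)+
  have lin2: "(A3 - B3) - 3 * (A2 - B2) + 3 * (A1 - B1) - (A0 - B0) - q * ((A5 - B5) - (A4 - B4)) =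
     (A3 - 3 * A2 + 3 * A1 - A0 - q * (A5 - A4)) - (B3 - 3 * B2 + 3 * B1 - B0 - q * (B5 - B4))"
    for A0 A1 A2 A3 A4 A5 B0 B1 B2 B3 B4 B5 q :: "scal poly" by (simp add: algebra_simps)
  have lin3: "(A3 - 2 * B3 + C3) - 3 * (A2 - 2 * B2 + C2) + 3 * (A1 - 2 * B1 + C1) - (A0 - 2 * B0 + C0) - q * ((A5 - 2 * B5 + C5) - (A4 - 2 * B4 + C4)) =
     (A3 - 3 * A2 + 3 * A1 - A0 - q * (A5 - A4)) - 2 * (B3 - 3 * B2 + 3 * B1 - B0 - q * (B5 - B4)) + (C3 - 3 * C2 + 3 * C1 - C0 - q * (C5 - C4))"
    for A0 A1 A2 A3 A4 A5 B0 B1 B2 B3 B4 B5 C0 C1 C2 C3 C4 C5 q :: "scal poly" by (simp add: algebra_simps)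
  show "lcubic (\<lambda>i. img (E i)) (\<lambda>i. img (E i)) i j = DE 0 2 0"
    by (subst lcubic_DE[OF img_simps(1) img_simps(1)]) (simp_all only: pbee lin2 cube_expr_def[symmetric] z, simp_all)
  show "lcubic (\<lambda>i. img (F i)) (\<lambda>i. img (F i)) i j = DE 0 (- 2) 0"
    by (subst lcubic_DE[OF img_simps(2) img_simps(2)]) (simp_all only: pbff lin2 cube_expr_def[symmetric] z, simp_all)
  show "lcubic (\<lambda>i. img (Psi i)) (\<lambda>i. img (E i)) i j = DE 0 1 0"
    by (subst lcubic_DE[OF img_simps(3) img_simps(1)]) (simp_all only: pbpe lin3 cube_expr_def[symmetric] z, simp_all)
  show "lcubic (\<lambda>i. img (Psi i)) (\<lambda>i. img (F i)) i j = DE 0 (- 1) 0"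
    by (subst lcubic_DE[OF img_simps(3) img_simps(2)]) (simp_all only: pbpf lin3 cube_expr_def[symmetric] z, simp_all)
qed

lemma lserre_zero:
  "lserre (\<lambda>i. img (E i)) i j k = DE 0 3 0" "lserre (\<lambda>i. img (F i)) i j k = DE 0 (- 3) 0"
proof -
  let ?x = "xx" and ?y = "xx + cc" and ?z = "xx + 2 * cc"
  define u v w where uvw: "u = xx - cc" "v = xx - 2 * cc" "w = xx - 3 * cc"
  have s: "sh 1 ?x = ?y" "sh 1 ?y = ?z" "sh 2 ?x = ?z" "sh (- 1) u = v" "sh (- 1) v = w" "sh (- 2) u = w"
    by (simp_all add: uvw sh_ops sh_numeral sh_xx sh_xx_cc algebra_simps)
  have e: "pb (?x ^ p) 1 (pb (?x ^ q) 1 (?x ^ (r + 1)) 1) 2 = ?x ^ p * (?y ^ q * ?z ^ (r + 1) - ?y ^ (r + 1) * ?z ^ q)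
     - (?x ^ q * ?y ^ (r + 1) - ?x ^ (r + 1) * ?y ^ q) * ?z ^ p" for p q r
    by (simp only: pb_def sh_ops(2,3) sh_power s)
  have f: "pb (u ^ p) (- 1) (pb (u ^ q) (- 1) (u ^ (r + 1)) (- 1)) (- 2) = u ^ p * (v ^ q * w ^ (r + 1) - v ^ (r + 1) * w ^ q)
     - (u ^ q * v ^ (r + 1) - u ^ (r + 1) * v ^ q) * w ^ p" for p q r
    by (simp only: pb_def sh_ops(2,3) sh_power s)
  have d: "(1::int) + 1 = 2" "(1::int) + 2 = 3" "(- 1::int) + - 1 = - 2" "(- 1::int) + - 2 = - 3" by simp_all
  have ph: "phi_poly f 1 g 2 = 0" "phi_poly f (- 1) g (- 2) = 0" for f g by (simp_all add: phi_poly_def)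
  have i1: "?x + ?z = 2 * ?y" and i2: "u + w = 2 * v" by (simp_all add: uvw algebra_simps)
  show "lserre (\<lambda>i. img (E i)) i j k = DE 0 3 0"
    unfolding lserre_def Let_def img_simps DE_ops(3) d ph DE_ops(1) e
    unfolding serre_id[OF i1] by simp
  show "lserre (\<lambda>i. img (F i)) i j k = DE 0 (- 3) 0"
    unfolding lserre_def Let_def img_simps uvw(1)[symmetric]
    unfolding DE_ops(3) d ph DE_ops(1) pb_neg minus_minus f
    unfolding minus_add_distrib[symmetric] serre_id[OF i2] by simp
qed

lemma bracket_zero:
  "lbracket Dbar (img (Psi i)) (img (Psi j)) = DE 0 0 0"
  "lsub (lbracket Dbar (img (E i)) (img (F j))) (img (Psi (i + j))) = DE 0 0 0"
  "lbracket Dbar (img (Psi 0)) (img (E j)) = DE 0 1 0"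
  "lbracket Dbar (img (Psi 1)) (img (E j)) = DE 0 1 0"
  "lsub (lbracket Dbar (img (Psi 2)) (img (E j))) (lsmult Dbar (2 * hh ^ 2) (img (E j))) = DE 0 1 0"
  "lbracket Dbar (img (Psi 0)) (img (F j)) = DE 0 (- 1) 0"
  "lbracket Dbar (img (Psi 1)) (img (F j)) = DE 0 (- 1) 0"
  "lsub (lbracket Dbar (img (Psi 2)) (img (F j))) (lsmult Dbar (- 2 * hh ^ 2) (img (F j))) = DE 0 (- 1) 0"
proof -
  have ph: "phi_poly f 0 g 1 = 0" "phi_poly f 0 g (- 1) = 0" for f g by (simp_all add: phi_poly_def)
  show "lbracket Dbar (img (Psi i)) (img (Psi j)) = DE 0 0 0"
    by (simp add: img_simps DE_ops pb_def phi_poly_zero_zero mult.commute)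
  have "pb (xx ^ i) 1 (- ((xx - cc) ^ j)) (- 1) = (xx - cc) ^ (i + j) - xx ^ (i + j)"
    by (simp add: pb_def sh_ops(7) sh_power sh_xx sh_xx_cc power_add mult.commute)
  then show "lsub (lbracket Dbar (img (E i)) (img (F j))) (img (Psi (i + j))) = DE 0 0 0"
    by (simp add: img_simps DE_ops lsub_DE phi_poly_ef)
  show "lbracket Dbar (img (Psi 0)) (img (E j)) = DE 0 1 0" "lbracket Dbar (img (Psi 0)) (img (F j)) = DE 0 (- 1) 0"
    by (simp_all add: img_simps DE_ops pb_def ph sh_ops)
  show "lbracket Dbar (img (Psi 1)) (img (E j)) = DE 0 1 0" "lbracket Dbar (img (Psi 1)) (img (F j)) = DE 0 (- 1) 0"
    by (simp_all add: img_simps DE_ops pb_def ph sh_ops sh_xx_cc)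
  have "pb ((xx - cc) ^ 2 - xx ^ 2) 0 (xx ^ j) 1 = 2 * cc ^ 2 * xx ^ j"
    by (simp add: pb_def sh_ops sh_numeral sh_power sh_xx sh_xx_cc power2_eq_square algebra_simps)
  then show "lsub (lbracket Dbar (img (Psi 2)) (img (E j))) (lsmult Dbar (2 * hh ^ 2) (img (E j))) = DE 0 1 0"
    unfolding img_simps DE_ops smult_poly by (simp add: lsub_DE ph)
  have "pb ((xx - cc) ^ 2 - xx ^ 2) 0 (- ((xx - cc) ^ j)) (- 1) = 2 * cc ^ 2 * (xx - cc) ^ j"
    by (simp add: pb_def sh_ops sh_numeral sh_power sh_xx sh_xx_cc power2_eq_square algebra_simps)
  then show "lsub (lbracket Dbar (img (Psi 2)) (img (F j))) (lsmult Dbar (- 2 * hh ^ 2) (img (F j))) = DE 0 (- 1) 0"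
    unfolding img_simps DE_ops smult_poly by (simp add: lsub_DE ph)
qed

lemma gen_UNIV: "gen g \<in> carrier (cfree UNIV)"
  by (simp add: gen_eq_word word_closed_UNIV)

interpretation AY: scal_alg AY by (rule cfree_scal_alg)

lemma Y_rels_carrier: "Y_rels \<subseteq> carrier AY"
  unfolding Y_rels_def Let_def cubic_def serre_def
  by (auto intro!: AY.minus_closed AY.comm_closed AY.smult_closed AY.add.m_closed gen_UNIV)

lemma theta_free_rels: assumes r: "r \<in> Y_rels" shows "theta_free r = \<zero>\<^bsub>UA\<^esub>"
proof -
  note h = alg_hom_cubic[OF theta_free_hom cfree_scal_alg U0.Q.scal_alg_axioms gen_UNIV gen_UNIV]
    alg_hom_serre[OF theta_free_hom cfree_scal_alg U0.Q.scal_alg_axioms gen_UNIV]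
    alg_hom_comm[OF theta_free_hom cfree_scal_alg U0.Q.scal_alg_axioms gen_UNIV gen_UNIV]
    alg_hom_minus[OF theta_free_hom cfree_scal_alg U0.Q.scal_alg_axioms]
    alg_hom_smult[OF theta_free_hom gen_UNIV] theta_free_gen
    AY.comm_closed[OF gen_UNIV gen_UNIV] AY.smult_closed[OF gen_UNIV] gen_UNIV
  note k = io_cubic[OF img_Dbar0 img_Dbar0] io_serre[OF img_Dbar0] io_ops(3)[OF img_Dbar0 img_Dbar0]
    io_ops(2)[OF img_Dbar0 img_Dbar0] io_ops(4) U0_closed img_Dbar0 lcubic_zero lserre_zero bracket_zero io_zero
  show ?thesis
    using r unfolding Y_rels_def Let_def
    by (elim UnE CollectE exE conjE) (simp_all only: h k)
qed

section \<open>The current Lie algebra modulo h\<close>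

definition lb :: "'r::ring \<Rightarrow> 'r \<Rightarrow> 'r" where "lb x y = x * y - y * x"

lemma lb_props:
  fixes x y z :: "'r::real_algebra_1"
  shows "lb (x + y) z = lb x z + lb y z" "lb x (y + z) = lb x y + lb x z"
    "lb (c *\<^sub>R x) y = c *\<^sub>R lb x y" "lb x (c *\<^sub>R y) = c *\<^sub>R lb x y"
    "lb (- x) y = - lb x y" "lb x (- y) = - lb x y" "lb 0 x = 0" "lb x 0 = 0" "lb x x = 0"
  by (simp_all add: lb_def algebra_simps)

lemma lb_antisym: "lb x y = - lb y (x :: 'r::ring)"
  by (simp add: lb_def)

lemma lb_jacobi: "lb x (lb y z) = lb (lb x y) z + lb y (lb x (z :: 'r::ring))"
  by (simp add: lb_def algebra_simps)

text \<open>The candidates for a basis of the half generated by the \<open>e\<^sub>i\<close>. The normalization makes \<open>[e\<^sub>0, -]\<close> act like a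
  derivative in \<open>i\<close>, which fixes these vectors.\<close>

fun tower :: "(nat \<Rightarrow> 'r::real_algebra_1) \<Rightarrow> nat \<Rightarrow> nat \<Rightarrow> 'r" where
  "tower e 0 i = e i"
| "tower e (Suc j) i = (1 / real (i + 1)) *\<^sub>R lb (e 0) (tower e j (i + 1))"

subsection \<open>Three linear systems\<close>

text \<open>The third differences of \<open>g\<close> vanish, so \<open>g\<close> is a quadratic polynomial in \<open>i\<close>; being antisymmetric under
  \<open>i \<mapsto> N - i\<close>, it is linear with zero at \<open>N/2\<close>. This is applied to \<open>g i = [e\<^sub>i, e\<^sub>N\<^sub>-\<^sub>i]\<close>.\<close>

lemma quadratic_system:
  fixes g :: "nat \<Rightarrow> 'v::real_vector"
  assumes d3: "\<And>i. i + 3 \<le> N \<Longrightarrow> g (i + 3) - 3 *\<^sub>R g (i + 2) + 3 *\<^sub>R g (i + 1) - g i = 0"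
    and anti: "\<And>i. i \<le> N \<Longrightarrow> g i = - g (N - i)" and i: "i \<le> N"
  shows "real N *\<^sub>R g i = (real N - 2 * real i) *\<^sub>R g 0"
proof (cases "N = 0")
  case True
  then show ?thesis using i by simp
next
  case False
  define k where "k i = real N *\<^sub>R g i - (real N - 2 * real i) *\<^sub>R g 0" for i
  have k0: "k 0 = 0" by (simp add: k_def)
  have ka: "k i = - k (N - i)" if "i \<le> N" for i
  proof -
    have "g i = - g (N - i)" by (rule anti[OF that])
    then show ?thesis using that by (simp add: k_def of_nat_diff algebra_simps)
  qed
  have k3: "k (i + 3) = 3 *\<^sub>R k (i + 2) - 3 *\<^sub>R k (i + 1) + k i" if "i + 3 \<le> N" for i
  proof -
    have "g (i + 3) = 3 *\<^sub>R g (i + 2) - 3 *\<^sub>R g (i + 1) + g i" using d3[OF that] by (simp add: algebra_simps)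
    then have "k (i + 3) - (3 *\<^sub>R k (i + 2) - 3 *\<^sub>R k (i + 1) + k i) = 0"
      by (simp add: k_def) (simp add: algebra_simps, simp flip: scaleR_left_distrib)
    then show ?thesis by simp
  qed
  define D where "D = k 2 - 2 *\<^sub>R k 1"
  have q: "i \<le> N \<Longrightarrow> k i = real i *\<^sub>R k 1 + (real i * (real i - 1) / 2) *\<^sub>R D" for i
  proof (induction i rule: less_induct)
    case (less i)
    consider "i = 0" | "i = 1" | "i = 2" | n where "i = n + 3"
    proof -
      have "i = 0 \<or> i = 1 \<or> i = 2 \<or> i = (i - 3) + 3" by arith
      then show thesis using that by blast
    qed
    then show ?case
    proof cases
      case 4
      have e: "k (n + 2) = real (n + 2) *\<^sub>R k 1 + (real (n + 2) * (real (n + 2) - 1) / 2) *\<^sub>R D"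
        "k (n + 1) = real (n + 1) *\<^sub>R k 1 + (real (n + 1) * (real (n + 1) - 1) / 2) *\<^sub>R D"
        "k n = real n *\<^sub>R k 1 + (real n * (real n - 1) / 2) *\<^sub>R D"
        by (rule less.IH; use less.prems 4 in simp)+
      have "k i = 3 *\<^sub>R k (n + 2) - 3 *\<^sub>R k (n + 1) + k n" using k3[of n] less.prems 4 by simp
      also have "\<dots> = (3 * real (n + 2) - 3 * real (n + 1) + real n) *\<^sub>R k 1 +
         (3 * (real (n + 2) * (real (n + 2) - 1) / 2) - 3 * (real (n + 1) * (real (n + 1) - 1) / 2) + real n * (real n - 1) / 2) *\<^sub>R D"
        unfolding e scaleR_add_right scaleR_add_left scaleR_diff_left scaleR_scaleR by (simp only: algebra_simps)
      also have "\<dots> = real i *\<^sub>R k 1 + (real i * (real i - 1) / 2) *\<^sub>R D"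
        by (rule arg_cong2[where f="\<lambda>a b. a *\<^sub>R k 1 + b *\<^sub>R D"]) (simp_all add: 4 field_simps)
      finally show ?thesis .
    qed (auto simp: k0 D_def)
  qed
  have kN: "k N = 0" using ka[of N] k0 by simp
  have "k i = 0"
  proof (cases "N = 1")
    case True
    then have "k 1 = 0" using kN by simp
    moreover have "i = 0 \<or> i = 1" using i True by auto
    ultimately show ?thesis using k0 by auto
  next
    case False
    then have N: "N \<ge> 2" using \<open>N \<noteq> 0\<close> by simp
    have e1: "real N *\<^sub>R k 1 + (real N * (real N - 1) / 2) *\<^sub>R D = 0" using q[of N] kN by simp
    have "k 1 = - k (N - 1)" using ka[of 1] N by simp
    moreover have "k (N - 1) = (real N - 1) *\<^sub>R k 1 + ((real N - 1) * (real N - 2) / 2) *\<^sub>R D"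
      using q[of "N - 1"] N by (simp add: of_nat_diff)
    ultimately have "k 1 + ((real N - 1) *\<^sub>R k 1 + ((real N - 1) * (real N - 2) / 2) *\<^sub>R D) = 0" by simp
    then have e2: "real N *\<^sub>R k 1 + ((real N - 1) * (real N - 2) / 2) *\<^sub>R D = 0"
      by (simp add: scaleR_diff_left)
    have "(real N * (real N - 1) / 2 - (real N - 1) * (real N - 2) / 2) *\<^sub>R D =
      (real N *\<^sub>R k 1 + (real N * (real N - 1) / 2) *\<^sub>R D) - (real N *\<^sub>R k 1 + ((real N - 1) * (real N - 2) / 2) *\<^sub>R D)"
      by (simp only: scaleR_diff_left add_diff_cancel_left)
    then have "(real N * (real N - 1) / 2 - (real N - 1) * (real N - 2) / 2) *\<^sub>R D = 0"
      unfolding e1 e2 by simp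
    moreover have "real N * (real N - 1) / 2 - (real N - 1) * (real N - 2) / 2 = real N - 1" by (simp add: field_simps)
    ultimately have D: "D = 0" using N by simp
    then have "k 1 = 0" using e1 N by simp
    then show ?thesis using q[OF i] D by simp
  qed
  then show ?thesis by (simp add: k_def)
qed

text \<open>Comparing the triples \<open>a, b, N - a - b\<close> and \<open>a + b, 0, N - a - b\<close> shows that \<open>g\<close> is affine, up to scaling;
  the triple \<open>0, 0, N\<close> fixes the slope. This is what the Serre relations say about the brackets of \<open>e\<^sub>a\<close>
  with vectors of degree 2.\<close>

lemma affine_system:
  fixes g :: "nat \<Rightarrow> 'v::real_vector"
  assumes s: "\<And>a b c. a + b + c = N \<Longrightarrow> g a + g b + g c = 0" and i: "i \<le> N"
  shows "real N *\<^sub>R g i = (real N - 3 * real i) *\<^sub>R g 0"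
proof -
  define k where "k a = real N *\<^sub>R g a - (real N - 3 * real a) *\<^sub>R g 0" for a
  have k0: "k 0 = 0" by (simp add: k_def)
  have ks: "k a + k b + k c = 0" if "a + b + c = N" for a b c
  proof -
    have "k a + k b + k c = real N *\<^sub>R (g a + g b + g c) - (3 * real N - 3 * (real a + real b + real c)) *\<^sub>R g 0"
      by (simp add: k_def algebra_simps) (simp flip: scaleR_left_distrib)
    moreover have "real a + real b + real c = real N" using that by (metis of_nat_add)
    ultimately show ?thesis using s[OF that] by simp
  qed
  have add: "k (a + b) = k a + k b" if "a + b \<le> N" for a b
  proof -
    have "k a + k b + k (N - (a + b)) = 0" "k (a + b) + k 0 + k (N - (a + b)) = 0" using that by (intro ks; simp)+
    then show ?thesis using k0 by (metis add.right_neutral add_right_cancel)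
  qed
  have lin: "a \<le> N \<Longrightarrow> k a = real a *\<^sub>R k 1" for a
  proof (induction a)
    case (Suc a)
    then show ?case using add[of 1 a] by (simp add: scaleR_add_left)
  qed (simp add: k0)
  have "k N = 0" using ks[of 0 0 N] k0 by simp
  then have "k 1 = 0 \<or> N = 0" using lin[of N] by auto
  then have "k i = 0" using lin[OF i] i k0 by auto
  then show ?thesis by (simp add: k_def)
qed

text \<open>The hypothesis \<open>star\<close> is the Jacobi identity for \<open>e\<^sub>a\<close> and two lower vectors, in which the inner brackets are already
  known; \<open>A j i\<close> is the unknown bracket of degree \<open>j\<close> with degree \<open>l + 1 - j\<close>. The cases \<open>a = 0\<close> and \<open>a = 1\<close> give
  recursions in \<open>i\<close> and \<open>j\<close> which, with antisymmetry and \<open>A 1 0 = 0\<close>, leave only the zero solution.\<close>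

lemma jacobi_system_zero:
  fixes A :: "nat \<Rightarrow> nat \<Rightarrow> 'v::real_vector"
  assumes l: "l \<ge> 3" and N: "N \<ge> 1"
    and star: "\<And>a i k j. a + i + k = N + 1 \<Longrightarrow> 1 \<le> j \<Longrightarrow> j < l \<Longrightarrow>
      (real j * real k - real i * real (l - j)) *\<^sub>R A 1 a =
      (real i - real j * real a) *\<^sub>R A (j + 1) (i + a - 1) + (real k - real (l - j) * real a) *\<^sub>R A j i"
    and anti: "\<And>j i. 1 \<le> j \<Longrightarrow> j \<le> l \<Longrightarrow> i \<le> N \<Longrightarrow> A j i = - A (l + 1 - j) (N - i)"
    and A0: "A 1 0 = 0"
  shows "1 \<le> j \<Longrightarrow> j \<le> l \<Longrightarrow> i \<le> N \<Longrightarrow> A j i = 0"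
proof -
  \<comment> \<open>The case \<open>a = 0\<close>, which is the Jacobi identity with \<open>e\<^sub>0\<close>.\<close>
  have S1: "real (Suc i) *\<^sub>R A (j + 1) i = - ((real N - real i) *\<^sub>R A j (Suc i))" if "i \<le> N" "1 \<le> j" "j < l" for i j
    using star[of 0 "Suc i" "N - i" j] that A0 by (simp add: of_nat_diff eq_neg_iff_add_eq_0)
  have "A (l - 2 + 1) N = 0" using S1[of N "l - 2"] l by simp
  moreover have "l - 2 + 1 = l - 1" using l by simp
  ultimately have "A (l - 1) N = 0" by simp
  then have A20: "A 2 0 = 0" using anti[of 2 0] l by (simp add: Suc_diff_le)
  have A11: "A 1 1 = 0"
  proof -
    have "real (Suc 0) *\<^sub>R A (1 + 1) 0 = - ((real N - real 0) *\<^sub>R A 1 (Suc 0))" using l by (intro S1) auto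
    then show ?thesis using A20 N by (simp add: numeral_2_eq_2)
  qed
  \<comment> \<open>The case \<open>a = 1\<close>, which is the Jacobi identity with \<open>e\<^sub>1\<close>.\<close>
  have S4: "(real i - real j) *\<^sub>R A (j + 1) i + (real N - real i - real (l - j)) *\<^sub>R A j i = 0" if "i \<le> N" "1 \<le> j" "j < l" for i j
    using star[of 1 i "N - i" j] that A11 by (simp add: of_nat_diff)
  have S5: "A 2 t = A 1 t" if t: "1 \<le> t" "t \<le> N" for t
  proof -
    obtain s where s: "t = Suc s" using t by (cases t) auto
    have a: "(real t - 1) *\<^sub>R A 2 t + (real N - real t - (real l - 1)) *\<^sub>R A 1 t = 0"
      using S4[of t 1] t l by (simp add: of_nat_diff numeral_2_eq_2)
    have b: "(real t - 3) *\<^sub>R A 3 s + (real N - real t - real l + 3) *\<^sub>R A 2 s = 0"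
      using S4[of s 2] t l s by (simp add: of_nat_diff numeral_3_eq_3 numeral_2_eq_2 algebra_simps)
    have c: "real t *\<^sub>R A 3 s = - ((real N + 1 - real t) *\<^sub>R A 2 t)"
      using S1[of s 2] t l s by (simp add: numeral_3_eq_3 numeral_2_eq_2 algebra_simps)
    have d: "real t *\<^sub>R A 2 s = - ((real N + 1 - real t) *\<^sub>R A 1 t)"
      using S1[of s 1] t l s by (simp add: numeral_2_eq_2 algebra_simps)
    have "(real t - 3) *\<^sub>R (real t *\<^sub>R A 3 s) + (real N - real t - real l + 3) *\<^sub>R (real t *\<^sub>R A 2 s)
       = real t *\<^sub>R ((real t - 3) *\<^sub>R A 3 s + (real N - real t - real l + 3) *\<^sub>R A 2 s)"
      by (simp add: scaleR_add_right mult.commute)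
    then have X: "(real t - 3) *\<^sub>R (real t *\<^sub>R A 3 s) + (real N - real t - real l + 3) *\<^sub>R (real t *\<^sub>R A 2 s) = 0" using b by simp
    have M: "q *\<^sub>R (\<alpha> *\<^sub>R A 2 t + \<beta> *\<^sub>R A 1 t) = - (\<alpha> *\<^sub>R (- (q *\<^sub>R A 2 t)) + \<beta> *\<^sub>R (- (q *\<^sub>R A 1 t)))" for q \<alpha> \<beta>
      by (simp add: scaleR_add_right mult.commute)
    have "(real N + 1 - real t) *\<^sub>R ((real t - 3) *\<^sub>R A 2 t + (real N - real t - real l + 3) *\<^sub>R A 1 t) = 0"
      unfolding M X[unfolded c d] by simp
    then have e: "(real t - 3) *\<^sub>R A 2 t + (real N - real t - real l + 3) *\<^sub>R A 1 t = 0" using t by simp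
    have G: "(x *\<^sub>R A 2 t + y *\<^sub>R A 1 t) - (x' *\<^sub>R A 2 t + y' *\<^sub>R A 1 t) = (x - x') *\<^sub>R A 2 t + (y - y') *\<^sub>R A 1 t" for x y x' y'
      by (simp add: algebra_simps)
    have "((real t - 1) - (real t - 3)) *\<^sub>R A 2 t + ((real N - real t - (real l - 1)) - (real N - real t - real l + 3)) *\<^sub>R A 1 t = 0"
      using G[of "real t - 1" "real N - real t - (real l - 1)" "real t - 3" "real N - real t - real l + 3"]
      unfolding a e by simp
    then have "2 *\<^sub>R (A 2 t - A 1 t) = 0" by (simp add: scaleR_diff_right)
    then show ?thesis by simp
  qed
  have S6: "A 1 (N - n) = 0" for n
  proof (induction n)
    case 0
    have "real (Suc N) *\<^sub>R A (1 + 1) N = - ((real N - real N) *\<^sub>R A 1 (Suc N))" using l by (intro S1) auto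
    then have "A 2 N = 0" by (simp add: numeral_2_eq_2)
    then show ?case using S5[of N] N by simp
  next
    case (Suc n)
    show ?case
    proof (cases "N - Suc n = 0")
      case True then show ?thesis using A0 by simp
    next
      case False
      then have n: "Suc (N - Suc n) = N - n" by simp
      have "real (Suc (N - Suc n)) *\<^sub>R A (1 + 1) (N - Suc n) = - ((real N - real (N - Suc n)) *\<^sub>R A 1 (Suc (N - Suc n)))"
        using l by (intro S1) auto
      then have "A 2 (N - Suc n) = 0" unfolding n using Suc False by (simp add: numeral_2_eq_2)
      then show ?thesis using S5[of "N - Suc n"] False by simp
    qed
  qed
  show "1 \<le> j \<Longrightarrow> j \<le> l \<Longrightarrow> i \<le> N \<Longrightarrow> A j i = 0" for j i
  proof (induction j arbitrary: i rule: nat_induct_at_least)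
    case base
    then show ?case using S6[of "N - i"] by simp
  next
    case (Suc j)
    have e: "real (Suc i) *\<^sub>R A (j + 1) i = - ((real N - real i) *\<^sub>R A j (Suc i))" using Suc by (intro S1) auto
    have Z: "(real N - real i) *\<^sub>R A j (Suc i) = 0"
    proof (cases "i = N")
      case False then show ?thesis using Suc by simp
    qed simp
    show ?case using e unfolding Z by simp
  qed
qed

text \<open>The expected brackets solve the same linear system, so subtracting them reduces the claim to the
  homogeneous case. For \<open>N = 0\<close>, where the formula would divide by zero, the system itself forces the bracket to vanish.\<close>

lemma jacobi_system:
  fixes A :: "nat \<Rightarrow> nat \<Rightarrow> 'v::real_vector"
  assumes l: "l \<ge> 3"
    and star: "\<And>a i k j. a + i + k = N + 1 \<Longrightarrow> 1 \<le> j \<Longrightarrow> j < l \<Longrightarrow>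
      (real j * real k - real i * real (l - j)) *\<^sub>R A 1 a =
      (real i - real j * real a) *\<^sub>R A (j + 1) (i + a - 1) + (real k - real (l - j) * real a) *\<^sub>R A j i"
    and anti: "\<And>j i. 1 \<le> j \<Longrightarrow> j \<le> l \<Longrightarrow> i \<le> N \<Longrightarrow> A j i = - A (l + 1 - j) (N - i)"
    and ji: "1 \<le> j" "j \<le> l" "i \<le> N"
  shows "A j i = (if N = 0 then 0 else ((real j * real N - real (l + 1) * real i) / real N) *\<^sub>R A 1 0)"
proof (cases "N = 0")
  case True
  have 1: "A j 0 = real j *\<^sub>R A 1 0" if "1 \<le> j" "j < l" for j
    using star[of 0 0 1 j] that True by simp
  have 2: "A 2 0 = - (real (l - 1) *\<^sub>R A 1 0)"
    using star[of 0 1 0 1] l True by (simp add: numeral_2_eq_2 flip: scaleR_minus_left)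
  have "2 *\<^sub>R A 1 0 = - (real (l - 1) *\<^sub>R A 1 0)" using 1[of 2] 2 l by simp
  then have "(2 + real (l - 1)) *\<^sub>R A 1 0 = 0" by (simp add: scaleR_add_left)
  then have z: "A 1 0 = 0" using l by simp
  have "A j 0 = 0" using 1[of j] anti[of j 0] z ji True by (cases "j < l") auto
  then show ?thesis using True ji by simp
next
  case False
  define s where "s j i = (real j * real N - real (l + 1) * real i) / real N" for j i
  define B where "B j i = A j i - s j i *\<^sub>R A 1 0" for j i
  have "B j i = 0"
  proof (rule jacobi_system_zero[OF l, of N])
    show "N \<ge> 1" using False by simp
    show "B 1 0 = 0" using False by (simp add: B_def s_def)
    show "B j i = - B (l + 1 - j) (N - i)" if "1 \<le> j" "j \<le> l" "i \<le> N" for j i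
    proof -
      have "s j i = - s (l + 1 - j) (N - i)"
        using that False by (simp add: s_def of_nat_diff field_simps)
      then show ?thesis using anti[OF that] by (simp add: B_def)
    qed
    fix a i k j assume h: "a + i + k = N + 1" "1 \<le> j" "j < l"
    define m where "m = real (l - j)"
    have lm: "real l = real j + m" using h by (simp add: m_def of_nat_diff)
    have k: "real k = real N + 1 - real a - real i" using h(1) by (metis add.commute add_diff_cancel_left' diff_diff_eq of_nat_1 of_nat_add)
    have N0: "real N \<noteq> 0" using False by simp
    have id: "(real j * real k - real i * m) * s 1 a = (real i - real j * real a) * s (j + 1) (i + a - 1) + (real k - m * real a) * s j i"
    proof (cases "i + a = 0")
      case True
      then show ?thesis using N0 by (simp add: s_def k)
    next
      case F: False
      then have r: "real (i + a - 1) = real i + real a - 1" by (subst of_nat_diff) auto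
      have "(real j * real k - real i * m) * (real 1 * real N - real (l + 1) * real a) =
        (real i - real j * real a) * (real (j + 1) * real N - real (l + 1) * real (i + a - 1))
        + (real k - m * real a) * (real j * real N - real (l + 1) * real i)"
        unfolding r k of_nat_add lm by (simp add: algebra_simps)
      then show ?thesis
        unfolding s_def times_divide_eq_right add_divide_distrib[symmetric] by simp
    qed
    show "(real j * real k - real i * real (l - j)) *\<^sub>R B 1 a =
      (real i - real j * real a) *\<^sub>R B (j + 1) (i + a - 1) + (real k - real (l - j) * real a) *\<^sub>R B j i"
      using star[OF h] arg_cong[OF id, of "\<lambda>c. c *\<^sub>R A 1 0"]
      unfolding B_def m_def by (simp add: scaleR_diff_right scaleR_add_left)
  qed (use ji in auto)
  then show ?thesis using False by (simp add: B_def s_def)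
qed

subsection \<open>Half of the Lie algebra\<close>

text \<open>The relations between the \<open>e\<^sub>i\<close>, or between the \<open>f\<^sub>i\<close>, modulo \<open>h\<close>.\<close>

locale current_half =
  fixes e :: "nat \<Rightarrow> 'r::real_algebra_1"
  assumes cub: "lb (e (i + 3)) (e j) - 3 *\<^sub>R lb (e (i + 2)) (e (j + 1)) + 3 *\<^sub>R lb (e (i + 1)) (e (j + 2)) - lb (e i) (e (j + 3)) = 0"
    and ser: "lb (e i) (lb (e j) (e (k + 1))) + lb (e i) (lb (e k) (e (j + 1))) + lb (e j) (lb (e i) (e (k + 1)))
      + lb (e j) (lb (e k) (e (i + 1))) + lb (e k) (lb (e i) (e (j + 1))) + lb (e k) (lb (e j) (e (i + 1))) = 0"
begin

definition W :: "nat \<Rightarrow> nat \<Rightarrow> 'r" where "W j i = tower e (j - 1) i"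

lemma W_1: "W 1 i = e i" by (simp add: W_def)

lemma W_Suc: "1 \<le> j \<Longrightarrow> W (j + 1) i = (1 / real (i + 1)) *\<^sub>R lb (e 0) (W j (i + 1))"
  by (cases j) (auto simp: W_def)

lemma lb_e0: "1 \<le> j \<Longrightarrow> lb (e 0) (W j (Suc i)) = real (Suc i) *\<^sub>R W (j + 1) i"
  using W_Suc[of j i] by (simp del: of_nat_Suc)

lemma scale_cancel: "real N *\<^sub>R x = real N *\<^sub>R y \<Longrightarrow> N \<noteq> 0 \<Longrightarrow> x = (y :: 'r)"
  by simp

lemma W_bracket_2: "lb (W 1 i) (W 1 k) = (real k - real i) *\<^sub>R W 2 (i + k - 1)"
proof (cases "i + k = 0")
  case True
  then show ?thesis by (simp add: lb_props)
next
  case False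
  define N where "N = i + k"
  have "real N *\<^sub>R lb (e i) (e (N - i)) = (real N - 2 * real i) *\<^sub>R lb (e 0) (e (N - 0))"
  proof (rule quadratic_system[where g="\<lambda>i. lb (e i) (e (N - i))"])
    fix n assume "n + 3 \<le> N"
    then obtain j where "N = n + 3 + j" using le_Suc_ex by blast
    then have "N - (n + 3) = j" "N - (n + 2) = j + 1" "N - (n + 1) = j + 2" "N - n = j + 3" by auto
    then show "lb (e (n + 3)) (e (N - (n + 3))) - 3 *\<^sub>R lb (e (n + 2)) (e (N - (n + 2))) + 3 *\<^sub>R lb (e (n + 1)) (e (N - (n + 1))) - lb (e n) (e (N - n)) = 0"
      using cub by simp
  next
    fix n assume "n \<le> N"
    then show "lb (e n) (e (N - n)) = - lb (e (N - n)) (e (N - (N - n)))"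
      by (simp add: lb_antisym[of "e n"])
  qed (simp add: N_def)
  moreover have "lb (e 0) (e N) = real N *\<^sub>R W 2 (N - 1)"
    using lb_e0[of 1 "N - 1"] False by (simp add: W_1[unfolded One_nat_def] N_def numeral_2_eq_2)
  ultimately have "real N *\<^sub>R lb (e i) (e k) = real N *\<^sub>R ((real N - 2 * real i) *\<^sub>R W 2 (N - 1))"
    by (simp add: N_def mult.commute)
  then have "lb (e i) (e k) = (real N - 2 * real i) *\<^sub>R W 2 (N - 1)"
    by (rule scale_cancel) (use False N_def in simp)
  then show ?thesis by (simp add: N_def W_1[unfolded One_nat_def])
qed

text \<open>In degree 3 the Serre relations are needed: by the brackets in degree 2 each of their six terms is a multiple of some
  \<open>[e\<^sub>a, W 2 (N - a)]\<close>, and they combine to the sum over \<open>a, b, c\<close>.\<close>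

lemma W_bracket_3: "lb (W 1 i) (W 2 k) = (real k - 2 * real i) *\<^sub>R W 3 (i + k - 1)"
proof -
  define N where "N = i + k"
  define g where "g a = lb (e a) (W 2 (N - a))" for a
  have e2: "lb (e q) (e (r + 1)) = (real r + 1 - real q) *\<^sub>R W 2 (q + r)" for q r
    using W_bracket_2[of q "r + 1"] by (simp add: W_1[unfolded One_nat_def] add.commute)
  have s: "g a + g b + g c = 0" if abc: "a + b + c = N" for a b c
  proof -
    have p: "lb (e a) (lb (e b) (e (c + 1))) + lb (e a) (lb (e c) (e (b + 1))) = 2 *\<^sub>R g a" if "a + b + c = N" for a b c
    proof -
      have "N - a = b + c" using that by auto
      then have "lb (e a) (lb (e b) (e (c + 1))) + lb (e a) (lb (e c) (e (b + 1))) = (real c + 1 - real b) *\<^sub>R g a + (real b + 1 - real c) *\<^sub>R g a"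
        unfolding e2 by (simp add: lb_props g_def add.commute)
      also have "\<dots> = ((real c + 1 - real b) + (real b + 1 - real c)) *\<^sub>R g a" by (simp only: scaleR_left_distrib)
      finally show ?thesis by simp
    qed
    have "2 *\<^sub>R g a + 2 *\<^sub>R g b + 2 *\<^sub>R g c = 0"
      using ser[of a b c] p[of a b c] p[of b a c] p[of c a b] abc by (simp add: add_ac)
    then have "2 *\<^sub>R (g a + g b + g c) = 0" by (simp add: scaleR_right_distrib)
    then show ?thesis by simp
  qed
  have g: "real N *\<^sub>R g i = (real N - 3 * real i) *\<^sub>R g 0"
    by (rule affine_system[OF s]) (simp_all add: N_def)
  show ?thesis
  proof (cases "N = 0")
    case True
    have "g 0 = 0"
    proof -
      have "3 *\<^sub>R g 0 = g 0 + g 0 + g 0" 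
      proof -
        have "3 *\<^sub>R g 0 = (1 + 1 + 1) *\<^sub>R g 0" by simp
        then show ?thesis by (simp only: scaleR_left_distrib scaleR_one)
      qed
      then show ?thesis using s[of 0 0 0] True by simp
    qed
    then show ?thesis using True by (simp add: N_def g_def W_1[unfolded One_nat_def])
  next
    case False
    have "g 0 = real N *\<^sub>R W 3 (N - 1)"
      using lb_e0[of 2 "N - 1"] False by (simp add: g_def numeral_3_eq_3)
    then have "real N *\<^sub>R g i = real N *\<^sub>R ((real N - 3 * real i) *\<^sub>R W 3 (N - 1))"
      using g by (simp add: mult.commute)
    then have "g i = (real N - 3 * real i) *\<^sub>R W 3 (N - 1)"
      by (rule scale_cancel) (rule False)
    then show ?thesis by (simp add: g_def N_def W_1[unfolded One_nat_def])
  qed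
qed

text \<open>Induction on the total degree. Degree 2 comes from the cubic difference relations, degree 3 from the Serre
  relations; from degree 4 on, the Jacobi identities alone determine the bracket. The truncated index
  \<open>i + k - 1\<close> is harmless since the coefficient vanishes for \<open>i = k = 0\<close>.\<close>

theorem W_bracket:
  "1 \<le> j \<Longrightarrow> 1 \<le> m \<Longrightarrow> lb (W j i) (W m k) = (real j * real k - real i * real m) *\<^sub>R W (j + m) (i + k - 1)"
proof (induction "j + m" arbitrary: i j k m rule: less_induct)
  case less
  have IH: "lb (W j' i') (W m' k') = (real j' * real k' - real i' * real m') *\<^sub>R W (j' + m') (i' + k' - 1)"
    if "1 \<le> j'" "1 \<le> m'" "j' + m' < j + m" for i' j' k' m'
    using less(1) that by blast
  consider "j = 1" "m = 1" | "j = 1" "m = 2" | "j = 2" "m = 1" | "4 \<le> j + m"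
    using less.prems by linarith
  then show ?case
  proof cases
    case 1
    then show ?thesis using W_bracket_2[of i k] by (simp add: numeral_2_eq_2)
  next
    case 2
    then show ?thesis using W_bracket_3[of i k] by (simp add: mult.commute numeral_3_eq_3)
  next
    case 3
    have "lb (W 2 i) (W 1 k) = - lb (W 1 k) (W 2 i)" by (rule lb_antisym)
    also have "\<dots> = (2 * real k - real i) *\<^sub>R W 3 (k + i - 1)"
      unfolding W_bracket_3 by (simp flip: scaleR_minus_left)
    finally show ?thesis using 3 by (simp add: add.commute numeral_3_eq_3)
  next
    case 4
    define l where "l = j + m - 1"
    have l: "l \<ge> 3" "j + m = l + 1" using 4 by (auto simp: l_def)
    define N where "N = i + k"
    define A where "A j i = lb (W j i) (W (l + 1 - j) (N - i))" for j i
    have "A j i = (if N = 0 then 0 else ((real j * real N - real (l + 1) * real i) / real N) *\<^sub>R A 1 0)"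
    proof (rule jacobi_system[OF l(1)])
      show "1 \<le> j" "j \<le> l" "i \<le> N" using less.prems l by (auto simp: N_def)
      fix j i assume "1 \<le> j" "j \<le> l" "i \<le> N"
      then have "l + 1 - (l + 1 - j) = j" "N - (N - i) = i" by auto
      then show "A j i = - A (l + 1 - j) (N - i)"
        unfolding A_def using lb_antisym[of "W j i"] by simp
    next
      fix a i k j assume h: "a + i + k = N + 1" "1 \<le> j" "j < l"
      define m where "m = l - j"
      have m: "1 \<le> m" "j + m = l" using h by (auto simp: m_def)
      have jac: "lb (W 1 a) (lb (W j i) (W m k)) = lb (lb (W 1 a) (W j i)) (W m k) + lb (W j i) (lb (W 1 a) (W m k))"
        by (rule lb_jacobi)
      have 1: "lb (W 1 a) (lb (W j i) (W m k)) = (real j * real k - real i * real m) *\<^sub>R A 1 a"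
      proof (cases "i + k = 0")
        case True
        then have "lb (W j i) (W m k) = 0" using IH[of j m i k] m h l by simp
        then show ?thesis using True by (simp add: lb_props)
      next
        case False
        then have "N - a = i + k - 1" using h by auto
        then show ?thesis using IH[of j m i k] m h l by (simp add: lb_props A_def)
      qed
      have 2: "lb (lb (W 1 a) (W j i)) (W m k) = (real i - real j * real a) *\<^sub>R A (j + 1) (i + a - 1)"
      proof (cases "i + a = 0")
        case True
        then have "lb (W 1 a) (W j i) = 0" using IH[of 1 j a i] m h l by simp
        then show ?thesis using True by (simp add: lb_props)
      next
        case False
        then have "N - (i + a - 1) = k" "l + 1 - (j + 1) = m" using h m by auto
        then show ?thesis using IH[of 1 j a i] m h l by (simp add: lb_props A_def add.commute mult.commute)
      qed
      have 3: "lb (W j i) (lb (W 1 a) (W m k)) = (real k - real m * real a) *\<^sub>R A j i"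
      proof (cases "k + a = 0")
        case True
        then have "lb (W 1 a) (W m k) = 0" using IH[of 1 m a k] m h l by simp
        then show ?thesis using True by (simp add: lb_props)
      next
        case False
        then have "N - i = a + k - 1" "l + 1 - j = 1 + m" using h m by auto
        then show ?thesis using IH[of 1 m a k] m h l by (simp add: lb_props A_def add.commute mult.commute)
      qed
      show "(real j * real k - real i * real (l - j)) *\<^sub>R A 1 a =
        (real i - real j * real a) *\<^sub>R A (j + 1) (i + a - 1) + (real k - real (l - j) * real a) *\<^sub>R A j i"
        using jac unfolding 1 2 3 m_def[symmetric] .
    qed
    moreover have "A 1 0 = real N *\<^sub>R W (l + 1) (N - 1)" if "N \<noteq> 0"
      using lb_e0[of l "N - 1"] that l by (simp add: A_def W_1[unfolded One_nat_def])
    moreover have "A j i = lb (W j i) (W m k)"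
    proof -
      have "l + 1 - j = m" using l by simp
      then show ?thesis by (simp add: A_def N_def)
    qed
    moreover have "real j * real N - real (l + 1) * real i = real j * real k - real i * real m"
      unfolding l(2)[symmetric] N_def by (simp add: algebra_simps)
    ultimately show ?thesis using l by (cases "N = 0") (auto simp: N_def)
  qed
qed

end

subsection \<open>Both halves\<close>

text \<open>The relations of the Yangian modulo \<open>h\<close>, with the centrality of \<open>p\<close> already extracted from the cubic relations.\<close>

locale current_algebra =
  fixes e f p :: "nat \<Rightarrow> 'r::real_algebra_1"
  assumes ee: "current_half e" and ff: "current_half f"
    and ef: "lb (e i) (f j) = p (i + j)" and pp: "lb (p i) (p j) = 0"
    and pe: "lb (p i) (e j) = 0" and pf: "lb (p i) (f j) = 0"
begin

sublocale P: current_half e by (rule ee)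
sublocale M: current_half f by (rule ff)

lemma p_P: "1 \<le> j \<Longrightarrow> lb (p i) (P.W j k) = 0"
proof (induction j arbitrary: k rule: nat_induct_at_least)
  case base then show ?case by (simp add: P.W_1[unfolded One_nat_def] pe)
next
  case (Suc j)
  then show ?case using lb_jacobi[of "p i" "e 0" "P.W j (k + 1)"] P.W_Suc[of j k] by (simp add: lb_props pe)
qed

lemma p_M: "1 \<le> j \<Longrightarrow> lb (p i) (M.W j k) = 0"
proof (induction j arbitrary: k rule: nat_induct_at_least)
  case base then show ?case by (simp add: M.W_1[unfolded One_nat_def] pf)
next
  case (Suc j)
  then show ?case using lb_jacobi[of "p i" "f 0" "M.W j (k + 1)"] M.W_Suc[of j k] by (simp add: lb_props pf)
qed

lemma e_M: "2 \<le> m \<Longrightarrow> lb (e i) (M.W m k) = 0"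
proof (induction m arbitrary: k rule: nat_induct_at_least)
  case base
  then show ?case
    using lb_jacobi[of "e i" "f 0" "f (k + 1)"] M.W_Suc[of 1 k] lb_antisym[of "f 0" "p (i + (k + 1))"]
    by (simp add: lb_props ef pf M.W_1[unfolded One_nat_def] numeral_2_eq_2)
next
  case (Suc m)
  then show ?case
    using lb_jacobi[of "e i" "f 0" "M.W m (k + 1)"] M.W_Suc[of m k] by (simp add: lb_props ef p_M)
qed

text \<open>The bracket \<open>[e\<^sub>i, f\<^sub>j]\<close> is central, so one more commutator with an \<open>e\<close> or \<open>f\<close> vanishes; this propagates along the
  towers by the Jacobi identity.\<close>

lemma P_M: "1 \<le> j \<Longrightarrow> 1 \<le> m \<Longrightarrow> \<not> (j = 1 \<and> m = 1) \<Longrightarrow> lb (P.W j i) (M.W m k) = 0"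
proof (induction j arbitrary: i rule: nat_induct_at_least)
  case base
  then show ?case using e_M[of m i k] by (simp add: P.W_1[unfolded One_nat_def])
next
  case (Suc j)
  have c: "lb (e 0) (lb (P.W j (i + 1)) (M.W m k)) = 0"
  proof (cases "j = 1 \<and> m = 1")
    case True
    then have "lb (P.W j (i + 1)) (M.W m k) = p (i + 1 + k)"
      by (simp add: P.W_1[unfolded One_nat_def] M.W_1[unfolded One_nat_def] ef)
    then show ?thesis using lb_antisym[of "e 0" "p (i + 1 + k)"] by (simp add: pe)
  next
    case False then show ?thesis using Suc by (simp add: lb_props)
  qed
  have d: "lb (P.W j (i + 1)) (lb (e 0) (M.W m k)) = 0"
  proof (cases "m = 1")
    case True
    then have "lb (e 0) (M.W m k) = p k" by (simp add: M.W_1[unfolded One_nat_def] ef)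
    then show ?thesis using lb_antisym[of "P.W j (i + 1)" "p k"] Suc by (simp add: p_P)
  next
    case False then show ?thesis using e_M[of m 0 k] Suc by (simp add: lb_props)
  qed
  have "lb (lb (e 0) (P.W j (i + 1))) (M.W m k) = 0"
    using lb_jacobi[of "e 0" "P.W j (i + 1)" "M.W m k"] c d by simp
  then show ?case using P.W_Suc[of j i] Suc by (simp add: lb_props)
qed

text \<open>Indexed like the basis of \<open>Dbar0\<close>; signs and factors are those of the elements that the homomorphism maps to
  \<open>basis_elt b\<close>. For instance \<open>\<psi>\<^sub>i\<^sub>+\<^sub>1 \<mapsto> (x - h)\<^sup>i\<^sup>+\<^sup>1 - x\<^sup>i\<^sup>+\<^sup>1 + \<dots>\<close> has leading term \<open>- (i + 1) h x\<^sup>i\<close>.\<close>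

definition cur_basis :: "bas \<Rightarrow> 'r" where
  "cur_basis b = (case b of None \<Rightarrow> - p 0 | Some (r, i) \<Rightarrow>
     if r = 0 then - ((1 / real (i + 1)) *\<^sub>R p (i + 1)) else if r > 0 then P.W (nat r) i else - M.W (nat (- r)) i)"

lemma p_cur_basis: "\<exists>c d. p n = c *\<^sub>R cur_basis d"
proof (cases n)
  case 0
  then have "p n = (- 1) *\<^sub>R cur_basis None" by (simp add: cur_basis_def)
  then show ?thesis by blast
next
  case (Suc i)
  have "(- c) *\<^sub>R (- ((1 / c) *\<^sub>R x)) = x" if "c \<noteq> 0" for c and x :: 'r using that by simp
  from this[of "real (i + 1)" "p (i + 1)"]
  have "p n = (- real (i + 1)) *\<^sub>R cur_basis (Some (0, i))" unfolding Suc by (simp add: cur_basis_def)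
  then show ?thesis by blast
qed

lemma e_cur_basis: "e i = 1 *\<^sub>R cur_basis (Some (1, i))" and f_cur_basis: "f i = (- 1) *\<^sub>R cur_basis (Some (- 1, i))"
  by (simp_all add: cur_basis_def P.W_1[unfolded One_nat_def] M.W_1[unfolded One_nat_def])

lemma cur_basis_cases:
  obtains (c) c n where "cur_basis b = c *\<^sub>R p n"
    | (P) j i where "1 \<le> j" "cur_basis b = P.W j i" "b = Some (int j, i)"
    | (M) j i where "1 \<le> j" "cur_basis b = - M.W j i" "b = Some (- int j, i)"
proof (cases b)
  case None
  then show ?thesis using c[of "- 1" 0] by (simp add: cur_basis_def)
next
  case (Some x)
  then obtain r i where b: "b = Some (r, i)" by (cases x) auto
  consider "r = 0" | "r > 0" | "r < 0" by linarith
  then show ?thesis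
  proof cases
    case 1
    then show ?thesis using c[of "- (1 / real (i + 1))" "i + 1"] b by (simp add: cur_basis_def)
  next
    case 2
    then show ?thesis using P[of "nat r" i] b by (simp add: cur_basis_def)
  next
    case 3
    then show ?thesis using M[of "nat (- r)" i] b by (simp add: cur_basis_def)
  qed
qed

text \<open>Stated in the form that sorting of words requires: a commutator of two basis vectors is a
  multiple of a single one.\<close>

lemma cur_basis_bracket: "\<exists>c d. lb (cur_basis a) (cur_basis b) = c *\<^sub>R cur_basis d"
proof -
  have z: "x = 0 \<Longrightarrow> \<exists>c d. x = c *\<^sub>R cur_basis d" for x by (rule exI[of _ 0]) simp
  have W_cur_basis: "P.W j i = 1 *\<^sub>R cur_basis (Some (int j, i))" "M.W j i = (- 1) *\<^sub>R cur_basis (Some (- int j, i))" if "1 \<le> j" for j i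
    using that by (simp_all add: cur_basis_def)
  have cur_word: "lb (p n) (cur_basis b) = 0" for n b
    by (cases b rule: cur_basis_cases) (simp_all add: lb_props pp p_P p_M)
  show ?thesis
  proof (cases a rule: cur_basis_cases)
    case (c c n)
    then show ?thesis by (intro z) (simp add: lb_props cur_word)
  next
    case a: (P j i)
    show ?thesis
    proof (cases b rule: cur_basis_cases)
      case (c c n)
      then show ?thesis using lb_antisym[of "cur_basis a" "p n"] by (intro z) (simp add: lb_props cur_word)
    next
      case b: (P m k)
      have "lb (cur_basis a) (cur_basis b) = (real j * real k - real i * real m) *\<^sub>R P.W (j + m) (i + k - 1)"
        unfolding a(2) b(2) by (rule P.W_bracket[OF a(1) b(1)])
      moreover have "P.W (j + m) (i + k - 1) = cur_basis (Some (int (j + m), i + k - 1))" using W_cur_basis(1)[of "j + m" "i + k - 1"] a by simp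
      ultimately show ?thesis by metis
    next
      case b: (M m k)
      show ?thesis
      proof (cases "j = 1 \<and> m = 1")
        case True
        then have "lb (cur_basis a) (cur_basis b) = - p (i + k)"
          by (simp add: a(2) b(2) lb_props P.W_1[unfolded One_nat_def] M.W_1[unfolded One_nat_def] ef)
        then show ?thesis using p_cur_basis[of "i + k"] by (metis scaleR_minus_left)
      next
        case False
        then show ?thesis by (intro z) (simp add: a(2) b(2) lb_props P_M[OF a(1) b(1)])
      qed
    qed
  next
    case a: (M j i)
    show ?thesis
    proof (cases b rule: cur_basis_cases)
      case (c c n)
      then show ?thesis using lb_antisym[of "cur_basis a" "p n"] by (intro z) (simp add: lb_props cur_word)
    next
      case b: (P m k)
      show ?thesis
      proof (cases "m = 1 \<and> j = 1")
        case True
        then have "lb (cur_basis a) (cur_basis b) = p (k + i)"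
          using lb_antisym[of "f i" "e k"] by (simp add: a(2) b(2) lb_props P.W_1[unfolded One_nat_def] M.W_1[unfolded One_nat_def] ef)
        then show ?thesis using p_cur_basis[of "k + i"] by simp
      next
        case False
        then show ?thesis using lb_antisym[of "M.W j i" "P.W m k"]
          by (intro z) (simp add: a(2) b(2) lb_props P_M[OF b(1) a(1)])
      qed
    next
      case b: (M m k)
      have "lb (cur_basis a) (cur_basis b) = (real j * real k - real i * real m) *\<^sub>R M.W (j + m) (i + k - 1)"
        unfolding a(2) b(2) by (simp add: lb_props M.W_bracket[OF a(1) b(1)])
      moreover have "M.W (j + m) (i + k - 1) = (- 1) *\<^sub>R cur_basis (Some (- int (j + m), i + k - 1))" using W_cur_basis(2)[of "j + m" "i + k - 1"] a by simp
      ultimately have "lb (cur_basis a) (cur_basis b) = ((real j * real k - real i * real m) * - 1) *\<^sub>R cur_basis (Some (- int (j + m), i + k - 1))"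
        by (simp only: scaleR_scaleR)
      then show ?thesis by blast
    qed
  qed
qed

subsection \<open>Ordered words span\<close>

definition cur_word :: "bas list \<Rightarrow> 'r" where "cur_word s = prod_list (map cur_basis s)"

lemma cur_word_append: "cur_word (u @ v) = cur_word u * cur_word v" by (simp add: cur_word_def)

text \<open>The spanning half of the Poincare-Birkhoff-Witt theorem: swapping a descent lowers the number of inversions,
  and the commutator is a shorter word.\<close>

lemma cur_word_sorted_span: "cur_word s \<in> span (cur_word ` {s. sorted s})"
proof (induction s rule: wf_induct_rule[OF wf_measures[of "[length, inversions]"]])
  case (1 s)
  show ?case
  proof (cases "desc s")
    case None
    then show ?thesis by (intro span_base imageI CollectI desc_NoneD)
  next
    case (Some x)
    then obtain u a b v where d: "desc s = Some (u, a, b, v)" by (cases x) auto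
    have s: "s = u @ a # b # v" "b < a" using desc_SomeD[OF d] by auto
    obtain c d where cd: "lb (cur_basis a) (cur_basis b) = c *\<^sub>R cur_basis d" using cur_basis_bracket by blast
    have "cur_basis a * cur_basis b = cur_basis b * cur_basis a + c *\<^sub>R cur_basis d" using cd by (simp add: lb_def algebra_simps)
    moreover have "cur_word s = cur_word u * (cur_basis a * cur_basis b) * cur_word v"
      by (simp add: s cur_word_append) (simp add: cur_word_def mult.assoc)
    ultimately have "cur_word s = cur_word u * (cur_basis b * cur_basis a + c *\<^sub>R cur_basis d) * cur_word v" by simp
    also have "\<dots> = cur_word (u @ b # a # v) + c *\<^sub>R cur_word (u @ d # v)"
      by (simp add: cur_word_append) (simp add: cur_word_def algebra_simps)
    finally have e: "cur_word s = cur_word (u @ b # a # v) + c *\<^sub>R cur_word (u @ d # v)" .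
    have "cur_word (u @ b # a # v) \<in> span (cur_word ` {s. sorted s})"
      by (rule 1) (simp add: s inversions_swap)
    moreover have "cur_word (u @ d # v) \<in> span (cur_word ` {s. sorted s})"
      by (rule 1) (simp add: s)
    ultimately show ?thesis unfolding e by (intro span_add span_scale)
  qed
qed

end

section \<open>Coordinates on the affine Yangian\<close>

interpretation Y: presentation "UNIV :: ygen set" Y_rels
  rewrites "pres_alg UNIV Y_rels = Y_alg"
proof -
  show "presentation (UNIV :: ygen set) Y_rels"
    unfolding presentation_def by (rule Y_rels_carrier)
qed (simp add: Y_alg_def)

text \<open>The coefficient of the sorted word \<open>s\<close> in the normal ordering of a word.\<close>

definition nu :: "bas list \<Rightarrow> bas list \<Rightarrow> scal" where
  "nu s = normal_order br (\<lambda>w. if w = s then 1 else 0)"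

lemma nu_sorted: "sorted w \<Longrightarrow> nu s w = (if w = s then 1 else 0)"
  by (simp add: nu_def B.normal_order_sorted)

lemma nu_kills: "a \<in> U.Iz \<Longrightarrow> lin (multi_ext (nu s)) a = 0"
  by (rule multi_ext_kills) (simp_all add: nu_def B.normal_order_swap)

text \<open>The coefficient of the sorted word \<open>s\<close> in the image in \<open>U(Dbar)\<close>.\<close>

definition pbw_coord :: "bas list \<Rightarrow> (ygen list \<Rightarrow> scal) \<Rightarrow> scal" where
  "pbw_coord s a = lin (multi_ext (nu s)) (push img a)"

lemma push_img_closed: "a \<in> carrier AY \<Longrightarrow> push img a \<in> carrier (cfree (carrier Dbar0))"
  using alg_hom_closed[OF push_alg_hom[of img UNIV "carrier Dbar0"]] img_Dbar0 by auto

lemma push_linear: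
  assumes "null a" "null b"
  shows "push u (\<lambda>w. a w + b w) = (\<lambda>w. push u a w + push u b w)"
    "push u (\<lambda>w. a w - b w) = (\<lambda>w. push u a w - push u b w)"
    "push u (\<lambda>w. c * a w) = (\<lambda>w. c * push u a w)"
  by (simp_all add: push_def lin_add lin_diff lin_smult assms)

lemma pbw_coord_linear:
  assumes "a \<in> carrier AY" "b \<in> carrier AY"
  shows "pbw_coord s (\<lambda>w. a w + b w) = pbw_coord s a + pbw_coord s b" "pbw_coord s (\<lambda>w. a w - b w) = pbw_coord s a - pbw_coord s b"
    "pbw_coord s (\<lambda>w. c * a w) = c * pbw_coord s a"
  using carrier_cfreeD[OF assms(1)] carrier_cfreeD[OF assms(2)]
  by (simp_all add: pbw_coord_def push_linear lin_add lin_diff lin_smult null_push)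

lemma theta_free_zero_iff: "a \<in> carrier AY \<Longrightarrow> theta_free a = \<zero>\<^bsub>UA\<^esub> \<longleftrightarrow> push img a \<in> U0.Iz"
  using U0.cl_ops(5)[OF cfree_closed(5) cfree_closed(5)] U0.cl_eq_iff[OF push_img_closed cfree_closed(5), of a]
  by (simp add: theta_free_def)

lemma theta_free_Iz: "a \<in> Y.Iz \<Longrightarrow> theta_free a = \<zero>\<^bsub>UA\<^esub>"
  by (rule Y.kernel_kills[OF U0.Q_sep_alg theta_free_hom theta_free_rels])

lemma pbw_coord_Iz: assumes "a \<in> Y.Iz" shows "pbw_coord s a = 0"
proof -
  have "push img a \<in> U0.Iz" using theta_free_Iz[OF assms] theta_free_zero_iff[OF Y.Iz_carrier[OF assms]] by simp
  then show ?thesis unfolding pbw_coord_def by (rule nu_kills[OF U0_Iz_sub])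
qed

section \<open>Reduction modulo h\<close>

text \<open>That the class of \<open>a\<close> in the Yangian is a multiple of \<open>h\<close>.\<close>

definition zero_mod_h :: "(ygen list \<Rightarrow> scal) \<Rightarrow> bool" where
  "zero_mod_h a \<longleftrightarrow> (\<exists>i\<in>Y.Iz. \<exists>d\<in>carrier AY. a = (\<lambda>w. i w + hh * d w))"

lemma zero_mod_h_I: "i \<in> Y.Iz \<Longrightarrow> d \<in> carrier AY \<Longrightarrow> zero_mod_h (\<lambda>w. i w + hh * d w)"
  by (auto simp: zero_mod_h_def)

lemma zero_mod_h_Iz: "i \<in> Y.Iz \<Longrightarrow> zero_mod_h i"
  using zero_mod_h_I[of i "\<lambda>w. 0"] by (simp add: cfree_closed)

lemma zero_mod_h_hh: "d \<in> carrier AY \<Longrightarrow> zero_mod_h (\<lambda>w. hh * d w)"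
  using zero_mod_h_I[OF Y.Iz_ops(1), of d] by simp

lemma zero_mod_h_add: assumes "zero_mod_h a" "zero_mod_h b" shows "zero_mod_h (\<lambda>w. a w + b w)"
proof -
  obtain i d j e where a: "i \<in> Y.Iz" "d \<in> carrier AY" "a = (\<lambda>w. i w + hh * d w)"
    and b: "j \<in> Y.Iz" "e \<in> carrier AY" "b = (\<lambda>w. j w + hh * e w)" using assms by (auto simp: zero_mod_h_def)
  have "zero_mod_h (\<lambda>w. (i w + j w) + hh * (d w + e w))"
    by (rule zero_mod_h_I) (use a b in \<open>auto intro: Y.Iz_ops cfree_closed\<close>)
  then show ?thesis by (simp add: a b algebra_simps)
qed

lemma zero_mod_h_smult: assumes "zero_mod_h a" shows "zero_mod_h (\<lambda>w. c * a w)"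
proof -
  obtain i d where a: "i \<in> Y.Iz" "d \<in> carrier AY" "a = (\<lambda>w. i w + hh * d w)" using assms by (auto simp: zero_mod_h_def)
  have "zero_mod_h (\<lambda>w. c * i w + hh * (c * d w))"
    by (rule zero_mod_h_I) (use a in \<open>auto intro: Y.Iz_ops cfree_closed\<close>)
  then show ?thesis by (simp add: a algebra_simps)
qed

lemma zero_mod_h_diff: assumes "zero_mod_h a" "zero_mod_h b" shows "zero_mod_h (\<lambda>w. a w - b w)"
  using zero_mod_h_add[OF assms(1) zero_mod_h_smult[OF assms(2), of "- 1"]] by simp

lemma zero_mod_h_cmul: assumes "zero_mod_h a" "x \<in> carrier AY" shows "zero_mod_h (cmul a x)" "zero_mod_h (cmul x a)"
proof -
  obtain i d where a: "i \<in> Y.Iz" "d \<in> carrier AY" "a = (\<lambda>w. i w + hh * d w)" using assms by (auto simp: zero_mod_h_def)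
  show "zero_mod_h (cmul a x)" unfolding a cmul_add_left cmul_smult_left
    by (rule zero_mod_h_I) (use a assms in \<open>auto intro: Y.Iz_ops cmul_closed\<close>)
  show "zero_mod_h (cmul x a)" unfolding a cmul_add_right cmul_smult_right
    by (rule zero_mod_h_I) (use a assms in \<open>auto intro: Y.Iz_ops cmul_closed\<close>)
qed

text \<open>The reduction modulo \<open>h\<close> is not the zero ring: the functional \<open>pbw_coord []\<close> takes the value \<open>1\<close> on the unit, but
  values divisible by \<open>h\<close> on all elements that vanish modulo \<open>h\<close>.\<close>

lemma zero_mod_h_one: "\<not> zero_mod_h (word [])"
proof
  assume "zero_mod_h (word [])"
  then obtain i d where a: "i \<in> Y.Iz" "d \<in> carrier AY" "word [] = (\<lambda>w. i w + hh * d w)" by (auto simp: zero_mod_h_def)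
  have "pbw_coord [] (word []) = 1" by (simp add: pbw_coord_def push_word nu_sorted)
  moreover have "pbw_coord [] (word []) = hh * pbw_coord [] d"
    unfolding a(3) using a by (simp add: pbw_coord_linear(1,3) Y.Iz_carrier cfree_closed pbw_coord_Iz pbw_coord_linear(3)[OF a(2) a(2)])
  ultimately have "fps_nth 1 0 = fps_nth (hh * pbw_coord [] d) 0" by simp
  then show False by simp
qed

definition yrel :: "(ygen list \<Rightarrow> scal) \<Rightarrow> (ygen list \<Rightarrow> scal) \<Rightarrow> bool" where
  "yrel a b \<longleftrightarrow> a \<in> carrier AY \<and> b \<in> carrier AY \<and> zero_mod_h (\<lambda>w. a w - b w)"

lemma yrel_refl: "a \<in> carrier AY \<Longrightarrow> yrel a a"
  using zero_mod_h_Iz[OF Y.Iz_ops(1)] by (simp add: yrel_def)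

lemma yrel_eqI: "a = b \<Longrightarrow> a \<in> carrier AY \<Longrightarrow> yrel a b"
  by (simp add: yrel_refl)

lemma yrel_carrier: "yrel a b \<Longrightarrow> a \<in> carrier AY" "yrel a b \<Longrightarrow> b \<in> carrier AY"
  by (auto simp: yrel_def)

text \<open>The algebra \<open>Y/hY\<close> as a type of its own, so that the computations with brackets can use type class
  arithmetic. Real scalars suffice there, as all structure constants are real; the complex scalars
  return through \<open>kap\<close>.\<close>

quotient_type ymod = "ygen list \<Rightarrow> scal" / partial: yrel
proof (rule part_equivpI)
  show "\<exists>x. yrel x x" using yrel_refl[OF cfree_closed(5)] by blast
  show "symp yrel"
  proof (rule sympI)
    fix a b assume "yrel a b"
    then show "yrel b a" using zero_mod_h_smult[of "\<lambda>w. a w - b w" "- 1"] by (simp add: yrel_def)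
  qed
  show "transp yrel"
  proof (rule transpI)
    fix a b c assume "yrel a b" "yrel b c"
    then show "yrel a c" using zero_mod_h_add[of "\<lambda>w. a w - b w" "\<lambda>w. b w - c w"] by (simp add: yrel_def)
  qed
qed

lemma yrel_add: "yrel a a' \<Longrightarrow> yrel b b' \<Longrightarrow> yrel (\<lambda>w. a w + b w) (\<lambda>w. a' w + b' w)"
  using zero_mod_h_add[of "\<lambda>w. a w - a' w" "\<lambda>w. b w - b' w"] by (simp add: yrel_def cfree_closed algebra_simps)

lemma yrel_diff: "yrel a a' \<Longrightarrow> yrel b b' \<Longrightarrow> yrel (\<lambda>w. a w - b w) (\<lambda>w. a' w - b' w)"
  using zero_mod_h_diff[of "\<lambda>w. a w - a' w" "\<lambda>w. b w - b' w"] by (simp add: yrel_def cfree_closed algebra_simps)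

lemma yrel_smult: "yrel a a' \<Longrightarrow> yrel (\<lambda>w. c * a w) (\<lambda>w. c * a' w)"
  using zero_mod_h_smult[of "\<lambda>w. a w - a' w" c] by (simp add: yrel_def cfree_closed algebra_simps)

lemma yrel_cmul: assumes "yrel a a'" "yrel b b'" shows "yrel (cmul a b) (cmul a' b')"
proof -
  have c: "a \<in> carrier AY" "a' \<in> carrier AY" "b \<in> carrier AY" "b' \<in> carrier AY"
    and J: "zero_mod_h (\<lambda>w. a w - a' w)" "zero_mod_h (\<lambda>w. b w - b' w)" using assms by (auto simp: yrel_def)
  have "zero_mod_h (\<lambda>w. cmul (\<lambda>w. a w - a' w) b w + cmul a' (\<lambda>w. b w - b' w) w)"
    by (rule zero_mod_h_add[OF zero_mod_h_cmul(1)[OF J(1) c(3)] zero_mod_h_cmul(2)[OF J(2) c(2)]])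
  then show ?thesis using c by (simp add: yrel_def cmul_closed cmul_diff_left cmul_diff_right)
qed

lemma word_AY: "word w \<in> carrier AY" by (rule word_closed_UNIV)

instantiation ymod :: real_algebra_1
begin

lift_definition zero_ymod :: ymod is "\<lambda>w. 0" by (rule yrel_refl[OF cfree_closed(5)])
lift_definition one_ymod :: ymod is "word []" by (rule yrel_refl[OF word_AY])
lift_definition plus_ymod :: "ymod \<Rightarrow> ymod \<Rightarrow> ymod" is "\<lambda>a b w. a w + b w" by (rule yrel_add)
lift_definition minus_ymod :: "ymod \<Rightarrow> ymod \<Rightarrow> ymod" is "\<lambda>a b w. a w - b w" by (rule yrel_diff)
lift_definition uminus_ymod :: "ymod \<Rightarrow> ymod" is "\<lambda>a w. (- 1) * a w" by (rule yrel_smult)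
lift_definition times_ymod :: "ymod \<Rightarrow> ymod \<Rightarrow> ymod" is cmul by (rule yrel_cmul)
lift_definition scaleR_ymod :: "real \<Rightarrow> ymod \<Rightarrow> ymod" is "\<lambda>r a w. fps_const (of_real r) * a w" by (rule yrel_smult)

instance
proof
  fix a b c :: ymod and r s :: real
  note intros = cfree_closed cmul_closed word_AY
  show "a + b + c = a + (b + c)"
    by (transfer, rule yrel_eqI) (auto simp: add.assoc dest: yrel_carrier intro!: intros)
  show "a + b = b + a"
    by (transfer, rule yrel_eqI) (auto simp: add.commute dest: yrel_carrier intro!: intros)
  show "0 + a = a"
    by (transfer, rule yrel_eqI) (auto dest: yrel_carrier)
  show "- a + a = 0"
    by (transfer, rule yrel_eqI) (auto dest: yrel_carrier intro!: intros)
  show "a - b = a + - b"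
    by (transfer, rule yrel_eqI) (auto dest: yrel_carrier intro!: intros)
  show "a * b * c = a * (b * c)"
    by (transfer, rule yrel_eqI) (auto intro!: cmul_assoc intros dest: yrel_carrier carrier_cfreeD)
  show "1 * a = a"
    by (transfer, rule yrel_eqI) (auto simp: cmul_one_left dest: yrel_carrier)
  show "a * 1 = a"
    by (transfer, rule yrel_eqI) (auto simp: cmul_one_right dest: yrel_carrier)
  show "(a + b) * c = a * c + b * c"
    by (transfer, rule yrel_eqI) (auto simp: cmul_add_left dest: yrel_carrier intro!: intros)
  show "a * (b + c) = a * b + a * c"
    by (transfer, rule yrel_eqI) (auto simp: cmul_add_right dest: yrel_carrier intro!: intros)
  show "(0 :: ymod) \<noteq> 1"
  proof
    assume "(0 :: ymod) = 1"
    then have "yrel (\<lambda>w. 0) (word [])" by transfer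
    then have "zero_mod_h (\<lambda>w. 0 - word [] w)" by (simp add: yrel_def)
    then show False using zero_mod_h_smult[of "\<lambda>w. 0 - word [] w" "- 1"] zero_mod_h_one by simp
  qed
  show "r *\<^sub>R (a + b) = r *\<^sub>R a + r *\<^sub>R b"
    by (transfer, rule yrel_eqI) (auto simp: distrib_left dest: yrel_carrier intro!: intros)
  show "(r + s) *\<^sub>R a = r *\<^sub>R a + s *\<^sub>R a"
    by (transfer, rule yrel_eqI) (auto simp: distrib_right fps_const_add[symmetric] simp del: fps_const_add dest: yrel_carrier intro!: intros)
  show "r *\<^sub>R s *\<^sub>R a = (r * s) *\<^sub>R a"
    by (transfer, rule yrel_eqI) (auto simp: mult.assoc[symmetric] dest: yrel_carrier intro!: intros)
  show "1 *\<^sub>R a = a"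
    by (transfer, rule yrel_eqI) (auto dest: yrel_carrier)
  show "r *\<^sub>R a * b = r *\<^sub>R (a * b)"
    by (transfer, rule yrel_eqI) (auto simp: cmul_smult_left dest: yrel_carrier intro!: intros)
  show "a * r *\<^sub>R b = r *\<^sub>R (a * b)"
    by (transfer, rule yrel_eqI) (auto simp: cmul_smult_right dest: yrel_carrier intro!: intros)
qed

end

definition q :: "(ygen list \<Rightarrow> scal) \<Rightarrow> ymod" where "q = abs_ymod"

lemma q_eq: "a \<in> carrier AY \<Longrightarrow> b \<in> carrier AY \<Longrightarrow> q a = q b \<longleftrightarrow> zero_mod_h (\<lambda>w. a w - b w)"
  using Quotient3_rel[OF Quotient3_ymod, of a b] yrel_refl[of a] yrel_refl[of b]
  by (simp add: q_def yrel_def)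

lemma q_ops:
  assumes "a \<in> carrier AY" "b \<in> carrier AY"
  shows "q (\<lambda>w. a w + b w) = q a + q b" "q (\<lambda>w. a w - b w) = q a - q b" "q (cmul a b) = q a * q b"
    "q (\<lambda>w. fps_const (of_real r) * a w) = r *\<^sub>R q a"
  unfolding q_def
  using plus_ymod.abs_eq[OF yrel_refl yrel_refl, OF assms] minus_ymod.abs_eq[OF yrel_refl yrel_refl, OF assms]
    times_ymod.abs_eq[OF yrel_refl yrel_refl, OF assms] scaleR_ymod.abs_eq[OF yrel_refl, OF assms(1)]
  by simp_all

lemma q_one: "q (word []) = 1" and q_zero: "q (\<lambda>w. 0) = 0"
  by (simp_all add: q_def one_ymod.abs_eq zero_ymod.abs_eq)

lemma q_Iz: "a \<in> Y.Iz \<Longrightarrow> q a = 0"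
  using q_eq[OF Y.Iz_carrier cfree_closed(5)] zero_mod_h_Iz q_zero by fastforce

lemma q_hh: "a \<in> carrier AY \<Longrightarrow> q (\<lambda>w. hh * a w) = 0"
  using q_eq[OF cfree_closed(3) cfree_closed(5), of a hh] zero_mod_h_hh[of a] q_zero by simp

text \<open>The complex constants in \<open>Y/hY\<close>.\<close>

definition kap :: "complex \<Rightarrow> ymod" where "kap z = q (\<lambda>w. fps_const z * word [] w)"

lemma q_smult: assumes a: "a \<in> carrier AY" shows "q (\<lambda>w. c * a w) = kap (fps_nth c 0) * q a"
proof -
  have "kap (fps_nth c 0) * q a = q (\<lambda>w. fps_const (fps_nth c 0) * a w)"
    unfolding kap_def using a
    by (simp add: q_ops(3)[symmetric] cfree_closed word_AY cmul_smult_left cmul_one_left)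
  also have "\<dots> = q (\<lambda>w. c * a w)"
  proof -
    have "c - fps_const (fps_nth c 0) = hh * fps_shift 1 c"
      by (rule fps_ext) auto
    then have "fps_const (fps_nth c 0) - c = hh * (- fps_shift 1 c)" by (simp add: algebra_simps)
    then have "(\<lambda>w. fps_const (fps_nth c 0) * a w - c * a w) = (\<lambda>w. hh * ((- fps_shift 1 c) * a w))"
      by (metis (no_types, lifting) left_diff_distrib mult.assoc)
    then have "zero_mod_h (\<lambda>w. fps_const (fps_nth c 0) * a w - c * a w)"
      using zero_mod_h_hh[OF cfree_closed(3)[OF a, of "- fps_shift 1 c"]] by simp
    then show ?thesis using a by (simp add: q_eq cfree_closed)
  qed
  finally show ?thesis by simp
qed

lemma q_word_Cons: "q (word (g # w)) = q (gen g) * q (word w)"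
  using q_ops(3)[OF word_AY word_AY, of "[g]" w] by (simp add: cmul_word gen_eq_word)

section \<open>The relations modulo h\<close>

lemma q_comm: "a \<in> carrier AY \<Longrightarrow> b \<in> carrier AY \<Longrightarrow> q (comm AY a b) = lb (q a) (q b)"
  by (simp add: cfree_comm q_ops cmul_closed lb_def)

lemma q_minus: "a \<in> carrier AY \<Longrightarrow> b \<in> carrier AY \<Longrightarrow> q (a \<ominus>\<^bsub>AY\<^esub> b) = q a - q b"
  by (simp add: cfree_minus q_ops)

lemma q_plus: "a \<in> carrier AY \<Longrightarrow> b \<in> carrier AY \<Longrightarrow> q (a \<oplus>\<^bsub>AY\<^esub> b) = q a + q b"
  by (simp add: cfree_simps q_ops)

lemma q_hh2: assumes "a \<in> carrier AY" shows "q (c * hh ^ 2 \<odot>\<^bsub>AY\<^esub> a) = 0" "q (hh ^ 2 \<odot>\<^bsub>AY\<^esub> a) = 0"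
proof -
  have "(\<lambda>w. c * hh ^ 2 * a w) = (\<lambda>w. hh * ((c * hh) * a w))" by (simp add: power2_eq_square mult_ac)
  then show "q (c * hh ^ 2 \<odot>\<^bsub>AY\<^esub> a) = 0" using q_hh[OF cfree_closed(3)[OF assms, of "c * hh"]] by (simp add: cfree_simps)
  have "(\<lambda>w. hh ^ 2 * a w) = (\<lambda>w. hh * (hh * a w))" by (simp add: power2_eq_square mult_ac)
  then show "q (hh ^ 2 \<odot>\<^bsub>AY\<^esub> a) = 0" using q_hh[OF cfree_closed(3)[OF assms, of "hh"]] by (simp add: cfree_simps)
qed

lemma q_3: "a \<in> carrier AY \<Longrightarrow> q (3 \<odot>\<^bsub>AY\<^esub> a) = 3 *\<^sub>R q a"
  using q_ops(4)[of a a 3] by (simp add: cfree_simps numeral_fps_const)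

lemma q_cubic:
  assumes "\<And>i. a i \<in> carrier AY" "\<And>i. b i \<in> carrier AY"
  shows "q (cubic AY a b i j) = lb (q (a (i + 3))) (q (b j)) - 3 *\<^sub>R lb (q (a (i + 2))) (q (b (j + 1)))
     + 3 *\<^sub>R lb (q (a (i + 1))) (q (b (j + 2))) - lb (q (a i)) (q (b (j + 3)))"
  unfolding cubic_def
  by (simp add: q_minus q_plus q_hh2 q_3 q_comm assms AY.minus_closed)

lemma q_serre:
  assumes "\<And>i. a i \<in> carrier AY"
  shows "q (serre AY a i j k) = lb (q (a i)) (lb (q (a j)) (q (a (k + 1)))) + lb (q (a i)) (lb (q (a k)) (q (a (j + 1))))
    + lb (q (a j)) (lb (q (a i)) (q (a (k + 1)))) + lb (q (a j)) (lb (q (a k)) (q (a (i + 1))))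
    + lb (q (a k)) (lb (q (a i)) (q (a (j + 1)))) + lb (q (a k)) (lb (q (a j)) (q (a (i + 1))))"
  unfolding serre_def Let_def
  by (simp add: q_plus q_comm assms)

definition ye :: "nat \<Rightarrow> ymod" where "ye i = q (gen (E i))"

definition yf :: "nat \<Rightarrow> ymod" where "yf i = q (gen (F i))"

definition yp :: "nat \<Rightarrow> ymod" where "yp i = q (gen (Psi i))"

lemma q_rel: "r \<in> Y_rels \<Longrightarrow> q r = 0"
  using Y.S_Iz q_Iz by blast

lemma rel_mem:
  "comm AY (gen (Psi i)) (gen (Psi j)) \<in> Y_rels"
  "comm AY (gen (E i)) (gen (F j)) \<ominus>\<^bsub>AY\<^esub> gen (Psi (i + j)) \<in> Y_rels"
  "cubic AY (\<lambda>i. gen (E i)) (\<lambda>i. gen (E i)) i j \<in> Y_rels"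
  "cubic AY (\<lambda>i. gen (F i)) (\<lambda>i. gen (F i)) i j \<in> Y_rels"
  "cubic AY (\<lambda>i. gen (Psi i)) (\<lambda>i. gen (E i)) i j \<in> Y_rels"
  "cubic AY (\<lambda>i. gen (Psi i)) (\<lambda>i. gen (F i)) i j \<in> Y_rels"
  "comm AY (gen (Psi 0)) (gen (E j)) \<in> Y_rels"
  "comm AY (gen (Psi 1)) (gen (E j)) \<in> Y_rels"
  "comm AY (gen (Psi 2)) (gen (E j)) \<ominus>\<^bsub>AY\<^esub> ((2 * hh ^ 2) \<odot>\<^bsub>AY\<^esub> gen (E j)) \<in> Y_rels"
  "comm AY (gen (Psi 0)) (gen (F j)) \<in> Y_rels"
  "comm AY (gen (Psi 1)) (gen (F j)) \<in> Y_rels"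
  "comm AY (gen (Psi 2)) (gen (F j)) \<ominus>\<^bsub>AY\<^esub> ((- 2 * hh ^ 2) \<odot>\<^bsub>AY\<^esub> gen (F j)) \<in> Y_rels"
  "serre AY (\<lambda>i. gen (E i)) i j k \<in> Y_rels"
  "serre AY (\<lambda>i. gen (F i)) i j k \<in> Y_rels"
proof -
  show "comm AY (gen (Psi i)) (gen (Psi j)) \<in> Y_rels"
    unfolding Y_rels_def Let_def by (rule UnI1, rule UnI1, rule UnI1, rule UnI1, rule UnI1, rule UnI1, rule UnI1, rule UnI1, rule UnI1, rule UnI1, rule UnI1, rule UnI1, rule UnI1) blast
  show "comm AY (gen (E i)) (gen (F j)) \<ominus>\<^bsub>AY\<^esub> gen (Psi (i + j)) \<in> Y_rels"
    unfolding Y_rels_def Let_def by (rule UnI1, rule UnI1, rule UnI1, rule UnI1, rule UnI1, rule UnI1, rule UnI1, rule UnI1, rule UnI1, rule UnI1, rule UnI1, rule UnI1, rule UnI2) blast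
  show "cubic AY (\<lambda>i. gen (E i)) (\<lambda>i. gen (E i)) i j \<in> Y_rels"
    unfolding Y_rels_def Let_def by (rule UnI1, rule UnI1, rule UnI1, rule UnI1, rule UnI1, rule UnI1, rule UnI1, rule UnI1, rule UnI1, rule UnI1, rule UnI1, rule UnI2) blast
  show "cubic AY (\<lambda>i. gen (F i)) (\<lambda>i. gen (F i)) i j \<in> Y_rels"
    unfolding Y_rels_def Let_def by (rule UnI1, rule UnI1, rule UnI1, rule UnI1, rule UnI1, rule UnI1, rule UnI1, rule UnI1, rule UnI1, rule UnI1, rule UnI2) blast
  show "cubic AY (\<lambda>i. gen (Psi i)) (\<lambda>i. gen (E i)) i j \<in> Y_rels"
    unfolding Y_rels_def Let_def by (rule UnI1, rule UnI1, rule UnI1, rule UnI1, rule UnI1, rule UnI1, rule UnI1, rule UnI1, rule UnI1, rule UnI2) blast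
  show "cubic AY (\<lambda>i. gen (Psi i)) (\<lambda>i. gen (F i)) i j \<in> Y_rels"
    unfolding Y_rels_def Let_def by (rule UnI1, rule UnI1, rule UnI1, rule UnI1, rule UnI1, rule UnI1, rule UnI1, rule UnI1, rule UnI2) blast
  show "comm AY (gen (Psi 0)) (gen (E j)) \<in> Y_rels"
    unfolding Y_rels_def Let_def by (rule UnI1, rule UnI1, rule UnI1, rule UnI1, rule UnI1, rule UnI1, rule UnI1, rule UnI2) blast
  show "comm AY (gen (Psi 1)) (gen (E j)) \<in> Y_rels"
    unfolding Y_rels_def Let_def by (rule UnI1, rule UnI1, rule UnI1, rule UnI1, rule UnI1, rule UnI1, rule UnI2) blast
  show "comm AY (gen (Psi 2)) (gen (E j)) \<ominus>\<^bsub>AY\<^esub> ((2 * hh ^ 2) \<odot>\<^bsub>AY\<^esub> gen (E j)) \<in> Y_rels"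
    unfolding Y_rels_def Let_def by (rule UnI1, rule UnI1, rule UnI1, rule UnI1, rule UnI1, rule UnI2) blast
  show "comm AY (gen (Psi 0)) (gen (F j)) \<in> Y_rels"
    unfolding Y_rels_def Let_def by (rule UnI1, rule UnI1, rule UnI1, rule UnI1, rule UnI2) blast
  show "comm AY (gen (Psi 1)) (gen (F j)) \<in> Y_rels"
    unfolding Y_rels_def Let_def by (rule UnI1, rule UnI1, rule UnI1, rule UnI2) blast
  show "comm AY (gen (Psi 2)) (gen (F j)) \<ominus>\<^bsub>AY\<^esub> ((- 2 * hh ^ 2) \<odot>\<^bsub>AY\<^esub> gen (F j)) \<in> Y_rels"
    unfolding Y_rels_def Let_def by (rule UnI1, rule UnI1, rule UnI2) blast
  show "serre AY (\<lambda>i. gen (E i)) i j k \<in> Y_rels"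
    unfolding Y_rels_def Let_def by (rule UnI1, rule UnI2) blast
  show "serre AY (\<lambda>i. gen (F i)) i j k \<in> Y_rels"
    unfolding Y_rels_def Let_def by (rule UnI2) blast
qed

text \<open>Modulo \<open>h\<close>, the cubic relation is a recursion for \<open>[\<psi>\<^sub>i\<^sub>+\<^sub>3, g\<^sub>j]\<close>, and the brackets with \<open>\<psi>\<^sub>0, \<psi>\<^sub>1, \<psi>\<^sub>2\<close>
  start it with zero; the bracket with \<open>\<psi>\<^sub>2\<close> is a multiple of \<open>h\<^sup>2\<close>.\<close>

lemma yp_central:
  fixes g :: "nat \<Rightarrow> ymod"
  assumes c: "\<And>i j. lb (yp (i + 3)) (g j) - 3 *\<^sub>R lb (yp (i + 2)) (g (j + 1)) + 3 *\<^sub>R lb (yp (i + 1)) (g (j + 2)) - lb (yp i) (g (j + 3)) = 0"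
    and b: "\<And>j. lb (yp 0) (g j) = 0" "\<And>j. lb (yp 1) (g j) = 0" "\<And>j. lb (yp 2) (g j) = 0"
  shows "lb (yp i) (g j) = 0"
proof (induction i arbitrary: j rule: less_induct)
  case (less i)
  have "i = 0 \<or> i = 1 \<or> i = 2 \<or> i = (i - 3) + 3" by arith
  moreover have ?case if i: "i = (i - 3) + 3"
  proof -
    have "lb (yp (i - 3)) (g (j + 3)) = 0" "lb (yp (i - 3 + 1)) (g (j + 2)) = 0" "lb (yp (i - 3 + 2)) (g (j + 1)) = 0"
      by (rule less.IH; use i in linarith)+
    then have "lb (yp (i - 3 + 3)) (g j) = 0" using c[of "i - 3" j] by simp
    then show ?thesis using i by simp
  qed
  ultimately show ?case using b by blast
qed

interpretation R: current_algebra ye yf yp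
proof (rule current_algebra.intro)
  note G = gen_UNIV
  note k = q_comm[OF G G] q_cubic[OF G G] q_serre[OF G]
  show "current_half ye"
    using rel_mem(3,13)[THEN q_rel] unfolding k by unfold_locales (simp_all add: ye_def)
  show "current_half yf"
    using rel_mem(4,14)[THEN q_rel] unfolding k by unfold_locales (simp_all add: yf_def)
  show "lb (ye i) (yf j) = yp (i + j)" for i j
    using rel_mem(2)[THEN q_rel, of i j] by (simp add: q_minus G k ye_def yf_def yp_def)
  show "lb (yp i) (yp j) = 0" for i j
    using rel_mem(1)[THEN q_rel, of i j] by (simp add: k yp_def)
  show "lb (yp i) (ye j) = 0" for i j
  proof (rule yp_central)
    show "lb (yp (i + 3)) (ye j) - 3 *\<^sub>R lb (yp (i + 2)) (ye (j + 1)) + 3 *\<^sub>R lb (yp (i + 1)) (ye (j + 2)) - lb (yp i) (ye (j + 3)) = 0" for i j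
      using rel_mem(5)[THEN q_rel, of i j] unfolding k by (simp only: ye_def yp_def)
    show "lb (yp 0) (ye j) = 0" "lb (yp 1) (ye j) = 0" for j
      using rel_mem(7,8)[THEN q_rel, of j] unfolding k by (simp_all only: ye_def yp_def)
    show "lb (yp 2) (ye j) = 0" for j
      using rel_mem(9)[THEN q_rel, of j] by (simp add: q_minus G k q_hh2 ye_def yp_def)
  qed
  show "lb (yp i) (yf j) = 0" for i j
  proof (rule yp_central)
    show "lb (yp (i + 3)) (yf j) - 3 *\<^sub>R lb (yp (i + 2)) (yf (j + 1)) + 3 *\<^sub>R lb (yp (i + 1)) (yf (j + 2)) - lb (yp i) (yf (j + 3)) = 0" for i j
      using rel_mem(6)[THEN q_rel, of i j] unfolding k by (simp only: yf_def yp_def)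
    show "lb (yp 0) (yf j) = 0" "lb (yp 1) (yf j) = 0" for j
      using rel_mem(10,11)[THEN q_rel, of j] unfolding k by (simp_all only: yf_def yp_def)
    show "lb (yp 2) (yf j) = 0" for j
      using rel_mem(12)[THEN q_rel, of j] q_hh2(1)[OF G, of "- 2"] by (simp add: q_minus G k yf_def yp_def)
  qed
qed

section \<open>Ordered words span modulo h\<close>

definition sorted_comb :: "ymod \<Rightarrow> bool" where
  "sorted_comb x \<longleftrightarrow> (\<exists>T c. finite T \<and> (\<forall>s\<in>T. sorted s) \<and> x = (\<Sum>s\<in>T. kap (c s) * R.cur_word s))"

lemma kap_ops: "kap (a + b) = kap a + kap b" "kap a * kap b = kap (a * b)" "kap 0 = 0"
  "kap (of_real r) * x = r *\<^sub>R x" "kap 1 = 1"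
proof -
  have c: "(\<lambda>w. fps_const z * word [] w) \<in> carrier AY" for z by (intro cfree_closed word_AY)
  show "kap (a + b) = kap a + kap b"
    unfolding kap_def q_ops(1)[OF c c, symmetric] by (simp flip: distrib_right)
  show "kap a * kap b = kap (a * b)"
    unfolding kap_def q_ops(3)[OF c c, symmetric] cmul_smult_left cmul_one_left by (simp flip: mult.assoc)
  show "kap 0 = 0" by (simp add: kap_def q_zero)
  show "kap 1 = 1" by (simp add: kap_def q_one)
  have "kap (of_real r) = r *\<^sub>R 1"
    unfolding kap_def q_ops(4)[OF word_AY word_AY] q_one ..
  then show "kap (of_real r) * x = r *\<^sub>R x" by simp
qed

lemma sorted_comb_add: assumes "sorted_comb x" "sorted_comb y" shows "sorted_comb (x + y)"
proof -
  obtain T c T' c' where x: "finite T" "\<forall>s\<in>T. sorted s" "x = (\<Sum>s\<in>T. kap (c s) * R.cur_word s)"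
    and y: "finite T'" "\<forall>s\<in>T'. sorted s" "y = (\<Sum>s\<in>T'. kap (c' s) * R.cur_word s)" using assms by (auto simp: sorted_comb_def)
  let ?c = "\<lambda>s. if s \<in> T then c s else 0" and ?c' = "\<lambda>s. if s \<in> T' then c' s else 0"
  have "x = (\<Sum>s\<in>T \<union> T'. kap (?c s) * R.cur_word s)" unfolding x(3)
    by (rule sum.mono_neutral_cong_left) (use x y in \<open>auto simp: kap_ops\<close>)
  moreover have "y = (\<Sum>s\<in>T \<union> T'. kap (?c' s) * R.cur_word s)" unfolding y(3)
    by (rule sum.mono_neutral_cong_left) (use x y in \<open>auto simp: kap_ops\<close>)
  ultimately have "x + y = (\<Sum>s\<in>T \<union> T'. kap (?c s + ?c' s) * R.cur_word s)"
    by (simp only: kap_ops(1) distrib_right sum.distrib)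
  then show ?thesis unfolding sorted_comb_def using x y by (intro exI[of _ "T \<union> T'"] exI[of _ "\<lambda>s. ?c s + ?c' s"]) auto
qed

lemma sorted_comb_kap: assumes "sorted_comb x" shows "sorted_comb (kap z * x)"
proof -
  obtain T c where x: "finite T" "\<forall>s\<in>T. sorted s" "x = (\<Sum>s\<in>T. kap (c s) * R.cur_word s)" using assms by (auto simp: sorted_comb_def)
  have "kap z * x = (\<Sum>s\<in>T. kap (z * c s) * R.cur_word s)"
    unfolding x(3) by (simp add: sum_distrib_left kap_ops(2)[symmetric] mult.assoc)
  then show ?thesis unfolding sorted_comb_def using x by (intro exI[of _ T] exI[of _ "\<lambda>s. z * c s"]) auto
qed

lemma sorted_comb_cur_word: "sorted_comb (r *\<^sub>R R.cur_word s)"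
proof -
  have z: "sorted_comb 0" unfolding sorted_comb_def by (intro exI[of _ "{}"]) auto
  have sp: "sorted_comb x" if "x \<in> span (R.cur_word ` {s. sorted s})" for x
    using that
  proof (induction rule: span_induct_alt)
    case (step c x y)
    then obtain s where s: "x = R.cur_word s" "sorted s" by auto
    have "sorted_comb x" unfolding sorted_comb_def s(1) using s(2) by (intro exI[of _ "{s}"] exI[of _ "\<lambda>_. 1"]) (simp add: kap_ops(5))
    then have "sorted_comb (c *\<^sub>R x)" using sorted_comb_kap[of x "of_real c"] by (simp add: kap_ops(4))
    then show ?case using step by (intro sorted_comb_add) auto
  qed (rule z)
  have "sorted_comb (R.cur_word s)" by (rule sp[OF R.cur_word_sorted_span])
  then show ?thesis using sorted_comb_kap[of "R.cur_word s" "of_real r"] by (simp add: kap_ops(4))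
qed

lemma q_word: "\<exists>r s. q (word w) = r *\<^sub>R R.cur_word s"
proof (induction w)
  case Nil
  have "q (word []) = 1 *\<^sub>R R.cur_word []" by (simp add: q_one R.cur_word_def)
  then show ?case by blast
next
  case (Cons g w)
  obtain r s where rs: "q (word w) = r *\<^sub>R R.cur_word s" using Cons by blast
  have "\<exists>c d. q (gen g) = c *\<^sub>R R.cur_basis d"
  proof (cases g)
    case (E i)
    then show ?thesis using R.e_cur_basis[of i] unfolding ye_def by blast
  next
    case (F i)
    then show ?thesis using R.f_cur_basis[of i] unfolding yf_def by blast
  next
    case (Psi i)
    then show ?thesis using R.p_cur_basis[of i] unfolding yp_def by blast
  qed
  then obtain c d where "q (gen g) = c *\<^sub>R R.cur_basis d" by blast
  then have "q (word (g # w)) = (c * r) *\<^sub>R R.cur_word (d # s)" by (simp add: q_word_Cons rs R.cur_word_def)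
  then show ?case by blast
qed

lemma sorted_comb_q: assumes "a \<in> carrier AY" shows "sorted_comb (q a)"
  using assms
proof (rule cfree_dense_induct[where X=UNIV and P="\<lambda>a. sorted_comb (q a)"])
  show "sorted_comb (q (\<lambda>w. 0))" using sorted_comb_cur_word[of 0] by (simp add: q_zero)
  show "sorted_comb (q (word w))" for w using q_word[of w] sorted_comb_cur_word by metis
  show "sorted_comb (q (\<lambda>w. a w + b w))" if "a \<in> carrier AY" "b \<in> carrier AY" "sorted_comb (q a)" "sorted_comb (q b)" for a b
    using that by (simp add: q_ops sorted_comb_add)
  show "sorted_comb (q (\<lambda>w. c * a w))" if "a \<in> carrier AY" "sorted_comb (q a)" for a c
    using that by (simp add: q_smult sorted_comb_kap)
  show "sorted_comb (q a)" if a: "a \<in> carrier AY"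
    and l: "\<And>n. \<exists>b d. b \<in> carrier AY \<and> d \<in> carrier AY \<and> sorted_comb (q b) \<and> a = (\<lambda>w. b w + hh ^ n * d w)" for a
  proof -
    obtain b d where b: "b \<in> carrier AY" "d \<in> carrier AY" "sorted_comb (q b)" "a = (\<lambda>w. b w + hh ^ 1 * d w)" using l by blast
    then have "q a = q b" by (simp add: q_ops cfree_closed q_hh)
    then show ?thesis using b by simp
  qed
qed auto

section \<open>Lifting the basis\<close>

text \<open>That some element of the free algebra has the class \<open>r\<close> in \<open>Y/hY\<close> and the image \<open>u\<close> in \<open>U(Dbar0)\<close>.\<close>

definition hits :: "ymod \<Rightarrow> ((dop \<times> scal) list \<Rightarrow> scal) set \<Rightarrow> bool" where
  "hits r u \<longleftrightarrow> (\<exists>a\<in>carrier AY. q a = r \<and> theta_free a = u)"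

lemma hits_I: "a \<in> carrier AY \<Longrightarrow> hits (q a) (theta_free a)"
  by (auto simp: hits_def)

lemma theta_free_ops:
  assumes "a \<in> carrier AY" "b \<in> carrier AY"
  shows "theta_free (\<lambda>w. a w + b w) = theta_free a \<oplus>\<^bsub>UA\<^esub> theta_free b" "theta_free (\<lambda>w. a w - b w) = theta_free a \<ominus>\<^bsub>UA\<^esub> theta_free b"
    "theta_free (cmul a b) = theta_free a \<otimes>\<^bsub>UA\<^esub> theta_free b" "theta_free (\<lambda>w. c * a w) = c \<odot>\<^bsub>UA\<^esub> theta_free a" "theta_free a \<in> carrier UA"
  using alg_hom_add[OF theta_free_hom assms] alg_hom_minus[OF theta_free_hom cfree_scal_alg U0.Q.scal_alg_axioms assms]
    alg_hom_mult[OF theta_free_hom assms] alg_hom_smult[OF theta_free_hom assms(1), of c] alg_hom_closed[OF theta_free_hom assms(1)] assms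
  by (simp_all add: cfree_minus) (simp_all add: cfree_simps)

text \<open>That \<open>r\<close> has a lift to the Yangian whose image is exactly the Lie algebra element \<open>x\<close>. The relation is linear
  and compatible with brackets, and if \<open>x\<close> has a lift then \<open>h x\<close> can be matched with \<open>0\<close>. So corrections of order
  \<open>h\<close> to \<open>x\<close> do not affect \<open>r\<close>.\<close>

definition lifts :: "ymod \<Rightarrow> dop \<times> scal \<Rightarrow> bool" where
  "lifts r x \<longleftrightarrow> x \<in> carrier Dbar0 \<and> hits r (U0.io x)"

lemma lifts_img: "lifts (q (gen g)) (img g)"
  using hits_I[OF gen_UNIV, of g] img_Dbar0 by (simp add: lifts_def theta_free_gen)

lemma lifts_add: assumes "lifts r x" "lifts r' x'" shows "lifts (r + r') (ladd Dbar x x')"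
proof -
  obtain a b where a: "a \<in> carrier AY" "q a = r" "theta_free a = U0.io x" and b: "b \<in> carrier AY" "q b = r'" "theta_free b = U0.io x'"
    and x: "x \<in> carrier Dbar0" "x' \<in> carrier Dbar0"
    using assms by (auto simp: lifts_def hits_def)
  have "q (\<lambda>w. a w + b w) = r + r'" "theta_free (\<lambda>w. a w + b w) = U0.io (ladd Dbar x x')"
    using a b x by (simp_all add: q_ops theta_free_ops io_ops)
  then show ?thesis using a b x unfolding lifts_def hits_def by (auto intro!: cfree_closed U0_closed)
qed

lemma lifts_scale: assumes "lifts r x" shows "lifts (t *\<^sub>R r) (lsmult Dbar (fps_const (of_real t)) x)"
proof -
  obtain a where a: "a \<in> carrier AY" "q a = r" "theta_free a = U0.io x" and x: "x \<in> carrier Dbar0"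
    using assms by (auto simp: lifts_def hits_def)
  have "q (\<lambda>w. fps_const (of_real t) * a w) = t *\<^sub>R r" "theta_free (\<lambda>w. fps_const (of_real t) * a w) = U0.io (lsmult Dbar (fps_const (of_real t)) x)"
    using a x by (simp_all add: q_ops(4)[OF a(1) a(1)] theta_free_ops(4)[OF a(1) a(1)] io_ops(2)[OF x x])
  then show ?thesis using a x unfolding lifts_def hits_def by (auto intro!: cfree_closed U0_closed)
qed

lemma lifts_smult: assumes "lifts r x" shows "\<exists>r'. lifts r' (lsmult Dbar c x)"
proof -
  obtain a where a: "a \<in> carrier AY" "q a = r" "theta_free a = U0.io x" and x: "x \<in> carrier Dbar0"
    using assms by (auto simp: lifts_def hits_def)
  have "theta_free (\<lambda>w. c * a w) = U0.io (lsmult Dbar c x)"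
    using a x by (simp add: theta_free_ops(4)[OF a(1) a(1)] io_ops(2)[OF x x])
  then show ?thesis using a x unfolding lifts_def hits_def by (auto intro!: cfree_closed U0_closed)
qed

lemma lifts_hh: assumes "lifts r x" shows "lifts 0 (lsmult Dbar (hh * c) x)"
proof -
  obtain a where a: "a \<in> carrier AY" "q a = r" "theta_free a = U0.io x" and x: "x \<in> carrier Dbar0"
    using assms by (auto simp: lifts_def hits_def)
  have "theta_free (\<lambda>w. (hh * c) * a w) = U0.io (lsmult Dbar (hh * c) x)"
    by (simp only: theta_free_ops(4)[OF a(1) a(1)] io_ops(2)[OF x x] a(3))
  moreover have "q (\<lambda>w. (hh * c) * a w) = 0" using q_hh[OF cfree_closed(3)[OF a(1), of c]] by (simp add: mult.assoc)
  ultimately show ?thesis using a x unfolding lifts_def hits_def by (blast intro!: cfree_closed U0_closed)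
qed

lemma lifts_bracket: assumes "lifts r x" "lifts r' x'" shows "lifts (lb r r') (lbracket Dbar x x')"
proof -
  obtain a b where a: "a \<in> carrier AY" "q a = r" "theta_free a = U0.io x" and b: "b \<in> carrier AY" "q b = r'" "theta_free b = U0.io x'"
    and x: "x \<in> carrier Dbar0" "x' \<in> carrier Dbar0"
    using assms by (auto simp: lifts_def hits_def)
  have "q (\<lambda>w. cmul a b w - cmul b a w) = lb r r'"
    using a b by (simp add: q_ops cmul_closed lb_def)
  moreover have "theta_free (\<lambda>w. cmul a b w - cmul b a w) = U0.io (lbracket Dbar x x')"
    using a b by (simp add: theta_free_ops cmul_closed io_ops(3)[OF x, symmetric] comm_def)
  ultimately show ?thesis using a b x unfolding lifts_def hits_def by (blast intro!: cfree_closed cmul_closed U0_closed)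
qed

subsection \<open>Finite differences\<close>

text \<open>Taylor expansion of \<open>(x + rh)\<^sup>n\<^sup>+\<^sup>1\<close> to first order; the remainder has degree below \<open>n\<close> in \<open>x\<close>.\<close>

lemma sh_power_expand:
  "\<exists>Q. sh r (xx ^ Suc n) = xx ^ Suc n + Polynomial.smult (of_int r * hh * of_nat (Suc n)) (xx ^ n) + Polynomial.smult (hh * hh) Q
    \<and> (\<forall>t\<ge>n. coeff Q t = 0)"
proof (induction n)
  case 0
  show ?case
    by (rule exI[of _ 0]) (simp add: sh_def xx_def pcompose_pCons)
next
  case (Suc n)
  then obtain Q where Q: "sh r (xx ^ Suc n) = xx ^ Suc n + Polynomial.smult (of_int r * hh * of_nat (Suc n)) (xx ^ n) + Polynomial.smult (hh * hh) Q"
    and z: "\<forall>t\<ge>n. coeff Q t = 0" by blast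
  have X: "sh r xx * p = xx * p + Polynomial.smult (of_int r * hh) p" for p
    by (simp add: sh_def xx_def pcompose_pCons)
  define Q' where "Q' = xx * Q + Polynomial.smult (of_int r * of_int r * of_nat (Suc n)) (xx ^ n) + Polynomial.smult (of_int r * hh) Q"
  have "sh r (xx ^ Suc (Suc n)) = sh r xx * sh r (xx ^ Suc n)" by (simp add: sh_ops)
  also have "\<dots> = xx ^ Suc (Suc n) + Polynomial.smult (of_int r * hh * of_nat (Suc (Suc n))) (xx ^ Suc n) + Polynomial.smult (hh * hh) Q'"
  proof -
    define N where "N = (of_nat (Suc n) :: scal)"
    have N2: "of_nat (Suc (Suc n)) = N + 1" by (simp add: N_def)
    have x: "xx * (c * p) = c * (xx * p)" "xx * Polynomial.smult d p = Polynomial.smult d (xx * p)" for c d p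
      by simp_all
    show ?thesis
      unfolding Q
      unfolding X Q'_def N_def[symmetric] N2 power_Suc
      by (simp add: smult_add_right smult_add_left distrib_left distrib_right mult_ac add_ac)
  qed
  finally have e: "sh r (xx ^ Suc (Suc n)) = xx ^ Suc (Suc n) + Polynomial.smult (of_int r * hh * of_nat (Suc (Suc n))) (xx ^ Suc n) + Polynomial.smult (hh * hh) Q'" .
  have "coeff Q' t = 0" if "t \<ge> Suc n" for t
  proof -
    have "coeff (xx * Q) t = coeff Q (t - 1)" using that by (cases t) (auto simp: xx_def)
    moreover have "coeff (xx ^ n) t = 0" using that by (simp add: monom_xx[symmetric])
    ultimately show ?thesis using z that by (simp add: Q'_def)
  qed
  then show ?case using e by blast
qed

lemma lifts_comb:
  assumes b: "\<And>t. t < n \<Longrightarrow> \<exists>r. lifts r (DE (monom k t) s 0)" and Q: "\<forall>t\<ge>n. coeff Q t = 0"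
  shows "\<exists>r. lifts r (DE (Polynomial.smult k Q) s 0)"
proof -
  have "lifts (q (\<lambda>w. 0)) (DE 0 s 0)"
    using hits_I[OF cfree_closed(5)] theta_free_Iz[OF Y.Iz_ops(1)] by (simp add: lifts_def io_zero DE_Dbar0[OF adm_ops(1)])
  then have z: "\<exists>r. lifts r (DE 0 s 0)" by blast
  have "\<exists>r. lifts r (DE (Polynomial.smult k (\<Sum>t\<in>T. monom (coeff Q t) t)) s 0)" if "finite T" "T \<subseteq> {..<n}" for T
    using that
  proof (induction T rule: finite_induct)
    case (insert x T)
    obtain r where r: "lifts r (DE (monom k x) s 0)" using b[of x] insert by auto
    obtain r1 where r1: "lifts r1 (lsmult Dbar (coeff Q x) (DE (monom k x) s 0))" using lifts_smult[OF r] by blast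
    obtain r2 where r2: "lifts r2 (DE (Polynomial.smult k (\<Sum>t\<in>T. monom (coeff Q t) t)) s 0)" using insert by auto
    have "ladd Dbar (lsmult Dbar (coeff Q x) (DE (monom k x) s 0)) (DE (Polynomial.smult k (\<Sum>t\<in>T. monom (coeff Q t) t)) s 0)
      = DE (Polynomial.smult k (\<Sum>t\<in>insert x T. monom (coeff Q t) t)) s 0"
      using insert by (simp add: DE_ops smult_monom smult_add_right mult.commute)
    then show ?case using lifts_add[OF r1 r2] by metis
  qed (use z in simp)
  from this[of "{..<n}"] have "\<exists>r. lifts r (DE (Polynomial.smult k (\<Sum>t<n. monom (coeff Q t) t)) s 0)" by simp
  moreover have "(\<Sum>t<n. monom (coeff Q t) t) = Q"
    by (rule poly_eqI) (use Q in \<open>auto simp: coeff_sum not_less\<close>)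
  ultimately show ?thesis by simp
qed

lemma fps_const_inverse: "n \<noteq> 0 \<Longrightarrow> fps_const (of_real (1 / real n)) * of_nat n = (1 :: scal)"
proof -
  assume "n \<noteq> 0"
  then have "of_real (1 / real n) * of_nat n = (1 :: complex)" by (simp add: field_simps)
  moreover have "(of_nat n :: scal) = fps_const (of_nat n)" by (simp add: fps_of_nat)
  ultimately show ?thesis by (simp only: fps_const_mult fps_const_1_eq_1)
qed

text \<open>The finite difference of \<open>x\<^sup>i\<^sup>+\<^sup>1\<close> is \<open>\<sigma> (i + 1) h x\<^sup>i\<close> plus \<open>h\<^sup>2\<close> times a polynomial of lower degree. The
  latter is \<open>h\<close> times something that is in the image by \<open>lower\<close>, so it can be subtracted
  without changing the class modulo \<open>h\<close>; likewise the central term.\<close>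

lemma lifts_solve:
  assumes D: "lifts r (DE (Polynomial.smult k (sh \<sigma> (xx ^ Suc i) - xx ^ Suc i)) s (hh * c0))" and \<sigma>: "\<sigma> = 1 \<or> \<sigma> = - 1"
    and lower: "\<And>t. t < i \<Longrightarrow> \<exists>r. lifts r (DE (monom (k * hh) t) s 0)" and c: "c0 = 0 \<or> lifts r0 (basis_elt None)"
  shows "lifts ((real_of_int \<sigma> / real (Suc i)) *\<^sub>R r) (DE (monom (k * hh) i) s 0)"
proof -
  obtain Q where Q: "sh \<sigma> (xx ^ Suc i) = xx ^ Suc i + Polynomial.smult (of_int \<sigma> * hh * of_nat (Suc i)) (xx ^ i) + Polynomial.smult (hh * hh) Q"
    "\<forall>t\<ge>i. coeff Q t = 0" using sh_power_expand by blast
  obtain r1 where r1: "lifts r1 (DE (Polynomial.smult (k * hh) Q) s 0)" using lifts_comb[OF lower Q(2)] by blast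
  have zz: "lifts 0 (DE 0 s (- hh * c0))"
  proof (cases "c0 = 0")
    case True
    have "lifts (q (\<lambda>w. 0)) (DE 0 s 0)"
      using hits_I[OF cfree_closed(5)] theta_free_Iz[OF Y.Iz_ops(1)] by (simp add: lifts_def io_zero DE_Dbar0[OF adm_ops(1)])
    then show ?thesis using True by (simp add: q_zero)
  next
    case False
    then have "lifts 0 (lsmult Dbar (hh * (- c0)) (basis_elt None))" using c lifts_hh by blast
    moreover have "lsmult Dbar (hh * (- c0)) (basis_elt None) = DE 0 s (- hh * c0)"
      by (simp add: basis_elt_simps DE_ops) (simp add: DE_def D_op_zero)
    ultimately show ?thesis by simp
  qed
  have "lifts (r + 0 + 0) (ladd Dbar (ladd Dbar (DE (Polynomial.smult k (sh \<sigma> (xx ^ Suc i) - xx ^ Suc i)) s (hh * c0))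
      (lsmult Dbar (hh * (- 1)) (DE (Polynomial.smult (k * hh) Q) s 0))) (DE 0 s (- hh * c0)))"
    by (intro lifts_add D lifts_hh[OF r1] zz)
  also have "ladd Dbar (ladd Dbar (DE (Polynomial.smult k (sh \<sigma> (xx ^ Suc i) - xx ^ Suc i)) s (hh * c0))
      (lsmult Dbar (hh * (- 1)) (DE (Polynomial.smult (k * hh) Q) s 0))) (DE 0 s (- hh * c0))
     = DE (Polynomial.smult (of_int \<sigma> * of_nat (Suc i)) (monom (k * hh) i)) s 0"
  proof -
    have m: "monom (k * hh) i = Polynomial.smult (k * hh) (xx ^ i)" by (simp add: monom_xx[symmetric] smult_monom)
    have "Polynomial.smult k (sh \<sigma> (xx ^ Suc i) - xx ^ Suc i) + Polynomial.smult (hh * - 1) (Polynomial.smult (k * hh) Q) + 0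
      = Polynomial.smult (of_int \<sigma> * of_nat (Suc i)) (monom (k * hh) i)"
      unfolding Q(1) m by (simp add: smult_add_right mult_ac del: of_nat_Suc)
    then show ?thesis by (simp only: DE_ops) simp
  qed
  finally have "lifts r (DE (Polynomial.smult (of_int \<sigma> * of_nat (Suc i)) (monom (k * hh) i)) s 0)" by simp
  from lifts_scale[OF this, of "real_of_int \<sigma> / real (Suc i)"]
  have "lifts ((real_of_int \<sigma> / real (Suc i)) *\<^sub>R r) (DE (Polynomial.smult (fps_const (of_real (real_of_int \<sigma> / real (Suc i))) * (of_int \<sigma> * of_nat (Suc i))) (monom (k * hh) i)) s 0)"
    by (simp add: DE_ops)
  moreover have "fps_const (of_real (real_of_int \<sigma> / real (Suc i))) * (of_int \<sigma> * of_nat (Suc i)) = (1 :: scal)"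
    using fps_const_inverse[of "Suc i"] \<sigma> by (auto simp del: of_nat_Suc simp: fps_const_neg[symmetric] simp del: fps_const_neg)
  ultimately show ?thesis by simp
qed

text \<open>The bracket of \<open>\<partial>\<^sup>\<sigma>\<close> with \<open>h\<^sup>j\<^sup>-\<^sup>1 x\<^sup>i\<^sup>+\<^sup>1 \<partial>\<^sup>\<sigma>\<^sup>j\<close> is \<open>h\<^sup>j\<^sup>-\<^sup>1\<close> times a finite difference of \<open>x\<^sup>i\<^sup>+\<^sup>1\<close>, so it has
  the leading term \<open>\<sigma> (i + 1) h\<^sup>j x\<^sup>i\<close>; this matches the recursion of \<open>tower\<close>.\<close>

lemma lifts_tower:
  fixes v :: "nat \<Rightarrow> nat \<Rightarrow> ymod"
  assumes \<sigma>: "\<sigma> = 1 \<or> \<sigma> = - 1" and base: "\<And>i. lifts (v 1 i) (DE (monom 1 i) \<sigma> 0)"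
    and step: "\<And>j i. 1 \<le> j \<Longrightarrow> v (j + 1) i = (real_of_int \<sigma> / real (Suc i)) *\<^sub>R lb (v 1 0) (v j (Suc i))"
  shows "1 \<le> j \<Longrightarrow> lifts (v j i) (DE (monom (hh ^ (j - 1)) i) (\<sigma> * int j) 0)"
proof (induction j arbitrary: i rule: nat_induct_at_least)
  case base
  then show ?case using assms(2)[of i] by simp
next
  case (Suc j)
  have s: "\<sigma> + \<sigma> * int j = \<sigma> * int (Suc j)" by (simp add: algebra_simps)
  have ph: "phi_poly f \<sigma> g (\<sigma> * int j) = 0" for f g
    by (rule phi_poly_degree) (use \<sigma> Suc(1) in auto)
  have br: "lbracket Dbar (DE (monom 1 0) \<sigma> 0) (DE (monom (hh ^ (j - 1)) (Suc i)) (\<sigma> * int j) 0) =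
     DE (Polynomial.smult (hh ^ (j - 1)) (sh \<sigma> (xx ^ Suc i) - xx ^ Suc i)) (\<sigma> * int (Suc j)) (hh * 0)" for i
  proof -
    have "monom (hh ^ (j - 1)) (Suc i) = Polynomial.smult (hh ^ (j - 1)) (xx ^ Suc i)"
      unfolding monom_xx[symmetric] by (simp add: smult_monom)
    moreover have "monom 1 0 = (1 :: scal poly)" by (simp add: monom_0 one_pCons)
    ultimately have "pb (monom 1 0) \<sigma> (monom (hh ^ (j - 1)) (Suc i)) (\<sigma> * int j) = Polynomial.smult (hh ^ (j - 1)) (sh \<sigma> (xx ^ Suc i) - xx ^ Suc i)"
      by (simp only: pb_def sh_ops mult_1 mult_1_right smult_diff_right)
    then show ?thesis unfolding DE_ops(3) ph s by simp
  qed
  have hp: "hh ^ (j - 1) * hh = hh ^ (Suc j - 1)" using Suc(1) by (cases j) (auto simp: mult.commute)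
  show ?case
  proof (induction i rule: less_induct)
    case (less i)
    have "lifts ((real_of_int \<sigma> / real (Suc i)) *\<^sub>R lb (v 1 0) (v j (Suc i))) (DE (monom (hh ^ (j - 1) * hh) i) (\<sigma> * int (Suc j)) 0)"
    proof (rule lifts_solve[OF _ \<sigma>])
      show "lifts (lb (v 1 0) (v j (Suc i))) (DE (Polynomial.smult (hh ^ (j - 1)) (sh \<sigma> (xx ^ Suc i) - xx ^ Suc i)) (\<sigma> * int (Suc j)) (hh * 0))"
        unfolding br[symmetric] by (rule lifts_bracket[OF assms(2) Suc(2)])
      show "\<exists>r. lifts r (DE (monom (hh ^ (j - 1) * hh) t) (\<sigma> * int (Suc j)) 0)" if "t < i" for t
        using less[OF that] unfolding hp by blast
    qed simp
    then show ?case unfolding hp using step[OF Suc(1), of i] by simp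
  qed
qed

text \<open>The elements of degree 0 come from \<open>\<psi>\<^sub>i\<^sub>+\<^sub>1\<close>, whose image is a finite difference, and those of
  degree \<open>\<plusminus> j\<close> from towers over the elements of degree \<open>\<plusminus> 1\<close>. Since \<open>f\<^sub>i\<close> has the image
  \<open>- (x - h)\<^sup>i \<partial>\<^sup>-\<^sup>1\<close>, the element \<open>x\<^sup>i \<partial>\<^sup>-\<^sup>1\<close> is first extracted from it by induction on \<open>i\<close>.\<close>

lemma lifts_cur_basis: "lifts (R.cur_basis b) (basis_elt b)"
proof -
  have none: "lifts (R.cur_basis None) (basis_elt None)"
  proof -
    have "lifts ((- 1) *\<^sub>R yp 0) (lsmult Dbar (fps_const (of_real (- 1))) (img (Psi 0)))"
      unfolding yp_def by (intro lifts_scale lifts_img)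
    moreover have "fps_const (of_real (- 1)) = (- 1 :: scal)" by (simp add: fps_const_neg[symmetric] del: fps_const_neg)
    ultimately show ?thesis by (simp add: img_simps DE_ops basis_elt_simps R.cur_basis_def)
  qed
  have zero: "lifts (R.cur_basis (Some (0, i))) (basis_elt (Some (0, i)))" for i
  proof (induction i rule: less_induct)
    case (less i)
    have "lifts (yp (Suc i)) (DE (Polynomial.smult 1 (sh (- 1) (xx ^ Suc i) - xx ^ Suc i)) 0 (hh * (- hh) ^ i))"
    proof -
      have "- ((- hh) ^ Suc i) = hh * (- hh) ^ i" "sh (- 1) (xx ^ Suc i) = (xx - cc) ^ Suc i"
        by (simp, simp only: sh_power, simp add: sh_xx)
      then show ?thesis using lifts_img[of "Psi (Suc i)"] by (simp only: yp_def img_simps smult_1_left)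
    qed
    then have "lifts ((real_of_int (- 1) / real (Suc i)) *\<^sub>R yp (Suc i)) (DE (monom (1 * hh) i) 0 0)"
    proof (rule lifts_solve)
      show "\<exists>r. lifts r (DE (monom (1 * hh) t) 0 0)" if "t < i" for t
        using less[OF that] by (auto simp: basis_elt_simps h_exp_def)
    qed (use none in auto)
    then show ?case by (simp add: basis_elt_simps h_exp_def R.cur_basis_def)
  qed
  have plus: "lifts (R.P.W j i) (DE (monom (hh ^ (j - 1)) i) (1 * int j) 0)" if "1 \<le> j" for j i
  proof (rule lifts_tower[where v=R.P.W])
    show "lifts (R.P.W 1 i) (DE (monom 1 i) 1 0)" for i
      using lifts_img[of "E i"] unfolding R.P.W_1 by (simp add: ye_def img_simps monom_xx)
    show "R.P.W (j + 1) i = (real_of_int 1 / real (Suc i)) *\<^sub>R lb (R.P.W 1 0) (R.P.W j (Suc i))" if "1 \<le> j" for j i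
      using R.P.W_Suc[OF that, of i] unfolding R.P.W_1 by simp
  qed (use that in auto)
  have f: "lifts (- yf i) (DE (monom 1 i) (- 1) 0)" for i
  proof (induction i rule: less_induct)
    case (less i)
    have m: "lifts (- yf i) (DE ((xx - cc) ^ i) (- 1) 0)"
    proof -
      have "lifts ((- 1) *\<^sub>R yf i) (lsmult Dbar (fps_const (of_real (- 1))) (img (F i)))"
        unfolding yf_def by (intro lifts_scale lifts_img)
      moreover have "fps_const (of_real (- 1)) = (- 1 :: scal)" by (simp add: fps_const_neg[symmetric] del: fps_const_neg)
      ultimately show ?thesis by (simp add: img_simps DE_ops)
    qed
    show ?case
    proof (cases i)
      case 0
      then show ?thesis using m by (simp add: monom_0 one_pCons)
    next
      case (Suc n)
      obtain Q where Q: "sh (- 1) (xx ^ Suc n) = xx ^ Suc n + Polynomial.smult (of_int (- 1) * hh * of_nat (Suc n)) (xx ^ n) + Polynomial.smult (hh * hh) Q"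
        "\<forall>t\<ge>n. coeff Q t = 0" using sh_power_expand by blast
      define Q' where "Q' = Polynomial.smult (- of_nat (Suc n)) (xx ^ n) + Polynomial.smult hh Q"
      have e: "(xx - cc) ^ i = xx ^ i + Polynomial.smult hh Q'"
        using Q(1) by (simp add: Suc sh_power[of _ xx "Suc n"] sh_xx Q'_def smult_add_right smult_diff_right mult.commute del: power_Suc of_nat_Suc)
      have "coeff Q' t = 0" if "t \<ge> i" for t
        using that Q(2) by (simp add: Q'_def Suc monom_xx[symmetric])
      then obtain r where r: "lifts r (DE (Polynomial.smult 1 Q') (- 1) 0)"
        using lifts_comb[of i 1 "- 1" Q'] less by blast
      have "lifts (- yf i + 0) (ladd Dbar (DE ((xx - cc) ^ i) (- 1) 0) (lsmult Dbar (hh * (- 1)) (DE (Polynomial.smult 1 Q') (- 1) 0)))"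
        by (intro lifts_add m lifts_hh[OF r])
      then show ?thesis by (simp add: e DE_ops monom_xx)
    qed
  qed
  have minus: "lifts (- R.M.W j i) (DE (monom (hh ^ (j - 1)) i) ((- 1) * int j) 0)" if "1 \<le> j" for j i
  proof (rule lifts_tower[where v="\<lambda>j i. - R.M.W j i"])
    show "lifts (- R.M.W 1 i) (DE (monom 1 i) (- 1) 0)" for i
      unfolding R.M.W_1 by (rule f)
    show "- R.M.W (j + 1) i = (real_of_int (- 1) / real (Suc i)) *\<^sub>R lb (- R.M.W 1 0) (- R.M.W j (Suc i))" if "1 \<le> j" for j i
      using R.M.W_Suc[OF that, of i] unfolding R.M.W_1 by (simp add: lb_props)
  qed (use that in auto)
  show ?thesis
  proof (cases b)
    case None
    then show ?thesis using none by simp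
  next
    case (Some x)
    then obtain r i where b: "b = Some (r, i)" by (cases x) auto
    consider "r = 0" | "r > 0" | "r < 0" by linarith
    then show ?thesis
    proof cases
      case 1 then show ?thesis using zero b by simp
    next
      case 2
      then show ?thesis using plus[of "nat r" i] b by (simp add: R.cur_basis_def basis_elt_simps h_exp_def)
    next
      case 3
      then show ?thesis using minus[of "nat (- r)" i] b by (simp add: R.cur_basis_def basis_elt_simps h_exp_def)
    qed
  qed
qed

section \<open>Ordered words and their coordinates\<close>

definition lift_basis :: "bas \<Rightarrow> ygen list \<Rightarrow> scal" where
  "lift_basis b = (SOME a. a \<in> carrier AY \<and> q a = R.cur_basis b \<and> theta_free a = U0.io (basis_elt b))"

lemma lift_basis: "lift_basis b \<in> carrier AY" "q (lift_basis b) = R.cur_basis b" "theta_free (lift_basis b) = U0.io (basis_elt b)"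
proof -
  have "\<exists>a. a \<in> carrier AY \<and> q a = R.cur_basis b \<and> theta_free a = U0.io (basis_elt b)"
    using lifts_cur_basis[of b] by (auto simp: lifts_def hits_def)
  from someI_ex[OF this] show "lift_basis b \<in> carrier AY" "q (lift_basis b) = R.cur_basis b" "theta_free (lift_basis b) = U0.io (basis_elt b)"
    unfolding lift_basis_def by blast+
qed

fun lift_word :: "bas list \<Rightarrow> ygen list \<Rightarrow> scal" where
  "lift_word [] = word []"
| "lift_word (b # s) = cmul (lift_basis b) (lift_word s)"

lemma basis_elt_words: "map basis_elt s \<in> lists (carrier Dbar0)"
  by (induction s) (auto simp: basis_elt_Dbar0)

lemma lift_word: "lift_word s \<in> carrier AY" "q (lift_word s) = R.cur_word s" "theta_free (lift_word s) = U0.cl (word (map basis_elt s))"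
proof (induction s)
  case Nil
  show "lift_word [] \<in> carrier AY" by (simp add: word_AY)
  show "q (lift_word []) = R.cur_word []" by (simp add: q_one R.cur_word_def)
  show "theta_free (lift_word []) = U0.cl (word (map basis_elt []))" by (simp add: theta_free_def push_word)
next
  case (Cons b s)
  show "lift_word (b # s) \<in> carrier AY" using Cons lift_basis by (simp add: cmul_closed)
  show "q (lift_word (b # s)) = R.cur_word (b # s)" using Cons lift_basis by (simp add: q_ops R.cur_word_def)
  have "theta_free (lift_word (b # s)) = U0.io (basis_elt b) \<otimes>\<^bsub>UA\<^esub> U0.cl (word (map basis_elt s))"
    using Cons lift_basis by (simp add: theta_free_ops)
  also have "\<dots> = U0.cl (cmul (word [basis_elt b]) (word (map basis_elt s)))"
    unfolding U0.io_eq gen_eq_word by (rule U0.cl_ops(2)) (auto intro!: word_closed simp: basis_elt_Dbar0)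
  finally show "theta_free (lift_word (b # s)) = U0.cl (word (map basis_elt (b # s)))" by (simp add: cmul_word)
qed

definition h_exp_basis :: "bas \<Rightarrow> nat" where "h_exp_basis b = (case b of None \<Rightarrow> 0 | Some (r, i) \<Rightarrow> h_exp r)"

lemma Dbar_coord_basis_elt: "Dbar_coord (basis_elt b) d = (if d = b then hh ^ h_exp_basis b else 0)"
  by (cases b; cases d) (auto simp: basis_elt_simps Dbar_coord_DE hc_def h_exp_basis_def split: prod.splits)

lemma multi_ext_basis_elt: "multi_ext g (map basis_elt s) = hh ^ sum_list (map h_exp_basis s) * g s"
proof (induction s arbitrary: g)
  case (Cons b s)
  have "multi_ext g (map basis_elt (b # s)) = hsum (\<lambda>d. if d = b then hh ^ h_exp_basis b * (hh ^ sum_list (map h_exp_basis s) * g (d # s)) else 0)"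
    by (simp add: Cons Dbar_coord_basis_elt) (rule arg_cong[where f=hsum], auto)
  then show ?case by (simp add: hsum_single power_add mult.assoc)
qed simp

text \<open>The image of the lifted word is the word in the \<open>basis_elt b\<close>, which are the basis elements of \<open>Dbar\<close> up to powers
  of \<open>h\<close>; a sorted word is its own normal ordering.\<close>

lemma pbw_coord_lift_word: assumes "sorted s" shows "pbw_coord t (lift_word s) = (if s = t then hh ^ sum_list (map h_exp_basis t) else 0)"
proof -
  have c: "push img (lift_word s) \<in> carrier (cfree (carrier Dbar0))" "word (map basis_elt s) \<in> carrier (cfree (carrier Dbar0))"
    by (simp_all add: push_img_closed lift_word word_closed[OF basis_elt_words])
  have "(\<lambda>w. push img (lift_word s) w - word (map basis_elt s) w) \<in> U0.Iz"
    using lift_word(3)[of s] U0.cl_eq_iff[OF c] by (simp add: theta_free_def)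
  then have "lin (multi_ext (nu t)) (\<lambda>w. push img (lift_word s) w - word (map basis_elt s) w) = 0"
    by (rule nu_kills[OF U0_Iz_sub])
  then have "pbw_coord t (lift_word s) = multi_ext (nu t) (map basis_elt s)"
    by (simp add: pbw_coord_def lin_diff null_word carrier_cfreeD[OF c(1)])
  then show ?thesis using assms by (simp add: multi_ext_basis_elt nu_sorted)
qed

text \<open>In \<open>Y/hY\<close> the ordered products span, and \<open>lift_word\<close> lifts them; the difference is a multiple of \<open>h\<close> modulo relations.\<close>

lemma first_order:
  assumes a: "a \<in> carrier AY"
  shows "\<exists>T c i d. finite T \<and> (\<forall>s\<in>T. sorted s) \<and> i \<in> Y.Iz \<and> d \<in> carrier AY \<and>
    a = (\<lambda>w. (\<Sum>s\<in>T. fps_const (c s) * lift_word s w) + (i w + hh * d w))"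
proof -
  obtain T c where T: "finite T" "\<forall>s\<in>T. sorted s" "q a = (\<Sum>s\<in>T. kap (c s) * R.cur_word s)"
    using sorted_comb_q[OF a] by (auto simp: sorted_comb_def)
  have qs: "q (\<lambda>w. \<Sum>s\<in>T. fps_const (c s) * lift_word s w) = (\<Sum>s\<in>T. kap (c s) * R.cur_word s)" if "finite T" for T
    using that
  proof (induction T rule: finite_induct)
    case (insert x T)
    have "(\<lambda>w. \<Sum>s\<in>T. fps_const (c s) * lift_word s w) \<in> carrier AY"
      by (intro cfree_sum_closed cfree_closed lift_word insert)
    then show ?case using insert
      by (simp add: q_ops(1)[OF cfree_closed(3)[OF lift_word(1)]] q_smult[OF lift_word(1)] lift_word)
  qed (simp add: q_zero)
  have s: "(\<lambda>w. \<Sum>s\<in>T. fps_const (c s) * lift_word s w) \<in> carrier AY"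
    by (intro cfree_sum_closed cfree_closed lift_word T)
  have "zero_mod_h (\<lambda>w. a w - (\<Sum>s\<in>T. fps_const (c s) * lift_word s w))"
    using q_eq[OF a s] T qs by simp
  then obtain i d where id: "i \<in> Y.Iz" "d \<in> carrier AY" "(\<lambda>w. a w - (\<Sum>s\<in>T. fps_const (c s) * lift_word s w)) = (\<lambda>w. i w + hh * d w)"
    by (auto simp: zero_mod_h_def)
  have "a = (\<lambda>w. (\<Sum>s\<in>T. fps_const (c s) * lift_word s w) + (i w + hh * d w))"
    using id(3) by (auto simp: fun_eq_iff algebra_simps)
  then show ?thesis using T id by blast
qed

lemma pbw_coord_sum:
  assumes "finite T" "\<forall>s\<in>T. sorted s"
  shows "pbw_coord t (\<lambda>w. \<Sum>s\<in>T. fps_const (c s) * lift_word s w) = (if t \<in> T then hh ^ sum_list (map h_exp_basis t) * fps_const (c t) else 0)"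
  using assms
proof (induction T rule: finite_induct)
  case empty
  show ?case using pbw_coord_Iz[OF Y.Iz_ops(1)] by simp
next
  case (insert x T)
  have "(\<lambda>w. \<Sum>s\<in>T. fps_const (c s) * lift_word s w) \<in> carrier AY"
    by (intro cfree_sum_closed cfree_closed lift_word insert)
  then have "pbw_coord t (\<lambda>w. \<Sum>s\<in>insert x T. fps_const (c s) * lift_word s w) =
    fps_const (c x) * pbw_coord t (lift_word x) + pbw_coord t (\<lambda>w. \<Sum>s\<in>T. fps_const (c s) * lift_word s w)"
    using insert by (simp add: pbw_coord_linear(1)[OF cfree_closed(3)[OF lift_word(1)]] pbw_coord_linear(3)[OF lift_word(1) lift_word(1)])
  then show ?case using insert by (auto simp: pbw_coord_lift_word mult.commute)
qed

lemma pbw_coord_first_order: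
  assumes "finite T" "\<forall>s\<in>T. sorted s" "i \<in> Y.Iz" "d \<in> carrier AY"
    "a = (\<lambda>w. (\<Sum>s\<in>T. fps_const (c s) * lift_word s w) + (i w + hh * d w))"
  shows "pbw_coord t a = (if t \<in> T then hh ^ sum_list (map h_exp_basis t) * fps_const (c t) else 0) + hh * pbw_coord t d"
proof -
  have c: "(\<lambda>w. \<Sum>s\<in>T. fps_const (c s) * lift_word s w) \<in> carrier AY" "i \<in> carrier AY" "(\<lambda>w. hh * d w) \<in> carrier AY" "(\<lambda>w. i w + hh * d w) \<in> carrier AY"
    using cfree_closed(1)[OF Y.Iz_carrier[OF assms(3)] cfree_closed(3)[OF assms(4)]] cfree_closed(3)[OF assms(4)] Y.Iz_carrier[OF assms(3)] cfree_sum_closed[OF assms(1), of "\<lambda>s w. fps_const (c s) * lift_word s w"] cfree_closed(3)[OF lift_word(1)]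
    by simp_all
  show ?thesis unfolding assms(5) pbw_coord_linear(1)[OF c(1,4)] pbw_coord_linear(1)[OF c(2,3)] pbw_coord_linear(3)[OF assms(4,4)]
    using pbw_coord_sum[OF assms(1,2)] pbw_coord_Iz[OF assms(3)] by simp
qed

text \<open>The image of \<open>Y\<close> lies in \<open>U(Dbar0)\<close>, whose basis elements carry these powers of \<open>h\<close>. The proof gains one power
  of \<open>h\<close> with each expansion to first order.\<close>

lemma pbw_coord_divisible: assumes "a \<in> carrier AY" shows "hh ^ sum_list (map h_exp_basis t) dvd pbw_coord t a"
proof -
  have "a \<in> carrier AY \<Longrightarrow> m \<le> sum_list (map h_exp_basis t) \<Longrightarrow> hh ^ m dvd pbw_coord t a" for m a
  proof (induction m arbitrary: a)
    case (Suc m)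
    obtain T c i d where f: "finite T" "\<forall>s\<in>T. sorted s" "i \<in> Y.Iz" "d \<in> carrier AY"
      "a = (\<lambda>w. (\<Sum>s\<in>T. fps_const (c s) * lift_word s w) + (i w + hh * d w))"
      using first_order[OF Suc.prems(1)] by blast
    have "hh ^ m dvd pbw_coord t d" using Suc f by simp
    then have 1: "hh ^ Suc m dvd hh * pbw_coord t d" by (simp add: mult_dvd_mono)
    have "hh ^ Suc m dvd hh ^ sum_list (map h_exp_basis t)" using Suc.prems(2) by (rule le_imp_power_dvd)
    then have "hh ^ Suc m dvd (if t \<in> T then hh ^ sum_list (map h_exp_basis t) * fps_const (c t) else 0)" by auto
    then show ?case unfolding pbw_coord_first_order[OF f] using 1 by (rule dvd_add)
  qed simp
  then show ?thesis using assms by blast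
qed

text \<open>In the expansion \<open>a = \<Sum> c\<^sub>s lift_word s + h d\<close> the coordinate \<open>s\<close> is \<open>h\<^sup>n (c\<^sub>s + h g)\<close> with a power series \<open>g\<close>,
  by the divisibility of the coordinates of \<open>d\<close>. So \<open>c\<^sub>s\<close> has to vanish, and \<open>d\<close> satisfies the same hypothesis as \<open>a\<close>.\<close>

lemma pbw_coord_zero_imp_Iz:
  assumes a: "a \<in> carrier AY" and F: "\<And>t. pbw_coord t a = 0"
  shows "a \<in> Y.Iz"
proof -
  have "\<exists>i d. i \<in> Y.Iz \<and> d \<in> carrier AY \<and> (\<forall>t. pbw_coord t d = 0) \<and> a = (\<lambda>w. i w + hh ^ n * d w)" for n
  proof (induction n)
    case 0
    show ?case by (intro exI[of _ "\<lambda>w. 0"] exI[of _ a]) (simp add: Y.Iz_ops a F)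
  next
    case (Suc n)
    then obtain j b where b: "j \<in> Y.Iz" "b \<in> carrier AY" "\<forall>t. pbw_coord t b = 0" "a = (\<lambda>w. j w + hh ^ n * b w)" by blast
    obtain T c i d where f: "finite T" "\<forall>s\<in>T. sorted s" "i \<in> Y.Iz" "d \<in> carrier AY"
      "b = (\<lambda>w. (\<Sum>s\<in>T. fps_const (c s) * lift_word s w) + (i w + hh * d w))"
      using first_order[OF b(2)] by blast
    have c0: "c t = 0" if "t \<in> T" for t
    proof -
      let ?K = "sum_list (map h_exp_basis t)"
      obtain g where g: "pbw_coord t d = hh ^ ?K * g" using pbw_coord_divisible[OF f(4), of t] by (auto simp: dvd_def)
      have "hh ^ ?K * (fps_const (c t) + hh * g) = 0"
        using pbw_coord_first_order[OF f, of t] b(3) that g by (simp add: algebra_simps)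
      then have "fps_const (c t) + hh * g = 0" by simp
      then have "fps_nth (fps_const (c t) + hh * g) 0 = 0" by simp
      then show ?thesis by simp
    qed
    then have b2: "b = (\<lambda>w. i w + hh * d w)" unfolding f(5) by (simp add: sum.neutral)
    have "hh * pbw_coord t d = 0" for t
      using pbw_coord_first_order[OF f, of t] b(3) c0[of t] by (auto split: if_splits)
    then have "pbw_coord t d = 0" for t by simp
    moreover have "a = (\<lambda>w. (j w + hh ^ n * i w) + hh ^ Suc n * d w)" by (simp add: b(4) b2 algebra_simps)
    moreover have "(\<lambda>w. j w + hh ^ n * i w) \<in> Y.Iz" by (intro Y.Iz_ops b f)
    ultimately show ?case using f(4) by blast
  qed
  then show ?thesis by (intro Y.Iz_lim[OF a]) blast
qed

section \<open>The isomorphism\<close>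

lemma theta_free_Dbar0: "x \<in> lspan Dbar (range basis_elt) \<Longrightarrow> \<exists>a\<in>carrier AY. theta_free a = U0.io x"
proof (induction rule: lspan.induct)
  case zero
  have "U0.io (lzero Dbar) = \<zero>\<^bsub>UA\<^esub>" unfolding DE_zero[symmetric, of 0] by (rule io_zero)
  then show ?case using theta_free_Iz[OF Y.Iz_ops(1)] by (intro bexI[of _ "\<lambda>w. 0"]) (auto simp: cfree_closed)
next
  case (base x)
  then obtain b where "x = basis_elt b" by blast
  then show ?case using lift_basis(1,3)[of b] by blast
next
  case (add x y)
  then obtain a b where ab: "a \<in> carrier AY" "theta_free a = U0.io x" "b \<in> carrier AY" "theta_free b = U0.io y" by blast
  have "theta_free (\<lambda>w. a w + b w) = U0.io (ladd Dbar x y)"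
    using ab add by (simp add: theta_free_ops io_ops carrier_Dbar0)
  then show ?case using ab cfree_closed(1) by blast
next
  case (smult x c)
  then obtain a where a: "a \<in> carrier AY" "theta_free a = U0.io x" by blast
  have x: "x \<in> carrier Dbar0" using smult by (simp add: carrier_Dbar0)
  have "theta_free (\<lambda>w. c * a w) = U0.io (lsmult Dbar c x)"
    by (simp add: theta_free_ops(4)[OF a(1) a(1)] a(2) io_ops(2)[OF x x])
  then show ?case using a cfree_closed(3) by blast
qed

lemma theta_free_words: "w \<in> lists (carrier Dbar0) \<Longrightarrow> \<exists>a\<in>carrier AY. theta_free a = U0.cl (word w)"
proof (induction w)
  case Nil
  then show ?case using lift_word(1,3)[of "[]"] by auto
next
  case (Cons x w)
  then obtain b where b: "b \<in> carrier AY" "theta_free b = U0.cl (word w)" by auto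
  obtain a where a: "a \<in> carrier AY" "theta_free a = U0.io x" using theta_free_Dbar0[of x] Cons.prems carrier_Dbar0 by auto
  have "theta_free (cmul a b) = U0.io x \<otimes>\<^bsub>UA\<^esub> U0.cl (word w)" using a b by (simp add: theta_free_ops)
  also have "\<dots> = U0.cl (cmul (word [x]) (word w))"
    unfolding U0.io_eq gen_eq_word by (rule U0.cl_ops(2)) (use Cons in \<open>auto intro!: word_closed\<close>)
  finally show ?case using cmul_closed[OF a(1) b(1)] by (auto simp: cmul_word)
qed

text \<open>All words in \<open>Dbar0\<close> are in the image, and modulo \<open>h\<close> every element is a finite combination of words.\<close>

lemma theta_free_first_order:
  assumes "u \<in> carrier UA"
  shows "\<exists>a\<in>carrier AY. \<exists>d\<in>carrier UA. u = theta_free a \<oplus>\<^bsub>UA\<^esub> hh \<odot>\<^bsub>UA\<^esub> d"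
  using assms
proof (rule U0.Q_dense_induct)
  fix w assume "w \<in> lists (carrier Dbar0)"
  then obtain a where a: "a \<in> carrier AY" "theta_free a = U0.cl (word w)" using theta_free_words by blast
  then have "U0.cl (word w) = theta_free a \<oplus>\<^bsub>UA\<^esub> hh \<odot>\<^bsub>UA\<^esub> \<zero>\<^bsub>UA\<^esub>" using theta_free_ops(5)[OF a(1) a(1)] by simp
  then show "\<exists>a\<in>carrier AY. \<exists>d\<in>carrier UA. U0.cl (word w) = theta_free a \<oplus>\<^bsub>UA\<^esub> hh \<odot>\<^bsub>UA\<^esub> d" using a by blast
next
  fix u v assume "\<exists>a\<in>carrier AY. \<exists>d\<in>carrier UA. u = theta_free a \<oplus>\<^bsub>UA\<^esub> hh \<odot>\<^bsub>UA\<^esub> d" "\<exists>a\<in>carrier AY. \<exists>d\<in>carrier UA. v = theta_free a \<oplus>\<^bsub>UA\<^esub> hh \<odot>\<^bsub>UA\<^esub> d"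
  then obtain a d b e where h: "a \<in> carrier AY" "d \<in> carrier UA" "u = theta_free a \<oplus>\<^bsub>UA\<^esub> hh \<odot>\<^bsub>UA\<^esub> d"
    "b \<in> carrier AY" "e \<in> carrier UA" "v = theta_free b \<oplus>\<^bsub>UA\<^esub> hh \<odot>\<^bsub>UA\<^esub> e" by blast
  have c: "theta_free a \<in> carrier UA" "theta_free b \<in> carrier UA" using theta_free_ops(5) h by auto
  have "u \<oplus>\<^bsub>UA\<^esub> v = theta_free (\<lambda>w. a w + b w) \<oplus>\<^bsub>UA\<^esub> hh \<odot>\<^bsub>UA\<^esub> (d \<oplus>\<^bsub>UA\<^esub> e)"
    using h c by (simp add: theta_free_ops U0.Q.smult_add U0.Q.a_ac)
  then show "\<exists>a\<in>carrier AY. \<exists>d\<in>carrier UA. u \<oplus>\<^bsub>UA\<^esub> v = theta_free a \<oplus>\<^bsub>UA\<^esub> hh \<odot>\<^bsub>UA\<^esub> d"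
    using cfree_closed(1)[OF h(1,4)] U0.Q.a_closed[OF h(2,5)] by blast
next
  fix u c assume "\<exists>a\<in>carrier AY. \<exists>d\<in>carrier UA. u = theta_free a \<oplus>\<^bsub>UA\<^esub> hh \<odot>\<^bsub>UA\<^esub> d"
  then obtain a d where h: "a \<in> carrier AY" "d \<in> carrier UA" "u = theta_free a \<oplus>\<^bsub>UA\<^esub> hh \<odot>\<^bsub>UA\<^esub> d" by blast
  have "c \<odot>\<^bsub>UA\<^esub> u = theta_free (\<lambda>w. c * a w) \<oplus>\<^bsub>UA\<^esub> hh \<odot>\<^bsub>UA\<^esub> (c \<odot>\<^bsub>UA\<^esub> d)"
    using h theta_free_ops(5)[OF h(1,1)] by (simp add: theta_free_ops(4)[OF h(1,1)] U0.Q.smult_add U0.Q.smult_smult mult.commute)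
  then show "\<exists>a\<in>carrier AY. \<exists>d\<in>carrier UA. c \<odot>\<^bsub>UA\<^esub> u = theta_free a \<oplus>\<^bsub>UA\<^esub> hh \<odot>\<^bsub>UA\<^esub> d"
    using cfree_closed(3)[OF h(1)] U0.Q.smult_closed[OF h(2)] by blast
next
  fix u assume "\<And>n. \<exists>b d. b \<in> carrier UA \<and> d \<in> carrier UA \<and> (\<exists>a\<in>carrier AY. \<exists>d\<in>carrier UA. b = theta_free a \<oplus>\<^bsub>UA\<^esub> hh \<odot>\<^bsub>UA\<^esub> d) \<and> u = b \<oplus>\<^bsub>UA\<^esub> hh ^ n \<odot>\<^bsub>UA\<^esub> d"
  \<comment> \<open>Approximation modulo \<open>h\<close> is all that the claim needs.\<close>
  from this[of 1] obtain b d a e where h: "d \<in> carrier UA" "a \<in> carrier AY" "e \<in> carrier UA" "b = theta_free a \<oplus>\<^bsub>UA\<^esub> hh \<odot>\<^bsub>UA\<^esub> e" "u = b \<oplus>\<^bsub>UA\<^esub> hh \<odot>\<^bsub>UA\<^esub> d"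
    by auto
  have "u = theta_free a \<oplus>\<^bsub>UA\<^esub> hh \<odot>\<^bsub>UA\<^esub> (e \<oplus>\<^bsub>UA\<^esub> d)"
    using h theta_free_ops(5)[OF h(2,2)] by (simp add: U0.Q.smult_add U0.Q.a_assoc)
  then show "\<exists>a\<in>carrier AY. \<exists>d\<in>carrier UA. u = theta_free a \<oplus>\<^bsub>UA\<^esub> hh \<odot>\<^bsub>UA\<^esub> d"
    using h U0.Q.a_closed[OF h(3,1)] by blast
qed

text \<open>Successive approximation: \<open>a n\<close> approximates the remainder \<open>D n\<close> that is left after \<open>n\<close> steps, and the series
  \<open>s 0 = \<Sum> h\<^sup>n a n\<close> converges in the completed free algebra. Its tails \<open>s m\<close> satisfy the same recursion as the
  remainders, so the difference \<open>D 0 - theta_free (s 0)\<close> is divisible by every power of \<open>h\<close>.\<close>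

lemma theta_free_surj: assumes u: "u \<in> carrier UA" shows "\<exists>a\<in>carrier AY. theta_free a = u"
proof -
  obtain al de where ad: "\<And>u. u \<in> carrier UA \<Longrightarrow> al u \<in> carrier AY \<and> de u \<in> carrier UA \<and> u = theta_free (al u) \<oplus>\<^bsub>UA\<^esub> hh \<odot>\<^bsub>UA\<^esub> de u"
    using theta_free_first_order by metis
  define D where "D n = (de ^^ n) u" for n
  have D: "D n \<in> carrier UA" for n by (induction n) (auto simp: D_def u ad)
  define a where "a n = al (D n)" for n
  have a: "a n \<in> carrier AY" for n using ad[OF D[of n]] by (simp add: a_def)
  have step: "D n = theta_free (a n) \<oplus>\<^bsub>UA\<^esub> hh \<odot>\<^bsub>UA\<^esub> D (Suc n)" for n
    using ad[OF D[of n]] by (simp add: a_def D_def)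
  define s where "s m = (\<lambda>w. hsum (\<lambda>n. hh ^ n * a (n + m) w))" for m
  have nn: "null (\<lambda>n. hh ^ n * f n)" for f :: "nat \<Rightarrow> scal"
  proof -
    have "{n. fps_nth (hh ^ n * f n) k \<noteq> 0} \<subseteq> {..k}" for k by (auto simp: fps_X_power_mult_nth not_le)
    then show ?thesis unfolding null_def using finite_subset by blast
  qed
  have s: "s m \<in> carrier AY" for m
    unfolding carrier_cfree null_def
  proof (intro conjI allI impI)
    fix k
    have "{w. fps_nth (s m w) k \<noteq> 0} \<subseteq> (\<Union>n\<le>k. \<Union>j\<le>k. {w. fps_nth (a (n + m) w) j \<noteq> 0})"
    proof
      fix w assume "w \<in> {w. fps_nth (s m w) k \<noteq> 0}"
      then obtain n where "fps_nth (hh ^ n * a (n + m) w) k \<noteq> 0"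
        unfolding s_def hsum_def by (auto elim: sum.not_neutral_contains_not_neutral)
      then have "n \<le> k" "fps_nth (a (n + m) w) (k - n) \<noteq> 0" by (auto simp: fps_X_power_mult_nth split: if_splits)
      then show "w \<in> (\<Union>n\<le>k. \<Union>j\<le>k. {w. fps_nth (a (n + m) w) j \<noteq> 0})" by (intro UN_I[of n] UN_I[of "k - n"]) auto
    qed
    moreover have "finite {w. fps_nth (a n w) j \<noteq> 0}" for n j using carrier_cfreeD[OF a[of n]] by (simp add: null_def)
    ultimately show "finite {w. fps_nth (s m w) k \<noteq> 0}" by (auto intro: finite_subset)
  qed simp
  have ss: "s m = (\<lambda>w. a m w + hh * s (Suc m) w)" for m
  proof
    fix w
    let ?f = "\<lambda>n. hh ^ n * a (n + m) w"
    have sp: "?f = (\<lambda>n. (if n = 0 then ?f n else 0) + (if n = 0 then 0 else ?f n))" by auto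
    have "hsum ?f = hsum (\<lambda>n. if n = 0 then ?f n else 0) + hsum (\<lambda>n. if n = 0 then 0 else ?f n)"
      by (subst sp, rule hsum_add; rule null_subset[OF nn[of "\<lambda>n. a (n + m) w"]]) (auto split: if_splits)
    also have "hsum (\<lambda>n. if n = 0 then ?f n else 0) = a m w" using hsum_single[of 0 ?f] by simp
    also have "hsum (\<lambda>n. if n = 0 then 0 else ?f n) = hsum (\<lambda>n. ?f (Suc n))"
    proof (rule hsum_reindex[symmetric, where \<pi>=Suc])
      have "c \<in> Suc ` {b. ?f (Suc b) \<noteq> 0}" if "(if c = 0 then 0 else ?f c) \<noteq> 0" for c
        using that by (cases c) (auto split: if_splits)
      then show "bij_betw Suc {b. ?f (Suc b) \<noteq> 0} {c. (if c = 0 then 0 else ?f c) \<noteq> 0}"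
        by (auto simp: bij_betw_def simp del: mult_eq_0_iff)
    qed simp
    also have "hsum (\<lambda>n. ?f (Suc n)) = hsum (\<lambda>n. hh * (hh ^ n * a (n + Suc m) w))" by (simp add: mult.assoc)
    also have "\<dots> = hh * s (Suc m) w" unfolding s_def by (rule hsum_cmult[OF nn])
    finally show "s m w = a m w + hh * s (Suc m) w" by (simp add: s_def)
  qed
  have ts: "theta_free (s m) \<in> carrier UA" for m using theta_free_ops(5)[OF s s] .
  have ta: "theta_free (a m) \<in> carrier UA" for m using theta_free_ops(5)[OF a a] .
  have t: "theta_free (s m) = theta_free (a m) \<oplus>\<^bsub>UA\<^esub> hh \<odot>\<^bsub>UA\<^esub> theta_free (s (Suc m))" for m
    by (subst ss) (simp add: theta_free_ops(1)[OF a cfree_closed(3)[OF s]] theta_free_ops(4)[OF s s])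
  define Df where "Df m = D m \<ominus>\<^bsub>UA\<^esub> theta_free (s m)" for m
  have Df: "Df m \<in> carrier UA" for m by (simp add: Df_def D ts U0.Q.minus_closed)
  have dd: "Df m = hh \<odot>\<^bsub>UA\<^esub> Df (Suc m)" for m
  proof -
    have "Df m = (theta_free (a m) \<oplus>\<^bsub>UA\<^esub> hh \<odot>\<^bsub>UA\<^esub> D (Suc m)) \<ominus>\<^bsub>UA\<^esub> (theta_free (a m) \<oplus>\<^bsub>UA\<^esub> hh \<odot>\<^bsub>UA\<^esub> theta_free (s (Suc m)))"
      unfolding Df_def using step[of m] t[of m] by simp
    also have "\<dots> = hh \<odot>\<^bsub>UA\<^esub> D (Suc m) \<ominus>\<^bsub>UA\<^esub> hh \<odot>\<^bsub>UA\<^esub> theta_free (s (Suc m))"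
      by (rule U0.Q.add_minus_add) (simp_all add: ta ts D)
    also have "\<dots> = hh \<odot>\<^bsub>UA\<^esub> Df (Suc m)" by (simp add: Df_def U0.Q.smult_minus D ts)
    finally show ?thesis .
  qed
  have "Df 0 = hh ^ n \<odot>\<^bsub>UA\<^esub> Df n" for n
  proof (induction n)
    case (Suc n)
    then show ?case using dd[of n] by (simp add: U0.Q.smult_smult[OF Df] mult.commute)
  qed (simp add: Df)
  then have "Df 0 = \<zero>\<^bsub>UA\<^esub>" using Df by (intro U0.Q.separated) blast+
  then have "D 0 = theta_free (s 0)" unfolding Df_def by (rule U0.Q.minus_eq_zeroD[OF D ts])
  then show ?thesis using s[of 0] by (auto simp: D_def)
qed

theorem theorem5p8:
  shows "inj_on (env_incl Dbar) (carrier (env Dbar0)) \<and>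
    (\<exists>\<theta> \<in> alg_hom Y_alg (env Dbar).
       theta_on_gens \<theta> \<and>
       (\<forall>\<theta>' \<in> alg_hom Y_alg (env Dbar). theta_on_gens \<theta>' \<longrightarrow>
          (\<forall>y \<in> carrier Y_alg. \<theta>' y = \<theta> y)) \<and>
       \<theta> ` carrier Y_alg \<subseteq> env_incl Dbar ` carrier (env Dbar0) \<and>
       (\<exists>\<theta>\<^sub>0 \<in> alg_iso Y_alg (env Dbar0).
          \<forall>y \<in> carrier Y_alg. \<theta> y = env_incl Dbar (\<theta>\<^sub>0 y)))"
proof -
  obtain \<theta>0 where h0: "\<theta>0 \<in> alg_hom Y_alg UA" and t0: "\<forall>a\<in>carrier AY. \<theta>0 (Y.cl a) = theta_free a"
    using Y.lift_hom[OF U0.Q_sep_alg theta_free_hom theta_free_rels] by blast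
  define \<theta> where "\<theta> = (\<lambda>y. env_incl Dbar (\<theta>0 y))"
  have h: "\<theta> \<in> alg_hom Y_alg (env Dbar)" unfolding \<theta>_def by (rule alg_hom_comp[OF h0 env_incl_hom])
  have tcl: "\<theta> (Y.cl a) = U.cl (push img a)" if "a \<in> carrier AY" for a
    using that t0 by (simp add: \<theta>_def theta_free_def env_incl_cl push_img_closed)
  have tgen: "\<theta> (Y_gen g) = env_in Dbar (img g)" for g
    by (simp add: Y_gen_def tcl gen_UNIV gen_eq_word word_AY push_word env_in_def)
  have gens: "theta_on_gens \<theta>"
    by (simp add: theta_on_gens_def tgen img_def)
  have uniq: "\<theta>' y = \<theta> y" if "\<theta>' \<in> alg_hom Y_alg (env Dbar)" "theta_on_gens \<theta>'" "y \<in> carrier Y_alg" for \<theta>' y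
  proof (rule Y.hom_unique[OF U.Q_sep_alg that(1) h _ that(3)])
    fix g :: ygen
    show "\<theta>' (Y.cl (gen g)) = \<theta> (Y.cl (gen g))"
      using that(2) gens unfolding theta_on_gens_def Y_gen_def by (cases g) simp_all
  qed
  have inj: "x = y" if xy: "x \<in> carrier Y_alg" "y \<in> carrier Y_alg" "\<theta> x = \<theta> y" for x y
  proof -
    obtain a b where a: "a \<in> carrier AY" "x = Y.cl a" and b: "b \<in> carrier AY" "y = Y.cl b"
      using xy by (auto simp: Y.carrier_Q)
    have d: "(\<lambda>w. a w - b w) \<in> carrier AY" by (intro cfree_closed a b)
    have "U.cl (push img a) = U.cl (push img b)" using xy(3) a b by (simp add: tcl)
    then have "(\<lambda>w. push img a w - push img b w) \<in> U.Iz"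
      using U.cl_eq_iff[OF Dbar0_Fr[OF push_img_closed[OF a(1)]] Dbar0_Fr[OF push_img_closed[OF b(1)]]] by simp
    then have "push img (\<lambda>w. a w - b w) \<in> U.Iz"
      by (simp add: push_linear(2)[OF carrier_cfreeD[OF a(1)] carrier_cfreeD[OF b(1)]])
    then have "pbw_coord t (\<lambda>w. a w - b w) = 0" for t unfolding pbw_coord_def by (rule nu_kills)
    then have "(\<lambda>w. a w - b w) \<in> Y.Iz" by (rule pbw_coord_zero_imp_Iz[OF d])
    then show "x = y" using a b by (simp add: Y.cl_eq_iff)
  qed
  have surj: "\<exists>y\<in>carrier Y_alg. \<theta>0 y = u" if "u \<in> carrier UA" for u
  proof -
    obtain a where "a \<in> carrier AY" "theta_free a = u" using theta_free_surj[OF \<open>u \<in> _\<close>] by blast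
    then show ?thesis using t0 by (intro bexI[of _ "Y.cl a"]) auto
  qed
  have "bij_betw \<theta>0 (carrier Y_alg) (carrier UA)"
    unfolding bij_betw_def
  proof
    show "inj_on \<theta>0 (carrier Y_alg)"
      by (rule inj_onI) (rule inj, simp_all add: \<theta>_def)
    show "\<theta>0 ` carrier Y_alg = carrier UA"
      using alg_hom_closed[OF h0] surj by blast
  qed
  then have iso: "\<theta>0 \<in> alg_iso Y_alg UA" using h0 by (simp add: alg_iso_def)
  have "inj_on (env_incl Dbar) (carrier UA)"
  proof (rule inj_onI)
    fix u v assume uv: "u \<in> carrier UA" "v \<in> carrier UA" "env_incl Dbar u = env_incl Dbar v"
    obtain x y where "x \<in> carrier Y_alg" "\<theta>0 x = u" "y \<in> carrier Y_alg" "\<theta>0 y = v"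
      using surj uv by metis
    then show "u = v" using inj[of x y] uv(3) by (simp add: \<theta>_def)
  qed
  moreover have "\<theta> ` carrier Y_alg \<subseteq> env_incl Dbar ` carrier UA"
    using alg_hom_closed[OF h0] by (auto simp: \<theta>_def)
  moreover have "\<forall>y\<in>carrier Y_alg. \<theta> y = env_incl Dbar (\<theta>0 y)" by (simp add: \<theta>_def)
  ultimately show ?thesis
    by (intro conjI bexI[OF _ h] bexI[OF _ iso] gens ballI impI uniq) auto
qed

end
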